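(* For every $n\ge 3$ the following hold (where $\cong$ denotes isomorphism of real Lie algebras and $=$ equality of subalgebras of $\mathfrak{su}(2^n)$): $\mathfrak a_0(n)\cong\mathfrak u(1)^{\oplus(n-1)}$; $\mathfrak a_1(n)\cong\mathfrak{so}(n)$; $\mathfrak a_2(n)\cong\mathfrak a_4(n)\cong\mathfrak{so}(n)\oplus\mathfrak{so}(n)$; $\mathfrak a_3(n)\cong \mathfrak{so}(2^{n-2})^{\oplus4}$ if $n\equiv0 \pmod 8$, $\cong\mathfrak{so}(2^{n-1})$ if $n\equiv\pm1\pmod 8$, $\cong\mathfrak{su}(2^{n-2})^{\oplus2}$ if $n\equiv\pm2\pmod 8$, $\cong\mathfrak{sp}(2^{n-2})$ if $n\equiv\pm3\pmod 8$, $\cong\mathfrak{sp}(2^{n-3})^{\oplus4}$ if $n\equiv4\pmod 8$; $\mathfrak a_5(n)\cong\mathfrak{so}(2^{n-2})^{\oplus4}$ if $n\equiv0\pmod 6$, $\cong\mathfrak{so}(2^{n-1})$ if $n\equiv\pm1\pmod 6$, $\cong\mathfrak{su}(2^{n-2})^{\oplus2}$ if $n\equiv\pm2\pmod 6$, $\cong\mathfrak{sp}(2^{n-2})$ if $n\equiv3\pmod 6$; $\mathfrak a_6(n)\cong\mathfrak a_7(n)\cong\mathfrak a_{10}(n)\cong\mathfrak{su}(2^{n-1})$ if $n$ is odd and $\cong\mathfrak{su}(2^{n-2})^{\oplus4}$ if $n\ge4$ is even; $\mathfrak a_8(n)\cong\mathfrak{so}(2n-1)$; $\mathfrak a_9(n)\cong\mathfrak{sp}(2^{n-2})$;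 $\mathfrak a_{11}(n)=\mathfrak a_{16}(n)=\mathfrak{so}(2^n)$ for $n\ge4$; $\mathfrak a_k(n)=\mathfrak{su}(2^n)$ for $k\in\{12,17,18,19,21,22\}$ and $n\ge4$; $\mathfrak a_{13}(n)=\mathfrak a_{20}(n)\cong\mathfrak a_{15}(n)\cong\mathfrak{su}(2^{n-1})\oplus\mathfrak{su}(2^{n-1})$; $\mathfrak a_{14}(n)\cong\mathfrak{so}(2n)$; $\mathfrak b_0(n)\cong\mathfrak u(1)^{\oplus n}$; $\mathfrak b_1(n)\cong\mathfrak u(1)^{\oplus(2n-1)}$; $\mathfrak b_2(n)\cong\mathfrak{sp}(2^{n-2})\oplus\mathfrak u(1)$; $\mathfrak b_3(n)\cong\mathfrak{su}(2)^{\oplus n}$; $\mathfrak b_4(n)\cong\mathfrak{su}(2^{n-1})\oplus\mathfrak{su}(2^{n-1})\oplus\mathfrak u(1)$.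
   Context: Pauli matrices $I,X,Y,Z$ are the standard $2\times2$ matrices. A length-$n$ Pauli string is $A^1\otimes\cdots\otimes A^n$ with $A^j\in\{I,X,Y,Z\}$, written $A^1A^2\cdots A^n$. For two-qubit strings $AB$ and $1\le i\ne j\le n$, $A_iB_j$ denotes the length-$n$ string with $A$ in position $i$, $B$ in position $j$ and $I$ elsewhere (so e.g. $XI$ placed at $(j,j+1)$ gives $X_j$). $\mathfrak{su}(N)$ is the real Lie algebra of traceless skew-Hermitian $N\times N$ matrices under the commutator; $\mathfrak{so}(N)$ is the real skew-symmetric matrices; $\mathfrak{sp}(N)=\{a\in\mathfrak{su}(2N): a^TJ=-Ja\}$ with $J=\begin{pmatrix}0&I_N\\-I_N&0\end{pmatrix}$; $\mathfrak u(1)$ is the one-dimensional real Lie algebra; $\mathfrak g^{\oplus m}$ is a direct sum of $m$ commuting copies. For a set $S$ of Pauli strings, $\mathrm{Lie}\langle S\rangle$ is the smallest real Lie subalgebra of $\mathfrak{u}(2^n)$ containing $\{iP: P\in S\}$. For a set $G$ of two-qubit Pauli strings $AB\neq II$ and $n\ge2$, the open-chain algebra is $G(n)=\mathrm{Lie}\langle A_jB_{j+1}: AB\in G,\ 1\le j\le n-1\rangle\subseteq\mathfrak{su}(2^n)$. Generating sets: $\mathfrak a_0=\{XX\}$, $\mathfrak a_1=\{XY\}$, $\mathfrak a_2=\{XY,YX\}$, $\mathfrak a_3=\{XX,YZ\}$, $\mathfrak a_4=\{XX,YY\}$, $\mathfrak a_5=\{XY,YZ\}$, $\mathfrak a_6=\{XX,YZ,ZY\}$,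 $\mathfrak a_7=\{XX,YY,ZZ\}$, $\mathfrak a_8=\{XX,XZ\}$, $\mathfrak a_9=\{XY,XZ\}$, $\mathfrak a_{10}=\{XY,YZ,ZX\}$, $\mathfrak a_{11}=\{XY,YX,YZ\}$, $\mathfrak a_{12}=\{XX,XY,YZ\}$, $\mathfrak a_{13}=\{XX,YY,YZ\}$, $\mathfrak a_{14}=\{XX,YY,XY\}$, $\mathfrak a_{15}=\{XX,XY,XZ\}$, $\mathfrak a_{16}=\{XY,YX,YZ,ZY\}$, $\mathfrak a_{17}=\{XX,XY,ZX\}$, $\mathfrak a_{18}=\{XX,XZ,YY,ZY\}$, $\mathfrak a_{19}=\{XX,XY,ZX,YZ\}$, $\mathfrak a_{20}=\{XX,YY,ZZ,ZY\}$, $\mathfrak a_{21}=\{XX,YY,XY,ZX\}$, $\mathfrak a_{22}=\{XX,XY,XZ,YX\}$, $\mathfrak b_0=\{XI,IX\}$, $\mathfrak b_1=\{XX,XI,IX\}$, $\mathfrak b_2=\{XY,XI,IX\}$, $\mathfrak b_3=\{XI,YI,IX,IY\}$, $\mathfrak b_4=\{XX,XY,XI,IX\}$. We write $\mathfrak a_k(n)$, $\mathfrak b_l(n)$ for the open-chain algebras of these generating sets. *)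

theory Defs
  imports Complex_Main "Jordan_Normal_Form.Matrix"
begin

datatype pauli = PI | PX | PY | PZ

definition pmat :: "pauli \<Rightarrow> complex mat" where
  "pmat p = (case p of
     PI \<Rightarrow> mat_of_rows_list 2 [[1, 0], [0, 1]]
   | PX \<Rightarrow> mat_of_rows_list 2 [[0, 1], [1, 0]]
   | PY \<Rightarrow> mat_of_rows_list 2 [[0, -\<i>], [\<i>, 0]]
   | PZ \<Rightarrow> mat_of_rows_list 2 [[1, 0], [0, -1]])"

definition kron :: "complex mat \<Rightarrow> complex mat \<Rightarrow> complex mat" where
  "kron A B = mat (dim_row A * dim_row B) (dim_col A * dim_col B)
     (\<lambda>(i, j). A $$ (i div dim_row B, j div dim_col B) * B $$ (i mod dim_row B, j mod dim_col B))"

fun pstring :: "pauli list \<Rightarrow> complex mat" where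
  "pstring [] = 1\<^sub>m 1"
| "pstring (p # ps) = kron (pmat p) (pstring ps)"

text \<open>A_i B_j for 1-based positions i, j: length-n string, A at i, B at j, I elsewhere.\<close>
definition placed :: "nat \<Rightarrow> nat \<Rightarrow> pauli \<Rightarrow> nat \<Rightarrow> pauli \<Rightarrow> pauli list" where
  "placed n i A j B = (replicate n PI)[i - 1 := A, j - 1 := B]"

definition comm :: "complex mat \<Rightarrow> complex mat \<Rightarrow> complex mat" where
  "comm A B = A * B - B * A"

definition real_lie_subalg :: "nat \<Rightarrow> complex mat set \<Rightarrow> bool" where
  "real_lie_subalg N L \<longleftrightarrow> L \<subseteq> carrier_mat N N \<and> 0\<^sub>m N N \<in> L
     \<and> (\<forall>A\<in>L. \<forall>B\<in>L. A + B \<in> L \<and> comm A B \<in> L)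
     \<and> (\<forall>A\<in>L. \<forall>r::real. complex_of_real r \<cdot>\<^sub>m A \<in> L)"

definition lie_gen :: "nat \<Rightarrow> complex mat set \<Rightarrow> complex mat set" where
  "lie_gen N S = \<Inter> {L. real_lie_subalg N L \<and> S \<subseteq> L}"

definition lie_iso :: "complex mat set \<Rightarrow> complex mat set \<Rightarrow> bool" (infix "\<cong>\<^sub>L" 50) where
  "L1 \<cong>\<^sub>L L2 \<longleftrightarrow> (\<exists>f. bij_betw f L1 L2 \<and>
     (\<forall>A\<in>L1. \<forall>B\<in>L1. f (A + B) = f A + f B \<and> f (comm A B) = comm (f A) (f B)) \<and>
     (\<forall>A\<in>L1. \<forall>r::real. f (complex_of_real r \<cdot>\<^sub>m A) = complex_of_real r \<cdot>\<^sub>m f A))"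

definition u_alg :: "nat \<Rightarrow> complex mat set" where
  "u_alg N = {A \<in> carrier_mat N N. \<forall>i<N. \<forall>j<N. A $$ (i, j) = - cnj (A $$ (j, i))}"

definition su_alg :: "nat \<Rightarrow> complex mat set" where
  "su_alg N = {A \<in> u_alg N. (\<Sum>i<N. A $$ (i, i)) = 0}"

definition so_alg :: "nat \<Rightarrow> complex mat set" where
  "so_alg N = {A \<in> carrier_mat N N. (\<forall>i<N. \<forall>j<N. A $$ (i, j) \<in> \<real>) \<and> transpose_mat A = - A}"

definition Jmat :: "nat \<Rightarrow> complex mat" where
  "Jmat N = four_block_mat (0\<^sub>m N N) (1\<^sub>m N) (- 1\<^sub>m N) (0\<^sub>m N N)"

definition sp_alg :: "nat \<Rightarrow> complex mat set" where
  "sp_alg N = {A \<in> su_alg (2 * N). transpose_mat A * Jmat N = - (Jmat N * A)}"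

definition u1 :: "complex mat set" where
  "u1 = u_alg 1"

definition dsum :: "complex mat set \<Rightarrow> complex mat set \<Rightarrow> complex mat set" (infixr "\<oplus>\<^sub>L" 65) where
  "L1 \<oplus>\<^sub>L L2 = {four_block_mat A (0\<^sub>m (dim_row A) (dim_col B)) (0\<^sub>m (dim_row B) (dim_col A)) B
                 | A B. A \<in> L1 \<and> B \<in> L2}"

fun dpow :: "complex mat set \<Rightarrow> nat \<Rightarrow> complex mat set" where
  "dpow L 0 = {0\<^sub>m 0 0}"
| "dpow L (Suc 0) = L"
| "dpow L (Suc (Suc m)) = L \<oplus>\<^sub>L dpow L (Suc m)"

definition chain_alg :: "(pauli \<times> pauli) set \<Rightarrow> nat \<Rightarrow> complex mat set" where
  "chain_alg G n = lie_gen (2 ^ n)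
     {\<i> \<cdot>\<^sub>m pstring (placed n j A (j + 1) B) | A B j. (A, B) \<in> G \<and> 1 \<le> j \<and> j \<le> n - 1}"

definition a_gens :: "nat \<Rightarrow> (pauli \<times> pauli) set" where
  "a_gens k = [
     {(PX,PX)},
     {(PX,PY)},
     {(PX,PY),(PY,PX)},
     {(PX,PX),(PY,PZ)},
     {(PX,PX),(PY,PY)},
     {(PX,PY),(PY,PZ)},
     {(PX,PX),(PY,PZ),(PZ,PY)},
     {(PX,PX),(PY,PY),(PZ,PZ)},
     {(PX,PX),(PX,PZ)},
     {(PX,PY),(PX,PZ)},
     {(PX,PY),(PY,PZ),(PZ,PX)},
     {(PX,PY),(PY,PX),(PY,PZ)},
     {(PX,PX),(PX,PY),(PY,PZ)},
     {(PX,PX),(PY,PY),(PY,PZ)},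
     {(PX,PX),(PY,PY),(PX,PY)},
     {(PX,PX),(PX,PY),(PX,PZ)},
     {(PX,PY),(PY,PX),(PY,PZ),(PZ,PY)},
     {(PX,PX),(PX,PY),(PZ,PX)},
     {(PX,PX),(PX,PZ),(PY,PY),(PZ,PY)},
     {(PX,PX),(PX,PY),(PZ,PX),(PY,PZ)},
     {(PX,PX),(PY,PY),(PZ,PZ),(PZ,PY)},
     {(PX,PX),(PY,PY),(PX,PY),(PZ,PX)},
     {(PX,PX),(PX,PY),(PX,PZ),(PY,PX)}] ! k"

definition b_gens :: "nat \<Rightarrow> (pauli \<times> pauli) set" where
  "b_gens l = [
     {(PX,PI),(PI,PX)},
     {(PX,PX),(PX,PI),(PI,PX)},
     {(PX,PY),(PX,PI),(PI,PX)},
     {(PX,PI),(PY,PI),(PI,PX),(PI,PY)},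
     {(PX,PX),(PX,PY),(PX,PI),(PI,PX)}] ! l"

definition aa :: "nat \<Rightarrow> nat \<Rightarrow> complex mat set" where
  "aa k n = chain_alg (a_gens k) n"

definition bb :: "nat \<Rightarrow> nat \<Rightarrow> complex mat set" where
  "bb l n = chain_alg (b_gens l) n"

end

theory Submission
  imports Defs "HOL-Library.Function_Algebras" "HOL-Library.Z2" "HOL-Library.Product_Plus"
begin

text \<open>The commutator of two Pauli strings vanishes or is a multiple of their product, so a chain algebra is spanned by
the closure of its generators under products of anticommuting pairs. Modulo phases the strings form a vector space over
the field with two elements, anticommutation is a symplectic form on it, and the closure is an orbit problem for
transvections: if all generators lie on q = 1 for a quadratic form q that refines the symplectic form, and the closure
contains an E6 diagram to which the remaining generators are connected, then it consists of all vectors outside the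
radical with q = 1; without an invariant q it consists of all vectors outside the radical. The Arf invariant of q
decides between orthogonal and symplectic algebras, the case without q gives special unitary ones, and the radical
accounts for the number of summands. A symplectic map between sets of strings lifts to a Lie isomorphism, because the
phases it fails to preserve form a symmetric cocycle, which is a coboundary of signs. The other chains are abelian, or
become paths of Majorana operators under the Jordan-Wigner map, or contain all strings supported away from a central element.\<close>

section \<open>Quadratic forms over the field with two elements\<close>

text \<open>Adjoining one more generator to a span costs a fixed amount of room: three mutually
  orthogonal hyperbolic pairs. The E6 diagram supplies this room and also a start that is a finite
  check, because modulo 2 the 36 positive roots of E6 are exactly the vectors with q = 1 in a
  nondegenerate space of dimension 6. Spans of rank four leave no room for it, which is why the
  shortest chains are settled by explicit lists of products. The other obstacle is the radical. For
  even n the Heisenberg chains span a space whose radical is generated by the strings of all X and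
  of all Z, and during the induction a vector may be radical at one stage and no longer so once the
  next generator arrives. Hence the invariant \<open>full\<close> speaks only of vectors outside the
  current radical, and the induction step has to reach vectors through detours that never leave this
  set. The periods 8 and 6 in the result come from the Arf invariant: it counts, modulo 2, the sites
  in one residue class modulo 4 or 3.\<close>

inductive_set gspan :: "'a::ab_group_add set \<Rightarrow> 'a set" for A where
  gspan_0: "0 \<in> gspan A"
| gspan_step: "a \<in> A \<Longrightarrow> x \<in> gspan A \<Longrightarrow> a + x \<in> gspan A"

lemma gspan_base: "a \<in> A \<Longrightarrow> a \<in> gspan A"
  using gspan_step[OF _ gspan_0] by fastforce

lemma gspan_add: "x \<in> gspan A \<Longrightarrow> y \<in> gspan A \<Longrightarrow> x + y \<in> gspan A"
  by (induction x rule: gspan.induct) (auto simp: add.assoc intro: gspan_step)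

lemma gspan_least:
  assumes "A \<subseteq> W" "0 \<in> W" "\<And>x y. x \<in> W \<Longrightarrow> y \<in> W \<Longrightarrow> x + y \<in> W"
  shows "gspan A \<subseteq> W"
proof
  fix x assume "x \<in> gspan A"
  then show "x \<in> W" by induction (use assms in auto)
qed

lemma gspan_mono: "A \<subseteq> gspan C \<Longrightarrow> gspan A \<subseteq> gspan C"
  by (rule gspan_least) (auto intro: gspan_0 gspan_add)

lemma gspan_empty: "gspan {} = {0}"
proof -
  have "gspan {} \<subseteq> {0::'a}" by (rule gspan_least) auto
  then show ?thesis using gspan_0 by blast
qed

text \<open>As x + x = 0, a generator is used at most once, so a span of k vectors arises by k
  doublings. All explicit enumerations of spans rest on this.\<close>

lemma gspan_insert:
  fixes a :: "'a::ab_group_add"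
  assumes dbl: "\<And>x::'a. x + x = 0"
  shows "gspan (insert a A) = gspan A \<union> (+) a ` gspan A"
proof
  show "gspan (insert a A) \<subseteq> gspan A \<union> (+) a ` gspan A"
  proof
    fix x assume "x \<in> gspan (insert a A)"
    then show "x \<in> gspan A \<union> (+) a ` gspan A"
    proof induction
      case gspan_0 then show ?case by (simp add: gspan.gspan_0)
    next
      case (gspan_step b x)
      have *: "a + (a + y) = y" for y using dbl[of a] by (simp flip: add.assoc)
      from gspan_step show ?case
        by (auto simp: * add.left_commute[of b a] intro: gspan.gspan_step)
    qed
  qed
  show "gspan A \<union> (+) a ` gspan A \<subseteq> gspan (insert a A)"
    using gspan_mono[of A "insert a A"] gspan_base[of _ "insert a A"] gspan_step[of a "insert a A"] by auto
qed

text \<open>Booleans stand for the field with two elements, with \<open>\<noteq>\<close> as its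
  addition. The setting is abstract because it serves Pauli strings, a form shifted by a linear
  functional, and pairs with an extra bit.\<close>

locale quad =
  fixes B :: "'a::ab_group_add \<Rightarrow> 'a \<Rightarrow> bool" and q :: "'a \<Rightarrow> bool"
  assumes dbl: "(x :: 'a) + x = 0"
    and B_sym: "B x y = B y x"
    and B_self: "\<not> B x x"
    and B_add: "B (x + y) z \<longleftrightarrow> (B x z \<noteq> B y z)"
    and q_add: "q (x + y) \<longleftrightarrow> ((q x \<noteq> q y) \<noteq> B x y)"
begin

lemma dbl2: "x + (x + y) = (y :: 'a)"
  using dbl[of x] by (simp flip: add.assoc)

lemma B_add2: "B z (x + y) \<longleftrightarrow> (B z x \<noteq> B z y)"
  using B_add B_sym by metis

lemma B_0 [simp]: "\<not> B 0 x" "\<not> B x 0"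
  using B_add[of 0 0 x] B_sym by auto

lemma q_0 [simp]: "\<not> q 0"
  using q_add[of 0 0] by simp

text \<open>The transvection along y fixes x unless \<open>B x y\<close> holds and then sends it to
  x + y, so this is stability under transvections along the set's own elements.\<close>

definition closed :: "'a set \<Rightarrow> bool" where
  "closed D \<longleftrightarrow> (\<forall>x\<in>D. \<forall>y\<in>D. B x y \<longrightarrow> x + y \<in> D)"

definition nonrad :: "'a set \<Rightarrow> 'a \<Rightarrow> bool" where
  "nonrad W w \<longleftrightarrow> (\<exists>x\<in>W. B w x)"

lemma nonradI: "x \<in> W \<Longrightarrow> B w x \<Longrightarrow> nonrad W w"
  by (auto simp: nonrad_def)

text \<open>D is not confined to W, so that one D can be kept fixed while W grows generator by
  generator.\<close>

definition full :: "'a set \<Rightarrow> 'a set \<Rightarrow> bool" where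
  "full D W \<longleftrightarrow> (\<forall>w\<in>W. q w \<longrightarrow> nonrad W w \<longrightarrow> w \<in> D)"

definition subgr :: "'a set \<Rightarrow> bool" where
  "subgr W \<longleftrightarrow> 0 \<in> W \<and> (\<forall>x\<in>W. \<forall>y\<in>W. x + y \<in> W)"

text \<open>A supply of hyperbolic pairs; each further orthogonality condition on them costs one pair.\<close>
definition rich :: "nat \<Rightarrow> 'a set \<Rightarrow> 'a set \<Rightarrow> bool" where
  "rich k S W \<longleftrightarrow> (\<exists>p r. \<forall>i<k. p i \<in> W \<and> r i \<in> W
     \<and> (\<forall>s\<in>S. \<not> B s (p i) \<and> \<not> B s (r i))
     \<and> (\<forall>j<k. B (p i) (r j) = (i = j) \<and> \<not> B (p i) (p j) \<and> \<not> B (r i) (r j)))"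

lemma rich_mono: "rich k S W \<Longrightarrow> W \<subseteq> W' \<Longrightarrow> rich k S W'"
  unfolding rich_def by blast

text \<open>If a sees some pair, that pair is sacrificed: its member y with \<open>B a y\<close> is
  added to every other vector seen by a. As y is orthogonal to the remaining pairs, their mutual
  values do not change.\<close>

lemma rich_orth:
  assumes W: "subgr W" and R: "rich (Suc k) S W"
  shows "rich k (insert a S) W"
proof -
  obtain p r where pr: "\<And>i. i < Suc k \<Longrightarrow> p i \<in> W \<and> r i \<in> W
     \<and> (\<forall>s\<in>S. \<not> B s (p i) \<and> \<not> B s (r i))
     \<and> (\<forall>j<Suc k. B (p i) (r j) = (i = j) \<and> \<not> B (p i) (p j) \<and> \<not> B (r i) (r j))"
    using R unfolding rich_def by blast
  show ?thesis
  proof (cases "\<exists>m<Suc k. B a (p m) \<or> B a (r m)")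
    case False
    then have "\<not> B a (p i) \<and> \<not> B a (r i)" if "i < k" for i using that less_SucI by blast
    with pr show ?thesis unfolding rich_def
      by (intro exI[of _ p] exI[of _ r]) (simp add: less_SucI)
  next
    case True
    then obtain m where m: "m < Suc k" "B a (p m) \<or> B a (r m)" by blast
    define y where "y = (if B a (p m) then p m else r m)"
    have y: "B a y" "y \<in> W" "\<And>s. s \<in> S \<Longrightarrow> \<not> B s y" using m pr[of m] by (auto simp: y_def)
    \<comment> \<open>Skips the sacrificed index m; the last index k takes its place.\<close>
    define f where "f i = (if i = m then k else i)" for i
    have f: "f i < Suc k" "f i \<noteq> m" "f i = f j \<longleftrightarrow> i = j" if "i < k" "j < k" for i j
      using that m by (auto simp: f_def)
    have yo: "\<not> B y (p (f i)) \<and> \<not> B y (r (f i)) \<and> \<not> B (p (f i)) y \<and> \<not> B (r (f i)) y" if "i < k" for i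
    proof -
      have "\<not> B y (p (f i)) \<and> \<not> B y (r (f i))"
      proof -
        have "B (p (f i)) (r m) = False" "B (p m) (r (f i)) = False" "\<not> B (p m) (p (f i))" "\<not> B (r m) (r (f i))"
          using pr[OF m(1)] pr[OF f(1)[OF that that]] f(1,2)[OF that that] m(1) by auto
        moreover from this(1) have "\<not> B (r m) (p (f i))" by (subst B_sym) simp
        ultimately show ?thesis by (simp add: y_def)
      qed
      then show ?thesis using B_sym by blast
    qed
    define g where "g x = (if B a x then x + y else x)" for x
    have "g (p (f i)) \<in> W \<and> g (r (f i)) \<in> W
     \<and> (\<forall>s\<in>insert a S. \<not> B s (g (p (f i))) \<and> \<not> B s (g (r (f i))))
     \<and> (\<forall>j<k. B (g (p (f i))) (g (r (f j))) = (i = j) \<and> \<not> B (g (p (f i))) (g (p (f j)))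
         \<and> \<not> B (g (r (f i))) (g (r (f j))))" if i: "i < k" for i
      using pr[OF f(1)[OF i i]] y W yo[OF i] yo f(1,3)[OF i] f(1)
      by (auto simp: g_def subgr_def B_add B_add2 B_self)
    then show ?thesis unfolding rich_def
      by (intro exI[of _ "\<lambda>i. g (p (f i))"] exI[of _ "\<lambda>i. g (r (f i))"]) simp
  qed
qed

text \<open>A linear functional may be added without changing the polar form. Singular vectors of
  the shifted form are those with \<open>q x = B e x\<close>: there both values are true, or become
  so after adding a radical vector on which both are true.\<close>

lemma quad_shift: "quad B (\<lambda>x. q x \<noteq> B e x)"
  by unfold_locales (auto simp: dbl B_sym B_self B_add B_add2 q_add)

text \<open>If the first members of both pairs have q = 1, their sum is singular because they are
  orthogonal.\<close>

lemma rich2_singular: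
  assumes "subgr W" "rich 2 S W"
  obtains t t' where "t \<in> W" "t' \<in> W" "B t t'" "\<not> q t" "\<And>s. s \<in> S \<Longrightarrow> \<not> B s t \<and> \<not> B s t'"
proof -
  obtain p r where pr: "\<And>i::nat. i < 2 \<Longrightarrow> p i \<in> W \<and> r i \<in> W
     \<and> (\<forall>s\<in>S. \<not> B s (p i) \<and> \<not> B s (r i))
     \<and> (\<forall>j<2::nat. B (p i) (r j) = (i = j) \<and> \<not> B (p i) (p j) \<and> \<not> B (r i) (r j))"
    using assms(2) unfolding rich_def by blast
  note a = pr[of 0] pr[of 1]
  consider "\<not> q (p 0)" | "\<not> q (p 1)" | "q (p 0)" "q (p 1)" by blast
  then show thesis
  proof cases
    case 1 with a show thesis by (intro that[of "p 0" "r 0"]) auto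
  next
    case 2 with a show thesis by (intro that[of "p 1" "r 1"]) auto
  next
    case 3 with a assms(1) show thesis
      by (intro that[of "p 0 + p 1" "r 0"]) (auto simp: q_add B_add B_add2 subgr_def)
  qed
qed

text \<open>By pigeonhole two of the three planes are of the same type. Two anisotropic planes yield
  singular vectors as sums across the planes; two planes of the other type contain one singular
  vector each.\<close>

lemma rich3_singular:
  assumes W: "subgr W" and R: "rich 3 {} W"
  obtains s t where "s \<in> W" "t \<in> W" "\<not> q s" "\<not> q t" "\<not> B s t"
    "nonrad W s" "nonrad W t" "nonrad W (s + t)"
proof -
  obtain p r where pr: "\<And>i::nat. i < 3 \<Longrightarrow> p i \<in> W \<and> r i \<in> W
     \<and> (\<forall>j<3::nat. B (p i) (r j) = (i = j) \<and> \<not> B (p i) (p j) \<and> \<not> B (r i) (r j))"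
    using R unfolding rich_def by blast
  have pick: "\<exists>i<3. \<exists>j<3. i \<noteq> j \<and> P i = P j" for P :: "nat \<Rightarrow> bool"
  proof -
    have "P 0 = P 1 \<or> P 0 = P 2 \<or> P 1 = P 2" by blast
    then show ?thesis
    proof (elim disjE)
      assume "P 0 = P 1"
      then show ?thesis by (intro exI[of _ "0::nat"] conjI exI[of _ "1::nat"]) auto
    next
      assume "P 0 = P 2"
      then show ?thesis by (intro exI[of _ "0::nat"] conjI exI[of _ "2::nat"]) auto
    next
      assume "P 1 = P 2"
      then show ?thesis by (intro exI[of _ "1::nat"] conjI exI[of _ "2::nat"]) auto
    qed
  qed
  obtain i j where ij: "i < 3" "j < 3" "i \<noteq> j"
     "(q (p i) \<and> q (r i)) = (q (p j) \<and> q (r j))"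
    using pick[of "\<lambda>i. q (p i) \<and> q (r i)"] by blast
  note a = pr[OF ij(1)] pr[OF ij(2)]
  show thesis
  proof (cases "q (p i) \<and> q (r i)")
    case True
    have x: "B (p i) (r i)" "\<not> B (p j) (r i)" "\<not> B (p i) (r j)" "\<not> B (r j) (r i)" "p i \<in> W" "r i \<in> W"
      using a ij by auto
    have "B (r i) (p i)" "\<not> B (r j) (p i)" using x(1,3) B_sym by blast+
    then have "nonrad W (p i + p j)" "nonrad W (r i + r j)" "nonrad W (p i + p j + (r i + r j))"
      using x nonradI[of "r i" W "p i + p j"] nonradI[of "p i" W "r i + r j"]
        nonradI[of "r i" W "p i + p j + (r i + r j)"] by (simp_all add: B_add B_self)
    with True a ij W show thesis
      by (intro that[of "p i + p j" "r i + r j"]) (auto simp: q_add B_add B_add2 subgr_def)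
  next
    case False
    have *: "\<exists>s s'. s \<in> {p i, r i} \<and> s' \<in> {p i, r i} \<and> \<not> q s \<and> B s s'" if "i < 3" "\<not> (q (p i) \<and> q (r i))" for i
      using that pr[OF that(1)] B_sym by blast
    obtain s s' where s: "s \<in> {p i, r i}" "s' \<in> {p i, r i}" "\<not> q s" "B s s'" using *[OF ij(1)] False by blast
    obtain t t' where t: "t \<in> {p j, r j}" "t' \<in> {p j, r j}" "\<not> q t" "B t t'" using *[OF ij(2)] False ij by blast
    have o: "\<not> B s t" "\<not> B t s'" "s \<in> W" "s' \<in> W" "t \<in> W" "t' \<in> W"
      using s t a ij B_sym by (auto; metis)+
    show thesis
      by (rule that[of s t]) (use s t o in \<open>auto simp: nonrad_def B_add\<close>)
  qed
qed

text \<open>If e and w anticommute and w is not radical, w lies in D and one product suffices. If w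
  is radical in W it is out of reach, and the pair e, w is replaced by the pair with a common g s +
  g t added to both. If e and w commute, an x with q x, \<open>B e x\<close> and not
  \<open>B w x\<close> is sought: then e + x and w + x lie in D, anticommute, and sum to e + w. The
  room given by three pairs is needed to make x and w + x nonradical.\<close>

lemma full_step_aux:
  assumes W: "subgr W" and D: "closed D" and F: "full D W" and R: "rich 3 {} W"
    and e: "e \<in> D" "q e" and x: "x \<in> W" "B e x"
    and w: "w \<in> W" "q (e + w)" "\<exists>y\<in>W. B (e + w) y"
  shows "e + w \<in> D"
proof -
  have add: "\<And>x y. x \<in> W \<Longrightarrow> y \<in> W \<Longrightarrow> x + y \<in> W" using W by (simp add: subgr_def)
  have cl: "\<And>x y. x \<in> D \<Longrightarrow> y \<in> D \<Longrightarrow> B x y \<Longrightarrow> x + y \<in> D" using D by (simp add: closed_def)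
  have DI: "\<And>x y. x \<in> W \<Longrightarrow> q x \<Longrightarrow> y \<in> W \<Longrightarrow> B x y \<Longrightarrow> x \<in> D"
    using F by (auto simp: full_def nonrad_def)
  interpret e: quad B "\<lambda>x. q x \<noteq> B e x" by (rule quad_shift)
  show ?thesis
  proof (cases "B e w")
    case ew: True
    then have qw: "q w" using w e by (simp add: q_add)
    show ?thesis
    proof (cases "nonrad W w")
      case True
      then show ?thesis using cl[OF e(1) _ ew] F w qw by (auto simp: full_def)
    next
      case False
      then have rad: "\<And>y. y \<in> W \<Longrightarrow> \<not> B w y" "\<And>y. y \<in> W \<Longrightarrow> \<not> B y w"
        using B_sym by (auto simp: nonrad_def)
      obtain s t where st: "s \<in> W" "t \<in> W" "\<not> (q s \<noteq> B e s)" "\<not> (q t \<noteq> B e t)" "\<not> B s t"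
        "e.nonrad W s" "e.nonrad W t" "e.nonrad W (s + t)"
        by (rule e.rich3_singular) (use W R in \<open>auto simp: subgr_def e.subgr_def rich_def e.rich_def\<close>)
      \<comment> \<open>For z singular in the shifted form both \<open>q z\<close> and
        \<open>B e z\<close> are true or both are false; in the second case the radical w, where
        both are true, repairs them.\<close>
      define g where "g z = (if B e z then z else w + z)" for z
      have g: "g z \<in> W" "q (g z)" "B e (g z)" "nonrad W (g z)" if "z \<in> W" "q z = B e z" "e.nonrad W z" for z
        using that rad w(1) qw ew by (auto simp: g_def add q_add B_add B_add2 nonrad_def e.nonrad_def)
      have qst: "q s = B e s" "q t = B e t" using st(3,4) by auto
      note gs = g[OF st(1) qst(1) st(6)] and gt = g[OF st(2) qst(2) st(7)]
      have gD: "g s \<in> D" "g t \<in> D" using gs gt F unfolding full_def by blast+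
      have "\<not> B t s" using st(5) B_sym by blast
      then have gst: "\<not> B (g s) (g t)" "\<not> B (g t) (g s)"
        using st(5) rad(1)[OF st(1)] rad(1)[OF st(2)] rad(2)[OF st(1)] rad(2)[OF st(2)]
        by (simp_all add: g_def B_add B_add2 B_self)
      have ge: "B (g s) e" "B (g t) e" using gs(3) gt(3) B_sym by blast+
      have 1: "e + g s \<in> D" using cl[OF e(1) gD(1)] gs(3) by simp
      have 2: "e + g s + g t \<in> D" using cl[OF 1 gD(2)] gt(3) gst by (simp add: B_add)
      have q3: "q (w + g s + g t)" using gs(2) gt(2) gst qw rad(1)[OF gs(1)] rad(1)[OF gt(1)] by (simp add: q_add B_add)
      obtain y where y: "y \<in> W" "B (s + t) y" using st(8) by (auto simp: nonrad_def e.nonrad_def)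
      have "B (g z) y = B z y" for z using rad(1)[OF y(1)] by (simp add: g_def B_add)
      then have "B (w + g s + g t) y" using rad(1)[OF y(1)] y(2) by (simp add: B_add)
      then have "nonrad W (w + g s + g t)" using y by (auto simp: nonrad_def)
      moreover have "w + g s + g t \<in> W" using gs(1) gt(1) w(1) add by simp
      ultimately have 3: "w + g s + g t \<in> D" using F q3 unfolding full_def by blast
      \<comment> \<open>Both e and w have been moved into reach by the same vector, which cancels in
        the sum.\<close>
      have "B (e + g s + g t) (w + g s + g t)"
        using gs(3) gt(3) ge gst ew rad(2)[OF gs(1)] rad(2)[OF gt(1)] by (simp add: B_add B_add2 B_self)
      from cl[OF 2 3 this] show ?thesis by (simp add: ac_simps dbl2 dbl)
    qed
  next
    case ew: False
    then have qw: "\<not> q w" using w e by (simp add: q_add)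
    obtain y where y: "y \<in> W" "B e y \<noteq> B w y" using w(3) by (auto simp: B_add)
    have "\<exists>x\<in>W. B e x \<and> \<not> B w x"
    proof -
      consider "\<not> B w x" | "\<not> B w y" | "B w x" "B w y" by blast
      then show ?thesis
      proof cases
        case 3 then show ?thesis using x y add by (intro bexI[of _ "x + y"]) (auto simp: B_add2)
      qed (use x y in auto)
    qed
    then obtain x1 where x1: "x1 \<in> W" "B e x1" "\<not> B w x1" by blast
    have "rich 1 {w, e} W" using rich_orth[OF W] R by (simp add: numeral_3_eq_3)
    then obtain t1 t2 where t: "t1 \<in> W" "t2 \<in> W" "\<not> B w t1" "\<not> B w t2" "\<not> B e t1" "\<not> B e t2" "B t1 t2"
      unfolding rich_def by auto
    then have t': "B t2 t1" using B_sym by blast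
    \<comment> \<open>Projects x1 off the plane of t1 and t2; its values against e and w stay, since
      that plane is orthogonal to both.\<close>
    define x0 where "x0 = (if B x1 t1 then t2 else 0) + ((if B x1 t2 then t1 else 0) + x1)"
    have x0: "x0 \<in> W" "B e x0" "\<not> B w x0" "\<not> B x0 t1" "\<not> B x0 t2"
      unfolding x0_def using x1 t t' add by (auto simp: B_add B_add2 B_self)
    have "\<exists>x\<in>W. q x \<and> B e x \<and> \<not> B w x \<and> nonrad W x \<and> nonrad W (w + x)"
    proof -
      \<comment> \<open>Adding z to x0 changes only the value of q, and z' witnesses that neither x0
        + z nor w + x0 + z is radical.\<close>
      have fin: ?thesis if "z \<in> W" "z' \<in> W" "B z z'" "\<not> B w z" "\<not> B e z" "\<not> B w z'" "\<not> B x0 z" "\<not> B x0 z'" "q z \<noteq> q x0" for z z'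
        by (rule bexI[of _ "x0 + z"]) (use that x0 add in \<open>auto simp: q_add B_add B_add2 nonrad_def\<close>)
      show ?thesis
      proof (cases "q x0")
        case False
        consider "q t1" | "q t2" | "q (t1 + t2)" using t by (auto simp: q_add)
        then show ?thesis
        proof cases
          case 1 show ?thesis by (rule fin[of t1 t2]) (use t x0 1 False in auto)
        next
          case 2 show ?thesis by (rule fin[of t2 t1]) (use t t' x0 2 False in auto)
        next
          case 3 show ?thesis by (rule fin[of "t1 + t2" t2]) (use t t' x0 3 False add in \<open>auto simp: B_add B_add2 B_self\<close>)
        qed
      next
        case qx0: True
        show ?thesis
        proof (cases "nonrad W x0 \<and> nonrad W (w + x0)")
          case True then show ?thesis using x0 qx0 by blast
        next
          case False
          moreover have "w + x0 \<in> W" "q (w + x0)" "B e (w + x0)"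
            using x0 qx0 qw w ew add by (auto simp: q_add B_add2)
          ultimately obtain s where s: "s \<in> W" "\<not> nonrad W s" "q s" "B e s"
            using x0 qx0 by blast
          then have rad: "\<And>y. y \<in> W \<Longrightarrow> \<not> B s y" "\<And>y. y \<in> W \<Longrightarrow> \<not> B y s"
            using B_sym by (auto simp: nonrad_def)
          have "rich 2 {w} W" using rich_orth[OF W] R by (simp add: numeral_3_eq_3 numeral_2_eq_2)
          then have "e.rich 2 {w} W" by (simp add: rich_def e.rich_def)
          from e.rich2_singular[OF _ this] obtain z z' where
            z: "z \<in> W" "z' \<in> W" "B z z'" "\<not> (q z \<noteq> B e z)"
              "\<And>s. s \<in> {w} \<Longrightarrow> \<not> B s z \<and> \<not> B s z'"
            using W by (auto simp: subgr_def e.subgr_def)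
          from z(5) have zw: "\<not> B w z" "\<not> B w z'" by simp_all
          \<comment> \<open>The obstruction is turned into a tool: s is radical with q and
            \<open>B e\<close> true, so it repairs a z on which both are false.\<close>
          define y where "y = (if B e z then z else s + z)"
          have "\<not> B s z" "\<not> B s z'" "\<not> B w s" using rad z(1,2) w(1) by blast+
          then have "q y" "B e y" "\<not> B w y" "B y z'" "B (w + y) z'"
            using z(3,4) zw s(3,4) by (simp_all add: y_def q_add B_add B_add2)
          moreover have "y \<in> W" using z(1) s(1) add by (simp add: y_def)
          ultimately show ?thesis using z(2) nonradI by blast
        qed
      qed
    qed
    then obtain x where x: "x \<in> W" "q x" "B e x" "\<not> B w x" "nonrad W x" "nonrad W (w + x)" by blast
    have 1: "e + x \<in> D" using cl[OF e(1) _ x(3)] F x by (auto simp: full_def)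
    have "q (w + x)" using x qw by (simp add: q_add)
    then have 2: "w + x \<in> D" using F x w add by (auto simp: full_def)
    have "\<not> B x w" using x B_sym by blast
    then have "B (e + x) (w + x)" using x ew by (simp add: B_add B_add2 B_self)
    from cl[OF 1 2 this] show ?thesis by (simp add: ac_simps dbl2 dbl)
  qed
qed

text \<open>A vector v of W that is nonradical only because of e is reached through the detour e +
  v, to which e is then added once more. For v = e + w a witness e + u can be traded for w + u in W,
  as e + w is orthogonal to itself.\<close>

lemma full_step:
  assumes W: "subgr W" and D: "closed D" and F: "full D W" and R: "rich 3 {} W"
    and e: "e \<in> D" "q e" and x: "x \<in> W" "B e x"
  shows "full D (W \<union> (+) e ` W)"
  unfolding full_def
proof (intro ballI impI)
  fix v assume v: "v \<in> W \<union> (+) e ` W" "q v" "nonrad (W \<union> (+) e ` W) v"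
  note aux = full_step_aux[OF W D F R e x]
  show "v \<in> D"
  proof (cases "v \<in> W")
    case True
    show ?thesis
    proof (cases "nonrad W v")
      case True then show ?thesis using F v(2) \<open>v \<in> W\<close> by (auto simp: full_def)
    next
      case False
      then have ve: "B v e" using v(3) by (auto simp: nonrad_def B_add2)
      have 0: "0 \<in> W" using W by (simp add: subgr_def)
      have "\<not> B v x" using False x by (auto simp: nonrad_def)
      then have "\<exists>y\<in>W. B (e + v) y" using x by (auto simp: B_add)
      moreover have "B e v" using ve B_sym by blast
      ultimately have "e + v \<in> D"
        by (intro aux) (use True v e in \<open>auto simp: q_add\<close>)
      moreover have "B e (e + v)" using ve B_sym B_self by (auto simp: B_add2)
      ultimately have "e + (e + v) \<in> D" using D e by (auto simp: closed_def)
      then show ?thesis by (simp add: dbl2)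
    qed
  next
    case False
    then obtain w where w: "w \<in> W" "v = e + w" using v by auto
    obtain y where y: "y \<in> W \<union> (+) e ` W" "B v y" using v by (auto simp: nonrad_def)
    have ww: "B (e + w) (e + w) = False" using B_self by simp
    have "\<exists>y\<in>W. B (e + w) y"
    proof (cases "y \<in> W")
      case True then show ?thesis using y w by auto
    next
      case False
      then obtain u where u: "u \<in> W" "y = e + u" using y by auto
      have "B w e = B e w" by (rule B_sym)
      then have "B (e + w) (w + u)"
        using y u w by (auto simp: B_add B_add2 B_self)
      then show ?thesis using W w u by (auto simp: subgr_def)
    qed
    then show ?thesis using aux[of w] w v by auto
  qed
qed

lemma subgr_gspan: "subgr (gspan A)"
  by (auto simp: subgr_def gspan_0 gspan_add)

lemma full_insert:
  assumes "closed D" "full D (gspan A)" "rich 3 {} (gspan A)" "e \<in> D" "q e" "x \<in> gspan A" "B e x"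
  shows "full D (gspan (insert e A)) \<and> rich 3 {} (gspan (insert e A))"
  unfolding gspan_insert[OF dbl]
  using full_step[OF subgr_gspan assms] rich_mono[OF assms(3)] by auto

lemma full_extend:
  assumes "closed D" "full D (gspan A)" "rich 3 {} (gspan A)"
    and "\<forall>i<length es. es ! i \<in> D \<and> q (es ! i) \<and> (\<exists>x \<in> A \<union> set (take i es). B (es ! i) x)"
  shows "full D (gspan (A \<union> set es)) \<and> rich 3 {} (gspan (A \<union> set es))"
  using assms(4)
proof (induction es rule: rev_induct)
  case Nil then show ?case using assms by simp
next
  case (snoc e es)
  have "\<forall>i<length es. es ! i \<in> D \<and> q (es ! i) \<and> (\<exists>x \<in> A \<union> set (take i es). B (es ! i) x)"
  proof (intro allI impI)
    fix i assume "i < length es"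
    then show "es ! i \<in> D \<and> q (es ! i) \<and> (\<exists>x \<in> A \<union> set (take i es). B (es ! i) x)"
      using snoc.prems[rule_format, of i] by (simp add: nth_append)
  qed
  then have IH: "full D (gspan (A \<union> set es))" "rich 3 {} (gspan (A \<union> set es))" using snoc.IH by auto
  obtain x where x: "x \<in> A \<union> set es" "B e x" "e \<in> D" "q e"
    using snoc.prems[rule_format, of "length es"] by auto
  have "A \<union> set (es @ [e]) = insert e (A \<union> set es)" by auto
  then show ?case
    using full_insert[OF assms(1) IH x(3,4) gspan_base[OF x(1)] x(2)] by simp
qed

lemma full_unrestricted:
  assumes W: "subgr W" and D: "closed D" and F: "full D W" and R: "rich 3 {} W"
    and e: "e \<in> D" "e \<in> W" "\<not> q e" "nonrad W e" and w: "w \<in> W" "nonrad W w"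
  shows "w \<in> D"
proof (cases "q w")
  case True then show ?thesis using F w by (auto simp: full_def)
next
  case False
  text \<open>Adjoining a coordinate s on which the form is linear removes the restriction to q = 1.\<close>
  define B' :: "'a \<times> bit \<Rightarrow> 'a \<times> bit \<Rightarrow> bool" where "B' x y = B (fst x) (fst y)" for x y
  define q' :: "'a \<times> bit \<Rightarrow> bool" where "q' x = (q (fst x) \<noteq> (snd x = 1))" for x
  interpret p: quad B' q'
  proof
    fix x y z :: "'a \<times> bit"
    show "x + x = 0" by (cases x) (auto simp: zero_prod_def dbl)
    show "B' x y = B' y x" using B_sym by (auto simp: B'_def)
    show "q' (x + y) = ((q' x \<noteq> q' y) \<noteq> B' x y)"
      by (cases "snd x"; cases "snd y"; auto simp: q_add q'_def B'_def)
  qed (auto simp: B_self B_add B'_def)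
  \<comment> \<open>Each vector has exactly one bit that makes q' true, so D' is a copy of D with
    prescribed bits, and q' = 1 holds on it by construction.\<close>
  define D' where "D' = {x::'a \<times> bit. fst x \<in> D \<and> q' x}"
  define W' where "W' = {x::'a \<times> bit. fst x \<in> W \<and> snd x = 0}"
  have 1: "p.subgr W'" using W by (auto simp: p.subgr_def subgr_def W'_def)
  have 2: "p.closed D'"
    using D p.q_add by (auto simp: p.closed_def closed_def D'_def B'_def)
  have 3: "p.full D' W'"
    using F by (auto simp: p.full_def full_def D'_def W'_def p.nonrad_def nonrad_def B'_def q'_def)
  obtain p r where pr: "\<forall>i<3::nat. p i \<in> W \<and> r i \<in> W
     \<and> (\<forall>j<3::nat. B (p i) (r j) = (i = j) \<and> \<not> B (p i) (p j) \<and> \<not> B (r i) (r j))"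
    using R unfolding rich_def by blast
  have 4: "p.rich 3 {} W'" unfolding p.rich_def
    by (intro exI[of _ "\<lambda>i. (p i, 0)"] exI[of _ "\<lambda>i. (r i, 0)"]) (use pr in \<open>auto simp: W'_def B'_def\<close>)
  obtain x where x: "x \<in> W" "B e x" using e by (auto simp: nonrad_def)
  have 5: "p.full D' (W' \<union> (+) (e, 1) ` W')"
    by (rule p.full_step[OF 1 2 3 4, where x = "(x, 0)"]) (use e x in \<open>auto simp: D'_def W'_def B'_def q'_def\<close>)
  have "(w, 1) = (e, 1) + (e + w, 0 :: bit)" by (simp add: dbl2)
  moreover have "(e + w, 0) \<in> W'" using W e w by (auto simp: W'_def subgr_def)
  ultimately have "(w, 1) \<in> W' \<union> (+) (e, 1) ` W'" by blast
  moreover have "p.nonrad (W' \<union> (+) (e, 1) ` W') (w, 1)"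
  proof -
    obtain x where "x \<in> W" "B w x" using w by (auto simp: nonrad_def)
    then show ?thesis unfolding p.nonrad_def
      by (intro bexI[of _ "(x, 0)"]) (auto simp: W'_def B'_def)
  qed
  moreover have "q' (w, 1)" using False by (simp add: q'_def)
  ultimately have "(w, 1) \<in> D'" using 5 by (simp add: p.full_def)
  then show ?thesis by (simp add: D'_def)
qed

end

section \<open>The E6 diagram as a starting span\<close>

context quad
begin

text \<open>The diagram is the path e1, ..., e5 with e6 attached to e3. The six vectors and the
  thirty sums derived below are the positive roots of E6 modulo 2; they exhaust the vectors with q =
  1 among the 64 of the span. The digits in the name of a fact list its summands.\<close>

lemma full_E6:
  assumes D: "closed D"
    and d1: "e1 \<in> D" and d2: "e2 \<in> D" and d3: "e3 \<in> D" and d4: "e4 \<in> D" and d5: "e5 \<in> D" and d6: "e6 \<in> D"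
    and qs: "q e1" "q e2" "q e3" "q e4" "q e5" "q e6"
    and E: "B e1 e2" "B e2 e3" "B e3 e4" "B e4 e5" "B e3 e6"
    and N: "\<not> B e1 e3" "\<not> B e1 e4" "\<not> B e1 e5" "\<not> B e1 e6" "\<not> B e2 e4" "\<not> B e2 e5" "\<not> B e2 e6"
      "\<not> B e3 e5" "\<not> B e4 e6" "\<not> B e5 e6"
  shows "full D (gspan {e1, e2, e3, e4, e5, e6}) \<and> rich 3 {} (gspan {e1, e2, e3, e4, e5, e6})"
proof
  have cl: "\<And>x y. x \<in> D \<Longrightarrow> y \<in> D \<Longrightarrow> B x y \<Longrightarrow> x + y \<in> D" using D by (simp add: closed_def)
  have E': "B e2 e1" "B e3 e2" "B e4 e3" "B e5 e4" "B e6 e3"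
    and N': "\<not> B e3 e1" "\<not> B e4 e1" "\<not> B e5 e1" "\<not> B e6 e1" "\<not> B e4 e2" "\<not> B e5 e2" "\<not> B e6 e2"
      "\<not> B e5 e3" "\<not> B e6 e4" "\<not> B e6 e5"
    using E N B_sym by blast+
  note gr = E N E' N' qs B_self B_add B_add2 ac_simps dbl dbl2
  have d12: "e1 + e2 \<in> D" using cl[OF d2 d1] by (simp add: gr)
  have d23: "e2 + e3 \<in> D" using cl[OF d3 d2] by (simp add: gr)
  have d34: "e3 + e4 \<in> D" using cl[OF d4 d3] by (simp add: gr)
  have d36: "e3 + e6 \<in> D" using cl[OF d6 d3] by (simp add: gr)
  have d45: "e4 + e5 \<in> D" using cl[OF d5 d4] by (simp add: gr)
  have d123: "e1 + (e2 + e3) \<in> D" using cl[OF d3 d12] by (simp add: gr)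
  have d234: "e2 + (e3 + e4) \<in> D" using cl[OF d4 d23] by (simp add: gr)
  have d236: "e2 + (e3 + e6) \<in> D" using cl[OF d6 d23] by (simp add: gr)
  have d345: "e3 + (e4 + e5) \<in> D" using cl[OF d5 d34] by (simp add: gr)
  have d346: "e3 + (e4 + e6) \<in> D" using cl[OF d6 d34] by (simp add: gr)
  have d1234: "e1 + (e2 + (e3 + e4)) \<in> D" using cl[OF d4 d123] by (simp add: gr)
  have d1236: "e1 + (e2 + (e3 + e6)) \<in> D" using cl[OF d6 d123] by (simp add: gr)
  have d2345: "e2 + (e3 + (e4 + e5)) \<in> D" using cl[OF d5 d234] by (simp add: gr)
  have d2346: "e2 + (e3 + (e4 + e6)) \<in> D" using cl[OF d6 d234] by (simp add: gr)
  have d3456: "e3 + (e4 + (e5 + e6)) \<in> D" using cl[OF d6 d345] by (simp add: gr)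
  have d12345: "e1 + (e2 + (e3 + (e4 + e5))) \<in> D" using cl[OF d5 d1234] by (simp add: gr)
  have d12346: "e1 + (e2 + (e3 + (e4 + e6))) \<in> D" using cl[OF d6 d1234] by (simp add: gr)
  have d23456: "e2 + (e3 + (e4 + (e5 + e6))) \<in> D" using cl[OF d6 d2345] by (simp add: gr)
  \<comment> \<open>Here e3 is added a second time: the corresponding root has coefficient 2 at e3,
    which vanishes modulo 2.\<close>
  have d246: "e2 + (e4 + e6) \<in> D" using cl[OF d3 d2346] by (simp add: gr)
  have d123456: "e1 + (e2 + (e3 + (e4 + (e5 + e6)))) \<in> D" using cl[OF d6 d12345] by (simp add: gr)
  have d1246: "e1 + (e2 + (e4 + e6)) \<in> D" using cl[OF d3 d12346] by (simp add: gr)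
  have d2456: "e2 + (e4 + (e5 + e6)) \<in> D" using cl[OF d3 d23456] by (simp add: gr)
  have d12456: "e1 + (e2 + (e4 + (e5 + e6))) \<in> D" using cl[OF d3 d123456] by (simp add: gr)
  have d146: "e1 + (e4 + e6) \<in> D" using cl[OF d2 d1246] by (simp add: gr)
  have d256: "e2 + (e5 + e6) \<in> D" using cl[OF d4 d2456] by (simp add: gr)
  have d1456: "e1 + (e4 + (e5 + e6)) \<in> D" using cl[OF d2 d12456] by (simp add: gr)
  have d1256: "e1 + (e2 + (e5 + e6)) \<in> D" using cl[OF d4 d12456] by (simp add: gr)
  have d156: "e1 + (e5 + e6) \<in> D" using cl[OF d4 d1456] by (simp add: gr)
  have d1356: "e1 + (e3 + (e5 + e6)) \<in> D" using cl[OF d3 d156] by (simp add: gr)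
  have d135: "e1 + (e3 + e5) \<in> D" using cl[OF d6 d1356] by (simp add: gr)
  have "\<forall>w \<in> gspan {e1, e2, e3, e4, e5, e6}. q w \<longrightarrow> w \<in> D"
    unfolding gspan_insert[OF dbl] gspan_empty
    by (simp add: ball_Un E N E' N' qs B_self B_add B_add2 q_add add.assoc d1 d2 d3 d4 d5 d6 d12 d23 d34 d36 d45 d123 d234 d236 d345 d346 d1234 d1236 d2345 d2346 d3456 d12345 d12346 d23456 d246 d123456 d1246 d2456 d12456 d146 d256 d1456 d1256 d156 d1356 d135)
  then show "full D (gspan {e1, e2, e3, e4, e5, e6})" by (simp add: full_def)
  let ?G = "gspan {e1, e2, e3, e4, e5, e6}"
  \<comment> \<open>Two disjoint edges of the path give the first two pairs. The third uses the edge
    from e3 to e6, where e1 and e5 cancel the values of e3 on e2 and e4.\<close>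
  let ?p = "\<lambda>i::nat. if i = 0 then e1 else if i = 1 then e4 else e1 + (e3 + e5)"
  let ?r = "\<lambda>i::nat. if i = 0 then e2 else if i = 1 then e5 else e6"
  have m: "e1 \<in> ?G" "e2 \<in> ?G" "e3 \<in> ?G" "e4 \<in> ?G" "e5 \<in> ?G" "e6 \<in> ?G" by (auto intro: gspan_base)
  have lt3: "(\<forall>i<3. P i) \<longleftrightarrow> P 0 \<and> P 1 \<and> P 2" for P :: "nat \<Rightarrow> bool"
    by (auto simp: less_Suc_eq numeral_3_eq_3 numeral_2_eq_2)
  show "rich 3 {} ?G"
    unfolding rich_def
    by (intro exI[of _ ?p] exI[of _ ?r])
      (simp add: lt3 m gspan_add E N E' N' B_self B_add B_add2)
qed

end

section \<open>Pauli strings as vectors\<close>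

text \<open>The Klein four-group: multiplication of Pauli matrices with the phases
  forgotten.\<close>

instantiation pauli :: ab_group_add
begin

definition zero_pauli :: pauli where "zero_pauli = PI"

fun plus_pauli :: "pauli \<Rightarrow> pauli \<Rightarrow> pauli" where
  "PI + b = b" | "a + PI = a"
| "PX + PX = PI" | "PX + PY = PZ" | "PX + PZ = PY"
| "PY + PX = PZ" | "PY + PY = PI" | "PY + PZ = PX"
| "PZ + PX = PY" | "PZ + PY = PX" | "PZ + PZ = PI"

definition uminus_pauli :: "pauli \<Rightarrow> pauli" where "- a = (a :: pauli)"
definition minus_pauli :: "pauli \<Rightarrow> pauli \<Rightarrow> pauli" where "a - b = (a + b :: pauli)"

instance
proof
  fix a b c :: pauli
  show "a + b + c = a + (b + c)" by (cases a; cases b; cases c) simp_all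
  show "a + b = b + a" by (cases a; cases b) simp_all
  show "0 + a = a" by (simp add: zero_pauli_def)
  show "- a + a = 0" by (cases a) (simp_all add: zero_pauli_def uminus_pauli_def)
  show "a - b = a + - b" unfolding minus_pauli_def uminus_pauli_def ..
qed

end

lemma pauli_neq_0 [simp]: "PX \<noteq> 0" "PY \<noteq> 0" "PZ \<noteq> 0" "0 \<noteq> PX" "0 \<noteq> PY" "0 \<noteq> PZ"
  by (simp_all add: zero_pauli_def)

lemma pauli_dbl [simp]: "(a :: pauli) + a = 0"
  by (cases a) (simp_all add: zero_pauli_def)

lemma PI_0 [simp]: "PI = 0" unfolding zero_pauli_def ..

lemma pauli_cases [case_names 0 X Y Z, cases type: pauli]:
  "(a = 0 \<Longrightarrow> P) \<Longrightarrow> (a = PX \<Longrightarrow> P) \<Longrightarrow> (a = PY \<Longrightarrow> P) \<Longrightarrow> (a = PZ \<Longrightarrow> P) \<Longrightarrow> P"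
  by (rule pauli.exhaust[of a]) auto

lemma UNIV_pauli: "UNIV = {0, PX, PY, PZ}"
  using pauli_cases by blast

instance pauli :: finite
  by standard (simp add: UNIV_pauli)

definition anti :: "pauli \<Rightarrow> pauli \<Rightarrow> bool" where
  "anti a b \<longleftrightarrow> a \<noteq> 0 \<and> b \<noteq> 0 \<and> a \<noteq> b"

lemma anti_simps [simp]:
  "\<not> anti 0 a" "\<not> anti a 0" "\<not> anti a a" "anti PX PY" "anti PX PZ" "anti PY PX" "anti PY PZ" "anti PZ PX" "anti PZ PY"
  by (simp_all add: anti_def)

lemma anti_sym: "anti a b = anti b a" by (auto simp: anti_def)

lemma anti_add: "anti (a + b) c \<longleftrightarrow> (anti a c \<noteq> anti b c)"
  by (cases a; cases b; cases c) simp_all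

text \<open>Y is the only antisymmetric Pauli matrix, and transposition reverses products. Hence
  being Y is a quadratic function whose polar form is anticommutation.\<close>

lemma PY_add: "(a + b = PY) \<longleftrightarrow> (((a = PY) \<noteq> (b = PY)) \<noteq> anti a b)"
  by (cases a; cases b) simp_all

text \<open>Infinite sequences rather than lists: addition is pointwise and independent of the
  length, which enters only through \<open>strs\<close> and the first argument of the forms.\<close>

type_synonym pstr = "nat \<Rightarrow> pauli"

primrec bc :: "nat \<Rightarrow> pstr \<Rightarrow> pstr \<Rightarrow> bool" where
  "bc 0 f g = False"
| "bc (Suc n) f g = (bc n f g \<noteq> anti (f n) (g n))"

primrec yodd :: "nat \<Rightarrow> pstr \<Rightarrow> bool" where
  "yodd 0 f = False"
| "yodd (Suc n) f = (yodd n f \<noteq> (f n = PY))"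

text \<open>Every quadratic refinement of the commutation form arises from the count of Y by a linear twist.\<close>
definition qf :: "nat \<Rightarrow> pstr \<Rightarrow> pstr \<Rightarrow> bool" where
  "qf n c f = (yodd n f \<noteq> bc n c f)"

lemma bc_sym: "bc n f g = bc n g f"
  by (induction n) (auto simp: anti_sym)

lemma bc_add: "bc n (f + g) h \<longleftrightarrow> (bc n f h \<noteq> bc n g h)"
  by (induction n) (auto simp: anti_add)

lemma bc_self [simp]: "\<not> bc n f f"
  by (induction n) auto

lemma yodd_add: "yodd n (f + g) \<longleftrightarrow> ((yodd n f \<noteq> yodd n g) \<noteq> bc n f g)"
  by (induction n) (auto simp: PY_add)

lemma pstr_dbl [simp]: "(f :: pstr) + f = 0" by (simp add: fun_eq_iff)

interpretation pq: quad "bc n" "qf n c" for n c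
proof
  fix f g h :: pstr
  show "f + f = 0" "bc n f g = bc n g f" "\<not> bc n f f" "bc n (f + g) h = (bc n f h \<noteq> bc n g h)"
    using bc_sym bc_add by auto
  have "bc n c (f + g) = (bc n c f \<noteq> bc n c g)" using bc_add bc_sym by metis
  then show "qf n c (f + g) = ((qf n c f \<noteq> qf n c g) \<noteq> bc n f g)"
    by (auto simp: qf_def yodd_add)
qed

lemmas bc_add2 = pq.B_add2
lemmas pstr_dbl2 = pq.dbl2

definition strs :: "nat \<Rightarrow> pstr set" where "strs n = {f. \<forall>i\<ge>n. f i = 0}"

definition pt :: "nat \<Rightarrow> pauli \<Rightarrow> pstr" where "pt j a = (\<lambda>i. if i = j then a else 0)"

definition cons :: "pauli \<Rightarrow> pstr \<Rightarrow> pstr" where "cons a f = (\<lambda>i. case i of 0 \<Rightarrow> a | Suc j \<Rightarrow> f j)"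

lemma strs_0 [simp]: "0 \<in> strs n" by (simp add: strs_def)
lemma strs_add [simp]: "f \<in> strs n \<Longrightarrow> g \<in> strs n \<Longrightarrow> f + g \<in> strs n" by (simp add: strs_def)
lemma strs_mono: "f \<in> strs m \<Longrightarrow> m \<le> n \<Longrightarrow> f \<in> strs n" by (simp add: strs_def)
lemma strs_pt [simp]: "j < n \<Longrightarrow> pt j a \<in> strs n" by (auto simp: strs_def pt_def)
lemma pt_apply [simp]: "pt j a i = (if i = j then a else 0)" by (simp add: pt_def)
lemma pt_0 [simp]: "pt j 0 = 0" by (simp add: pt_def fun_eq_iff)
lemma pt_add: "pt j a + pt j b = pt j (a + b)" by (simp add: fun_eq_iff)
lemma strs_zero: "strs 0 = {0}" by (auto simp: strs_def fun_eq_iff)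

lemma strsD: "f \<in> strs n \<Longrightarrow> n \<le> i \<Longrightarrow> f i = 0" by (simp add: strs_def)

lemma strs_eqI: "f \<in> strs n \<Longrightarrow> g \<in> strs n \<Longrightarrow> (\<And>i. i < n \<Longrightarrow> f i = g i) \<Longrightarrow> f = g"
  using strsD by (auto simp: fun_eq_iff) (metis not_le)

lemma cons_0 [simp]: "cons a f 0 = a" and cons_Suc [simp]: "cons a f (Suc i) = f i"
  by (simp_all add: cons_def)

lemma cons_add: "cons a f + cons b g = cons (a + b) (f + g)"
  by (auto simp: fun_eq_iff cons_def split: nat.splits)

lemma cons_collapse: "cons (f 0) (\<lambda>i. f (Suc i)) = f"
  by (auto simp: fun_eq_iff cons_def split: nat.splits)

lemma cons_eq [simp]: "cons a f = cons b g \<longleftrightarrow> a = b \<and> f = g"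
  by (metis cons_0 cons_Suc ext)

lemma cons_strs [simp]: "cons a f \<in> strs (Suc n) \<longleftrightarrow> f \<in> strs n"
  by (auto simp: strs_def cons_def split: nat.splits)

lemma cons_0_0 [simp]: "cons 0 0 = 0"
  by (auto simp: fun_eq_iff cons_def split: nat.splits)

lemma strs_Suc: "strs (Suc n) = (\<lambda>(a, f). cons a f) ` (UNIV \<times> strs n)"
proof -
  have "f \<in> (\<lambda>(a, f). cons a f) ` (UNIV \<times> strs n)" if "f \<in> strs (Suc n)" for f
    by (rule image_eqI[of _ _ "(f 0, \<lambda>i. f (Suc i))"]) (use that in \<open>auto simp: cons_collapse strs_def\<close>)
  then show ?thesis by auto
qed

lemma finite_strs [simp]: "finite (strs n)"
  by (induction n) (simp_all add: strs_zero strs_Suc)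

lemma bc_cons: "bc (Suc n) (cons a f) (cons b g) = (anti a b \<noteq> bc n f g)"
  by (induction n) auto

lemma yodd_cons: "yodd (Suc n) (cons a f) = ((a = PY) \<noteq> yodd n f)"
  by (induction n) auto

lemma bc_pt [simp]: "bc n f (pt j a) = (j < n \<and> anti (f j) a)"
  by (induction n) (auto simp: less_Suc_eq)

lemma bc_pt2 [simp]: "bc n (pt j a) f = (j < n \<and> anti a (f j))"
  by (subst bc_sym) (auto simp: anti_sym)

lemma yodd_pt [simp]: "yodd n (pt j a) = (j < n \<and> a = PY)"
  by (induction n) (auto simp: less_Suc_eq)

lemma bc_cong: "(\<And>i. i < n \<Longrightarrow> f i = f' i) \<Longrightarrow> (\<And>i. i < n \<Longrightarrow> g i = g' i) \<Longrightarrow> bc n f g = bc n f' g'"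
  by (induction n) auto

lemma yodd_cong: "(\<And>i. i < n \<Longrightarrow> f i = f' i) \<Longrightarrow> yodd n f = yodd n f'"
  by (induction n) auto

lemma bc_mono: "f \<in> strs k \<Longrightarrow> k \<le> n \<Longrightarrow> bc n f g = bc k f g"
  by (induction n) (auto simp: le_Suc_eq strs_def)

lemma bc_zero [simp]: "\<not> bc n 0 f" "\<not> bc n f 0"
  using pq.B_0 by auto

lemma yodd_zero [simp]: "\<not> yodd n 0" by (induction n) auto

text \<open>A nonzero letter anticommutes with some letter placed at the same site; this single-site
  string is the witness.\<close>

lemma strs_nondeg:
  assumes "f \<in> strs n" "f \<noteq> 0"
  obtains g where "g \<in> strs n" "bc n f g"
proof -
  obtain i where i: "f i \<noteq> 0" using assms(2) by (auto simp: fun_eq_iff)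
  then have "i < n" using assms(1) by (metis not_le strsD)
  moreover obtain a where "anti (f i) a" using i by (cases "f i") (auto intro: that[of PX] that[of PY])
  ultimately show thesis by (intro that[of "pt i a"]) auto
qed

section \<open>Pauli strings as matrices\<close>

lemma sum_div_mod:
  "(\<Sum>k<a * b. f (k div b) (k mod b)) = (\<Sum>p<a. \<Sum>q<(b::nat). f p q)" for f :: "nat \<Rightarrow> nat \<Rightarrow> 'a::comm_monoid_add"
proof (cases "b = 0")
  case False
  have "(\<Sum>k<a * b. f (k div b) (k mod b)) = (\<Sum>p<a. \<Sum>k=p*b..<p*b+b. f (k div b) (k mod b))"
    by (rule sum.nat_group[symmetric])
  also have "\<dots> = (\<Sum>p<a. \<Sum>q<b. f p q)"
  proof (rule sum.cong[OF refl])
    fix p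
    have "(\<Sum>k=p*b..<p*b+b. f (k div b) (k mod b)) = (\<Sum>k=0+p*b..<b+p*b. f (k div b) (k mod b))"
      by (simp add: add.commute)
    also have "\<dots> = (\<Sum>q=0..<b. f ((q + p*b) div b) ((q + p*b) mod b))"
      by (rule sum.shift_bounds_nat_ivl)
    also have "\<dots> = (\<Sum>q<b. f p q)"
      using False by (intro sum.cong) (auto simp: lessThan_atLeast0)
    finally show "(\<Sum>k=p*b..<p*b+b. f (k div b) (k mod b)) = (\<Sum>q<b. f p q)" .
  qed
  finally show ?thesis .
qed simp

lemma kron_dim [simp]: "dim_row (kron A B) = dim_row A * dim_row B" "dim_col (kron A B) = dim_col A * dim_col B"
  by (simp_all add: kron_def)

lemma kron_carrier: "A \<in> carrier_mat a b \<Longrightarrow> B \<in> carrier_mat c d \<Longrightarrow> kron A B \<in> carrier_mat (a * c) (b * d)"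
  by (auto simp: kron_def)

lemma kron_index:
  "i < dim_row A * dim_row B \<Longrightarrow> j < dim_col A * dim_col B \<Longrightarrow>
   kron A B $$ (i, j) = A $$ (i div dim_row B, j div dim_col B) * B $$ (i mod dim_row B, j mod dim_col B)"
  by (simp add: kron_def)

lemma less_mult_div_mod: "i < a * b \<Longrightarrow> i div b < a \<and> i mod b < (b::nat)"
  by (metis less_mult_imp_div_less less_nat_zero_code mod_less_divisor mult_0_right neq0_conv)

lemma kron_mult:
  assumes "A \<in> carrier_mat a b" "B \<in> carrier_mat c d" "C \<in> carrier_mat b e" "D \<in> carrier_mat d f"
  shows "kron A B * kron C D = kron (A * C) (B * D)"
proof (rule eq_matI)
  fix i j assume "i < dim_row (kron (A * C) (B * D))" "j < dim_col (kron (A * C) (B * D))"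
  then have ij: "i < a * c" "j < e * f" using assms by auto
  note dm = less_mult_div_mod[OF ij(1)] less_mult_div_mod[OF ij(2)]
  have "(kron A B * kron C D) $$ (i, j) = (\<Sum>k<b * d. kron A B $$ (i, k) * kron C D $$ (k, j))"
    using assms ij by (simp add: scalar_prod_def lessThan_atLeast0)
  also have "\<dots> = (\<Sum>k<b * d. (A $$ (i div c, k div d) * C $$ (k div d, j div f)) * (B $$ (i mod c, k mod d) * D $$ (k mod d, j mod f)))"
    using assms ij by (intro sum.cong) (auto simp: kron_index)
  also have "\<dots> = (\<Sum>p<b. \<Sum>q<d. (A $$ (i div c, p) * C $$ (p, j div f)) * (B $$ (i mod c, q) * D $$ (q, j mod f)))"
    by (rule sum_div_mod)
  also have "\<dots> = (A * C) $$ (i div c, j div f) * (B * D) $$ (i mod c, j mod f)"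
    using assms dm by (simp add: scalar_prod_def lessThan_atLeast0 sum_product)
  finally show "(kron A B * kron C D) $$ (i, j) = kron (A * C) (B * D) $$ (i, j)"
    using assms ij by (simp add: kron_index)
qed (use assms in auto)

lemma pmat_carrier [simp]: "pmat p \<in> carrier_mat 2 2"
  by (cases p rule: pauli.exhaust) (simp_all add: pmat_def mat_of_rows_list_def numeral_2_eq_2 del: PI_0)

lemma pmat_index:
  "pmat 0 $$ (0,0) = 1" "pmat 0 $$ (0,Suc 0) = 0" "pmat 0 $$ (Suc 0,0) = 0" "pmat 0 $$ (Suc 0,Suc 0) = 1"
  "pmat PX $$ (0,0) = 0" "pmat PX $$ (0,Suc 0) = 1" "pmat PX $$ (Suc 0,0) = 1" "pmat PX $$ (Suc 0,Suc 0) = 0"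
  "pmat PY $$ (0,0) = 0" "pmat PY $$ (0,Suc 0) = - \<i>" "pmat PY $$ (Suc 0,0) = \<i>" "pmat PY $$ (Suc 0,Suc 0) = 0"
  "pmat PZ $$ (0,0) = 1" "pmat PZ $$ (0,Suc 0) = 0" "pmat PZ $$ (Suc 0,0) = 0" "pmat PZ $$ (Suc 0,Suc 0) = -1"
  by (simp_all add: pmat_def mat_of_rows_list_def zero_pauli_def del: PI_0)

lemma pmat_0: "pmat 0 = 1\<^sub>m 2"
  by (rule eq_matI) (auto simp: pmat_index less_2_cases_iff carrier_matD[OF pmat_carrier])

definition ph1 :: "pauli \<Rightarrow> pauli \<Rightarrow> complex" where
  "ph1 a b = (if (a, b) \<in> {(PX,PY),(PY,PZ),(PZ,PX)} then \<i>
     else if (a, b) \<in> {(PY,PX),(PZ,PY),(PX,PZ)} then - \<i> else 1)"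

lemma ph1_table [simp]: "ph1 0 a = 1" "ph1 a 0 = 1" "ph1 a a = 1"
  "ph1 PX PY = \<i>" "ph1 PY PZ = \<i>" "ph1 PZ PX = \<i>" "ph1 PY PX = - \<i>" "ph1 PZ PY = - \<i>" "ph1 PX PZ = - \<i>"
  by (auto simp: ph1_def)

lemma mat2_mult_index:
  assumes "A \<in> carrier_mat 2 2" "B \<in> carrier_mat 2 2" "i < 2" "j < 2"
  shows "(A * B) $$ (i, j) = A $$ (i, 0) * B $$ (0, j) + A $$ (i, Suc 0) * B $$ (Suc 0, j)"
proof -
  have "{0..<2} = {0, Suc 0}" by auto
  then show ?thesis using assms by (simp add: scalar_prod_def)
qed

lemma pmat_mult_entries:
  "\<forall>i\<in>{0, Suc 0}. \<forall>j\<in>{0, Suc 0}. pmat a $$ (i, 0) * pmat b $$ (0, j) + pmat a $$ (i, Suc 0) * pmat b $$ (Suc 0, j)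
     = ph1 a b * pmat (a + b) $$ (i, j)"
  by (cases a; cases b; simp only: ph1_table plus_pauli.simps add_0_left add_0_right pauli_dbl;
      simp add: pmat_index)

lemma pmat_mult: "pmat a * pmat b = ph1 a b \<cdot>\<^sub>m pmat (a + b)"
proof (rule eq_matI)
  fix i j assume "i < dim_row (ph1 a b \<cdot>\<^sub>m pmat (a + b))" "j < dim_col (ph1 a b \<cdot>\<^sub>m pmat (a + b))"
  then have ij: "i < 2" "j < 2" using carrier_matD[OF pmat_carrier] by auto
  then have "(ph1 a b \<cdot>\<^sub>m pmat (a + b)) $$ (i, j) = ph1 a b * pmat (a + b) $$ (i, j)"
    using carrier_matD[OF pmat_carrier] by auto
  moreover have "i = 0 \<or> i = Suc 0" "j = 0 \<or> j = Suc 0" using ij by auto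
  ultimately show "(pmat a * pmat b) $$ (i, j) = (ph1 a b \<cdot>\<^sub>m pmat (a + b)) $$ (i, j)"
    unfolding mat2_mult_index[OF pmat_carrier pmat_carrier ij]
    using pmat_mult_entries[of a b] by auto
qed (use carrier_matD[OF pmat_carrier] in auto)

lemma kron_smult:
  "kron (x \<cdot>\<^sub>m A) (y \<cdot>\<^sub>m B) = (x * y) \<cdot>\<^sub>m kron A B"
  by (rule eq_matI) (auto simp: kron_index less_mult_div_mod mult_ac)

definition ps :: "nat \<Rightarrow> pstr \<Rightarrow> complex mat" where
  "ps n f = pstring (map f [0..<n])"

definition phn :: "nat \<Rightarrow> pstr \<Rightarrow> pstr \<Rightarrow> complex" where
  "phn n f g = (\<Prod>i<n. ph1 (f i) (g i))"

lemma ps_0: "ps 0 f = 1\<^sub>m 1" by (simp add: ps_def)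

lemma ps_Suc: "ps (Suc n) f = kron (pmat (f 0)) (ps n (\<lambda>i. f (Suc i)))"
  by (simp add: ps_def upt_conv_Cons map_Suc_upt[symmetric] comp_def del: upt_Suc)

lemma ps_cons: "ps (Suc n) (cons a f) = kron (pmat a) (ps n f)"
  by (simp add: ps_Suc)

lemma ps_carrier [simp]: "ps n f \<in> carrier_mat (2 ^ n) (2 ^ n)"
proof (induction n arbitrary: f)
  case (Suc n) then show ?case using kron_carrier[OF pmat_carrier] by (simp add: ps_Suc)
qed (simp add: ps_0)

lemma ps_dim [simp]: "dim_row (ps n f) = 2 ^ n" "dim_col (ps n f) = 2 ^ n"
  using carrier_matD[OF ps_carrier] by auto

lemma ps_mult: "ps n f * ps n g = phn n f g \<cdot>\<^sub>m ps n (f + g)"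
proof (induction n arbitrary: f g)
  case 0 show ?case by (rule eq_matI) (auto simp: ps_0 phn_def)
next
  case (Suc n)
  let ?f = "\<lambda>i. f (Suc i)" and ?g = "\<lambda>i. g (Suc i)"
  have "ps (Suc n) f * ps (Suc n) g = kron (pmat (f 0) * pmat (g 0)) (ps n ?f * ps n ?g)"
    unfolding ps_Suc by (rule kron_mult[OF pmat_carrier ps_carrier pmat_carrier ps_carrier])
  also have "\<dots> = (ph1 (f 0) (g 0) * phn n ?f ?g) \<cdot>\<^sub>m kron (pmat (f 0 + g 0)) (ps n (?f + ?g))"
    by (simp only: pmat_mult Suc.IH kron_smult)
  also have "?f + ?g = (\<lambda>i. (f + g) (Suc i))" by (simp add: fun_eq_iff)
  also have "(ph1 (f 0) (g 0) * phn n ?f ?g) \<cdot>\<^sub>m kron (pmat (f 0 + g 0)) (ps n (\<lambda>i. (f + g) (Suc i)))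
      = phn (Suc n) f g \<cdot>\<^sub>m ps (Suc n) (f + g)"
    by (simp add: ps_Suc phn_def prod.lessThan_Suc_shift del: prod.lessThan_Suc)
  finally show ?case .
qed

lemma ps_zero: "ps n 0 = 1\<^sub>m (2 ^ n)"
proof (induction n)
  case (Suc n)
  have "kron (1\<^sub>m 2) (1\<^sub>m (2 ^ n)) = (1\<^sub>m (2 * 2 ^ n) :: complex mat)"
    by (rule eq_matI) (auto simp: kron_index less_mult_div_mod, metis div_mult_mod_eq)
  with Suc show ?case by (simp add: ps_Suc pmat_0 zero_fun_def)
qed (simp add: ps_0)

lemma ph1_swap: "ph1 b a = (if anti a b then - ph1 a b else ph1 a b)"
  by (cases a; cases b; simp)

lemma ph1_sq: "ph1 a b * ph1 a b = (if anti a b then -1 else 1)"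
  by (cases a; cases b; simp)

lemma ph1_cocycle: "ph1 a b * ph1 (a + b) c = ph1 a (b + c) * ph1 b c"
  by (cases a; cases b; cases c; simp)

lemma phn_self [simp]: "phn n f f = 1" "phn n 0 f = 1" "phn n f 0 = 1"
  by (simp_all add: phn_def)

text \<open>Each anticommuting site contributes i or -i, with square -1, and every other site
  contributes 1; so the phase is imaginary exactly for anticommuting strings.\<close>

lemma phn_sq: "phn n f g * phn n f g = (if bc n f g then -1 else 1)"
proof (induction n)
  case (Suc n)
  have "phn (Suc n) f g * phn (Suc n) f g = (phn n f g * phn n f g) * (ph1 (f n) (g n) * ph1 (f n) (g n))"
    by (simp add: phn_def mult_ac)
  then show ?case by (simp add: Suc ph1_sq)
qed (simp add: phn_def)

lemma phn_swap: "phn n g f = (if bc n f g then - phn n f g else phn n f g)"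
proof (induction n)
  case (Suc n)
  have "phn (Suc n) f g = phn n f g * ph1 (f n) (g n)" for f g by (simp add: phn_def)
  then show ?case using Suc ph1_swap[of "g n" "f n"] by simp
qed (simp add: phn_def)

text \<open>This is associativity of the matrix product, read on phases; the choice of signs in
  \<open>sign_exists\<close> depends on it.\<close>

lemma phn_cocycle: "phn n f g * phn n (f + g) h = phn n f (g + h) * phn n g h"
  by (simp add: phn_def ph1_cocycle flip: prod.distrib)

section \<open>Real spans of matrices\<close>

text \<open>The index type is arbitrary, so that strings and pairs of indices are treated alike. The
  entrywise form keeps the dimension fixed without side conditions on the family.\<close>

definition lincomb :: "nat \<Rightarrow> 's set \<Rightarrow> ('s \<Rightarrow> complex) \<Rightarrow> ('s \<Rightarrow> complex mat) \<Rightarrow> complex mat" where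
  "lincomb N S c M = mat N N (\<lambda>(i, j). \<Sum>s\<in>S. c s * M s $$ (i, j))"

definition spanM :: "nat \<Rightarrow> 's set \<Rightarrow> ('s \<Rightarrow> complex mat) \<Rightarrow> complex mat set" where
  "spanM N S M = {lincomb N S (\<lambda>s. complex_of_real (r s)) M | r. True}"

definition indep :: "nat \<Rightarrow> 's set \<Rightarrow> ('s \<Rightarrow> complex mat) \<Rightarrow> bool" where
  "indep N S M \<longleftrightarrow> (\<forall>r. lincomb N S (\<lambda>s. complex_of_real (r s)) M = 0\<^sub>m N N \<longrightarrow> (\<forall>s\<in>S. r s = 0))"

lemma lincomb_carrier [simp]: "lincomb N S c M \<in> carrier_mat N N"
  and lincomb_dim [simp]: "dim_row (lincomb N S c M) = N" "dim_col (lincomb N S c M) = N"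
  by (simp_all add: lincomb_def)

lemma lincomb_index [simp]: "i < N \<Longrightarrow> j < N \<Longrightarrow> lincomb N S c M $$ (i, j) = (\<Sum>s\<in>S. c s * M s $$ (i, j))"
  by (simp add: lincomb_def)

lemma lincomb_cong:
  "(\<And>s. s \<in> S \<Longrightarrow> c s = c' s) \<Longrightarrow> (\<And>s. s \<in> S \<Longrightarrow> M s = M' s) \<Longrightarrow> lincomb N S c M = lincomb N S c' M'"
  by (rule eq_matI) auto

lemma lincomb_add: "lincomb N S c M + lincomb N S d M = lincomb N S (\<lambda>s. c s + d s) M"
  by (rule eq_matI) (auto simp: sum.distrib distrib_right)

lemma lincomb_smult: "x \<cdot>\<^sub>m lincomb N S c M = lincomb N S (\<lambda>s. x * c s) M"
  by (rule eq_matI) (auto simp: sum_distrib_left mult_ac)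

lemma lincomb_zero: "(\<And>s. s \<in> S \<Longrightarrow> c s = 0) \<Longrightarrow> lincomb N S c M = 0\<^sub>m N N"
  by (rule eq_matI) auto

lemma lincomb_single:
  assumes "finite S" "t \<in> S" "M t \<in> carrier_mat N N"
  shows "lincomb N S (\<lambda>s. if s = t then x else 0) M = x \<cdot>\<^sub>m M t"
proof (rule eq_matI)
  fix i j assume "i < dim_row (x \<cdot>\<^sub>m M t)" "j < dim_col (x \<cdot>\<^sub>m M t)"
  then have ij: "i < N" "j < N" "i < dim_row (M t)" "j < dim_col (M t)" using assms by auto
  have "(\<Sum>s\<in>S. (if s = t then x else 0) * M s $$ (i, j)) = (\<Sum>s\<in>S. if s = t then x * M t $$ (i, j) else 0)"
    by (rule sum.cong) auto
  then show "lincomb N S (\<lambda>s. if s = t then x else 0) M $$ (i, j) = (x \<cdot>\<^sub>m M t) $$ (i, j)"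
    using assms ij by simp
qed (use assms in auto)

lemma lincomb_mult:
  assumes S: "finite S" "finite T" and M: "\<And>s. s \<in> S \<Longrightarrow> M s \<in> carrier_mat N N" "\<And>t. t \<in> T \<Longrightarrow> M' t \<in> carrier_mat N N"
  shows "lincomb N S c M * lincomb N T d M' = lincomb N (S \<times> T) (\<lambda>(s, t). c s * d t) (\<lambda>(s, t). M s * M' t)"
proof (rule eq_matI)
  fix i j assume "i < dim_row (lincomb N (S \<times> T) (\<lambda>(s, t). c s * d t) (\<lambda>(s, t). M s * M' t))"
    "j < dim_col (lincomb N (S \<times> T) (\<lambda>(s, t). c s * d t) (\<lambda>(s, t). M s * M' t))"
  then have ij: "i < N" "j < N" by auto
  have "(lincomb N S c M * lincomb N T d M') $$ (i, j)
      = (\<Sum>k<N. (\<Sum>s\<in>S. c s * M s $$ (i, k)) * (\<Sum>t\<in>T. d t * M' t $$ (k, j)))"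
    using ij by (simp add: scalar_prod_def lessThan_atLeast0)
  also have "\<dots> = (\<Sum>k<N. \<Sum>(s, t)\<in>S \<times> T. (c s * d t) * (M s $$ (i, k) * M' t $$ (k, j)))"
    by (simp add: sum_product sum.cartesian_product mult_ac)
  also have "\<dots> = (\<Sum>(s, t)\<in>S \<times> T. (c s * d t) * (\<Sum>k<N. M s $$ (i, k) * M' t $$ (k, j)))"
    by (subst sum.swap) (simp add: sum_distrib_left case_prod_unfold)
  also have "\<dots> = (\<Sum>(s, t)\<in>S \<times> T. (c s * d t) * (M s * M' t) $$ (i, j))"
  proof (intro sum.cong refl, clarify)
    fix s t assume "s \<in> S" "t \<in> T"
    then show "c s * d t * (\<Sum>k<N. M s $$ (i, k) * M' t $$ (k, j)) = c s * d t * (M s * M' t) $$ (i, j)"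
      using carrier_matD[OF M(1)[of s]] carrier_matD[OF M(2)[of t]] ij by (simp add: scalar_prod_def lessThan_atLeast0)
  qed
  finally show "(lincomb N S c M * lincomb N T d M') $$ (i, j)
      = lincomb N (S \<times> T) (\<lambda>(s, t). c s * d t) (\<lambda>(s, t). M s * M' t) $$ (i, j)"
    using ij by (simp add: case_prod_unfold)
qed auto

lemma comm_carrier [simp]: "A \<in> carrier_mat N N \<Longrightarrow> B \<in> carrier_mat N N \<Longrightarrow> comm A B \<in> carrier_mat N N"
  unfolding comm_def by (intro minus_carrier_mat mult_carrier_mat)

lemma comm_index:
  "A \<in> carrier_mat N N \<Longrightarrow> B \<in> carrier_mat N N \<Longrightarrow> i < N \<Longrightarrow> j < N \<Longrightarrow>
    comm A B $$ (i, j) = (A * B) $$ (i, j) - (B * A) $$ (i, j)"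
  by (auto simp: comm_def)

lemma lincomb_comm:
  assumes S: "finite S" "finite T" and M: "\<And>s. s \<in> S \<Longrightarrow> M s \<in> carrier_mat N N" "\<And>t. t \<in> T \<Longrightarrow> M' t \<in> carrier_mat N N"
  shows "comm (lincomb N S c M) (lincomb N T d M') = lincomb N (S \<times> T) (\<lambda>(s, t). c s * d t) (\<lambda>(s, t). comm (M s) (M' t))"
proof (rule eq_matI)
  fix i j assume "i < dim_row (lincomb N (S \<times> T) (\<lambda>(s, t). c s * d t) (\<lambda>(s, t). comm (M s) (M' t)))"
    "j < dim_col (lincomb N (S \<times> T) (\<lambda>(s, t). c s * d t) (\<lambda>(s, t). comm (M s) (M' t)))"
  then have ij: "i < N" "j < N" by auto
  have "(\<Sum>(t, s)\<in>T \<times> S. (d t * c s) * (M' t * M s) $$ (i, j)) = (\<Sum>(s, t)\<in>S \<times> T. (c s * d t) * (M' t * M s) $$ (i, j))"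
    unfolding sum.cartesian_product[symmetric] by (subst sum.swap) (simp add: mult.commute)
  moreover have "(lincomb N S c M * lincomb N T d M') $$ (i, j) = (\<Sum>(s, t)\<in>S \<times> T. (c s * d t) * (M s * M' t) $$ (i, j))"
    using lincomb_mult[OF S M, where c = c and d = d] ij by (simp only: lincomb_index case_prod_unfold)
  moreover have "(lincomb N T d M' * lincomb N S c M) $$ (i, j) = (\<Sum>(t, s)\<in>T \<times> S. (d t * c s) * (M' t * M s) $$ (i, j))"
    using lincomb_mult[OF S(2,1) M(2,1), where c = d and d = c] ij by (simp only: lincomb_index case_prod_unfold)
  ultimately have "comm (lincomb N S c M) (lincomb N T d M') $$ (i, j)
     = (\<Sum>(s, t)\<in>S \<times> T. (c s * d t) * ((M s * M' t) $$ (i, j) - (M' t * M s) $$ (i, j)))"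
    unfolding comm_index[OF lincomb_carrier lincomb_carrier ij]
    by (simp only: case_prod_unfold sum_subtractf[symmetric] right_diff_distrib)
  also have "\<dots> = (\<Sum>(s, t)\<in>S \<times> T. (c s * d t) * comm (M s) (M' t) $$ (i, j))"
  proof (intro sum.cong refl, clarify)
    fix s t assume "s \<in> S" "t \<in> T"
    then show "c s * d t * ((M s * M' t) $$ (i, j) - (M' t * M s) $$ (i, j)) = c s * d t * comm (M s) (M' t) $$ (i, j)"
      using comm_index[OF M(1) M(2) ij] by simp
  qed
  finally show "comm (lincomb N S c M) (lincomb N T d M') $$ (i, j)
     = lincomb N (S \<times> T) (\<lambda>(s, t). c s * d t) (\<lambda>(s, t). comm (M s) (M' t)) $$ (i, j)"
    using ij by (simp add: case_prod_unfold)
qed (use carrier_matD[OF comm_carrier[OF lincomb_carrier lincomb_carrier]] in auto)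

lemma lincomb_lincomb:
  "lincomb N T a (\<lambda>t. lincomb N S (k t) M) = lincomb N S (\<lambda>s. \<Sum>t\<in>T. a t * k t s) M"
  by (rule eq_matI) (auto simp: sum_distrib_left sum_distrib_right mult_ac intro: sum.swap)

lemma spanM_I: "lincomb N S (\<lambda>s. complex_of_real (r s)) M \<in> spanM N S M"
  by (auto simp: spanM_def)

lemma spanM_E:
  assumes "A \<in> spanM N S M"
  obtains r where "A = lincomb N S (\<lambda>s. complex_of_real (r s)) M"
  using assms by (auto simp: spanM_def)

text \<open>The structure constants k are an explicit argument because isomorphisms are obtained
  from two families over one index set with literally the same k.\<close>

definition structured :: "nat \<Rightarrow> 's set \<Rightarrow> ('s \<Rightarrow> complex mat) \<Rightarrow> ('s \<Rightarrow> 's \<Rightarrow> 's \<Rightarrow> real) \<Rightarrow> bool" where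
  "structured N S M k \<longleftrightarrow> finite S \<and> (\<forall>s\<in>S. M s \<in> carrier_mat N N)
     \<and> (\<forall>s\<in>S. \<forall>t\<in>S. comm (M s) (M t) = lincomb N S (\<lambda>u. complex_of_real (k s t u)) M)"

lemma structured_comm:
  assumes "structured N S M k"
  shows "comm (lincomb N S (\<lambda>s. complex_of_real (r s)) M) (lincomb N S (\<lambda>s. complex_of_real (q s)) M)
    = lincomb N S (\<lambda>u. complex_of_real (\<Sum>(s, t)\<in>S \<times> S. r s * q t * k s t u)) M"
proof -
  have fin: "finite S" and M: "\<And>s. s \<in> S \<Longrightarrow> M s \<in> carrier_mat N N" using assms by (auto simp: structured_def)
  have "comm (lincomb N S (\<lambda>s. complex_of_real (r s)) M) (lincomb N S (\<lambda>s. complex_of_real (q s)) M)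
     = lincomb N (S \<times> S) (\<lambda>(s, t). complex_of_real (r s) * complex_of_real (q t)) (\<lambda>(s, t). comm (M s) (M t))"
    by (rule lincomb_comm[OF fin fin M M])
  also have "\<dots> = lincomb N (S \<times> S) (\<lambda>(s, t). complex_of_real (r s * q t))
      (\<lambda>st. lincomb N S (\<lambda>u. complex_of_real (k (fst st) (snd st) u)) M)"
    by (rule lincomb_cong) (use assms in \<open>auto simp: structured_def\<close>)
  also have "\<dots> = lincomb N S (\<lambda>u. complex_of_real (\<Sum>(s, t)\<in>S \<times> S. r s * q t * k s t u)) M"
    unfolding lincomb_lincomb by (rule lincomb_cong) (auto simp: case_prod_unfold)
  finally show ?thesis .
qed

lemma spanM_lie:
  assumes "structured N S M k"
  shows "real_lie_subalg N (spanM N S M)"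
  unfolding real_lie_subalg_def
proof (intro conjI ballI allI)
  show "spanM N S M \<subseteq> carrier_mat N N" by (auto simp: spanM_def)
  show "0\<^sub>m N N \<in> spanM N S M" using spanM_I[of N S "\<lambda>_. 0" M] by (simp add: lincomb_zero)
  fix A assume "A \<in> spanM N S M"
  then obtain r where r: "A = lincomb N S (\<lambda>s. complex_of_real (r s)) M" by (rule spanM_E)
  show "complex_of_real x \<cdot>\<^sub>m A \<in> spanM N S M" for x
    unfolding r lincomb_smult of_real_mult[symmetric] by (rule spanM_I)
  fix B assume "B \<in> spanM N S M"
  then obtain q where q: "B = lincomb N S (\<lambda>s. complex_of_real (q s)) M" by (rule spanM_E)
  show "A + B \<in> spanM N S M" unfolding r q lincomb_add of_real_add[symmetric] by (rule spanM_I)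
  show "comm A B \<in> spanM N S M" unfolding r q structured_comm[OF assms] by (rule spanM_I)
qed

lemma indep_coeff_eq:
  assumes "indep N S M"
    and "lincomb N S (\<lambda>s. complex_of_real (r s)) M = lincomb N S (\<lambda>s. complex_of_real (q s)) M" "s \<in> S"
  shows "r s = q s"
proof -
  have "lincomb N S (\<lambda>s. complex_of_real (r s - q s)) M
     = lincomb N S (\<lambda>s. complex_of_real (r s)) M + (-1) \<cdot>\<^sub>m lincomb N S (\<lambda>s. complex_of_real (q s)) M"
    unfolding lincomb_smult lincomb_add by (rule lincomb_cong) auto
  also have "\<dots> = 0\<^sub>m N N" unfolding assms(2) by (rule eq_matI) auto
  finally show ?thesis using assms(1,3) unfolding indep_def by fastforce
qed

theorem structured_iso:
  assumes st: "structured N S M k" "structured N' S M' k" and ind: "indep N S M" "indep N' S M'"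
  shows "spanM N S M \<cong>\<^sub>L spanM N' S M'"
proof -
  let ?L = "\<lambda>r. lincomb N S (\<lambda>s. complex_of_real (r s)) M"
  let ?L' = "\<lambda>r. lincomb N' S (\<lambda>s. complex_of_real (r s)) M'"
  \<comment> \<open>Independence determines the coefficients only on S; outside S the choice is
    arbitrary but has no effect on the combination.\<close>
  define f where "f A = ?L' (SOME r. A = ?L r)" for A
  have f: "f (?L r) = ?L' r" for r
  proof -
    have "?L r = ?L (SOME q. ?L r = ?L q)" by (rule someI[of "\<lambda>q. ?L r = ?L q" r]) simp
    then have "r s = (SOME q. ?L r = ?L q) s" if "s \<in> S" for s
      using indep_coeff_eq[OF ind(1)] that by metis
    then show ?thesis unfolding f_def by (intro lincomb_cong) auto
  qed
  have LL: "?L r = ?L q" if "?L' r = ?L' q" for r q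
    using indep_coeff_eq[OF ind(2) that] by (intro lincomb_cong) auto
  have inj: "inj_on f (spanM N S M)"
  proof (rule inj_onI)
    fix A B assume A: "A \<in> spanM N S M" and B: "B \<in> spanM N S M" and fAB: "f A = f B"
    obtain r where r: "A = ?L r" using A by (rule spanM_E)
    obtain q where q: "B = ?L q" using B by (rule spanM_E)
    show "A = B" using LL[of r q] fAB unfolding r q f by blast
  qed
  have "f ` spanM N S M = spanM N' S M'"
  proof
    show "f ` spanM N S M \<subseteq> spanM N' S M'" by (auto elim!: spanM_E simp: f spanM_I)
    show "spanM N' S M' \<subseteq> f ` spanM N S M"
    proof
      fix C assume "C \<in> spanM N' S M'"
      then obtain r where "C = f (?L r)" unfolding f by (rule spanM_E)
      then show "C \<in> f ` spanM N S M" using spanM_I by blast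
    qed
  qed
  with inj have "bij_betw f (spanM N S M) (spanM N' S M')" by (simp add: bij_betw_def)
  moreover have "f (A + B) = f A + f B \<and> f (comm A B) = comm (f A) (f B)"
    if A: "A \<in> spanM N S M" and B: "B \<in> spanM N S M" for A B
  proof -
    obtain r where r: "A = ?L r" using A by (rule spanM_E)
    obtain q where q: "B = ?L q" using B by (rule spanM_E)
    note rq = r q
    have "A + B = ?L (\<lambda>s. r s + q s)" "f A + f B = ?L' (\<lambda>s. r s + q s)"
      unfolding rq f lincomb_add by simp_all
    then have "f (A + B) = f A + f B" by (simp only: f)
    moreover have "f (comm A B) = comm (f A) (f B)"
      unfolding rq f structured_comm[OF st(1)] structured_comm[OF st(2)] ..
    ultimately show ?thesis ..
  qed
  moreover have "f (complex_of_real x \<cdot>\<^sub>m A) = complex_of_real x \<cdot>\<^sub>m f A" if A: "A \<in> spanM N S M" for A x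
  proof -
    obtain r where r: "A = ?L r" using A by (rule spanM_E)
    have "complex_of_real x \<cdot>\<^sub>m A = ?L (\<lambda>s. x * r s)" "complex_of_real x \<cdot>\<^sub>m f A = ?L' (\<lambda>s. x * r s)"
      unfolding r f lincomb_smult by simp_all
    then show ?thesis by (simp only: f)
  qed
  ultimately show ?thesis unfolding lie_iso_def by blast
qed

lemma lie_iso_trans:
  assumes "L1 \<cong>\<^sub>L L2" "L2 \<cong>\<^sub>L L3"
  shows "L1 \<cong>\<^sub>L L3"
proof -
  obtain f g where f: "bij_betw f L1 L2"
      "\<And>A B. A \<in> L1 \<Longrightarrow> B \<in> L1 \<Longrightarrow> f (A + B) = f A + f B \<and> f (comm A B) = comm (f A) (f B)"
      "\<And>A r. A \<in> L1 \<Longrightarrow> f (complex_of_real r \<cdot>\<^sub>m A) = complex_of_real r \<cdot>\<^sub>m f A"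
    and g: "bij_betw g L2 L3"
      "\<And>A B. A \<in> L2 \<Longrightarrow> B \<in> L2 \<Longrightarrow> g (A + B) = g A + g B \<and> g (comm A B) = comm (g A) (g B)"
      "\<And>A r. A \<in> L2 \<Longrightarrow> g (complex_of_real r \<cdot>\<^sub>m A) = complex_of_real r \<cdot>\<^sub>m g A"
    using assms unfolding lie_iso_def by blast
  have "f A \<in> L2" if "A \<in> L1" for A using f(1) that by (auto simp: bij_betw_def)
  then show ?thesis unfolding lie_iso_def
    by (intro exI[of _ "g \<circ> f"]) (auto simp: f(2,3) g(2,3) bij_betw_trans[OF f(1) g(1)])
qed

text \<open>To recognise the preimage of a sum or commutator, that sum or commutator of preimages
  has to lie in the domain; hence the assumption that the domain is a Lie subalgebra.\<close>

lemma lie_iso_sym: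
  assumes "L1 \<cong>\<^sub>L L2" "real_lie_subalg N L1"
  shows "L2 \<cong>\<^sub>L L1"
proof -
  obtain f where f: "bij_betw f L1 L2"
      "\<And>A B. A \<in> L1 \<Longrightarrow> B \<in> L1 \<Longrightarrow> f (A + B) = f A + f B \<and> f (comm A B) = comm (f A) (f B)"
      "\<And>A r. A \<in> L1 \<Longrightarrow> f (complex_of_real r \<cdot>\<^sub>m A) = complex_of_real r \<cdot>\<^sub>m f A"
    using assms unfolding lie_iso_def by blast
  define g where "g = inv_into L1 f"
  have g: "g (f A) = A" if "A \<in> L1" for A using f(1) that by (simp add: g_def bij_betw_def inv_into_f_f)
  have ex: "\<exists>A\<in>L1. C = f A" if "C \<in> L2" for C using f(1) that by (auto simp: bij_betw_def)
  have cl: "A + B \<in> L1" "comm A B \<in> L1" "complex_of_real r \<cdot>\<^sub>m A \<in> L1" if "A \<in> L1" "B \<in> L1" for A B r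
    using assms(2) that by (auto simp: real_lie_subalg_def)
  have "g (C + D) = g C + g D \<and> g (comm C D) = comm (g C) (g D)" if "C \<in> L2" "D \<in> L2" for C D
  proof -
    obtain A B where AB: "A \<in> L1" "C = f A" "B \<in> L1" "D = f B" using ex \<open>C \<in> L2\<close> \<open>D \<in> L2\<close> by metis
    have "C + D = f (A + B)" "comm C D = f (comm A B)" using f(2)[OF AB(1,3)] AB by auto
    then show ?thesis using AB g cl[OF AB(1,3)] by simp
  qed
  moreover have "g (complex_of_real r \<cdot>\<^sub>m C) = complex_of_real r \<cdot>\<^sub>m g C" if "C \<in> L2" for C r
  proof -
    obtain A where A: "A \<in> L1" "C = f A" using ex \<open>C \<in> L2\<close> by metis
    have "complex_of_real r \<cdot>\<^sub>m C = f (complex_of_real r \<cdot>\<^sub>m A)" using f(3)[OF A(1)] A by simp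
    then show ?thesis using A g cl(3)[OF A(1) A(1)] by simp
  qed
  moreover have "bij_betw g L2 L1" unfolding g_def by (rule bij_betw_inv_into[OF f(1)])
  ultimately show ?thesis unfolding lie_iso_def by blast
qed

section \<open>Lie algebras spanned by Pauli strings\<close>

definition pm :: "nat \<Rightarrow> pstr \<Rightarrow> complex mat" where "pm n f = \<i> \<cdot>\<^sub>m ps n f"

definition spanR :: "nat \<Rightarrow> pstr set \<Rightarrow> complex mat set" where "spanR n S = spanM (2 ^ n) S (pm n)"

text \<open>For anticommuting strings the phase is imaginary, so cs n f g is the real structure constant; it vanishes otherwise.\<close>
definition cs :: "nat \<Rightarrow> pstr \<Rightarrow> pstr \<Rightarrow> real" where
  "cs n f g = (if bc n f g then - 2 * Im (phn n f g) else 0)"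

lemma pm_carrier [simp]: "pm n f \<in> carrier_mat (2 ^ n) (2 ^ n)"
  by (simp add: pm_def)

lemma pm_dim [simp]: "dim_row (pm n f) = 2 ^ n" "dim_col (pm n f) = 2 ^ n"
  by (simp_all add: pm_def)

lemma phn_Im: "bc n f g \<Longrightarrow> phn n f g = \<i> * complex_of_real (Im (phn n f g))"
  and Im_phn_sq: "bc n f g \<Longrightarrow> Im (phn n f g) * Im (phn n f g) = 1"
proof -
  assume "bc n f g"
  then have *: "phn n f g * phn n f g = -1" by (simp add: phn_sq)
  then have "(phn n f g - \<i>) * (phn n f g + \<i>) = 0" by (simp add: algebra_simps)
  then have "phn n f g = \<i> \<or> phn n f g = - \<i>" by (simp add: eq_neg_iff_add_eq_0)
  then show "phn n f g = \<i> * complex_of_real (Im (phn n f g))" "Im (phn n f g) * Im (phn n f g) = 1" by auto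
qed

text \<open>For anticommuting strings write the phase as i x. The two factors i give -1 and
  antisymmetry gives 2, so the commutator is -2 i x times the string f + g, that is -2 x times its
  skew-Hermitian version.\<close>

lemma comm_pm: "comm (pm n f) (pm n g) = complex_of_real (cs n f g) \<cdot>\<^sub>m pm n (f + g)"
proof -
  have m: "pm n f * pm n g = (- phn n f g) \<cdot>\<^sub>m ps n (f + g)" for f g
  proof -
    have "pm n f * pm n g = \<i> \<cdot>\<^sub>m (\<i> \<cdot>\<^sub>m (ps n f * ps n g))"
      unfolding pm_def mult_smult_distrib[OF smult_carrier_mat[OF ps_carrier] ps_carrier]
        mult_smult_assoc_mat[OF ps_carrier ps_carrier] ..
    then show ?thesis unfolding ps_mult by (auto intro!: eq_matI)
  qed
  have gf: "g + f = f + g" by (simp add: add.commute)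
  show ?thesis
  proof (cases "bc n f g")
    case True
    then have "phn n g f = - phn n f g" by (simp add: phn_swap[of n g f])
    moreover obtain x where x: "phn n f g = \<i> * complex_of_real x" using phn_Im[OF True] by blast
    ultimately show ?thesis unfolding comm_def m gf
      using True by (intro eq_matI) (auto simp: pm_def cs_def)
  next
    case False
    then have "phn n g f = phn n f g" by (simp add: phn_swap[of n g f])
    then show ?thesis unfolding comm_def m gf
      using False by (intro eq_matI) (auto simp: pm_def cs_def)
  qed
qed

section \<open>Independence of strings through the trace form\<close>

definition tr :: "complex mat \<Rightarrow> complex" where "tr A = (\<Sum>i<dim_row A. A $$ (i, i))"

lemma tr_kron:
  assumes "A \<in> carrier_mat a a" "B \<in> carrier_mat b b"
  shows "tr (kron A B) = tr A * tr B"
proof -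
  have "tr (kron A B) = (\<Sum>k<a * b. A $$ (k div b, k div b) * B $$ (k mod b, k mod b))"
    using assms by (auto simp: tr_def kron_index intro!: sum.cong)
  also have "\<dots> = (\<Sum>p<a. \<Sum>q<b. A $$ (p, p) * B $$ (q, q))"
    by (rule sum_div_mod)
  finally show ?thesis using assms by (auto simp: tr_def sum_product)
qed

lemma tr_pmat: "tr (pmat a) = (if a = 0 then 2 else 0)"
proof -
  have "{..<2} = {0, Suc 0}" by auto
  then show ?thesis using carrier_matD[OF pmat_carrier]
    by (cases a) (simp_all add: tr_def pmat_index)
qed

lemma tr_ps: "f \<in> strs n \<Longrightarrow> tr (ps n f) = (if f = 0 then 2 ^ n else 0)"
proof (induction n arbitrary: f)
  case 0 then show ?case by (simp add: strs_zero tr_def ps_0)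
next
  case (Suc n)
  then obtain a g where f: "f = cons a g" "g \<in> strs n" by (auto simp: strs_Suc)
  have "f = 0 \<longleftrightarrow> a = 0 \<and> g = 0" unfolding f(1) using cons_eq[of a g 0 0] by (simp only: cons_0_0)
  moreover have "tr (ps (Suc n) f) = tr (pmat a) * tr (ps n g)"
    unfolding f(1) ps_cons by (rule tr_kron[OF pmat_carrier ps_carrier])
  ultimately show ?case unfolding Suc.IH[OF f(2)] tr_pmat by (simp del: zero_fun_apply)
qed

lemma tr_mult_lincomb:
  assumes "finite S" "A \<in> carrier_mat N N" "\<And>s. s \<in> S \<Longrightarrow> M s \<in> carrier_mat N N"
  shows "tr (A * lincomb N S c M) = (\<Sum>s\<in>S. c s * tr (A * M s))"
proof -
  have "tr (A * lincomb N S c M) = (\<Sum>i<N. \<Sum>k<N. A $$ (i, k) * (\<Sum>s\<in>S. c s * M s $$ (k, i)))"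
    using assms by (simp add: tr_def scalar_prod_def lessThan_atLeast0)
  also have "\<dots> = (\<Sum>i<N. \<Sum>k<N. \<Sum>s\<in>S. c s * (A $$ (i, k) * M s $$ (k, i)))"
    by (simp add: sum_distrib_left mult_ac)
  also have "\<dots> = (\<Sum>i<N. \<Sum>s\<in>S. \<Sum>k<N. c s * (A $$ (i, k) * M s $$ (k, i)))"
    by (intro sum.cong refl sum.swap)
  also have "\<dots> = (\<Sum>s\<in>S. \<Sum>i<N. \<Sum>k<N. c s * (A $$ (i, k) * M s $$ (k, i)))"
    by (rule sum.swap)
  also have "\<dots> = (\<Sum>s\<in>S. c s * tr (A * M s))"
  proof (rule sum.cong[OF refl])
    fix s assume "s \<in> S"
    then show "(\<Sum>i<N. \<Sum>k<N. c s * (A $$ (i, k) * M s $$ (k, i))) = c s * tr (A * M s)"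
      using assms(2) assms(3)[of s] by (simp add: tr_def scalar_prod_def lessThan_atLeast0 sum_distrib_left)
  qed
  finally show ?thesis .
qed

text \<open>Multiplication by t turns every other string of S into a nonzero string, whose trace
  vanishes; only the coefficient of t survives.\<close>

lemma ps_coeff:
  assumes "finite S" "S \<subseteq> strs n" "t \<in> S"
  shows "tr (ps n t * lincomb (2 ^ n) S c (ps n)) = c t * 2 ^ n"
proof -
  have "tr (x \<cdot>\<^sub>m ps n f) = x * tr (ps n f)" for x f by (simp add: tr_def sum_distrib_left)
  then have "tr (ps n t * lincomb (2 ^ n) S c (ps n)) = (\<Sum>s\<in>S. c s * (phn n t s * tr (ps n (t + s))))"
    unfolding tr_mult_lincomb[OF assms(1) ps_carrier ps_carrier] by (simp add: ps_mult)
  also have "\<dots> = (\<Sum>s\<in>S. if s = t then c t * 2 ^ n else 0)"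
  proof (rule sum.cong[OF refl])
    fix s assume s: "s \<in> S"
    have "t + s = 0 \<longleftrightarrow> s = t" by (metis add.right_neutral pstr_dbl pstr_dbl2)
    moreover have "t + s \<in> strs n" using s assms(2,3) by (meson strs_add subsetD)
    ultimately show "c s * (phn n t s * tr (ps n (t + s))) = (if s = t then c t * 2 ^ n else 0)"
      by (simp add: tr_ps)
  qed
  finally show ?thesis using assms by simp
qed

lemma indep_pm:
  assumes "finite S" "S \<subseteq> strs n"
  shows "indep (2 ^ n) S (pm n)"
  unfolding indep_def
proof (intro allI impI ballI)
  fix r :: "pstr \<Rightarrow> real" and s
  assume z: "lincomb (2 ^ n) S (\<lambda>s. complex_of_real (r s)) (pm n) = 0\<^sub>m (2 ^ n) (2 ^ n)" and s: "s \<in> S"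
  have "lincomb (2 ^ n) S (\<lambda>s. complex_of_real (r s) * \<i>) (ps n) = lincomb (2 ^ n) S (\<lambda>s. complex_of_real (r s)) (pm n)"
    by (rule eq_matI) (auto simp: pm_def mult_ac)
  then have "complex_of_real (r s) * \<i> * 2 ^ n = tr (ps n s * 0\<^sub>m (2 ^ n) (2 ^ n))"
    using ps_coeff[OF assms s] z by metis
  also have "\<dots> = 0" by (simp add: tr_def)
  finally show "r s = 0" by simp
qed

text \<open>As simplification rules these eta-expand sums of strings.\<close>
declare plus_fun_apply [simp del] zero_fun_apply [simp del]
lemmas fun_app = plus_fun_apply zero_fun_apply

section \<open>Closures of sets of strings and the algebras they generate\<close>

inductive_set pcl :: "nat \<Rightarrow> pstr set \<Rightarrow> pstr set" for n G where
  pcl_base: "f \<in> G \<Longrightarrow> f \<in> pcl n G"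
| pcl_step: "f \<in> pcl n G \<Longrightarrow> g \<in> pcl n G \<Longrightarrow> bc n f g \<Longrightarrow> f + g \<in> pcl n G"

abbreviation pclosed :: "nat \<Rightarrow> pstr set \<Rightarrow> bool" where "pclosed n \<equiv> quad.closed (bc n)"

lemma pclosedD: "pclosed n S \<Longrightarrow> f \<in> S \<Longrightarrow> g \<in> S \<Longrightarrow> bc n f g \<Longrightarrow> f + g \<in> S"
  by (auto simp: pq.closed_def)

lemma pclosedI: "(\<And>f g. f \<in> S \<Longrightarrow> g \<in> S \<Longrightarrow> bc n f g \<Longrightarrow> f + g \<in> S) \<Longrightarrow> pclosed n S"
  by (auto simp: pq.closed_def)

lemma pcl_closed: "pclosed n (pcl n G)"
  by (auto intro: pclosedI pcl_step)

lemma pcl_least: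
  assumes "G \<subseteq> S" "pclosed n S"
  shows "pcl n G \<subseteq> S"
proof
  fix f assume "f \<in> pcl n G"
  then show "f \<in> S" by induction (use assms pclosedD in auto)
qed

lemma pcl_mono: "G \<subseteq> pcl n H \<Longrightarrow> pcl n G \<subseteq> pcl n H"
  by (rule pcl_least[OF _ pcl_closed])

lemma pcl_eqI: "G \<subseteq> pcl n H \<Longrightarrow> H \<subseteq> pcl n G \<Longrightarrow> pcl n G = pcl n H"
  using pcl_mono by blast

lemma pcl_strs: "G \<subseteq> strs n \<Longrightarrow> pcl n G \<subseteq> strs n"
  by (erule pcl_least) (rule pclosedI, rule strs_add)

lemma finite_pcl: "G \<subseteq> strs n \<Longrightarrow> finite (pcl n G)"
  by (rule finite_subset[OF pcl_strs finite_strs])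

lemma structured_pm:
  assumes "S \<subseteq> strs n" "pclosed n S"
  shows "structured (2 ^ n) S (pm n) (\<lambda>f g u. if u = f + g then cs n f g else 0)"
proof -
  have fin: "finite S" using assms(1) finite_strs finite_subset by blast
  have "comm (pm n f) (pm n g) = lincomb (2 ^ n) S (\<lambda>u. complex_of_real (if u = f + g then cs n f g else 0)) (pm n)"
    if "f \<in> S" "g \<in> S" for f g
  proof (cases "bc n f g")
    case True
    then have "f + g \<in> S" by (rule pclosedD[OF assms(2) that])
    then have "lincomb (2 ^ n) S (\<lambda>u. if u = f + g then complex_of_real (cs n f g) else 0) (pm n)
        = complex_of_real (cs n f g) \<cdot>\<^sub>m pm n (f + g)"
      by (intro lincomb_single[OF fin]) simp_all
    moreover have "(\<lambda>u. complex_of_real (if u = f + g then cs n f g else 0)) = (\<lambda>u. if u = f + g then complex_of_real (cs n f g) else 0)"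
      by auto
    ultimately show ?thesis by (simp only: comm_pm)
  next
    case False
    then have "cs n f g = 0" by (simp add: cs_def)
    then have "comm (pm n f) (pm n g) = 0\<^sub>m (2 ^ n) (2 ^ n)" unfolding comm_pm by (intro eq_matI) auto
    moreover have "lincomb (2 ^ n) S (\<lambda>u. complex_of_real (if u = f + g then cs n f g else 0)) (pm n) = 0\<^sub>m (2 ^ n) (2 ^ n)"
      using \<open>cs n f g = 0\<close> by (intro lincomb_zero) simp
    ultimately show ?thesis by simp
  qed
  then show ?thesis using fin by (auto simp: structured_def)
qed

lemma lie_lincomb:
  assumes "real_lie_subalg N L" "finite S" "\<And>s. s \<in> S \<Longrightarrow> M s \<in> L"
  shows "lincomb N S (\<lambda>s. complex_of_real (r s)) M \<in> L"
  using assms(2,3)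
proof (induction S)
  case empty
  have "lincomb N {} (\<lambda>s. complex_of_real (r s)) M = 0\<^sub>m N N" by (rule lincomb_zero) simp
  then show ?case using assms(1) by (simp add: real_lie_subalg_def)
next
  case (insert s S)
  have Ms: "M s \<in> L" "M s \<in> carrier_mat N N" using insert assms(1) by (auto simp: real_lie_subalg_def)
  then have "lincomb N (insert s S) (\<lambda>s. complex_of_real (r s)) M
      = complex_of_real (r s) \<cdot>\<^sub>m M s + lincomb N S (\<lambda>s. complex_of_real (r s)) M"
    using insert(1,2) by (intro eq_matI) auto
  then show ?case using Ms insert assms(1) by (simp add: real_lie_subalg_def)
qed

lemma pm_in_spanR:
  assumes "finite S" "f \<in> S"
  shows "pm n f \<in> spanR n S"
proof -
  have "pm n f = 1 \<cdot>\<^sub>m pm n f" by (intro eq_matI) auto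
  also have "\<dots> = lincomb (2 ^ n) S (\<lambda>s. if s = f then 1 else 0) (pm n)"
    by (rule lincomb_single[symmetric]) (use assms in auto)
  also have "\<dots> = lincomb (2 ^ n) S (\<lambda>s. complex_of_real (if s = f then 1 else 0)) (pm n)"
    by (rule lincomb_cong) auto
  finally show ?thesis unfolding spanR_def by (metis spanM_I)
qed

lemma spanR_lie: "S \<subseteq> strs n \<Longrightarrow> pclosed n S \<Longrightarrow> real_lie_subalg (2 ^ n) (spanR n S)"
  unfolding spanR_def by (rule spanM_lie[OF structured_pm])

text \<open>The commutator of anticommuting strings is a nonzero real multiple of their product, so
  rescaling recovers the product itself inside any subalgebra that contains the generators.\<close>

theorem lie_gen_spanR:
  assumes G: "G \<subseteq> strs n"
  shows "lie_gen (2 ^ n) (pm n ` G) = spanR n (pcl n G)"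
proof
  have "pm n ` G \<subseteq> spanR n (pcl n G)"
    using pm_in_spanR[OF finite_pcl[OF G]] pcl_base by blast
  then show "lie_gen (2 ^ n) (pm n ` G) \<subseteq> spanR n (pcl n G)"
    using spanR_lie[OF pcl_strs[OF G] pcl_closed] by (auto simp: lie_gen_def)
  show "spanR n (pcl n G) \<subseteq> lie_gen (2 ^ n) (pm n ` G)"
    unfolding lie_gen_def
  proof (intro Inter_greatest)
    fix L assume "L \<in> {L. real_lie_subalg (2 ^ n) L \<and> pm n ` G \<subseteq> L}"
    then have L: "real_lie_subalg (2 ^ n) L" "pm n ` G \<subseteq> L" by auto
    have "pm n f \<in> L" if "f \<in> pcl n G" for f
      using that
    proof induction
      case (pcl_base f) then show ?case using L by auto
    next
      case (pcl_step f g)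
      have "comm (pm n f) (pm n g) \<in> L" using pcl_step L by (auto simp: real_lie_subalg_def)
      then have "complex_of_real (1 / cs n f g) \<cdot>\<^sub>m (complex_of_real (cs n f g) \<cdot>\<^sub>m pm n (f + g)) \<in> L"
        using L unfolding comm_pm real_lie_subalg_def by blast
      moreover have "cs n f g \<noteq> 0" using pcl_step(3) Im_phn_sq[of n f g] by (auto simp: cs_def)
      then have "complex_of_real (1 / cs n f g) \<cdot>\<^sub>m (complex_of_real (cs n f g) \<cdot>\<^sub>m pm n (f + g)) = pm n (f + g)"
        by (intro eq_matI) auto
      ultimately show ?case by simp
    qed
    then show "spanR n (pcl n G) \<subseteq> L"
      using lie_lincomb[OF L(1) finite_pcl[OF G]] by (auto simp: spanR_def spanM_def)
  qed
qed

text \<open>Sites and bonds are counted from 0 here, whereas \<open>placed\<close> counts from 1;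
  bond j joins the sites j and j + 1.\<close>

definition pr :: "nat \<Rightarrow> pauli \<Rightarrow> pauli \<Rightarrow> pstr" where "pr j a b = pt j a + pt (Suc j) b"

definition cg :: "nat \<Rightarrow> (pauli \<times> pauli) set \<Rightarrow> pstr set" where
  "cg n G = {pr j a b | j a b. (a, b) \<in> G \<and> Suc j < n}"

lemma pr_strs [simp]: "Suc j < n \<Longrightarrow> pr j a b \<in> strs n"
  by (auto simp: pr_def intro!: strs_add)

lemma cg_strs: "cg n G \<subseteq> strs n" by (auto simp: cg_def)

lemma pstring_placed:
  assumes "1 \<le> j" "j \<le> n - 1"
  shows "pstring (placed n j a (j + 1) b) = ps n (pr (j - 1) a b)"
  unfolding ps_def
proof (rule arg_cong[of _ _ pstring], rule nth_equalityI)
  fix i assume "i < length (placed n j a (j + 1) b)"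
  then have "i < n" by (simp add: placed_def)
  then show "placed n j a (j + 1) b ! i = map (pr (j - 1) a b) [0..<n] ! i"
    using assms by (auto simp: placed_def pr_def nth_list_update fun_app)
qed (simp add: placed_def)

lemma chain_alg_spanR: "chain_alg G n = spanR n (pcl n (cg n G))"
proof -
  have "{\<i> \<cdot>\<^sub>m pstring (placed n j A (j + 1) B) | A B j. (A, B) \<in> G \<and> 1 \<le> j \<and> j \<le> n - 1} = pm n ` cg n G"
  proof (intro equalityI subsetI)
    fix X assume "X \<in> {\<i> \<cdot>\<^sub>m pstring (placed n j A (j + 1) B) | A B j. (A, B) \<in> G \<and> 1 \<le> j \<and> j \<le> n - 1}"
    then obtain A B j where *: "X = \<i> \<cdot>\<^sub>m pstring (placed n j A (j + 1) B)" "(A, B) \<in> G" "1 \<le> j" "j \<le> n - 1"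
      by blast
    have "X = pm n (pr (j - 1) A B)" unfolding *(1) pstring_placed[OF *(3,4)] pm_def ..
    moreover have "Suc (j - 1) < n" using *(3,4) by simp
    then have "pr (j - 1) A B \<in> cg n G" using *(2) unfolding cg_def by blast
    ultimately show "X \<in> pm n ` cg n G" by blast
  next
    fix X assume "X \<in> pm n ` cg n G"
    then obtain A B j where *: "X = pm n (pr j A B)" "(A, B) \<in> G" "Suc j < n" by (auto simp: cg_def)
    have "pstring (placed n (Suc j) A (Suc j + 1) B) = ps n (pr j A B)"
      using pstring_placed[of "Suc j" n A B] *(3) by simp
    then have "X = \<i> \<cdot>\<^sub>m pstring (placed n (Suc j) A (Suc j + 1) B)"
      using *(1) by (simp add: pm_def)
    moreover have "1 \<le> Suc j" "Suc j \<le> n - 1" using *(3) by auto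
    ultimately show "X \<in> {\<i> \<cdot>\<^sub>m pstring (placed n j A (j + 1) B) | A B j. (A, B) \<in> G \<and> 1 \<le> j \<and> j \<le> n - 1}"
      using *(2) by blast
  qed
  then show ?thesis unfolding chain_alg_def by (simp add: lie_gen_spanR cg_strs)
qed

section \<open>Lifting maps of strings to Lie isomorphisms\<close>

lemma spanM_signed:
  assumes fin: "finite S" and T: "\<Phi> ` S \<subseteq> strs m" "inj_on \<Phi> S"
    and sgn: "\<forall>f\<in>S. s f * s f = (1 :: real)"
  shows "spanM (2 ^ m) S (\<lambda>f. complex_of_real (s f) \<cdot>\<^sub>m pm m (\<Phi> f)) = spanR m (\<Phi> ` S)"
    and "indep (2 ^ m) S (\<lambda>f. complex_of_real (s f) \<cdot>\<^sub>m pm m (\<Phi> f))"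
proof -
  note s = bspec[OF sgn]
  define M' where "M' f = complex_of_real (s f) \<cdot>\<^sub>m pm m (\<Phi> f)" for f
  have re: "lincomb (2 ^ m) S (\<lambda>f. complex_of_real (r f)) M'
     = lincomb (2 ^ m) (\<Phi> ` S) (\<lambda>g. complex_of_real (r (inv_into S \<Phi> g) * s (inv_into S \<Phi> g))) (pm m)" for r
    by (rule eq_matI) (simp_all add: sum.reindex[OF T(2)] M'_def mult_ac T(2))
  have sp: "spanM (2 ^ m) S M' = spanR m (\<Phi> ` S)"
  proof
    show "spanM (2 ^ m) S M' \<subseteq> spanR m (\<Phi> ` S)"
    proof
      fix A assume "A \<in> spanM (2 ^ m) S M'"
      then obtain r where "A = lincomb (2 ^ m) S (\<lambda>f. complex_of_real (r f)) M'" by (rule spanM_E)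
      then show "A \<in> spanR m (\<Phi> ` S)" unfolding re spanR_def by (simp only: spanM_I)
    qed
    show "spanR m (\<Phi> ` S) \<subseteq> spanM (2 ^ m) S M'"
    proof
      fix A assume "A \<in> spanR m (\<Phi> ` S)"
      then obtain q where q: "A = lincomb (2 ^ m) (\<Phi> ` S) (\<lambda>s. complex_of_real (q s)) (pm m)"
        unfolding spanR_def by (rule spanM_E)
      have "A = lincomb (2 ^ m) S (\<lambda>f. complex_of_real (q (\<Phi> f) * s f)) M'"
        unfolding re q
      proof (rule lincomb_cong)
        fix g assume "g \<in> \<Phi> ` S"
        then obtain f where "f \<in> S" "g = \<Phi> f" by blast
        then show "complex_of_real (q g) = complex_of_real (q (\<Phi> (inv_into S \<Phi> g)) * s (inv_into S \<Phi> g) * s (inv_into S \<Phi> g))"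
          using s[of f] T(2) by (simp add: mult.assoc)
      qed simp
      then show "A \<in> spanM (2 ^ m) S M'" using spanM_I by metis
    qed
  qed
  have ind: "indep (2 ^ m) S M'"
    unfolding indep_def re
  proof (intro allI impI ballI)
    fix r f
    assume z: "lincomb (2 ^ m) (\<Phi> ` S) (\<lambda>g. complex_of_real (r (inv_into S \<Phi> g) * s (inv_into S \<Phi> g))) (pm m) = 0\<^sub>m (2 ^ m) (2 ^ m)"
      and f: "f \<in> S"
    have "\<forall>g\<in>\<Phi> ` S. r (inv_into S \<Phi> g) * s (inv_into S \<Phi> g) = 0"
      by (rule indep_pm[OF finite_imageI[OF fin] T(1), unfolded indep_def, THEN spec, THEN mp, OF z])
    then have "r f * s f = 0" using f T(2) by auto
    then show "r f = 0" using s[OF f] by auto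
  qed
  show "spanM (2 ^ m) S (\<lambda>f. complex_of_real (s f) \<cdot>\<^sub>m pm m (\<Phi> f)) = spanR m (\<Phi> ` S)"
    "indep (2 ^ m) S (\<lambda>f. complex_of_real (s f) \<cdot>\<^sub>m pm m (\<Phi> f))"
    using sp ind unfolding M'_def .
qed

text \<open>A map of Pauli strings that respects commutation lifts to the matrices once the phases agree up to a choice of signs s.\<close>
theorem signed_iso:
  assumes S: "S \<subseteq> strs n" "pclosed n S" and T: "\<Phi> ` S \<subseteq> strs m" "inj_on \<Phi> S"
    and s: "\<And>f. f \<in> S \<Longrightarrow> s f * s f = (1 :: real)"
    and bc: "\<And>f g. f \<in> S \<Longrightarrow> g \<in> S \<Longrightarrow> bc m (\<Phi> f) (\<Phi> g) = bc n f g"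
    and hom: "\<And>f g. f \<in> S \<Longrightarrow> g \<in> S \<Longrightarrow> bc n f g \<Longrightarrow> \<Phi> (f + g) = \<Phi> f + \<Phi> g"
    and ph: "\<And>f g. f \<in> S \<Longrightarrow> g \<in> S \<Longrightarrow> bc n f g \<Longrightarrow>
      s f * s g * Im (phn m (\<Phi> f) (\<Phi> g)) = s (f + g) * Im (phn n f g)"
  shows "spanR n S \<cong>\<^sub>L spanR m (\<Phi> ` S)" and "spanR m (\<Phi> ` S) \<cong>\<^sub>L spanR n S"
proof -
  let ?k = "\<lambda>f g u. if u = f + g then cs n f g else 0"
  \<comment> \<open>The image basis stays indexed by S, with the signs absorbed, so that it can have
    the same structure constants as the original basis.\<close>
  define M' where "M' f = complex_of_real (s f) \<cdot>\<^sub>m pm m (\<Phi> f)" for f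
  have fin: "finite S" using S(1) finite_strs finite_subset by blast
  have M'c: "M' f \<in> carrier_mat (2 ^ m) (2 ^ m)" for f by (simp add: M'_def)
  have "\<forall>f\<in>S. s f * s f = 1" using s by blast
  note sp = spanM_signed(1)[where s = s, OF fin T this, folded M'_def]
  have "\<forall>f\<in>S. s f * s f = 1" using s by blast
  note ind = spanM_signed(2)[where s = s, OF fin T this, folded M'_def]
  have "comm (M' f) (M' g) = lincomb (2 ^ m) S (\<lambda>u. complex_of_real (?k f g u)) M'" if "f \<in> S" "g \<in> S" for f g
  proof -
    have "comm (M' f) (M' g) = complex_of_real (s f * s g) \<cdot>\<^sub>m comm (pm m (\<Phi> f)) (pm m (\<Phi> g))"
      unfolding comm_def M'_def
      by (rule eq_matI) (auto simp: mult_smult_distrib[OF smult_carrier_mat[OF pm_carrier] pm_carrier]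
        mult_smult_assoc_mat[OF pm_carrier pm_carrier] algebra_simps simp del: index_mult_mat(1))
    also have "\<dots> = complex_of_real (s f * s g * cs m (\<Phi> f) (\<Phi> g)) \<cdot>\<^sub>m pm m (\<Phi> f + \<Phi> g)"
      unfolding comm_pm by (rule eq_matI) auto
    also have "\<dots> = lincomb (2 ^ m) S (\<lambda>u. complex_of_real (?k f g u)) M'"
    proof (cases "bc n f g")
      case True
      then have fg: "f + g \<in> S" by (rule pclosedD[OF S(2) that])
      have e: "s f * s g * cs m (\<Phi> f) (\<Phi> g) = cs n f g * s (f + g)"
        using ph[OF that True] bc[OF that] True by (simp add: cs_def algebra_simps)
      have "lincomb (2 ^ m) S (\<lambda>u. complex_of_real (?k f g u)) M' = lincomb (2 ^ m) S (\<lambda>u. if u = f + g then complex_of_real (cs n f g) else 0) M'"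
        by (rule lincomb_cong) auto
      also have "\<dots> = complex_of_real (cs n f g) \<cdot>\<^sub>m M' (f + g)"
        by (rule lincomb_single[OF fin fg M'c])
      also have "\<dots> = complex_of_real (cs n f g * s (f + g)) \<cdot>\<^sub>m pm m (\<Phi> f + \<Phi> g)"
        unfolding M'_def hom[OF that True] by (rule eq_matI) auto
      finally show ?thesis using e by simp
    next
      case False
      then have "cs m (\<Phi> f) (\<Phi> g) = 0" "cs n f g = 0" using bc[OF that] by (auto simp: cs_def)
      then have "lincomb (2 ^ m) S (\<lambda>u. complex_of_real (?k f g u)) M' = 0\<^sub>m (2 ^ m) (2 ^ m)"
        by (intro lincomb_zero) auto
      moreover have "complex_of_real (s f * s g * cs m (\<Phi> f) (\<Phi> g)) \<cdot>\<^sub>m pm m (\<Phi> f + \<Phi> g) = 0\<^sub>m (2 ^ m) (2 ^ m)"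
        using \<open>cs m (\<Phi> f) (\<Phi> g) = 0\<close> by (intro eq_matI) auto
      ultimately show ?thesis by simp
    qed
    finally show ?thesis .
  qed
  then have st: "structured (2 ^ m) S M' ?k" using fin M'c by (auto simp: structured_def)
  note st0 = structured_pm[OF S]
  show "spanR n S \<cong>\<^sub>L spanR m (\<Phi> ` S)"
    using structured_iso[OF st0 st indep_pm[OF fin S(1)] ind] unfolding sp spanR_def .
  show "spanR m (\<Phi> ` S) \<cong>\<^sub>L spanR n S"
    using structured_iso[OF st st0 ind indep_pm[OF fin S(1)]] unfolding sp spanR_def .
qed

text \<open>A symmetric two-cocycle on an elementary abelian 2-group that is trivial on the diagonal is a coboundary.\<close>
lemma sign_exists:
  fixes \<beta> :: "'a::ab_group_add \<Rightarrow> 'a \<Rightarrow> real"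
  assumes fin: "finite A" and sub: "gspan A \<subseteq> H" and HA: "\<And>x y. x \<in> H \<Longrightarrow> y \<in> H \<Longrightarrow> x + y \<in> H"
    and dbl: "\<And>x::'a. x + x = 0"
    and sym: "\<And>x y. x \<in> H \<Longrightarrow> y \<in> H \<Longrightarrow> \<beta> x y = \<beta> y x"
    and coc: "\<And>x y z. x \<in> H \<Longrightarrow> y \<in> H \<Longrightarrow> z \<in> H \<Longrightarrow> \<beta> x y * \<beta> (x + y) z = \<beta> x (y + z) * \<beta> y z"
    and diag: "\<And>x. x \<in> H \<Longrightarrow> \<beta> x x = 1" and nil: "\<And>x. x \<in> H \<Longrightarrow> \<beta> 0 x = 1"
    and sq: "\<And>x y. x \<in> H \<Longrightarrow> y \<in> H \<Longrightarrow> \<beta> x y * \<beta> x y = 1"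
  shows "\<exists>s. (\<forall>x\<in>gspan A. s x * s x = 1) \<and> (\<forall>x\<in>gspan A. \<forall>y\<in>gspan A. s x * s y * \<beta> x y = s (x + y))"
  using fin sub
proof (induction A)
  case empty
  have "(0::'a) \<in> H" using empty gspan_0 by blast
  then show ?case using diag[of 0] by (intro exI[of _ "\<lambda>_. 1"]) (auto simp: gspan_empty)
next
  case (insert e A)
  have dbl2: "x + (x + y) = y" for x y :: 'a using dbl[of x] by (simp flip: add.assoc)
  have e: "e \<in> H" using insert.prems gspan_base by blast
  have sA: "gspan A \<subseteq> H" using insert.prems gspan_mono[of A "insert e A"] gspan_base[of _ "insert e A"] by blast
  obtain s where s: "\<And>x. x \<in> gspan A \<Longrightarrow> s x * s x = 1"
    "\<And>x y. x \<in> gspan A \<Longrightarrow> y \<in> gspan A \<Longrightarrow> s x * s y * \<beta> x y = s (x + y)"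
    using insert.IH[OF sA] by blast
  show ?case
  proof (cases "e \<in> gspan A")
    case True
    then have "gspan (insert e A) = gspan A"
      unfolding gspan_insert[OF dbl] using gspan_add by blast
    then show ?thesis using s by (intro exI[of _ s]) simp
  next
    case False
    have not: "e + x \<notin> gspan A" if "x \<in> gspan A" for x
      using False gspan_add[OF that] that by (metis dbl2 add.commute)
    \<comment> \<open>Outside the old span x = e + y with y = e + x. Once e gets the sign +1, the
      coboundary relation for e and y forces this value.\<close>
    define t where "t x = (if x \<in> gspan A then s x else s (e + x) * \<beta> e (e + x))" for x
    have t: "t x = s x" "t (e + x) = s x * \<beta> e x" if "x \<in> gspan A" for x
      using that not by (auto simp: t_def dbl2)
    have 1: "t x * t x = 1" if "x \<in> gspan (insert e A)" for x
    proof -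
      have "(s x * \<beta> e x) * (s x * \<beta> e x) = 1" if "x \<in> gspan A" for x
        using s(1)[OF that] sq[of e x] e sA that by (metis (no_types) mult.assoc mult.left_commute mult_1_right subsetD)
      then show ?thesis using that s(1) t unfolding gspan_insert[OF dbl] by auto
    qed
    have mixed: "s x * (s y * \<beta> e y) * \<beta> x (e + y) = s (x + y) * \<beta> e (x + y)" if "x \<in> gspan A" "y \<in> gspan A" for x y
    proof -
      have H: "x \<in> H" "y \<in> H" using that sA by auto
      have "\<beta> e y * \<beta> x (e + y) = \<beta> x y * \<beta> e (x + y)"
        using coc[OF H e] sym[OF e H(2)] sym[OF HA[OF H] e] by (simp add: add.commute mult.commute)
      then show ?thesis unfolding s(2)[OF that, symmetric] by (simp add: mult_ac)
    qed
    have both: "(s x * \<beta> e x) * (s y * \<beta> e y) * \<beta> (e + x) (e + y) = s (x + y)" if "x \<in> gspan A" "y \<in> gspan A" for x y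
    proof -
      have H: "x \<in> H" "y \<in> H" using that sA by auto
      have "\<beta> x e * \<beta> (x + e) (e + y) = \<beta> x y * \<beta> e (e + y)"
        using coc[OF H(1) e HA[OF e H(2)]] by (simp add: dbl2)
      \<comment> \<open>The cocycle identity at e, e, y; triviality on the diagonal enters
        here.\<close>
      moreover have "\<beta> e (e + y) * \<beta> e y = 1"
        using coc[OF e e H(2)] diag[OF e] nil[OF H(2)] dbl[of e] by simp
      ultimately have "\<beta> e x * \<beta> e y * \<beta> (e + x) (e + y) = \<beta> x y"
        using sym[OF e H(1)] by (simp add: add.commute mult_ac)
      then show ?thesis unfolding s(2)[OF that, symmetric] by (simp add: mult_ac)
    qed
    have "t x * t y * \<beta> x y = t (x + y)" if xy: "x \<in> gspan (insert e A)" "y \<in> gspan (insert e A)" for x y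
    proof -
      have xH: "x \<in> H" "y \<in> H" using xy insert.prems by auto
      from xy consider (a) "x \<in> gspan A" "y \<in> gspan A" | (b) y' where "x \<in> gspan A" "y' \<in> gspan A" "y = e + y'"
        | (c) x' where "x' \<in> gspan A" "y \<in> gspan A" "x = e + x'"
        | (d) x' y' where "x' \<in> gspan A" "y' \<in> gspan A" "x = e + x'" "y = e + y'"
        unfolding gspan_insert[OF dbl] by blast
      then show ?thesis
      proof cases
        case a
        then show ?thesis using s(2)[OF a] t(1)[OF a(1)] t(1)[OF a(2)] t(1)[OF gspan_add[OF a]] by simp
      next
        case b
        then have "x + y = e + (x + y')" by (simp add: ac_simps)
        then have "t (x + y) = s (x + y') * \<beta> e (x + y')" using t(2)[OF gspan_add[OF b(1,2)]] by (simp only:)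
        then show ?thesis using mixed[OF b(1,2)] t(1)[OF b(1)] t(2)[OF b(2)] b(3) by simp
      next
        case c
        then have "x + y = e + (y + x')" by (simp add: ac_simps)
        then have "t (x + y) = s (y + x') * \<beta> e (y + x')" using t(2)[OF gspan_add[OF c(2,1)]] by (simp only:)
        moreover have "\<beta> x y = \<beta> y (e + x')" using sym[OF xH] c(3) by simp
        moreover have "t x = s x' * \<beta> e x'" using t(2)[OF c(1)] c(3) by simp
        ultimately show ?thesis using mixed[OF c(2,1)] t(1)[OF c(2)] by (simp only: mult_ac)
      next
        case d
        then have "x + y = x' + y'" by (simp add: ac_simps dbl2)
        then have "t (x + y) = s (x' + y')" using t(1)[OF gspan_add[OF d(1,2)]] by (simp only:)
        moreover have "t x = s x' * \<beta> e x'" "t y = s y' * \<beta> e y'" using t(2) d by simp_all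
        ultimately show ?thesis using both[OF d(1,2)] d(3,4) by (simp only:)
      qed
    qed
    then show ?thesis using 1 by blast
  qed
qed

lemma phn_nonzero: "phn n f g \<noteq> 0"
  using phn_sq[of n f g] by (auto split: if_splits)

text \<open>The quotient of the two phases is 1 or -1, since both squares equal the same commutation
  sign, and it is symmetric, since both phases react to an exchange in the same way. It is a cocycle
  on the subgroup H, hence a coboundary of signs. Injectivity is asked only on S, so that central
  letters may be dropped.\<close>

theorem frame_iso:
  assumes H: "H \<subseteq> strs n" "gspan H = H"
    and \<Psi>: "\<And>f. f \<in> H \<Longrightarrow> \<Psi> f \<in> strs m"
      "\<And>f g. f \<in> H \<Longrightarrow> g \<in> H \<Longrightarrow> \<Psi> (f + g) = \<Psi> f + \<Psi> g"
      "\<And>f g. f \<in> H \<Longrightarrow> g \<in> H \<Longrightarrow> bc m (\<Psi> f) (\<Psi> g) = bc n f g"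
    and S: "S \<subseteq> H" "pclosed n S" "inj_on \<Psi> S"
  shows "spanR n S \<cong>\<^sub>L spanR m (\<Psi> ` S)" and "spanR m (\<Psi> ` S) \<cong>\<^sub>L spanR n S"
proof -
  define b where "b f g = phn m (\<Psi> f) (\<Psi> g) / phn n f g" for f g
  define \<beta> where "\<beta> f g = Re (b f g)" for f g
  have HA: "f + g \<in> H" if "f \<in> H" "g \<in> H" for f g using gspan_add that H(2) by metis
  have b: "b f g = 1 \<or> b f g = -1" if "f \<in> H" "g \<in> H" for f g
  proof -
    have "b f g * b f g = 1"
      using phn_sq[of m "\<Psi> f" "\<Psi> g"] phn_sq[of n f g] \<Psi>(3)[OF that] by (auto simp: b_def)
    then have "(b f g - 1) * (b f g + 1) = 0" by (simp add: algebra_simps)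
    then show ?thesis by (simp add: eq_neg_iff_add_eq_0)
  qed
  then have b\<beta>: "b f g = complex_of_real (\<beta> f g)" if "f \<in> H" "g \<in> H" for f g
    using that by (fastforce simp: \<beta>_def)
  have z: "0 \<in> H" using H(2) gspan_0 by metis
  then have \<Psi>0: "\<Psi> 0 = 0" using \<Psi>(2)[OF z z] by simp
  have coc: "\<beta> x y * \<beta> (x + y) w = \<beta> x (y + w) * \<beta> y w" if "x \<in> H" "y \<in> H" "w \<in> H" for x y w
  proof -
    have "b x y * b (x + y) w = b x (y + w) * b y w"
      using phn_cocycle[of m "\<Psi> x" "\<Psi> y" "\<Psi> w"] phn_cocycle[of n x y w] that
      by (simp add: b_def \<Psi>(2) HA)
    then have "complex_of_real (\<beta> x y * \<beta> (x + y) w) = complex_of_real (\<beta> x (y + w) * \<beta> y w)"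
      using b\<beta> HA that by simp
    then show ?thesis by (simp only: of_real_eq_iff)
  qed
  have "\<exists>s. (\<forall>x\<in>gspan H. s x * s x = 1) \<and> (\<forall>x\<in>gspan H. \<forall>y\<in>gspan H. s x * s y * \<beta> x y = s (x + y))"
  proof (rule sign_exists)
    show "finite H" using H(1) finite_strs finite_subset by blast
    show "gspan H \<subseteq> H" using H(2) by simp
    fix x y assume x: "x \<in> H" and y: "y \<in> H"
    show "\<beta> x y = \<beta> y x" using \<Psi>(3)[OF x y] phn_swap[of n y x] phn_swap[of m "\<Psi> y" "\<Psi> x"]
      by (simp add: \<beta>_def b_def)
    show "\<beta> x y * \<beta> x y = 1" using b[OF x y] by (auto simp: \<beta>_def)
  qed (use HA coc \<Psi>0 in \<open>auto simp: \<beta>_def b_def\<close>)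
  then obtain s where s: "\<And>x. x \<in> H \<Longrightarrow> s x * s x = (1::real)"
    "\<And>x y. x \<in> H \<Longrightarrow> y \<in> H \<Longrightarrow> s x * s y * \<beta> x y = s (x + y)"
    unfolding H(2) by blast
  have SH: "f \<in> H" if "f \<in> S" for f using that S by auto
  have ph: "s f * s g * Im (phn m (\<Psi> f) (\<Psi> g)) = s (f + g) * Im (phn n f g)" if "f \<in> S" "g \<in> S" for f g
  proof -
    have "phn m (\<Psi> f) (\<Psi> g) = complex_of_real (\<beta> f g) * phn n f g"
      using b\<beta>[OF SH[OF that(1)] SH[OF that(2)]] phn_nonzero[of n f g] by (simp add: b_def field_simps)
    then have "Im (phn m (\<Psi> f) (\<Psi> g)) = \<beta> f g * Im (phn n f g)" by simp
    then show ?thesis using s(2)[OF SH[OF that(1)] SH[OF that(2)]] by (simp flip: mult.assoc)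
  qed
  have Sn: "S \<subseteq> strs n" "\<Psi> ` S \<subseteq> strs m" using S H \<Psi>(1) by auto
  show "spanR n S \<cong>\<^sub>L spanR m (\<Psi> ` S)" "spanR m (\<Psi> ` S) \<cong>\<^sub>L spanR n S"
    by (rule signed_iso[OF Sn(1) S(2) Sn(2) S(3), of s]; use s SH \<Psi> ph in auto)+
qed

section \<open>The classical Lie algebras as spans of Pauli strings\<close>

lemma sum_strs_Suc: "(\<Sum>f\<in>strs (Suc n). F f) = (\<Sum>a\<in>UNIV. \<Sum>f\<in>strs n. F (cons a f))"
proof -
  have inj: "inj_on (\<lambda>(a, f). cons a f) (UNIV \<times> strs n)" by (auto simp: inj_on_def)
  show ?thesis unfolding strs_Suc sum.reindex[OF inj] sum.cartesian_product
    by (simp add: case_prod_unfold comp_def)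
qed

lemma ps_cons_index:
  assumes "i < 2 * 2 ^ n" "j < 2 * 2 ^ n"
  shows "ps (Suc n) (cons a f) $$ (i, j) = pmat a $$ (i div 2 ^ n, j div 2 ^ n) * ps n f $$ (i mod 2 ^ n, j mod 2 ^ n)"
  using assms carrier_matD[OF pmat_carrier[of a]] by (simp add: ps_cons kron_index)

lemma kron_lincomb:
  "kron (pmat p) (lincomb (2 ^ n) (strs n) c (ps n))
     = lincomb (2 ^ Suc n) (strs (Suc n)) (\<lambda>f. if f 0 = p then c (\<lambda>i. f (Suc i)) else 0) (ps (Suc n))"
proof (rule eq_matI)
  fix i j
  assume "i < dim_row (lincomb (2 ^ Suc n) (strs (Suc n)) (\<lambda>f. if f 0 = p then c (\<lambda>i. f (Suc i)) else 0) (ps (Suc n)))"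
    "j < dim_col (lincomb (2 ^ Suc n) (strs (Suc n)) (\<lambda>f. if f 0 = p then c (\<lambda>i. f (Suc i)) else 0) (ps (Suc n)))"
  then have ij: "i < 2 * 2 ^ n" "j < 2 * 2 ^ n" by auto
  have "(\<Sum>f\<in>strs (Suc n). (if f 0 = p then c (\<lambda>i. f (Suc i)) else 0) * ps (Suc n) f $$ (i, j))
      = (\<Sum>a\<in>UNIV. if a = p then (\<Sum>f\<in>strs n. c f * ps (Suc n) (cons a f) $$ (i, j)) else 0)"
    unfolding sum_strs_Suc by (rule sum.cong[OF refl]) auto
  also have "\<dots> = (\<Sum>f\<in>strs n. c f * ps (Suc n) (cons p f) $$ (i, j))"
    by simp
  also have "\<dots> = pmat p $$ (i div 2 ^ n, j div 2 ^ n) * (\<Sum>f\<in>strs n. c f * ps n f $$ (i mod 2 ^ n, j mod 2 ^ n))"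
    unfolding ps_cons_index[OF ij] sum_distrib_left by (rule sum.cong) auto
  finally show "kron (pmat p) (lincomb (2 ^ n) (strs n) c (ps n)) $$ (i, j)
      = lincomb (2 ^ Suc n) (strs (Suc n)) (\<lambda>f. if f 0 = p then c (\<lambda>i. f (Suc i)) else 0) (ps (Suc n)) $$ (i, j)"
    using ij carrier_matD[OF pmat_carrier[of p]] by (simp add: kron_index)
qed (use carrier_matD[OF pmat_carrier[of p]] in auto)

lemma kron_decomposition:
  fixes A :: "complex mat"
  assumes "A \<in> carrier_mat (2 * N) (2 * N)"
  shows "\<exists>B. (\<forall>p. B p \<in> carrier_mat N N) \<and>
    A = kron (pmat 0) (B 0) + kron (pmat PX) (B PX) + (kron (pmat PY) (B PY) + kron (pmat PZ) (B PZ))"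
proof -
  define b where "b u v = mat N N (\<lambda>(i, j). A $$ (u * N + i, v * N + j))" for u v :: nat
  \<comment> \<open>The four 2 by 2 Pauli matrices are solved for from the blocks: I and Z share the
    diagonal, X and Y the rest. The off-diagonal blocks are B X - i B Y and B X + i B Y, whence the
    factor i/2 for Y.\<close>
  define B where "B p = (if p = 0 then (1/2) \<cdot>\<^sub>m (b 0 0 + b 1 1) else if p = PX then (1/2) \<cdot>\<^sub>m (b 0 1 + b 1 0)
    else if p = PY then (\<i>/2) \<cdot>\<^sub>m (b 0 1 - b 1 0) else (1/2) \<cdot>\<^sub>m (b 0 0 - b 1 1))" for p
  have B: "B p \<in> carrier_mat N N" for p by (auto simp: B_def b_def)
  have "A = kron (pmat 0) (B 0) + kron (pmat PX) (B PX) + (kron (pmat PY) (B PY) + kron (pmat PZ) (B PZ))" (is "A = ?R")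
  proof (rule eq_matI)
    have d: "dim_row ?R = 2 * N" "dim_col ?R = 2 * N"
      using carrier_matD[OF pmat_carrier] carrier_matD[OF B] by auto
    then show "dim_row A = dim_row ?R" "dim_col A = dim_col ?R" using assms by auto
    fix i j assume "i < dim_row ?R" "j < dim_col ?R"
    then have ij: "i < 2 * N" "j < 2 * N" using d by auto
    note dm = less_mult_div_mod[OF ij(1)] less_mult_div_mod[OF ij(2)]
    have e: "?R $$ (i, j) = (\<Sum>p\<in>UNIV. pmat p $$ (i div N, j div N) * B p $$ (i mod N, j mod N))"
      using ij carrier_matD[OF pmat_carrier] carrier_matD[OF B] by (simp add: kron_index UNIV_pauli)
    have x: "A $$ (i, j) = b (i div N) (j div N) $$ (i mod N, j mod N)"
      using dm by (simp add: b_def)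
    have "i div N = 0 \<or> i div N = Suc 0" "j div N = 0 \<or> j div N = Suc 0" using dm by auto
    moreover have "b u v $$ (i mod N, j mod N) = A $$ (u * N + i mod N, v * N + j mod N)" for u v
      using dm by (simp add: b_def)
    moreover have "dim_row (b u v) = N" "dim_col (b u v) = N" for u v by (simp_all add: b_def)
    moreover have "i mod N < N" "j mod N < N" using dm by auto
    ultimately show "A $$ (i, j) = ?R $$ (i, j)"
      unfolding e x using dm by (elim disjE) (simp_all add: UNIV_pauli B_def pmat_index field_simps)
  qed
  then show ?thesis using B by blast
qed

theorem pauli_expansion:
  assumes "A \<in> carrier_mat (2 ^ n) (2 ^ n)"
  shows "\<exists>c. A = lincomb (2 ^ n) (strs n) c (ps n)"
  using assms
proof (induction n arbitrary: A)
  case 0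
  then show ?case
    by (intro exI[of _ "\<lambda>_. A $$ (0, 0)"] eq_matI) (auto simp: strs_zero ps_0)
next
  case (Suc n)
  then have "A \<in> carrier_mat (2 * 2 ^ n) (2 * 2 ^ n)" by simp
  then obtain B where B: "\<And>p. B p \<in> carrier_mat (2 ^ n) (2 ^ n)"
    "A = kron (pmat 0) (B 0) + kron (pmat PX) (B PX) + (kron (pmat PY) (B PY) + kron (pmat PZ) (B PZ))"
    using kron_decomposition by blast
  have "\<exists>c. \<forall>p. B p = lincomb (2 ^ n) (strs n) (c p) (ps n)"
    using Suc.IH[OF B(1)] by (rule choice[OF allI])
  then obtain c where "\<And>p. B p = lincomb (2 ^ n) (strs n) (c p) (ps n)" by blast
  then show ?case unfolding B(2) by (simp only: kron_lincomb lincomb_add) blast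
qed

lemma yodd_Suc0: "yodd (Suc n) f = ((f 0 = PY) \<noteq> yodd n (\<lambda>i. f (Suc i)))"
  using yodd_cons[of n "f 0" "\<lambda>i. f (Suc i)"] by (simp only: cons_collapse)

lemma pmat_herm: "u < 2 \<Longrightarrow> v < 2 \<Longrightarrow> pmat a $$ (u, v) = cnj (pmat a $$ (v, u))"
  by (cases a) (auto simp: less_2_cases_iff pmat_index)

lemma pmat_transpose: "u < 2 \<Longrightarrow> v < 2 \<Longrightarrow> pmat a $$ (v, u) = (if a = PY then -1 else 1) * pmat a $$ (u, v)"
  by (cases a) (auto simp: less_2_cases_iff pmat_index)

lemma ps_herm: "i < 2 ^ n \<Longrightarrow> j < 2 ^ n \<Longrightarrow> ps n f $$ (i, j) = cnj (ps n f $$ (j, i))"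
proof (induction n arbitrary: f i j)
  case (Suc n)
  then have ij: "i < 2 * 2 ^ n" "j < 2 * 2 ^ n" by auto
  note dm = less_mult_div_mod[OF ij(1)] less_mult_div_mod[OF ij(2)]
  have *: "ps (Suc n) f $$ (k, l) = pmat (f 0) $$ (k div 2 ^ n, l div 2 ^ n) * ps n (\<lambda>i. f (Suc i)) $$ (k mod 2 ^ n, l mod 2 ^ n)"
    if "k < 2 * 2 ^ n" "l < 2 * 2 ^ n" for k l
    using ps_cons_index[OF that, of "f 0" "\<lambda>i. f (Suc i)"] by (simp only: cons_collapse)
  have "pmat (f 0) $$ (i div 2 ^ n, j div 2 ^ n) = cnj (pmat (f 0) $$ (j div 2 ^ n, i div 2 ^ n))"
    "ps n (\<lambda>i. f (Suc i)) $$ (i mod 2 ^ n, j mod 2 ^ n) = cnj (ps n (\<lambda>i. f (Suc i)) $$ (j mod 2 ^ n, i mod 2 ^ n))"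
    using dm by (blast intro: pmat_herm Suc.IH)+
  then show ?case unfolding *[OF ij] *[OF ij(2,1)] by simp
qed (simp add: ps_0)

lemma ps_transpose: "i < 2 ^ n \<Longrightarrow> j < 2 ^ n \<Longrightarrow> ps n f $$ (j, i) = (if yodd n f then -1 else 1) * ps n f $$ (i, j)"
proof (induction n arbitrary: f i j)
  case (Suc n)
  then have ij: "i < 2 * 2 ^ n" "j < 2 * 2 ^ n" by auto
  note dm = less_mult_div_mod[OF ij(1)] less_mult_div_mod[OF ij(2)]
  have 1: "ps (Suc n) f $$ (i, j) = pmat (f 0) $$ (i div 2 ^ n, j div 2 ^ n) * ps n (\<lambda>i. f (Suc i)) $$ (i mod 2 ^ n, j mod 2 ^ n)"
    using ps_cons_index[OF ij, of "f 0" "\<lambda>i. f (Suc i)"] by (simp only: cons_collapse)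
  have 2: "ps (Suc n) f $$ (j, i) = pmat (f 0) $$ (j div 2 ^ n, i div 2 ^ n) * ps n (\<lambda>i. f (Suc i)) $$ (j mod 2 ^ n, i mod 2 ^ n)"
    using ps_cons_index[OF ij(2,1), of "f 0" "\<lambda>i. f (Suc i)"] by (simp only: cons_collapse)
  show ?case unfolding 1 2 yodd_Suc0
    using pmat_transpose[of "i div 2 ^ n" "j div 2 ^ n" "f 0"]
      Suc.IH[of "i mod 2 ^ n" "j mod 2 ^ n" "\<lambda>i. f (Suc i)"] dm by (simp del: yodd.simps)
qed (simp add: ps_0)

lemma ps_coeff_eq:
  assumes "lincomb (2 ^ n) (strs n) c (ps n) = lincomb (2 ^ n) (strs n) d (ps n)" "f \<in> strs n"
  shows "c f = d f"
proof -
  have "c f * 2 ^ n = d f * 2 ^ n"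
    using ps_coeff[OF finite_strs subset_refl assms(2), of c] ps_coeff[OF finite_strs subset_refl assms(2), of d] assms(1) by simp
  then show ?thesis by simp
qed

lemma pm_ps_lincomb: "lincomb (2 ^ n) S c (pm n) = lincomb (2 ^ n) S (\<lambda>f. \<i> * c f) (ps n)"
  by (rule eq_matI) (auto simp: pm_def mult_ac)

text \<open>Strings are Hermitian, so skew-Hermitian matrices have purely imaginary coefficients;
  the factor i in \<open>pm\<close> makes them real.\<close>

lemma u_alg_expansion:
  assumes A: "A \<in> u_alg (2 ^ n)"
  obtains r where "A = lincomb (2 ^ n) (strs n) (\<lambda>f. complex_of_real (r f)) (pm n)"
proof -
  have Ac: "A \<in> carrier_mat (2 ^ n) (2 ^ n)" using A by (simp add: u_alg_def)
  obtain c where c: "A = lincomb (2 ^ n) (strs n) c (ps n)" using pauli_expansion[OF Ac] by blast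
  have "lincomb (2 ^ n) (strs n) c (ps n) = lincomb (2 ^ n) (strs n) (\<lambda>f. - cnj (c f)) (ps n)"
  proof (rule eq_matI)
    fix i j assume "i < dim_row (lincomb (2 ^ n) (strs n) (\<lambda>f. - cnj (c f)) (ps n))"
      "j < dim_col (lincomb (2 ^ n) (strs n) (\<lambda>f. - cnj (c f)) (ps n))"
    then have ij: "i < 2 ^ n" "j < 2 ^ n" by auto
    have "A $$ (i, j) = - cnj (A $$ (j, i))" using A ij unfolding u_alg_def by blast
    also have "\<dots> = (\<Sum>f\<in>strs n. - cnj (c f) * cnj (ps n f $$ (j, i)))"
      unfolding c using ij by (simp add: sum_negf)
    also have "\<dots> = (\<Sum>f\<in>strs n. - cnj (c f) * ps n f $$ (i, j))"
      by (rule sum.cong[OF refl]) (simp only: ps_herm[OF ij, symmetric])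
    finally show "lincomb (2 ^ n) (strs n) c (ps n) $$ (i, j) = lincomb (2 ^ n) (strs n) (\<lambda>f. - cnj (c f)) (ps n) $$ (i, j)"
      unfolding c using ij by simp
  qed auto
  then have cf: "c f = - cnj (c f)" if "f \<in> strs n" for f using ps_coeff_eq that by blast
  have "A = lincomb (2 ^ n) (strs n) (\<lambda>f. complex_of_real (Im (c f))) (pm n)"
    unfolding c pm_ps_lincomb by (rule lincomb_cong) (use cf in \<open>auto simp: complex_eq_iff\<close>)
  then show thesis by (rule that)
qed

lemma lincomb_pm_u: "lincomb (2 ^ n) S (\<lambda>f. complex_of_real (r f)) (pm n) \<in> u_alg (2 ^ n)"
  unfolding u_alg_def
proof (intro CollectI conjI allI impI)
  fix i j :: nat assume ij: "i < 2 ^ n" "j < 2 ^ n"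
  have "(\<Sum>f\<in>S. complex_of_real (r f) * pm n f $$ (i, j)) = (\<Sum>f\<in>S. - cnj (complex_of_real (r f) * pm n f $$ (j, i)))"
    by (rule sum.cong[OF refl]) (use ij ps_herm[OF ij] in \<open>simp add: pm_def\<close>)
  then show "lincomb (2 ^ n) S (\<lambda>f. complex_of_real (r f)) (pm n) $$ (i, j)
     = - cnj (lincomb (2 ^ n) S (\<lambda>f. complex_of_real (r f)) (pm n) $$ (j, i))"
    using ij by (simp add: sum_negf)
qed simp

lemma spanR_restrict:
  assumes "S \<subseteq> strs n" "\<And>f. f \<in> strs n \<Longrightarrow> f \<notin> S \<Longrightarrow> r f = 0"
  shows "lincomb (2 ^ n) (strs n) (\<lambda>f. complex_of_real (r f)) (pm n) \<in> spanR n S"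
proof -
  have "(\<Sum>f\<in>strs n. complex_of_real (r f) * pm n f $$ ij) = (\<Sum>f\<in>S. complex_of_real (r f) * pm n f $$ ij)" for ij
    by (rule sum.mono_neutral_right) (use assms in auto)
  then have "lincomb (2 ^ n) (strs n) (\<lambda>f. complex_of_real (r f)) (pm n) = lincomb (2 ^ n) S (\<lambda>f. complex_of_real (r f)) (pm n)"
    by (intro eq_matI) simp_all
  then show ?thesis unfolding spanR_def by (simp only: spanM_I)
qed

lemma spanR_extend:
  assumes "S \<subseteq> strs n" "A \<in> spanR n S"
  obtains r where "A = lincomb (2 ^ n) (strs n) (\<lambda>f. complex_of_real (r f)) (pm n)" "\<And>f. f \<notin> S \<Longrightarrow> r f = 0"
proof -
  obtain r where r: "A = lincomb (2 ^ n) S (\<lambda>f. complex_of_real (r f)) (pm n)"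
    using assms(2) unfolding spanR_def by (rule spanM_E)
  have "(\<Sum>f\<in>S. complex_of_real (r f) * pm n f $$ ij)
      = (\<Sum>f\<in>strs n. complex_of_real (if f \<in> S then r f else 0) * pm n f $$ ij)" for ij
    by (rule sum.mono_neutral_cong_left) (use assms(1) in auto)
  then have "A = lincomb (2 ^ n) (strs n) (\<lambda>f. complex_of_real (if f \<in> S then r f else 0)) (pm n)"
    unfolding r by (intro eq_matI) simp_all
  then show thesis by (rule that) auto
qed

lemma lincomb_mult_left:
  assumes "X \<in> carrier_mat N N" "\<And>s. s \<in> S \<Longrightarrow> M s \<in> carrier_mat N N"
  shows "X * lincomb N S c M = lincomb N S c (\<lambda>s. X * M s)"
proof (rule eq_matI)
  fix i j assume "i < dim_row (lincomb N S c (\<lambda>s. X * M s))" "j < dim_col (lincomb N S c (\<lambda>s. X * M s))"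
  then have ij: "i < N" "j < N" by auto
  have "(X * lincomb N S c M) $$ (i, j) = (\<Sum>k<N. \<Sum>s\<in>S. c s * (X $$ (i, k) * M s $$ (k, j)))"
    using assms(1) ij by (simp add: scalar_prod_def lessThan_atLeast0 sum_distrib_left mult_ac)
  also have "\<dots> = (\<Sum>s\<in>S. \<Sum>k<N. c s * (X $$ (i, k) * M s $$ (k, j)))" by (rule sum.swap)
  also have "\<dots> = (\<Sum>s\<in>S. c s * (X * M s) $$ (i, j))"
  proof (rule sum.cong[OF refl])
    fix s assume "s \<in> S"
    then show "(\<Sum>k<N. c s * (X $$ (i, k) * M s $$ (k, j))) = c s * (X * M s) $$ (i, j)"
      using assms(1) carrier_matD[OF assms(2)[of s]] ij by (simp add: scalar_prod_def lessThan_atLeast0 sum_distrib_left)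
  qed
  finally show "(X * lincomb N S c M) $$ (i, j) = lincomb N S c (\<lambda>s. X * M s) $$ (i, j)" using ij by simp
qed (use assms in auto)

lemma lincomb_mult_right:
  assumes "X \<in> carrier_mat N N" "\<And>s. s \<in> S \<Longrightarrow> M s \<in> carrier_mat N N"
  shows "lincomb N S c M * X = lincomb N S c (\<lambda>s. M s * X)"
proof (rule eq_matI)
  fix i j assume "i < dim_row (lincomb N S c (\<lambda>s. M s * X))" "j < dim_col (lincomb N S c (\<lambda>s. M s * X))"
  then have ij: "i < N" "j < N" by auto
  have "(lincomb N S c M * X) $$ (i, j) = (\<Sum>k<N. \<Sum>s\<in>S. c s * (M s $$ (i, k) * X $$ (k, j)))"
    using assms(1) ij by (simp add: scalar_prod_def lessThan_atLeast0 sum_distrib_right mult.assoc)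
  also have "\<dots> = (\<Sum>s\<in>S. \<Sum>k<N. c s * (M s $$ (i, k) * X $$ (k, j)))" by (rule sum.swap)
  also have "\<dots> = (\<Sum>s\<in>S. c s * (M s * X) $$ (i, j))"
  proof (rule sum.cong[OF refl])
    fix s assume "s \<in> S"
    then show "(\<Sum>k<N. c s * (M s $$ (i, k) * X $$ (k, j))) = c s * (M s * X) $$ (i, j)"
      using assms(1) carrier_matD[OF assms(2)[of s]] ij by (simp add: scalar_prod_def lessThan_atLeast0 sum_distrib_left)
  qed
  finally show "(lincomb N S c M * X) $$ (i, j) = lincomb N S c (\<lambda>s. M s * X) $$ (i, j)" using ij by simp
qed (use assms in auto)

theorem u_alg_spanR: "u_alg (2 ^ n) = spanR n (strs n)"
proof
  show "u_alg (2 ^ n) \<subseteq> spanR n (strs n)"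
  proof
    fix A assume "A \<in> u_alg (2 ^ n)"
    then obtain r where "A = lincomb (2 ^ n) (strs n) (\<lambda>f. complex_of_real (r f)) (pm n)" by (rule u_alg_expansion)
    then show "A \<in> spanR n (strs n)" unfolding spanR_def by (simp only: spanM_I)
  qed
  show "spanR n (strs n) \<subseteq> u_alg (2 ^ n)"
    unfolding spanR_def spanM_def using lincomb_pm_u by blast
qed

lemma tr_lincomb_pm: "(\<Sum>i<2 ^ n. lincomb (2 ^ n) (strs n) c (pm n) $$ (i, i)) = \<i> * c 0 * 2 ^ n"
proof -
  have "(\<Sum>i<2 ^ n. lincomb (2 ^ n) (strs n) c (pm n) $$ (i, i)) = tr (ps n 0 * lincomb (2 ^ n) (strs n) (\<lambda>f. \<i> * c f) (ps n))"
    by (simp add: ps_zero pm_ps_lincomb tr_def left_mult_one_mat[OF lincomb_carrier])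
  then show ?thesis using ps_coeff[of "strs n" n 0 "\<lambda>f. \<i> * c f"] by simp
qed

theorem su_alg_spanR: "su_alg (2 ^ n) = spanR n (strs n - {0})"
proof
  show "su_alg (2 ^ n) \<subseteq> spanR n (strs n - {0})"
  proof
    fix A assume A: "A \<in> su_alg (2 ^ n)"
    then have "A \<in> u_alg (2 ^ n)" by (simp add: su_alg_def)
    then obtain r where r: "A = lincomb (2 ^ n) (strs n) (\<lambda>f. complex_of_real (r f)) (pm n)" by (rule u_alg_expansion)
    have "(\<Sum>i<2 ^ n. A $$ (i, i)) = 0" using A by (simp add: su_alg_def)
    then have "\<i> * complex_of_real (r 0) * 2 ^ n = 0" unfolding r tr_lincomb_pm .
    then have "r 0 = 0" by simp
    then show "A \<in> spanR n (strs n - {0})" unfolding r by (intro spanR_restrict) auto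
  qed
  show "spanR n (strs n - {0}) \<subseteq> su_alg (2 ^ n)"
  proof
    fix A assume "A \<in> spanR n (strs n - {0})"
    then obtain r where r: "A = lincomb (2 ^ n) (strs n) (\<lambda>f. complex_of_real (r f)) (pm n)" "\<And>f. f \<notin> strs n - {0} \<Longrightarrow> r f = 0"
      by (rule spanR_extend[rotated]) auto
    have "r 0 = 0" using r(2) by simp
    then have "(\<Sum>i<2 ^ n. A $$ (i, i)) = 0" unfolding r(1) tr_lincomb_pm by simp
    then show "A \<in> su_alg (2 ^ n)" unfolding su_alg_def using lincomb_pm_u r(1) by blast
  qed
qed

lemma transpose_lincomb_pm:
  "transpose_mat (lincomb (2 ^ n) S c (pm n)) = lincomb (2 ^ n) S (\<lambda>f. (if yodd n f then - c f else c f)) (pm n)"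
proof (rule eq_matI)
  fix i j assume "i < dim_row (lincomb (2 ^ n) S (\<lambda>f. (if yodd n f then - c f else c f)) (pm n))"
    "j < dim_col (lincomb (2 ^ n) S (\<lambda>f. (if yodd n f then - c f else c f)) (pm n))"
  then have ij: "i < 2 ^ n" "j < 2 ^ n" by auto
  have "(\<Sum>f\<in>S. c f * pm n f $$ (j, i)) = (\<Sum>f\<in>S. (if yodd n f then - c f else c f) * pm n f $$ (i, j))"
    by (rule sum.cong[OF refl]) (use ij ps_transpose[OF ij] in \<open>simp add: pm_def\<close>)
  then show "transpose_mat (lincomb (2 ^ n) S c (pm n)) $$ (i, j) = lincomb (2 ^ n) S (\<lambda>f. (if yodd n f then - c f else c f)) (pm n) $$ (i, j)"
    using ij by simp
qed auto

lemma uminus_lincomb: "- lincomb N S c M = lincomb N S (\<lambda>s. - c s) M"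
  by (rule eq_matI) (auto simp: sum_negf)

lemma pm_coeff_eq:
  assumes "lincomb (2 ^ n) (strs n) (\<lambda>f. complex_of_real (r f)) (pm n) = lincomb (2 ^ n) (strs n) (\<lambda>f. complex_of_real (q f)) (pm n)" "f \<in> strs n"
  shows "r f = q f"
  using indep_coeff_eq[OF indep_pm[OF finite_strs subset_refl] assms] .

lemma complex_of_real_if: "(if b then - complex_of_real x else complex_of_real x) = complex_of_real (if b then - x else x)"
  by simp

text \<open>Transposition multiplies a string by -1 for each Y. A real antisymmetric matrix is
  skew-Hermitian, and conversely a matrix that is both antisymmetric and skew-Hermitian is
  real.\<close>

theorem so_alg_spanR: "so_alg (2 ^ n) = spanR n {f \<in> strs n. yodd n f}"
proof
  show "so_alg (2 ^ n) \<subseteq> spanR n {f \<in> strs n. yodd n f}"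
  proof
    fix A assume A: "A \<in> so_alg (2 ^ n)"
    then have Ac: "A \<in> carrier_mat (2 ^ n) (2 ^ n)" and At: "transpose_mat A = - A"
      and Ar: "\<And>i j. i < 2 ^ n \<Longrightarrow> j < 2 ^ n \<Longrightarrow> A $$ (i, j) \<in> \<real>" by (auto simp: so_alg_def)
    have "A $$ (i, j) = - cnj (A $$ (j, i))" if "i < 2 ^ n" "j < 2 ^ n" for i j
    proof -
      have "transpose_mat A $$ (j, i) = (- A) $$ (j, i)" using At by simp
      then have "A $$ (i, j) = - A $$ (j, i)" using Ac that by simp
      moreover have "cnj (A $$ (j, i)) = A $$ (j, i)" using Ar[OF that(2,1)] by (simp add: Reals_cnj_iff)
      ultimately show ?thesis by simp
    qed
    then have "A \<in> u_alg (2 ^ n)" using Ac unfolding u_alg_def by blast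
    then obtain r where r: "A = lincomb (2 ^ n) (strs n) (\<lambda>f. complex_of_real (r f)) (pm n)" by (rule u_alg_expansion)
    have "lincomb (2 ^ n) (strs n) (\<lambda>f. complex_of_real (if yodd n f then - r f else r f)) (pm n)
        = lincomb (2 ^ n) (strs n) (\<lambda>f. complex_of_real (- r f)) (pm n)"
      using At unfolding r transpose_lincomb_pm uminus_lincomb complex_of_real_if of_real_minus .
    then have "(if yodd n f then - r f else r f) = - r f" if "f \<in> strs n" for f
      using pm_coeff_eq[of n "\<lambda>f. if yodd n f then - r f else r f" "\<lambda>f. - r f"] that by blast
    then have "r f = 0" if "f \<in> strs n" "\<not> yodd n f" for f using that by (metis equal_neg_zero)
    then show "A \<in> spanR n {f \<in> strs n. yodd n f}" unfolding r by (intro spanR_restrict) simp_all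
  qed
  show "spanR n {f \<in> strs n. yodd n f} \<subseteq> so_alg (2 ^ n)"
  proof
    fix A assume "A \<in> spanR n {f \<in> strs n. yodd n f}"
    then obtain r where r: "A = lincomb (2 ^ n) {f \<in> strs n. yodd n f} (\<lambda>f. complex_of_real (r f)) (pm n)"
      unfolding spanR_def by (rule spanM_E)
    have t: "transpose_mat A = - A"
      unfolding r transpose_lincomb_pm uminus_lincomb by (rule lincomb_cong) auto
    have u: "A \<in> u_alg (2 ^ n)" unfolding r by (rule lincomb_pm_u)
    then have c: "A \<in> carrier_mat (2 ^ n) (2 ^ n)" by (simp add: u_alg_def)
    have "A $$ (i, j) \<in> \<real>" if "i < 2 ^ n" "j < 2 ^ n" for i j
    proof -
      have "transpose_mat A $$ (j, i) = (- A) $$ (j, i)" using t by simp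
      then have "A $$ (i, j) = - A $$ (j, i)" using c that by simp
      moreover have "A $$ (i, j) = - cnj (A $$ (j, i))" using u that unfolding u_alg_def by blast
      ultimately have "cnj (A $$ (j, i)) = A $$ (j, i)" by simp
      then have "A $$ (j, i) \<in> \<real>" by (simp add: Reals_cnj_iff)
      then show ?thesis using \<open>A $$ (i, j) = - A $$ (j, i)\<close> by simp
    qed
    then show "A \<in> so_alg (2 ^ n)" using t c by (simp add: so_alg_def)
  qed
qed

text \<open>Multiplying Y by i gives the matrix with rows (0, 1) and (-1, 0), so J is itself a Pauli
  string up to i and conjugation by it only changes signs of strings.\<close>

lemma Jmat_pm: "Jmat (2 ^ m) = pm (Suc m) (pt 0 PY)"
proof -
  have "pt 0 PY = cons PY 0" by (auto simp: fun_eq_iff cons_def fun_app split: nat.splits)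
  then have "pm (Suc m) (pt 0 PY) = \<i> \<cdot>\<^sub>m kron (pmat PY) (1\<^sub>m (2 ^ m))"
    by (simp add: pm_def ps_cons ps_zero)
  also have "\<dots> = Jmat (2 ^ m)"
  proof (rule eq_matI)
    show "dim_row (\<i> \<cdot>\<^sub>m kron (pmat PY) (1\<^sub>m (2 ^ m))) = dim_row (Jmat (2 ^ m))"
      "dim_col (\<i> \<cdot>\<^sub>m kron (pmat PY) (1\<^sub>m (2 ^ m))) = dim_col (Jmat (2 ^ m))"
      using carrier_matD[OF pmat_carrier[of PY]] by (auto simp: Jmat_def)
    fix i j assume "i < dim_row (Jmat (2 ^ m))" "j < dim_col (Jmat (2 ^ m))"
    then have ij: "i < 2 * 2 ^ m" "j < 2 * 2 ^ m" by (auto simp: Jmat_def)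
    have "u div 2 ^ m = (if u < 2 ^ m then 0 else Suc 0)" "u mod 2 ^ m = (if u < 2 ^ m then u else u - 2 ^ m)"
      if "u < 2 * 2 ^ m" for u :: nat
      using that by (auto simp: le_mod_geq le_div_geq)
    then show "(\<i> \<cdot>\<^sub>m kron (pmat PY) (1\<^sub>m (2 ^ m))) $$ (i, j) = Jmat (2 ^ m) $$ (i, j)"
      using ij carrier_matD[OF pmat_carrier[of PY]] by (auto simp: Jmat_def kron_index pmat_index)
  qed
  finally show ?thesis by simp
qed

lemma pm_mult: "pm n f * pm n g = (- phn n f g) \<cdot>\<^sub>m ps n (f + g)"
proof -
  have "pm n f * pm n g = \<i> \<cdot>\<^sub>m (\<i> \<cdot>\<^sub>m (ps n f * ps n g))"
    unfolding pm_def mult_smult_distrib[OF smult_carrier_mat[OF ps_carrier] ps_carrier]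
      mult_smult_assoc_mat[OF ps_carrier ps_carrier] ..
  then show ?thesis unfolding ps_mult by (auto intro!: eq_matI)
qed

lemma pm_swap: "pm n f * pm n g = (if bc n f g then -1 else 1) \<cdot>\<^sub>m (pm n g * pm n f)"
  unfolding pm_mult phn_swap[of n f g] by (rule eq_matI) (auto simp: add.commute bc_sym)

lemma pm_conj: "pm n g * (pm n f * pm n g) = (if bc n f g then 1 else -1) \<cdot>\<^sub>m pm n f"
proof -
  have "pm n g * (pm n f * pm n g) = (if bc n f g then -1 else 1) \<cdot>\<^sub>m (pm n g * (pm n g * pm n f))"
    unfolding pm_swap[of n f g] by (rule mult_smult_distrib[OF pm_carrier mult_carrier_mat[OF pm_carrier pm_carrier]])
  also have "pm n g * (pm n g * pm n f) = pm n g * pm n g * pm n f"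
    by (rule assoc_mult_mat[symmetric]) auto
  also have "pm n g * pm n g = (-1) \<cdot>\<^sub>m 1\<^sub>m (2 ^ n)"
    unfolding pm_mult by (simp add: ps_zero)
  also have "(-1) \<cdot>\<^sub>m 1\<^sub>m (2 ^ n) * pm n f = (-1) \<cdot>\<^sub>m pm n f"
    by (simp add: mult_smult_assoc_mat[OF one_carrier_mat pm_carrier] left_mult_one_mat[OF pm_carrier])
  finally show ?thesis by (auto intro!: eq_matI)
qed

text \<open>The defining condition is equivalent to invariance under transposing and multiplying by
  J on both sides. A string gains -1 from the transpose if it has an odd number of Y, and another -1
  from the two factors J if it commutes with J; the signs cancel exactly when the form twisted by Y
  at site 0 equals 1.\<close>

theorem sp_alg_spanR: "sp_alg (2 ^ m) = spanR (Suc m) {f \<in> strs (Suc m). qf (Suc m) (pt 0 PY) f}"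
proof -
  define n where "n = Suc m"
  define y where "y = pt 0 PY"
  let ?J = "pm n y"
  let ?L = "\<lambda>r. lincomb (2 ^ n) (strs n) (\<lambda>f. complex_of_real (r f)) (pm n)"
  let ?r' = "\<lambda>r f. if qf n y f then r f else - r f :: real"
  have J: "Jmat (2 ^ m) = ?J" unfolding Jmat_pm n_def y_def ..
  have JJ: "?J * ?J = (-1) \<cdot>\<^sub>m 1\<^sub>m (2 ^ n)" unfolding pm_mult by (simp add: ps_zero)
  have conj: "?J * (transpose_mat (?L r) * ?J) = ?L (?r' r)" for r
  proof -
    have "?J * (transpose_mat (?L r) * ?J)
       = lincomb (2 ^ n) (strs n) (\<lambda>f. complex_of_real (if yodd n f then - r f else r f)) (\<lambda>f. ?J * (pm n f * ?J))"
      unfolding transpose_lincomb_pm complex_of_real_if lincomb_mult_right[OF pm_carrier pm_carrier]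
      by (rule lincomb_mult_left[OF pm_carrier mult_carrier_mat[OF pm_carrier pm_carrier]])
    also have "\<dots> = ?L (?r' r)"
      unfolding pm_conj
    proof (rule eq_matI)
      fix i j assume "i < dim_row (?L (?r' r))" "j < dim_col (?L (?r' r))"
      then have ij: "i < 2 ^ n" "j < 2 ^ n" by auto
      have "(\<Sum>f\<in>strs n. complex_of_real (if yodd n f then - r f else r f) * ((if bc n f y then 1 else - 1) \<cdot>\<^sub>m pm n f) $$ (i, j))
        = (\<Sum>f\<in>strs n. complex_of_real (?r' r f) * pm n f $$ (i, j))"
        by (rule sum.cong[OF refl]) (use ij in \<open>auto simp: qf_def bc_sym[of n y]\<close>)
      then show "lincomb (2 ^ n) (strs n) (\<lambda>f. complex_of_real (if yodd n f then - r f else r f))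
          (\<lambda>f. (if bc n f y then 1 else - 1) \<cdot>\<^sub>m pm n f) $$ (i, j) = ?L (?r' r) $$ (i, j)"
        using ij by simp
    qed auto
    finally show ?thesis .
  qed
  \<comment> \<open>J squares to -1, so multiplication by J on the left leads from one side to the
    other and back.\<close>
  have iff: "transpose_mat A * ?J = - (?J * A) \<longleftrightarrow> ?J * (transpose_mat A * ?J) = A" if A: "A \<in> carrier_mat (2 ^ n) (2 ^ n)" for A
  proof
    have JJX: "?J * (?J * X) = - X" if "X \<in> carrier_mat (2 ^ n) (2 ^ n)" for X
    proof -
      have "?J * (?J * X) = ?J * ?J * X" by (rule assoc_mult_mat[symmetric]) (use that in auto)
      then show ?thesis unfolding JJ mult_smult_assoc_mat[OF one_carrier_mat that] left_mult_one_mat[OF that]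
        by (auto intro!: eq_matI)
    qed
    have JA: "?J * A \<in> carrier_mat (2 ^ n) (2 ^ n)" by (rule mult_carrier_mat[OF pm_carrier A])
    have At: "transpose_mat A * ?J \<in> carrier_mat (2 ^ n) (2 ^ n)"
      by (rule mult_carrier_mat[OF _ pm_carrier]) (use A in simp)
    { assume "transpose_mat A * ?J = - (?J * A)"
      then have "?J * (transpose_mat A * ?J) = - (?J * (?J * A))" using JA by (simp add: uminus_mult_right_mat)
      then show "?J * (transpose_mat A * ?J) = A" unfolding JJX[OF A] by simp }
    { assume "?J * (transpose_mat A * ?J) = A"
      then have "?J * A = - (transpose_mat A * ?J)" using JJX[OF At] by simp
      then show "transpose_mat A * ?J = - (?J * A)" by simp }
  qed
  have "sp_alg (2 ^ m) = spanR n {f \<in> strs n. qf n y f}"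
  proof
    have N: "2 * 2 ^ m = (2::nat) ^ n" by (simp add: n_def)
    show "sp_alg (2 ^ m) \<subseteq> spanR n {f \<in> strs n. qf n y f}"
    proof
      fix A assume "A \<in> sp_alg (2 ^ m)"
      then have A: "A \<in> u_alg (2 ^ n)" "transpose_mat A * ?J = - (?J * A)" by (auto simp: sp_alg_def su_alg_def N J)
      obtain r where r: "A = ?L r" using A(1) by (rule u_alg_expansion)
      have "?L (?r' r) = ?L r" using A(2) iff[of A] conj[of r] unfolding r by simp
      then have "?r' r f = r f" if "f \<in> strs n" for f using pm_coeff_eq[of n "?r' r" r f] that by simp
      then have "r f = 0" if "f \<in> strs n" "\<not> qf n y f" for f using that by force
      then show "A \<in> spanR n {f \<in> strs n. qf n y f}" unfolding r by (intro spanR_restrict) auto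
    qed
    show "spanR n {f \<in> strs n. qf n y f} \<subseteq> sp_alg (2 ^ m)"
    proof
      fix A assume A: "A \<in> spanR n {f \<in> strs n. qf n y f}"
      then obtain r where r: "A = ?L r" "\<And>f. f \<notin> {f \<in> strs n. qf n y f} \<Longrightarrow> r f = 0"
        by (rule spanR_extend[rotated]) auto
      have r0: "r f = 0" if "f \<in> strs n" "\<not> qf n y f" for f using r(2) that by blast
      have "?L (?r' r) = ?L r" by (rule lincomb_cong) (use r0 in auto)
      then have "transpose_mat A * ?J = - (?J * A)" using iff[of A] conj[of r] unfolding r(1) by simp
      moreover have "r 0 = 0" using r0[of 0] by (simp add: qf_def)
      then have "A \<in> su_alg (2 ^ n)" unfolding su_alg_def
        using tr_lincomb_pm[of n "\<lambda>f. complex_of_real (r f)"] lincomb_pm_u[of n "strs n" r] r(1) by simp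
      ultimately show "A \<in> sp_alg (2 ^ m)" by (simp add: sp_alg_def N J)
    qed
  qed
  then show ?thesis by (simp add: n_def y_def)
qed

section \<open>Direct sums\<close>

definition blk :: "complex mat \<Rightarrow> complex mat \<Rightarrow> complex mat" where
  "blk A B = four_block_mat A (0\<^sub>m (dim_row A) (dim_col B)) (0\<^sub>m (dim_row B) (dim_col A)) B"

lemma dsum_blk: "L1 \<oplus>\<^sub>L L2 = {blk A B | A B. A \<in> L1 \<and> B \<in> L2}"
  by (simp add: dsum_def blk_def)

lemma dsum_assoc: "(L1 \<oplus>\<^sub>L L2) \<oplus>\<^sub>L L3 = L1 \<oplus>\<^sub>L L2 \<oplus>\<^sub>L L3"
proof -
  have *: "blk A (blk B C) = blk (blk A B) C" for A B C
    unfolding blk_def by (rule assoc_four_block_mat)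
  show ?thesis unfolding dsum_blk
  proof (intro equalityI subsetI)
    fix X assume "X \<in> {blk A B |A B. A \<in> {blk A B |A B. A \<in> L1 \<and> B \<in> L2} \<and> B \<in> L3}"
    then obtain A B C where "X = blk (blk A B) C" "A \<in> L1" "B \<in> L2" "C \<in> L3" by blast
    then show "X \<in> {blk A B |A B. A \<in> L1 \<and> B \<in> {blk A B |A B. A \<in> L2 \<and> B \<in> L3}}" unfolding *[symmetric] by blast
  next
    fix X assume "X \<in> {blk A B |A B. A \<in> L1 \<and> B \<in> {blk A B |A B. A \<in> L2 \<and> B \<in> L3}}"
    then obtain A B C where "X = blk A (blk B C)" "A \<in> L1" "B \<in> L2" "C \<in> L3" by blast
    then show "X \<in> {blk A B |A B. A \<in> {blk A B |A B. A \<in> L1 \<and> B \<in> L2} \<and> B \<in> L3}" unfolding * by blast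
  qed
qed

lemma blk_carrier: "A \<in> carrier_mat N N \<Longrightarrow> B \<in> carrier_mat M M \<Longrightarrow> blk A B \<in> carrier_mat (N + M) (N + M)"
  by (auto simp: blk_def)

lemma blk_index:
  assumes "A \<in> carrier_mat N N" "B \<in> carrier_mat M M" "i < N + M" "j < N + M"
  shows "blk A B $$ (i, j) = (if i < N then if j < N then A $$ (i, j) else 0
    else if j < N then 0 else B $$ (i - N, j - N))"
  using assms by (auto simp: blk_def)

lemma dsum_carrier: "L1 \<subseteq> carrier_mat N N \<Longrightarrow> L2 \<subseteq> carrier_mat M M \<Longrightarrow> L1 \<oplus>\<^sub>L L2 \<subseteq> carrier_mat (N + M) (N + M)"
  unfolding dsum_blk using blk_carrier by blast

lemma dpow_carrier: "L \<subseteq> carrier_mat N N \<Longrightarrow> dpow L (Suc m) \<subseteq> carrier_mat (Suc m * N) (Suc m * N)"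
proof (induction m)
  case (Suc m)
  then show ?case using dsum_carrier[OF Suc.prems Suc.IH[OF Suc.prems]] by simp
qed simp

lemma blk_add:
  assumes "A \<in> carrier_mat N N" "A' \<in> carrier_mat N N" "B \<in> carrier_mat M M" "B' \<in> carrier_mat M M"
  shows "blk A B + blk A' B' = blk (A + A') (B + B')"
  using assms by (intro eq_matI) (auto simp: blk_def)

lemma blk_smult:
  assumes "A \<in> carrier_mat N N" "B \<in> carrier_mat M M"
  shows "x \<cdot>\<^sub>m blk A B = blk (x \<cdot>\<^sub>m A) (x \<cdot>\<^sub>m B)"
  using assms by (intro eq_matI) (auto simp: blk_def)

lemma blk_inj:
  assumes c: "A \<in> carrier_mat N N" "A' \<in> carrier_mat N N" "B \<in> carrier_mat M M" "B' \<in> carrier_mat M M"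
    and eq: "blk A B = blk A' B'"
  shows "A = A' \<and> B = B'"
proof
  show "A = A'"
  proof (rule eq_matI)
    fix i j assume "i < dim_row A'" "j < dim_col A'"
    then show "A $$ (i, j) = A' $$ (i, j)"
      using c blk_index[OF c(1,3), of i j] blk_index[OF c(2,4), of i j] eq by simp
  qed (use c in auto)
  show "B = B'"
  proof (rule eq_matI)
    fix i j assume "i < dim_row B'" "j < dim_col B'"
    then show "B $$ (i, j) = B' $$ (i, j)"
      using c blk_index[OF c(1,3), of "N + i" "N + j"] blk_index[OF c(2,4), of "N + i" "N + j"] eq by simp
  qed (use c in auto)
qed

lemma blk_comm:
  assumes c: "A \<in> carrier_mat N N" "A' \<in> carrier_mat N N" "B \<in> carrier_mat M M" "B' \<in> carrier_mat M M"
  shows "comm (blk A B) (blk A' B') = blk (comm A A') (comm B B')"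
proof -
  have m: "blk A B * blk A' B' = blk (A * A') (B * B')"
    if c: "A \<in> carrier_mat N N" "A' \<in> carrier_mat N N" "B \<in> carrier_mat M M" "B' \<in> carrier_mat M M" for A A' B B'
  proof -
    have z: "0\<^sub>m N M \<in> carrier_mat N M" "0\<^sub>m M N \<in> carrier_mat M N" by auto
    have "blk A B * blk A' B' = four_block_mat (A * A' + 0\<^sub>m N M * 0\<^sub>m M N) (A * 0\<^sub>m N M + 0\<^sub>m N M * B')
        (0\<^sub>m M N * A' + B * 0\<^sub>m M N) (0\<^sub>m M N * 0\<^sub>m N M + B * B')"
      using mult_four_block_mat[OF c(1) z c(3) c(2) z c(4)] c by (simp add: blk_def)
    also have "\<dots> = blk (A * A') (B * B')"
      unfolding blk_def using c by (intro cong_four_block_mat) auto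
    finally show ?thesis .
  qed
  have AA: "A * A' \<in> carrier_mat N N" "A' * A \<in> carrier_mat N N" "B * B' \<in> carrier_mat M M" "B' * B \<in> carrier_mat M M"
    using c by auto
  show ?thesis unfolding comm_def m[OF c] m[OF c(2,1,4,3)]
    using AA by (intro eq_matI) (auto simp: blk_def simp del: index_mult_mat)
qed

lemma comm_neg:
  assumes "A \<in> carrier_mat N N" "B \<in> carrier_mat N N"
  shows "comm B A = - comm A B" "comm (- A) B = - comm A B" "comm A (- B) = - comm A B" "comm A A = 0\<^sub>m N N"
proof -
  have AB: "A * B \<in> carrier_mat N N" "B * A \<in> carrier_mat N N" "A * A \<in> carrier_mat N N" using assms by auto
  show "comm B A = - comm A B" unfolding comm_def using AB by (intro eq_matI) (auto simp del: index_mult_mat)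
  show "comm A A = 0\<^sub>m N N" unfolding comm_def using AB by (intro eq_matI) (auto simp del: index_mult_mat)
  have n: "- A * B = - (A * B)" "B * - A = - (B * A)" "A * - B = - (A * B)" "- B * A = - (B * A)"
    using assms by (auto intro!: eq_matI simp: scalar_prod_def sum_negf)
  show "comm (- A) B = - comm A B" "comm A (- B) = - comm A B"
    unfolding comm_def n using AB by (auto intro!: eq_matI simp del: index_mult_mat)
qed

lemma comm_add_add:
  assumes c: "A \<in> carrier_mat N N" "B \<in> carrier_mat N N" "A' \<in> carrier_mat N N" "B' \<in> carrier_mat N N"
    and z: "comm A B' = 0\<^sub>m N N" "comm B A' = 0\<^sub>m N N"
  shows "comm (A + B) (A' + B') = comm A A' + comm B B'"
proof (rule eq_matI)
  have cc: "comm A A' \<in> carrier_mat N N" "comm B B' \<in> carrier_mat N N" using c by auto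
  have ab: "A + B \<in> carrier_mat N N" "A' + B' \<in> carrier_mat N N" using c by auto
  show "dim_row (comm (A + B) (A' + B')) = dim_row (comm A A' + comm B B')"
    "dim_col (comm (A + B) (A' + B')) = dim_col (comm A A' + comm B B')"
    using cc carrier_matD[OF comm_carrier[OF ab]] by auto
  fix i j assume "i < dim_row (comm A A' + comm B B')" "j < dim_col (comm A A' + comm B B')"
  then have ij: "i < N" "j < N" using cc by auto
  have d: "((X + Y) * (X' + Y')) $$ (i, j) = (X * X') $$ (i, j) + (X * Y') $$ (i, j) + ((Y * X') $$ (i, j) + (Y * Y') $$ (i, j))"
    if "X \<in> carrier_mat N N" "Y \<in> carrier_mat N N" "X' \<in> carrier_mat N N" "Y' \<in> carrier_mat N N" for X Y X' Y' :: "complex mat"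
    using that ij by (simp add: scalar_prod_def distrib_left distrib_right sum.distrib)
  have "comm A B' $$ (i, j) = 0" "comm B A' $$ (i, j) = 0" using z ij by auto
  then have "(A * B') $$ (i, j) = (B' * A) $$ (i, j)" "(B * A') $$ (i, j) = (A' * B) $$ (i, j)"
    unfolding comm_index[OF c(1,4) ij] comm_index[OF c(2,3) ij] by auto
  then show "comm (A + B) (A' + B') $$ (i, j) = (comm A A' + comm B B') $$ (i, j)"
    unfolding comm_index[OF ab ij] d[OF c] d[OF c(3,4,1,2)]
    using cc ij comm_index[OF c(1,3) ij] comm_index[OF c(2,4) ij] by (simp del: index_mult_mat)
qed

text \<open>Passage from an internal direct sum of commuting subalgebras to block diagonal matrices;
  unique decomposition makes the blockwise map well defined.\<close>

lemma lie_iso_dsum: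
  assumes K: "real_lie_subalg N K1" "real_lie_subalg N K2"
    and L: "L = {A + B | A B. A \<in> K1 \<and> B \<in> K2}"
    and uniq: "\<And>A B A' B'. A \<in> K1 \<Longrightarrow> A' \<in> K1 \<Longrightarrow> B \<in> K2 \<Longrightarrow> B' \<in> K2 \<Longrightarrow> A + B = A' + B' \<Longrightarrow> A = A' \<and> B = B'"
    and com: "\<And>A B. A \<in> K1 \<Longrightarrow> B \<in> K2 \<Longrightarrow> comm A B = 0\<^sub>m N N"
    and iso: "K1 \<cong>\<^sub>L L1" "K2 \<cong>\<^sub>L L2"
    and car: "L1 \<subseteq> carrier_mat N1 N1" "L2 \<subseteq> carrier_mat N2 N2"
  shows "L \<cong>\<^sub>L L1 \<oplus>\<^sub>L L2"
proof -
  obtain f where f: "bij_betw f K1 L1"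
      "\<And>A B. A \<in> K1 \<Longrightarrow> B \<in> K1 \<Longrightarrow> f (A + B) = f A + f B \<and> f (comm A B) = comm (f A) (f B)"
      "\<And>A r. A \<in> K1 \<Longrightarrow> f (complex_of_real r \<cdot>\<^sub>m A) = complex_of_real r \<cdot>\<^sub>m f A"
    using iso(1) unfolding lie_iso_def by blast
  obtain g where g: "bij_betw g K2 L2"
      "\<And>A B. A \<in> K2 \<Longrightarrow> B \<in> K2 \<Longrightarrow> g (A + B) = g A + g B \<and> g (comm A B) = comm (g A) (g B)"
      "\<And>A r. A \<in> K2 \<Longrightarrow> g (complex_of_real r \<cdot>\<^sub>m A) = complex_of_real r \<cdot>\<^sub>m g A"
    using iso(2) unfolding lie_iso_def by blast
  have fL: "f A \<in> L1" "f A \<in> carrier_mat N1 N1" if "A \<in> K1" for A using f(1) car that by (auto simp: bij_betw_def)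
  have gL: "g A \<in> L2" "g A \<in> carrier_mat N2 N2" if "A \<in> K2" for A using g(1) car that by (auto simp: bij_betw_def)
  have Kc: "A \<in> carrier_mat N N" if "A \<in> K1 \<or> A \<in> K2" for A using K that by (auto simp: real_lie_subalg_def)
  have cl1: "A + B \<in> K1" "comm A B \<in> K1" "complex_of_real r \<cdot>\<^sub>m A \<in> K1" if "A \<in> K1" "B \<in> K1" for A B r
    using K(1) that by (auto simp: real_lie_subalg_def)
  have cl2: "A + B \<in> K2" "comm A B \<in> K2" "complex_of_real r \<cdot>\<^sub>m A \<in> K2" if "A \<in> K2" "B \<in> K2" for A B r
    using K(2) that by (auto simp: real_lie_subalg_def)
  define F where "F X = (SOME Y. \<exists>A\<in>K1. \<exists>B\<in>K2. X = A + B \<and> Y = blk (f A) (g B))" for X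
  have F: "F (A + B) = blk (f A) (g B)" if "A \<in> K1" "B \<in> K2" for A B
    unfolding F_def
  proof (rule some_equality)
    show "\<exists>A'\<in>K1. \<exists>B'\<in>K2. A + B = A' + B' \<and> blk (f A) (g B) = blk (f A') (g B')" using that by blast
    fix Y assume "\<exists>A'\<in>K1. \<exists>B'\<in>K2. A + B = A' + B' \<and> Y = blk (f A') (g B')"
    then obtain A' B' where "A' \<in> K1" "B' \<in> K2" "A + B = A' + B'" "Y = blk (f A') (g B')" by blast
    then show "Y = blk (f A) (g B)" using uniq[OF that(1) _ that(2)] by blast
  qed
  have "inj_on F L"
  proof (rule inj_onI)
    fix X X' assume "X \<in> L" "X' \<in> L" and e: "F X = F X'"
    then obtain A B A' B' where *: "X = A + B" "A \<in> K1" "B \<in> K2" "X' = A' + B'" "A' \<in> K1" "B' \<in> K2"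
      unfolding L by blast
    then have "blk (f A) (g B) = blk (f A') (g B')" using e F by simp
    then have "f A = f A'" "g B = g B'" using blk_inj[OF fL(2) fL(2) gL(2) gL(2)] * by blast+
    then have "A = A'" "B = B'" using f(1) g(1) * by (auto simp: bij_betw_def inj_on_def)
    then show "X = X'" using * by simp
  qed
  moreover have "F ` L = L1 \<oplus>\<^sub>L L2"
  proof
    show "F ` L \<subseteq> L1 \<oplus>\<^sub>L L2"
    proof
      fix Y assume "Y \<in> F ` L"
      then obtain A B where AB: "Y = F (A + B)" "A \<in> K1" "B \<in> K2" unfolding L by blast
      show "Y \<in> L1 \<oplus>\<^sub>L L2" unfolding AB(1) F[OF AB(2,3)] dsum_blk using fL(1)[OF AB(2)] gL(1)[OF AB(3)] by blast
    qed
    show "L1 \<oplus>\<^sub>L L2 \<subseteq> F ` L"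
    proof
      fix Y assume "Y \<in> L1 \<oplus>\<^sub>L L2"
      then obtain C D where Y: "Y = blk C D" "C \<in> L1" "D \<in> L2" unfolding dsum_blk by blast
      obtain A where A: "A \<in> K1" "C = f A" using f(1) Y(2) by (auto simp: bij_betw_def)
      obtain B where B: "B \<in> K2" "D = g B" using g(1) Y(3) by (auto simp: bij_betw_def)
      have "Y = F (A + B)" unfolding Y A(2) B(2) F[OF A(1) B(1)] ..
      then show "Y \<in> F ` L" unfolding L using A B by blast
    qed
  qed
  ultimately have "bij_betw F L (L1 \<oplus>\<^sub>L L2)" by (simp add: bij_betw_def)
  moreover have "F (X + X') = F X + F X' \<and> F (comm X X') = comm (F X) (F X')" if X: "X \<in> L" and X': "X' \<in> L" for X X'
  proof -
    obtain A B where AB: "X = A + B" "A \<in> K1" "B \<in> K2" using X unfolding L by blast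
    obtain A' B' where AB': "X' = A' + B'" "A' \<in> K1" "B' \<in> K2" using X' unfolding L by blast
    note c = Kc[OF disjI1[OF AB(2)]] Kc[OF disjI2[OF AB(3)]] Kc[OF disjI1[OF AB'(2)]] Kc[OF disjI2[OF AB'(3)]]
    have s: "X + X' = (A + A') + (B + B')" unfolding AB AB' using c by (intro eq_matI) auto
    have "comm B A' = 0\<^sub>m N N" using com[OF AB'(2) AB(3)] comm_neg(1)[OF c(3) c(2)] by auto
    then have k: "comm X X' = comm A A' + comm B B'" unfolding AB AB'
      using comm_add_add[OF c com[OF AB(2) AB'(3)]] by simp
    note FX = F[OF AB(2,3)] F[OF AB'(2,3)]
    note l = fL(2)[OF AB(2)] fL(2)[OF AB'(2)] gL(2)[OF AB(3)] gL(2)[OF AB'(3)]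
    show ?thesis
      unfolding s k F[OF cl1(1)[OF AB(2) AB'(2)] cl2(1)[OF AB(3) AB'(3)]] F[OF cl1(2)[OF AB(2) AB'(2)] cl2(2)[OF AB(3) AB'(3)]]
      unfolding AB(1) AB'(1) FX blk_add[OF l] blk_comm[OF l]
      using f(2)[OF AB(2) AB'(2)] g(2)[OF AB(3) AB'(3)] by simp
  qed
  moreover have "F (complex_of_real r \<cdot>\<^sub>m X) = complex_of_real r \<cdot>\<^sub>m F X" if X: "X \<in> L" for X r
  proof -
    obtain A B where AB: "X = A + B" "A \<in> K1" "B \<in> K2" using X unfolding L by blast
    note c = Kc[OF disjI1[OF AB(2)]] Kc[OF disjI2[OF AB(3)]]
    have s: "complex_of_real r \<cdot>\<^sub>m X = complex_of_real r \<cdot>\<^sub>m A + complex_of_real r \<cdot>\<^sub>m B"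
      unfolding AB using c by (intro eq_matI) (auto simp: distrib_left)
    show ?thesis
      unfolding s F[OF cl1(3)[OF AB(2,2)] cl2(3)[OF AB(3,3)]]
      unfolding AB(1) F[OF AB(2,3)] blk_smult[OF fL(2)[OF AB(2)] gL(2)[OF AB(3)]] f(3)[OF AB(2)] g(3)[OF AB(3)] ..
  qed
  ultimately show ?thesis unfolding lie_iso_def by blast
qed

lemma spanR_union:
  assumes S: "S1 \<subseteq> strs n" "S2 \<subseteq> strs n" and disj: "S1 \<inter> S2 = {}" and cl: "pclosed n S1" "pclosed n S2"
    and com: "\<And>f g. f \<in> S1 \<Longrightarrow> g \<in> S2 \<Longrightarrow> \<not> bc n f g"
    and iso: "spanR n S1 \<cong>\<^sub>L L1" "spanR n S2 \<cong>\<^sub>L L2"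
    and car: "L1 \<subseteq> carrier_mat N1 N1" "L2 \<subseteq> carrier_mat N2 N2"
  shows "spanR n (S1 \<union> S2) \<cong>\<^sub>L L1 \<oplus>\<^sub>L L2"
proof (rule lie_iso_dsum[OF spanR_lie[OF S(1) cl(1)] spanR_lie[OF S(2) cl(2)] _ _ _ iso car])
  have fin: "finite S1" "finite S2" using S finite_strs finite_subset by blast+
  let ?L = "\<lambda>S r. lincomb (2 ^ n) S (\<lambda>f. complex_of_real (r f)) (pm n)"
  have un: "?L (S1 \<union> S2) r = ?L S1 r + ?L S2 r" for r
    by (rule eq_matI) (simp_all add: sum.union_disjoint[OF fin disj])
  show "spanR n (S1 \<union> S2) = {A + B |A B. A \<in> spanR n S1 \<and> B \<in> spanR n S2}"
  proof (intro equalityI subsetI)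
    fix X assume "X \<in> spanR n (S1 \<union> S2)"
    then obtain r where "X = ?L (S1 \<union> S2) r" unfolding spanR_def by (rule spanM_E)
    then show "X \<in> {A + B |A B. A \<in> spanR n S1 \<and> B \<in> spanR n S2}"
      unfolding un spanR_def using spanM_I by blast
  next
    fix X assume "X \<in> {A + B |A B. A \<in> spanR n S1 \<and> B \<in> spanR n S2}"
    then obtain r q where X: "X = ?L S1 r + ?L S2 q" unfolding spanR_def spanM_def by blast
    have "X = ?L (S1 \<union> S2) (\<lambda>f. if f \<in> S1 then r f else q f)"
      unfolding X un by (intro arg_cong2[of _ _ _ _ "(+)"] lincomb_cong) (use disj in auto)
    then show "X \<in> spanR n (S1 \<union> S2)" unfolding spanR_def by (simp only: spanM_I)
  qed
  show "A = A' \<and> B = B'" if ab: "A \<in> spanR n S1" "A' \<in> spanR n S1" "B \<in> spanR n S2" "B' \<in> spanR n S2" "A + B = A' + B'" for A B A' B'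
  proof -
    obtain a where a: "A = ?L (strs n) a" "\<And>f. f \<notin> S1 \<Longrightarrow> a f = 0" using spanR_extend[OF S(1) ab(1)] by blast
    obtain a' where a': "A' = ?L (strs n) a'" "\<And>f. f \<notin> S1 \<Longrightarrow> a' f = 0" using spanR_extend[OF S(1) ab(2)] by blast
    obtain b where b: "B = ?L (strs n) b" "\<And>f. f \<notin> S2 \<Longrightarrow> b f = 0" using spanR_extend[OF S(2) ab(3)] by blast
    obtain b' where b': "B' = ?L (strs n) b'" "\<And>f. f \<notin> S2 \<Longrightarrow> b' f = 0" using spanR_extend[OF S(2) ab(4)] by blast
    have "?L (strs n) (\<lambda>f. a f + b f) = ?L (strs n) (\<lambda>f. a' f + b' f)"
      using ab(5) unfolding a(1) b(1) a'(1) b'(1) lincomb_add by simp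
    then have *: "a f + b f = a' f + b' f" if "f \<in> strs n" for f
      using pm_coeff_eq[of n "\<lambda>f. a f + b f" "\<lambda>f. a' f + b' f"] that by blast
    have "a f = a' f \<and> b f = b' f" if "f \<in> strs n" for f
      using *[OF that] a(2)[of f] a'(2)[of f] b(2)[of f] b'(2)[of f] disj by (cases "f \<in> S1"; cases "f \<in> S2") auto
    then show ?thesis unfolding a(1) a'(1) b(1) b'(1) by (auto intro!: lincomb_cong)
  qed
  show "comm A B = 0\<^sub>m (2 ^ n) (2 ^ n)" if A: "A \<in> spanR n S1" and B: "B \<in> spanR n S2" for A B
  proof -
    obtain r where r: "A = ?L S1 r" using A unfolding spanR_def by (rule spanM_E)
    obtain q where q: "B = ?L S2 q" using B unfolding spanR_def by (rule spanM_E)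
    have z: "comm (pm n f) (pm n g) = 0\<^sub>m (2 ^ n) (2 ^ n)" if "f \<in> S1" "g \<in> S2" for f g
      unfolding comm_pm using com[OF that] by (intro eq_matI) (auto simp: cs_def)
    show ?thesis unfolding r q lincomb_comm[OF fin pm_carrier pm_carrier]
      by (rule eq_matI) (auto simp: z intro!: sum.neutral)
  qed
qed

text \<open>Indices run from 0 to m, so there is at least one summand and the count is m + 1;
  \<open>dpow\<close> with exponent 0 would be the degenerate algebra of 0 by 0 matrices.\<close>

lemma spanR_UN:
  assumes S: "\<And>j. j \<le> m \<Longrightarrow> S j \<subseteq> strs n" "\<And>j. j \<le> m \<Longrightarrow> pclosed n (S j)" "\<And>j. j \<le> m \<Longrightarrow> spanR n (S j) \<cong>\<^sub>L L"
    and disj: "\<And>i j. i \<le> m \<Longrightarrow> j \<le> m \<Longrightarrow> i \<noteq> j \<Longrightarrow> S i \<inter> S j = {}"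
    and com: "\<And>i j f g. i \<le> m \<Longrightarrow> j \<le> m \<Longrightarrow> i \<noteq> j \<Longrightarrow> f \<in> S i \<Longrightarrow> g \<in> S j \<Longrightarrow> \<not> bc n f g"
    and car: "L \<subseteq> carrier_mat N N"
  shows "pclosed n (\<Union>j\<le>m. S j) \<and> spanR n (\<Union>j\<le>m. S j) \<cong>\<^sub>L dpow L (Suc m)"
  using S disj com
proof (induction m)
  case 0 then show ?case by simp
next
  case (Suc m)
  have IH: "pclosed n (\<Union>j\<le>m. S j)" "spanR n (\<Union>j\<le>m. S j) \<cong>\<^sub>L dpow L (Suc m)"
    using Suc.IH[OF Suc.prems(1-4)] Suc.prems(5) le_SucI by blast+
  have d: "S (Suc m) \<inter> (\<Union>j\<le>m. S j) = {}"
  proof -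
    have "S (Suc m) \<inter> S j = {}" if "j \<le> m" for j using Suc.prems(4)[of "Suc m" j] that by simp
    then show ?thesis by blast
  qed
  have c: "\<not> bc n f g" if fg: "f \<in> S (Suc m)" "g \<in> (\<Union>j\<le>m. S j)" for f g
  proof -
    obtain j where "j \<le> m" "g \<in> S j" using fg(2) by blast
    then show ?thesis using Suc.prems(5)[of "Suc m" j f g] fg(1) by simp
  qed
  have sub: "(\<Union>j\<le>m. S j) \<subseteq> strs n" using Suc.prems(1) by (meson UN_least atMost_iff le_SucI)
  have u: "(\<Union>j\<le>Suc m. S j) = S (Suc m) \<union> (\<Union>j\<le>m. S j)" by (simp add: atMost_Suc)
  have "spanR n (S (Suc m) \<union> (\<Union>j\<le>m. S j)) \<cong>\<^sub>L L \<oplus>\<^sub>L dpow L (Suc m)"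
    by (rule spanR_union[OF Suc.prems(1)[OF le_refl] sub d Suc.prems(2)[OF le_refl] IH(1) c Suc.prems(3)[OF le_refl] IH(2) car dpow_carrier[OF car]])
  moreover have "pclosed n (S (Suc m) \<union> (\<Union>j\<le>m. S j))"
  proof (rule pclosedI)
    fix f g assume fg: "f \<in> S (Suc m) \<union> (\<Union>j\<le>m. S j)" "g \<in> S (Suc m) \<union> (\<Union>j\<le>m. S j)" "bc n f g"
    have "bc n g f" using fg(3) bc_sym by blast
    then consider "f \<in> S (Suc m)" "g \<in> S (Suc m)" | "f \<in> (\<Union>j\<le>m. S j)" "g \<in> (\<Union>j\<le>m. S j)"
      using fg c[of f g] c[of g f] by blast
    then show "f + g \<in> S (Suc m) \<union> (\<Union>j\<le>m. S j)"
      using pclosedD[OF Suc.prems(2)[OF le_refl] _ _ fg(3)] pclosedD[OF IH(1) _ _ fg(3)] by cases blast+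
  qed
  ultimately show ?case unfolding u by simp
qed

lemma u1_carrier: "u1 \<subseteq> carrier_mat 1 1" by (auto simp: u1_def u_alg_def)

lemma spanR_single_u1:
  assumes "f \<in> strs n"
  shows "spanR n {f} \<cong>\<^sub>L u1"
proof -
  \<comment> \<open>The only string of length zero is the 1 by 1 identity, so u(1) is the unitary
    algebra of length zero.\<close>
  have "u1 = spanR 0 ((\<lambda>_. 0) ` {f})"
    using u_alg_spanR[of 0] by (simp add: u1_def strs_zero)
  moreover have "spanR n {f} \<cong>\<^sub>L spanR 0 ((\<lambda>_. 0) ` {f})"
    by (rule signed_iso(1)[where s = "\<lambda>_. 1"]) (use assms in \<open>auto intro: pclosedI\<close>)
  ultimately show ?thesis by simp
qed

lemma spanR_abelian:
  assumes "\<And>j. j \<le> m \<Longrightarrow> f j \<in> strs n" "inj_on f {..m}" "\<And>i j. i \<le> m \<Longrightarrow> j \<le> m \<Longrightarrow> \<not> bc n (f i) (f j)"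
  shows "spanR n (f ` {..m}) \<cong>\<^sub>L dpow u1 (Suc m)"
proof -
  have "f ` {..m} = (\<Union>j\<le>m. {f j})" by auto
  moreover have "spanR n (\<Union>j\<le>m. {f j}) \<cong>\<^sub>L dpow u1 (Suc m)"
    by (rule conjunct2[OF spanR_UN[OF _ _ spanR_single_u1 _ _ u1_carrier]])
      (use assms in \<open>auto intro: pclosedI dest: inj_onD\<close>)
  ultimately show ?thesis by simp
qed

text \<open>A leading letter that is diagonal. As I + Z and I - Z are multiples of the projections
  on the two blocks, the span splits into two copies of the span of T.\<close>

definition dbl :: "pstr set \<Rightarrow> pstr set" where "dbl T = {cons a f | a f. a \<in> {0, PZ} \<and> f \<in> T}"

lemma dbl_lincomb:
  assumes fin: "finite T"
  shows "lincomb (2 ^ Suc n) (dbl T) c (pm (Suc n))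
    = blk (lincomb (2 ^ n) T (\<lambda>f. c (cons 0 f) + c (cons PZ f)) (pm n)) (lincomb (2 ^ n) T (\<lambda>f. c (cons 0 f) - c (cons PZ f)) (pm n))"
    (is "?A = blk ?P ?Q")
proof (rule eq_matI)
  have b: "blk ?P ?Q \<in> carrier_mat (2 ^ n + 2 ^ n) (2 ^ n + 2 ^ n)" by (rule blk_carrier) auto
  then show "dim_row ?A = dim_row (blk ?P ?Q)" "dim_col ?A = dim_col (blk ?P ?Q)" by auto
  fix i j assume "i < dim_row (blk ?P ?Q)" "j < dim_col (blk ?P ?Q)"
  then have ij: "i < 2 * 2 ^ n" "j < 2 * 2 ^ n" using b by auto
  have dm: "u div 2 ^ n = (if u < 2 ^ n then 0 else Suc 0)" "u mod 2 ^ n = (if u < 2 ^ n then u else u - 2 ^ n)"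
    if "u < 2 * 2 ^ n" for u :: nat
    using that by (auto simp: le_mod_geq le_div_geq)
  have p: "pm (Suc n) (cons a f) $$ (i, j) = pmat a $$ (i div 2 ^ n, j div 2 ^ n) * pm n f $$ (i mod 2 ^ n, j mod 2 ^ n)" for a f
    using ij ps_cons_index[OF ij, of a f] by (simp add: pm_def)
  have d: "dbl T = cons 0 ` T \<union> cons PZ ` T" by (auto simp: dbl_def)
  have "(\<Sum>s\<in>dbl T. c s * pm (Suc n) s $$ (i, j)) = (\<Sum>s\<in>cons 0 ` T. c s * pm (Suc n) s $$ (i, j)) + (\<Sum>s\<in>cons PZ ` T. c s * pm (Suc n) s $$ (i, j))"
    unfolding d by (rule sum.union_disjoint) (use fin in auto)
  then have "?A $$ (i, j) = (\<Sum>f\<in>T. c (cons 0 f) * pm (Suc n) (cons 0 f) $$ (i, j)) + (\<Sum>f\<in>T. c (cons PZ f) * pm (Suc n) (cons PZ f) $$ (i, j))"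
    using ij by (simp add: sum.reindex inj_on_def)
  also have "\<dots> = (\<Sum>f\<in>T. (c (cons 0 f) * pmat 0 $$ (i div 2 ^ n, j div 2 ^ n) + c (cons PZ f) * pmat PZ $$ (i div 2 ^ n, j div 2 ^ n))
      * pm n f $$ (i mod 2 ^ n, j mod 2 ^ n))"
    unfolding p sum.distrib[symmetric] by (rule sum.cong) (auto simp: algebra_simps)
  also have "\<dots> = blk ?P ?Q $$ (i, j)"
  proof -
    have "i < 2 ^ n + 2 ^ n" "j < 2 ^ n + 2 ^ n" using ij by auto
    note bi = blk_index[OF lincomb_carrier lincomb_carrier this]
    show ?thesis unfolding bi dm[OF ij(1)] dm[OF ij(2)] using ij by (auto simp: pmat_index)
  qed
  finally show "?A $$ (i, j) = blk ?P ?Q $$ (i, j)" .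
qed

theorem spanR_dbl:
  assumes "finite T"
  shows "spanR (Suc n) (dbl T) = spanR n T \<oplus>\<^sub>L spanR n T"
proof (intro equalityI subsetI)
  fix X assume "X \<in> spanR (Suc n) (dbl T)"
  then obtain r where X: "X = lincomb (2 ^ Suc n) (dbl T) (\<lambda>f. complex_of_real (r f)) (pm (Suc n))"
    unfolding spanR_def by (rule spanM_E)
  show "X \<in> spanR n T \<oplus>\<^sub>L spanR n T"
    unfolding X dbl_lincomb[OF assms] of_real_add[symmetric] of_real_diff[symmetric] dsum_blk spanR_def
    using spanM_I[of "2 ^ n" T "\<lambda>f. r (cons 0 f) + r (cons PZ f)" "pm n"]
      spanM_I[of "2 ^ n" T "\<lambda>f. r (cons 0 f) - r (cons PZ f)" "pm n"] by blast
next
  fix X assume "X \<in> spanR n T \<oplus>\<^sub>L spanR n T"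
  then obtain a b where X: "X = blk (lincomb (2 ^ n) T (\<lambda>f. complex_of_real (a f)) (pm n)) (lincomb (2 ^ n) T (\<lambda>f. complex_of_real (b f)) (pm n))"
    unfolding dsum_blk spanR_def spanM_def by blast
  \<comment> \<open>Half sum and half difference solve for the coefficients with leading I and Z,
    given those of the two blocks.\<close>
  define r where "r g = (if g 0 = 0 then (a (\<lambda>i. g (Suc i)) + b (\<lambda>i. g (Suc i))) / 2 else (a (\<lambda>i. g (Suc i)) - b (\<lambda>i. g (Suc i))) / 2)" for g :: pstr
  have "X = lincomb (2 ^ Suc n) (dbl T) (\<lambda>f. complex_of_real (r f)) (pm (Suc n))"
    unfolding X dbl_lincomb[OF assms] of_real_add[symmetric] of_real_diff[symmetric]
    by (intro arg_cong2[of _ _ _ _ blk] lincomb_cong) (auto simp: r_def field_simps)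
  then show "X \<in> spanR (Suc n) (dbl T)" unfolding spanR_def by (simp only: spanM_I)
qed

section \<open>Orthogonal Lie algebras from anticommuting strings\<close>

definition ltp :: "nat \<Rightarrow> (nat \<times> nat) set" where "ltp m = {(i, j). i < j \<and> j < m}"

text \<open>The orthogonal commutation relations in a basis indexed by ordered pairs. The local
  function e expands the element with indices x, y, which is minus a basis element when the pair is
  reversed. The factor 2 is that of commutators of Pauli strings.\<close>

definition so_coeff :: "nat \<times> nat \<Rightarrow> nat \<times> nat \<Rightarrow> nat \<times> nat \<Rightarrow> real" where
  "so_coeff s t p = (let e = (\<lambda>x y. if p = (x, y) then 1 else if p = (y, x) then -1 else 0 :: real); (i, j) = s; (k, l) = t in
     2 * (of_bool (j = k) * e i l - of_bool (i = k) * e j l - of_bool (j = l) * e i k + of_bool (i = l) * e j k))"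

lemma finite_ltp [simp]: "finite (ltp m)"
  by (rule finite_subset[of _ "{..<m} \<times> {..<m}"]) (auto simp: ltp_def)

text \<open>These few relations determine all structure constants; they are checked once for
  elementary antisymmetric matrices and once for products of anticommuting strings.\<close>

lemma structured_so:
  fixes G :: "nat \<Rightarrow> nat \<Rightarrow> complex mat"
  assumes c: "\<And>i j. G i j \<in> carrier_mat N N"
    and anti: "\<And>i j. i < m \<Longrightarrow> j < m \<Longrightarrow> G j i = - G i j"
    and tri: "\<And>i j l. i < m \<Longrightarrow> j < m \<Longrightarrow> l < m \<Longrightarrow> i \<noteq> j \<Longrightarrow> j \<noteq> l \<Longrightarrow> i \<noteq> l \<Longrightarrow> comm (G i j) (G j l) = 2 \<cdot>\<^sub>m G i l"
    and disj: "\<And>i j k l. i < m \<Longrightarrow> j < m \<Longrightarrow> k < m \<Longrightarrow> l < m \<Longrightarrow> distinct [i, j, k, l] \<Longrightarrow> comm (G i j) (G k l) = 0\<^sub>m N N"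
  shows "structured N (ltp m) (\<lambda>(i, j). G i j) so_coeff"
proof -
  let ?M = "\<lambda>(i, j). G i j"
  have e: "lincomb N (ltp m) (\<lambda>p. complex_of_real (x * (if p = (i, j) then 1 else if p = (j, i) then -1 else 0))) ?M = complex_of_real x \<cdot>\<^sub>m G i j"
    if "i < m" "j < m" "i \<noteq> j" for i j x
  proof (cases "i < j")
    case True
    have "lincomb N (ltp m) (\<lambda>p. complex_of_real (x * (if p = (i, j) then 1 else if p = (j, i) then -1 else 0))) ?M
       = lincomb N (ltp m) (\<lambda>p. if p = (i, j) then complex_of_real x else 0) ?M"
      by (rule lincomb_cong) (use True in \<open>auto simp: ltp_def\<close>)
    also have "\<dots> = complex_of_real x \<cdot>\<^sub>m ?M (i, j)"
      by (rule lincomb_single) (use True that c in \<open>simp_all add: ltp_def[of m] finite_ltp[unfolded ltp_def]\<close>)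
    finally show ?thesis by simp
  next
    case False
    have "lincomb N (ltp m) (\<lambda>p. complex_of_real (x * (if p = (i, j) then 1 else if p = (j, i) then -1 else 0))) ?M
       = lincomb N (ltp m) (\<lambda>p. if p = (j, i) then - complex_of_real x else 0) ?M"
    proof (rule lincomb_cong)
      fix p assume "p \<in> ltp m"
      then have "p \<noteq> (i, j)" using False by (auto simp: ltp_def)
      then show "complex_of_real (x * (if p = (i, j) then 1 else if p = (j, i) then -1 else 0)) = (if p = (j, i) then - complex_of_real x else 0)"
        by simp
    qed simp
    also have "\<dots> = - complex_of_real x \<cdot>\<^sub>m ?M (j, i)"
      by (rule lincomb_single) (use False that c in \<open>simp_all add: ltp_def[of m] finite_ltp[unfolded ltp_def]\<close>)
    also have "\<dots> = complex_of_real x \<cdot>\<^sub>m G i j" using anti[OF that(1,2)] c by (auto intro!: eq_matI)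
    finally show ?thesis .
  qed
  have e2: "lincomb N (ltp m) (\<lambda>p. complex_of_real (so_coeff (i, j) (k, l) p)) ?M = complex_of_real x \<cdot>\<^sub>m G u v"
    if "\<And>p. p \<in> ltp m \<Longrightarrow> so_coeff (i, j) (k, l) p = x * (if p = (u, v) then 1 else if p = (v, u) then -1 else 0)" "u < m" "v < m" "u \<noteq> v" for i j k l u v x
    unfolding e[OF that(2-4), symmetric] by (rule lincomb_cong) (simp_all add: that(1))
  have "comm (G i j) (G k l) = lincomb N (ltp m) (\<lambda>p. complex_of_real (so_coeff (i, j) (k, l) p)) ?M"
    if ij: "i < j" "j < m" and kl: "k < l" "l < m" for i j k l
  proof -
    have lt: "i < m" "k < m" using ij kl by auto
    consider "j = k" | "i = l" | "i = k" "j \<noteq> l" | "j = l" "i \<noteq> k" | "i = k" "j = l" | "distinct [i, j, k, l]"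
      using ij kl by fastforce
    then show ?thesis
    proof cases
      case 1
      have "lincomb N (ltp m) (\<lambda>p. complex_of_real (so_coeff (i, j) (k, l) p)) ?M = complex_of_real 2 \<cdot>\<^sub>m G i l"
        by (rule e2) (use 1 ij kl in \<open>auto simp: so_coeff_def\<close>)
      then show ?thesis using tri[of i j l] 1 ij kl lt by simp
    next
      case 2
      have "lincomb N (ltp m) (\<lambda>p. complex_of_real (so_coeff (i, j) (k, l) p)) ?M = complex_of_real (-2) \<cdot>\<^sub>m G k j"
        by (rule e2) (use 2 ij kl in \<open>auto simp: so_coeff_def\<close>)
      moreover have "comm (G i j) (G k l) = - comm (G k i) (G i j)" unfolding 2[symmetric] by (rule comm_neg(1)[OF c c])
      ultimately show ?thesis using tri[of k i j] 2 ij kl lt c by (auto intro!: eq_matI)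
    next
      case 3
      have "lincomb N (ltp m) (\<lambda>p. complex_of_real (so_coeff (i, j) (k, l) p)) ?M = complex_of_real (-2) \<cdot>\<^sub>m G j l"
        by (rule e2) (use 3 ij kl in \<open>auto simp: so_coeff_def\<close>)
      moreover have "comm (G i j) (G k l) = - comm (G j i) (G i l)"
        unfolding 3(1)[symmetric] using comm_neg(2)[OF c c, of j i i l] anti[of j i] ij lt by auto
      ultimately show ?thesis using tri[of j i l] 3 ij kl lt c by (auto intro!: eq_matI)
    next
      case 4
      have "lincomb N (ltp m) (\<lambda>p. complex_of_real (so_coeff (i, j) (k, l) p)) ?M = complex_of_real (-2) \<cdot>\<^sub>m G i k"
        by (rule e2) (use 4 ij kl in \<open>auto simp: so_coeff_def\<close>)
      moreover have "comm (G i j) (G k l) = - comm (G i j) (G j k)"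
        unfolding 4(1)[symmetric] using comm_neg(3)[OF c c, of i j j k] anti[of j k] ij lt by auto
      ultimately show ?thesis using tri[of i j k] 4 ij kl lt c by (auto intro!: eq_matI)
    next
      case 5
      have "lincomb N (ltp m) (\<lambda>p. complex_of_real (so_coeff (i, j) (k, l) p)) ?M = 0\<^sub>m N N"
        by (rule lincomb_zero) (use 5 ij in \<open>auto simp: so_coeff_def ltp_def\<close>)
      then show ?thesis using 5 comm_neg(4)[OF c c] by simp
    next
      case 6
      have "lincomb N (ltp m) (\<lambda>p. complex_of_real (so_coeff (i, j) (k, l) p)) ?M = 0\<^sub>m N N"
        by (rule lincomb_zero) (use 6 in \<open>auto simp: so_coeff_def\<close>)
      then show ?thesis using disj[OF lt(1) ij(2) lt(2) kl(2) 6] by simp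
    qed
  qed
  then have k: "comm (?M s) (?M t) = lincomb N (ltp m) (\<lambda>u. complex_of_real (so_coeff s t u)) ?M"
    if "s \<in> ltp m" "t \<in> ltp m" for s t
    using that by (cases s; cases t) (simp add: ltp_def[of m] split_beta)
  show ?thesis unfolding structured_def using c k finite_ltp by (auto simp: split_beta)
qed

text \<open>The entry 2 is a normalisation: it makes the commutator of the elements i, j and j, l
  equal to twice the element i, l, as for Pauli strings.\<close>

definition so_gen :: "nat \<Rightarrow> nat \<Rightarrow> nat \<Rightarrow> complex mat" where
  "so_gen N i j = mat N N (\<lambda>(a, b). 2 * (of_bool (a = i \<and> b = j) - of_bool (a = j \<and> b = i)))"

lemma so_gen_carrier: "so_gen N i j \<in> carrier_mat N N" by (simp add: so_gen_def)

lemma so_gen_mult: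
  assumes "i < N" "j < N" "k < N" "l < N" "a < N" "b < N"
  shows "(so_gen N i j * so_gen N k l) $$ (a, b) =
    4 * (of_bool (j = k \<and> a = i \<and> b = l) - of_bool (j = l \<and> a = i \<and> b = k) - of_bool (i = k \<and> a = j \<and> b = l) + of_bool (i = l \<and> a = j \<and> b = k))"
proof -
  have "(so_gen N i j * so_gen N k l) $$ (a, b) = (\<Sum>x<N. so_gen N i j $$ (a, x) * so_gen N k l $$ (x, b))"
    using assms by (simp add: scalar_prod_def so_gen_def lessThan_atLeast0)
  also have "\<dots> = (\<Sum>x<N. (if x = j then 4 * of_bool (a = i) * (of_bool (j = k \<and> b = l) - of_bool (j = l \<and> b = k)) else 0)
      - (if x = i then 4 * of_bool (a = j) * (of_bool (i = k \<and> b = l) - of_bool (i = l \<and> b = k)) else 0))"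
    using assms by (intro sum.cong) (auto simp: so_gen_def)
  also have "\<dots> = 4 * of_bool (a = i) * (of_bool (j = k \<and> b = l) - of_bool (j = l \<and> b = k))
      - 4 * of_bool (a = j) * (of_bool (i = k \<and> b = l) - of_bool (i = l \<and> b = k))"
    using assms by (simp add: sum_subtractf)
  finally show ?thesis by (simp add: of_bool_conj algebra_simps)
qed

lemma structured_so_gen: "structured N (ltp N) (\<lambda>(i, j). so_gen N i j) so_coeff"
proof (rule structured_so)
  show "so_gen N i j \<in> carrier_mat N N" for i j by (rule so_gen_carrier)
  show "so_gen N j i = - so_gen N i j" for i j by (rule eq_matI) (auto simp: so_gen_def)
  fix i j l assume "i < N" "j < N" "l < N" "i \<noteq> j" "j \<noteq> l" "i \<noteq> l"
  then show "comm (so_gen N i j) (so_gen N j l) = 2 \<cdot>\<^sub>m so_gen N i l"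
    by (intro eq_matI) (simp_all add: comm_index[OF so_gen_carrier so_gen_carrier] so_gen_mult carrier_matD[OF so_gen_carrier]
      carrier_matD[OF comm_carrier[OF so_gen_carrier so_gen_carrier]] del: index_mult_mat, auto simp: so_gen_def)
next
  fix i j k l assume "i < N" "j < N" "k < N" "l < N" "distinct [i, j, k, l]"
  then show "comm (so_gen N i j) (so_gen N k l) = 0\<^sub>m N N"
    by (intro eq_matI) (auto simp add: comm_index[OF so_gen_carrier so_gen_carrier] so_gen_mult carrier_matD[OF so_gen_carrier]
      carrier_matD[OF comm_carrier[OF so_gen_carrier so_gen_carrier]] simp del: index_mult_mat)
qed

lemma lincomb_so_gen:
  assumes "a < N" "b < N"
  shows "lincomb N (ltp N) c (\<lambda>(i, j). so_gen N i j) $$ (a, b) = (if a < b then 2 * c (a, b) else if b < a then - 2 * c (b, a) else 0)"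
proof -
  have "lincomb N (ltp N) c (\<lambda>(i, j). so_gen N i j) $$ (a, b)
     = (\<Sum>p\<in>ltp N. (if p = (a, b) then 2 * c (a, b) else 0) - (if p = (b, a) then 2 * c (b, a) else 0))"
    unfolding lincomb_index[OF assms]
  proof (rule sum.cong[OF refl])
    fix p assume "p \<in> ltp N"
    then obtain i j where "p = (i, j)" "i < j" by (auto simp: ltp_def)
    then show "c p * (case p of (i, j) \<Rightarrow> so_gen N i j) $$ (a, b)
        = (if p = (a, b) then 2 * c (a, b) else 0) - (if p = (b, a) then 2 * c (b, a) else 0)"
      using assms by (cases "a = i \<and> b = j"; cases "a = j \<and> b = i") (simp_all add: so_gen_def)
  qed
  moreover have "(a, b) \<in> ltp N \<longleftrightarrow> a < b" "(b, a) \<in> ltp N \<longleftrightarrow> b < a" using assms by (auto simp: ltp_def)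
  ultimately show ?thesis by (simp add: sum_subtractf)
qed

lemma so_alg_spanM: "so_alg N = spanM N (ltp N) (\<lambda>(i, j). so_gen N i j)"
proof (intro equalityI subsetI)
  fix A assume A: "A \<in> so_alg N"
  have neg: "A $$ (b, a) = - A $$ (a, b)" if "a < N" "b < N" for a b
  proof -
    have c: "A \<in> carrier_mat N N" and t: "transpose_mat A = - A" using A by (auto simp: so_alg_def)
    have "A $$ (b, a) = transpose_mat A $$ (a, b)" using c that by simp
    also have "\<dots> = - A $$ (a, b)" unfolding t using c that by simp
    finally show ?thesis .
  qed
  have re: "complex_of_real (Re (A $$ (a, b))) = A $$ (a, b)" if "a < N" "b < N" for a b
    using A that by (auto simp: so_alg_def)
  have "A = lincomb N (ltp N) (\<lambda>p. complex_of_real (Re (A $$ p) / 2)) (\<lambda>(i, j). so_gen N i j)"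
  proof (rule eq_matI)
    fix a b assume "a < dim_row (lincomb N (ltp N) (\<lambda>p. complex_of_real (Re (A $$ p) / 2)) (\<lambda>(i, j). so_gen N i j))"
      "b < dim_col (lincomb N (ltp N) (\<lambda>p. complex_of_real (Re (A $$ p) / 2)) (\<lambda>(i, j). so_gen N i j))"
    then have ab: "a < N" "b < N" by auto
    have "A $$ (a, a) = 0" using neg[OF ab(1,1)] by simp
    then show "A $$ (a, b) = lincomb N (ltp N) (\<lambda>p. complex_of_real (Re (A $$ p) / 2)) (\<lambda>(i, j). so_gen N i j) $$ (a, b)"
      unfolding lincomb_so_gen[OF ab] using re[OF ab] re[OF ab(2,1)] neg[OF ab(2,1)] ab by (cases a b rule: linorder_cases) auto
  qed (use A in \<open>auto simp: so_alg_def\<close>)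
  then show "A \<in> spanM N (ltp N) (\<lambda>(i, j). so_gen N i j)" using spanM_I by metis
next
  fix A assume "A \<in> spanM N (ltp N) (\<lambda>(i, j). so_gen N i j)"
  then obtain r where r: "A = lincomb N (ltp N) (\<lambda>p. complex_of_real (r p)) (\<lambda>(i, j). so_gen N i j)" by (rule spanM_E)
  have ent: "A $$ (a, b) = (if a < b then 2 * complex_of_real (r (a, b)) else if b < a then - 2 * complex_of_real (r (b, a)) else 0)"
    if "a < N" "b < N" for a b unfolding r by (rule lincomb_so_gen[OF that])
  have "A \<in> carrier_mat N N" by (simp add: r)
  then show "A \<in> so_alg N" unfolding so_alg_def
    by (auto simp: ent intro!: eq_matI)
qed

lemma indep_so_gen: "indep N (ltp N) (\<lambda>(i, j). so_gen N i j)"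
  unfolding indep_def
proof (intro allI impI ballI)
  fix r :: "nat \<times> nat \<Rightarrow> real" and p
  assume z: "lincomb N (ltp N) (\<lambda>s. complex_of_real (r s)) (\<lambda>(i, j). so_gen N i j) = 0\<^sub>m N N" and p: "p \<in> ltp N"
  obtain a b where ab: "p = (a, b)" "a < b" "b < N" using p by (auto simp: ltp_def)
  have "0\<^sub>m N N $$ (a, b) = 2 * complex_of_real (r (a, b))"
    unfolding z[symmetric] using lincomb_so_gen[of a N b "\<lambda>s. complex_of_real (r s)"] ab by simp
  then show "r p = 0" using ab by simp
qed

text \<open>For i different from j the sign x i j is chosen so that \<open>G i j\<close> is the
  actual matrix product of the two strings, not merely their sum up to sign. The products of two out
  of m anticommuting square roots of 1 satisfy the relations of so(m).\<close>

theorem majorana_iso: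
  assumes c: "\<And>i. i < m \<Longrightarrow> c i \<in> strs n" and anti: "\<And>i j. i < m \<Longrightarrow> j < m \<Longrightarrow> bc n (c i) (c j) = (i \<noteq> j)"
  shows "spanR n {c i + c j | i j. i < j \<and> j < m} \<cong>\<^sub>L so_alg m"
proof -
  define x where "x i j = Im (phn n (c i) (c j))" for i j
  define G where "G i j = complex_of_real (x i j) \<cdot>\<^sub>m pm n (c i + c j)" for i j
  have Gc: "G i j \<in> carrier_mat (2 ^ n) (2 ^ n)" for i j by (simp add: G_def)
  have xsq: "x i j * x i j = 1" if "i < m" "j < m" "i \<noteq> j" for i j
    using Im_phn_sq[of n "c i" "c j"] anti[OF that(1,2)] that(3) by (simp add: x_def)
  have bcs: "bc n (c i + c j) (c k + c l) = (((i \<noteq> k) \<noteq> (j \<noteq> k)) \<noteq> ((i \<noteq> l) \<noteq> (j \<noteq> l)))"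
    if "i < m" "j < m" "k < m" "l < m" for i j k l
    using that anti by (simp add: bc_add bc_add2)
  have "structured (2 ^ n) (ltp m) (\<lambda>(i, j). G i j) so_coeff"
  proof (rule structured_so[OF Gc])
    fix i j assume ij: "i < m" "j < m"
    show "G j i = - G i j"
    proof (cases "i = j")
      case True then show ?thesis by (intro eq_matI) (auto simp: G_def x_def)
    next
      case False
      then have "x j i = - x i j" using phn_swap[of n "c j" "c i"] anti[OF ij] by (simp add: x_def)
      then show ?thesis by (intro eq_matI) (auto simp: G_def add.commute)
    qed
  next
    fix i j l assume lt: "i < m" "j < m" "l < m" and ne: "i \<noteq> j" "j \<noteq> l" "i \<noteq> l"
    define y where "y = Im (phn n (c i + c j) (c j + c l))"
    have sum: "c i + c j + (c j + c l) = c i + c l" by (simp add: add.assoc pstr_dbl2)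
    have b: "bc n (c i + c j) (c j + c l)" using bcs[OF lt(1,2,2,3)] ne by simp
    have "phn n (c i) (c j) * phn n (c i + c j) (c j + c l) = phn n (c i) (c l) * phn n (c j) (c j + c l)"
      using phn_cocycle[of n "c i" "c j" "c j + c l"] by (simp add: pstr_dbl2)
    moreover have "phn n (c j) (c j + c l) * phn n (c j) (c l) = 1"
      using phn_cocycle[of n "c j" "c j" "c l"] by simp
    ultimately have e: "phn n (c i) (c j) * phn n (c j) (c l) * phn n (c i + c j) (c j + c l) = phn n (c i) (c l)"
      by (metis mult.assoc mult.commute mult_1_right)
    have "bc n (c i) (c j)" "bc n (c j) (c l)" "bc n (c i) (c l)" using anti lt ne by auto
    note im = this[THEN phn_Im, folded x_def] phn_Im[OF b, folded y_def]
    have "\<i> * complex_of_real (- (x i j * x j l * y)) = \<i> * complex_of_real (x i l)"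
      using e unfolding im by (simp add: mult_ac)
    then have y: "- (x i j * x j l * y) = x i l" by (simp only: mult_cancel_left complex_i_not_zero simp_thms of_real_eq_iff)
    have "comm (G i j) (G j l) = complex_of_real (x i j * x j l) \<cdot>\<^sub>m comm (pm n (c i + c j)) (pm n (c j + c l))"
      unfolding comm_def G_def
      by (rule eq_matI) (auto simp: mult_smult_distrib[OF smult_carrier_mat[OF pm_carrier] pm_carrier]
        mult_smult_assoc_mat[OF pm_carrier pm_carrier] algebra_simps simp del: index_mult_mat(1))
    also have "\<dots> = complex_of_real (2 * x i l) \<cdot>\<^sub>m pm n (c i + c l)"
      unfolding comm_pm sum y[symmetric] using b by (intro eq_matI) (auto simp: cs_def y_def)
    finally show "comm (G i j) (G j l) = 2 \<cdot>\<^sub>m G i l" unfolding G_def by (auto intro!: eq_matI)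
  next
    fix i j k l assume lt: "i < m" "j < m" "k < m" "l < m" "distinct [i, j, k, l]"
    then have "cs n (c i + c j) (c k + c l) = 0" using bcs by (simp add: cs_def)
    then have z: "comm (pm n (c i + c j)) (pm n (c k + c l)) = 0\<^sub>m (2 ^ n) (2 ^ n)"
      unfolding comm_pm by (intro eq_matI) auto
    have "comm (G i j) (G k l) = complex_of_real (x i j * x k l) \<cdot>\<^sub>m comm (pm n (c i + c j)) (pm n (c k + c l))"
      unfolding comm_def G_def
      by (rule eq_matI) (auto simp: mult_smult_distrib[OF smult_carrier_mat[OF pm_carrier] pm_carrier]
        mult_smult_assoc_mat[OF pm_carrier pm_carrier] algebra_simps simp del: index_mult_mat(1))
    then show "comm (G i j) (G k l) = 0\<^sub>m (2 ^ n) (2 ^ n)" unfolding z by (auto intro!: eq_matI)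
  qed
  moreover define \<Phi> where "\<Phi> = (\<lambda>(i, j). c i + c j)"
  have sgn: "\<forall>p\<in>ltp m. x (fst p) (snd p) * x (fst p) (snd p) = 1"
    using xsq by (auto simp: ltp_def)
  have sub: "\<Phi> ` ltp m \<subseteq> strs n" using c by (auto simp: \<Phi>_def ltp_def intro!: strs_add)
  \<comment> \<open>The strings anticommuting with a pair sum are its two members, so the pair can
    be recovered; this gives injectivity.\<close>
  have det: "bc n (\<Phi> p) (c k) = (k = fst p \<or> k = snd p)" if "p \<in> ltp m" "k < m" for p k
    using that anti by (auto simp: \<Phi>_def ltp_def bc_add)
  have inj: "inj_on \<Phi> (ltp m)"
  proof (rule inj_onI)
    fix p p' assume p: "p \<in> ltp m" "p' \<in> ltp m" "\<Phi> p = \<Phi> p'"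
    have "(k = fst p \<or> k = snd p) = (k = fst p' \<or> k = snd p')" if "k < m" for k
      using det[OF p(1) that] det[OF p(2) that] p(3) by simp
    from this[of "fst p"] this[of "snd p"] this[of "fst p'"] this[of "snd p'"] show "p = p'"
      using p(1,2) by (cases p; cases p') (auto simp: ltp_def)
  qed
  have eq: "(\<lambda>(i, j). G i j) = (\<lambda>p. complex_of_real (x (fst p) (snd p)) \<cdot>\<^sub>m pm n (\<Phi> p))"
    by (auto simp: G_def \<Phi>_def)
  note sp = spanM_signed[where s = "\<lambda>p. x (fst p) (snd p)", OF finite_ltp sub inj sgn, folded eq]
  have im: "\<Phi> ` ltp m = {c i + c j | i j. i < j \<and> j < m}" by (auto simp: \<Phi>_def ltp_def)
  ultimately show ?thesis
    using structured_iso[OF _ structured_so_gen sp(2) indep_so_gen] unfolding sp(1) so_alg_spanM im by simp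
qed

text \<open>Neighbouring sums telescope to all sums of two, and two such sums anticommute only if
  the pairs share exactly one member, which then cancels.\<close>

lemma pcl_path:
  assumes anti: "\<And>i j. i < m \<Longrightarrow> j < m \<Longrightarrow> bc n (c i) (c j) = (i \<noteq> j)"
  shows "pcl n {c k + c (Suc k) | k. Suc k < m} = {c i + c j | i j. i < j \<and> j < m}"
proof
  have sym: "{c i + c j | i j. i < j \<and> j < m} = {c i + c j | i j. i < m \<and> j < m \<and> i \<noteq> j}"
  proof (intro equalityI subsetI)
    fix f assume "f \<in> {c i + c j | i j. i < m \<and> j < m \<and> i \<noteq> j}"
    then obtain i j where "f = c i + c j" "i < m" "j < m" "i \<noteq> j" by blast
    then show "f \<in> {c i + c j | i j. i < j \<and> j < m}"
    proof (cases "i < j")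
      case False
      then have "f = c j + c i" "j < i" using \<open>f = c i + c j\<close> \<open>i \<noteq> j\<close> by (simp_all add: add.commute)
      then show ?thesis using \<open>i < m\<close> unfolding mem_Collect_eq by (intro exI conjI)
    qed (unfold mem_Collect_eq, intro exI conjI)
  next
    fix f assume "f \<in> {c i + c j | i j. i < j \<and> j < m}"
    then obtain i j where "f = c i + c j" "i < j" "j < m" by blast
    moreover from this have "i < m" "i \<noteq> j" by auto
    ultimately show "f \<in> {c i + c j | i j. i < m \<and> j < m \<and> i \<noteq> j}" unfolding mem_Collect_eq by (intro exI conjI)
  qed
  show "pcl n {c k + c (Suc k) | k. Suc k < m} \<subseteq> {c i + c j | i j. i < j \<and> j < m}"
  proof (rule pcl_least)
    show "{c k + c (Suc k) | k. Suc k < m} \<subseteq> {c i + c j | i j. i < j \<and> j < m}" by auto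
    show "pclosed n {c i + c j | i j. i < j \<and> j < m}"
      unfolding sym
    proof (rule pclosedI)
      fix f g assume "f \<in> {c i + c j | i j. i < m \<and> j < m \<and> i \<noteq> j}" "g \<in> {c i + c j | i j. i < m \<and> j < m \<and> i \<noteq> j}" and b: "bc n f g"
      then obtain i j k l where *: "f = c i + c j" "i < m" "j < m" "i \<noteq> j" "g = c k + c l" "k < m" "l < m" "k \<noteq> l" by blast
      then have "((i \<noteq> k) \<noteq> (j \<noteq> k)) \<noteq> ((i \<noteq> l) \<noteq> (j \<noteq> l))" using b anti by (simp add: bc_add bc_add2)
      then consider "i = k" "j \<noteq> l" | "i = l" "j \<noteq> k" | "j = k" "i \<noteq> l" | "j = l" "i \<noteq> k" using * by blast
      then show "f + g \<in> {c i + c j | i j. i < m \<and> j < m \<and> i \<noteq> j}"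
      proof cases
        case 1 then have "f + g = c j + c l" using * by (simp add: ac_simps pstr_dbl2)
        then show ?thesis using * 1 by blast
      next
        case 2 then have "f + g = c j + c k" using * by (simp add: ac_simps pstr_dbl2)
        then show ?thesis using * 2 by blast
      next
        case 3 then have "f + g = c i + c l" using * by (simp add: ac_simps pstr_dbl2)
        then show ?thesis using * 3 by blast
      next
        case 4 then have "f + g = c i + c k" using * by (simp add: ac_simps pstr_dbl2)
        then show ?thesis using * 4 by blast
      qed
    qed
  qed
  have "c i + c (i + Suc d) \<in> pcl n {c k + c (Suc k) | k. Suc k < m}" if "i + Suc d < m" for i d
    using that
  proof (induction d)
    case 0 then show ?case by (intro pcl_base) auto
  next
    case (Suc d)
    have 1: "c i + c (i + Suc d) \<in> pcl n {c k + c (Suc k) | k. Suc k < m}" using Suc by simp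
    have 2: "c (i + Suc d) + c (Suc (i + Suc d)) \<in> pcl n {c k + c (Suc k) | k. Suc k < m}"
      using Suc.prems by (intro pcl_base) auto
    have "bc n (c i + c (i + Suc d)) (c (i + Suc d) + c (Suc (i + Suc d)))"
      using Suc.prems anti by (simp add: bc_add bc_add2)
    from pcl_step[OF 1 2 this] show ?case by (simp add: add.assoc pstr_dbl2)
  qed
  then show "{c i + c j | i j. i < j \<and> j < m} \<subseteq> pcl n {c k + c (Suc k) | k. Suc k < m}"
    by (auto simp: less_iff_Suc_add)
qed

lemma so_alg_carrier: "so_alg N \<subseteq> carrier_mat N N" by (auto simp: so_alg_def)
lemma su_alg_carrier: "su_alg N \<subseteq> carrier_mat N N" by (auto simp: su_alg_def u_alg_def)
lemma sp_alg_carrier: "sp_alg N \<subseteq> carrier_mat (2 * N) (2 * N)" by (auto simp: sp_alg_def su_alg_def u_alg_def)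

section \<open>Closures of generating sets\<close>

fun acomm :: "pauli list \<Rightarrow> pauli list \<Rightarrow> bool" where
  "acomm (a # l) (b # m) = (anti a b \<noteq> acomm l m)"
| "acomm _ _ = False"

text \<open>The offset k allows a computation on a short window to be transported to any place of a
  chain of any length.\<close>

definition emb :: "nat \<Rightarrow> pauli list \<Rightarrow> pstr" where
  "emb k l = (\<lambda>i. if k \<le> i \<and> i < k + length l then l ! (i - k) else 0)"

text \<open>A certificate entry (i, j) multiplies the generator number i with the element number j obtained so far.\<close>
fun derivl :: "pauli list list \<Rightarrow> pauli list list \<Rightarrow> (nat \<times> nat) list \<Rightarrow> pauli list list" where
  "derivl gs acc [] = acc"
| "derivl gs acc ((i, j) # r) = (if i < length gs \<and> j < length acc \<and> acomm (gs ! i) (acc ! j)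
     then derivl gs (acc @ [map2 (+) (gs ! i) (acc ! j)]) r else acc)"

fun conn :: "pauli list list \<Rightarrow> pauli list list \<Rightarrow> bool" where
  "conn acc [] = True"
| "conn acc (g # gs) = ((\<exists>x\<in>set acc. acomm g x) \<and> conn (g # acc) gs)"

fun spanl :: "nat \<Rightarrow> pauli list list \<Rightarrow> pauli list list" where
  "spanl n [] = [replicate n PI]"
| "spanl n (g # gs) = (let r = spanl n gs in r @ map (map2 (+) g) r)"

fun yoddl :: "pauli list \<Rightarrow> bool" where
  "yoddl [] = False"
| "yoddl (a # l) = ((a = PY) \<noteq> yoddl l)"

abbreviation full where "full n c \<equiv> quad.full (bc n) (qf n c)"
abbreviation rich where "rich n \<equiv> quad.rich (bc n)"
abbreviation nonrad where "nonrad n \<equiv> quad.nonrad (bc n)"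

lemma emb_Nil [simp]: "emb k [] = 0" by (auto simp: emb_def fun_eq_iff fun_app)

lemma emb_Cons [simp]: "emb k (a # l) = pt k a + emb (Suc k) l"
proof
  fix i
  show "emb k (a # l) i = (pt k a + emb (Suc k) l) i"
  proof (cases "i \<le> k")
    case False
    then obtain d where "i = Suc k + d" by (metis add_Suc less_imp_Suc_add not_le)
    then show ?thesis by (simp add: emb_def fun_app)
  qed (auto simp: emb_def fun_app)
qed

lemma emb_low: "i < k \<Longrightarrow> emb k l i = 0" by (simp add: emb_def)

lemma emb_add: "length l = length m \<Longrightarrow> emb k (map2 (+) l m) = emb k l + emb k m"
  by (auto simp: emb_def fun_eq_iff fun_app)

lemma bc_emb: "length l = length m \<Longrightarrow> k + length l \<le> N \<Longrightarrow> bc N (emb k l) (emb k m) = acomm l m"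
proof (induction l m arbitrary: k rule: list_induct2)
  case (Cons a l b m)
  then have "bc N (emb (Suc k) l) (emb (Suc k) m) = acomm l m" by simp
  moreover have "(pt k a + emb (Suc k) l) k = a" for a l by (simp add: fun_app emb_low)
  ultimately show ?case using Cons.prems by (simp add: bc_add bc_add2 emb_low)
qed simp

lemma yodd_emb: "k + length l \<le> N \<Longrightarrow> yodd N (emb k l) = yoddl l"
  by (induction l arbitrary: k) (simp_all add: yodd_add emb_low)

lemma bc_emb_left: "length l = n \<Longrightarrow> bc n c (emb 0 l) = acomm (map c [0..<n]) l"
proof -
  assume l: "length l = n"
  have "bc n c (emb 0 l) = bc n (emb 0 (map c [0..<n])) (emb 0 l)"
    by (rule bc_cong) (auto simp: emb_def)
  then show ?thesis using bc_emb[of "map c [0..<n]" l 0 n] l by simp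
qed

lemma emb_replicate_0: "emb k (replicate n 0) = 0"
  by (auto simp: emb_def fun_eq_iff fun_app)

text \<open>Certificates need no validity assumption: an entry with a bad index or commuting factors
  ends the evaluation. D is any closed set, since the same certificate is also read inside a
  span.\<close>

lemma derivl_sound:
  assumes D: "pclosed N D" "k + n \<le> N" and gs: "\<forall>l\<in>set gs. length l = n \<and> emb k l \<in> D"
  shows "\<forall>l\<in>set acc. length l = n \<and> emb k l \<in> D \<Longrightarrow> \<forall>l\<in>set (derivl gs acc c). length l = n \<and> emb k l \<in> D"
proof (induction c arbitrary: acc)
  case (Cons x r)
  obtain i j where x: "x = (i, j)" by (cases x)
  show ?case
  proof (cases "i < length gs \<and> j < length acc \<and> acomm (gs ! i) (acc ! j)")
    case True
    then have m: "gs ! i \<in> set gs" "acc ! j \<in> set acc" by auto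
    then have l: "length (gs ! i) = n" "emb k (gs ! i) \<in> D" "length (acc ! j) = n" "emb k (acc ! j) \<in> D"
      using gs Cons.prems by auto
    then have "bc N (emb k (gs ! i)) (emb k (acc ! j))" using True bc_emb[of "gs ! i" "acc ! j" k N] D(2) by simp
    then have "emb k (map2 (+) (gs ! i) (acc ! j)) \<in> D"
      using pclosedD[OF D(1) l(2,4)] l by (simp add: emb_add)
    then have "\<forall>l\<in>set (acc @ [map2 (+) (gs ! i) (acc ! j)]). length l = n \<and> emb k l \<in> D"
      using Cons.prems l by auto
    from Cons.IH[OF this] show ?thesis using True by (simp add: x)
  qed (use Cons.prems in \<open>auto simp: x\<close>)
qed simp

lemma derivl_pcl:
  assumes "\<forall>l\<in>set gs. length l = n \<and> emb k l \<in> pcl N G" "k + n \<le> N" "l \<in> set (derivl gs gs c)"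
  shows "emb k l \<in> pcl N G"
  using derivl_sound[OF pcl_closed assms(2,1), of gs c] assms by blast

lemma gspan_pclosed: "pclosed N (gspan A)"
  by (intro pclosedI gspan_add)

lemma spanl_gspan:
  assumes "\<forall>g\<in>set gs. length g = n"
  shows "gspan (emb k ` set gs) = emb k ` set (spanl n gs) \<and> (\<forall>l\<in>set (spanl n gs). length l = n)"
  using assms
proof (induction gs)
  case Nil then show ?case by (simp add: gspan_empty emb_replicate_0)
next
  case (Cons g gs)
  then have IH: "gspan (emb k ` set gs) = emb k ` set (spanl n gs)" "\<forall>l\<in>set (spanl n gs). length l = n" by auto
  have "emb k ` (map2 (+) g) ` set (spanl n gs) = (+) (emb k g) ` emb k ` set (spanl n gs)"
    unfolding image_image by (rule image_cong[OF refl]) (use IH Cons.prems in \<open>simp add: emb_add\<close>)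
  then show ?case using IH Cons.prems
    by (simp add: gspan_insert[OF pstr_dbl] Let_def image_Un) auto
qed

lemma nonrad_gspan:
  assumes "nonrad n (gspan A) f"
  shows "\<exists>g\<in>A. bc n f g"
proof (rule ccontr)
  assume no: "\<not> ?thesis"
  have "gspan A \<subseteq> {g. \<not> bc n f g}"
    by (rule gspan_least) (use no in \<open>auto simp: bc_add2\<close>)
  then show False using assms by (auto simp: pq.nonrad_def)
qed

lemma list_closure:
  fixes gs bs :: "pauli list list"
  assumes gs: "\<forall>g\<in>set gs. length g = n \<and> emb 0 g \<in> D" and D: "pclosed n D" and bs: "\<forall>g\<in>set bs. length g = n"
    and chk: "\<forall>l\<in>set (spanl n bs). P l \<and> (\<exists>g\<in>set bs. acomm l g) \<longrightarrow> l \<in> set (derivl gs gs c)"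
    and f: "f \<in> gspan (emb 0 ` set bs)" "nonrad n (gspan (emb 0 ` set bs)) f"
      and P: "\<And>l. length l = n \<Longrightarrow> emb 0 l = f \<Longrightarrow> P l"
  shows "f \<in> D"
proof -
  obtain l where l: "l \<in> set (spanl n bs)" "length l = n" "f = emb 0 l"
    using f(1) spanl_gspan[OF bs, of 0] by auto
  obtain g where "g \<in> set bs" "bc n f (emb 0 g)" using nonrad_gspan[OF f(2)] by auto
  then have "\<exists>g\<in>set bs. acomm l g" using bc_emb[of l g 0 n] bs l by auto
  then have "l \<in> set (derivl gs gs c)" using chk l P by blast
  then show ?thesis using derivl_sound[OF D, of 0 n gs gs c] gs l by simp
qed

lemma full_lists:
  assumes gs: "\<forall>g\<in>set gs. length g = n \<and> emb 0 g \<in> D" and D: "pclosed n D"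
    and chk: "\<forall>l\<in>set (spanl n gs). (yoddl l \<noteq> acomm (map c [0..<n]) l) \<and> (\<exists>g\<in>set gs. acomm l g) \<longrightarrow> l \<in> set (derivl gs gs cert)"
  shows "full n c D (gspan (emb 0 ` set gs))"
  unfolding pq.full_def
proof (intro ballI impI)
  fix f assume f: "f \<in> gspan (emb 0 ` set gs)" "qf n c f" "nonrad n (gspan (emb 0 ` set gs)) f"
  show "f \<in> D"
  proof (rule list_closure[OF gs D _ chk f(1,3)])
    fix l assume l: "length l = n" "emb 0 l = f"
    then show "yoddl l \<noteq> acomm (map c [0..<n]) l"
      using f(2) yodd_emb[of 0 l n] bc_emb_left[of l n c] by (simp add: qf_def)
  qed (use gs in auto)
qed

lemma conn_extend:
  assumes "pclosed N D" "full N c D (gspan A)" "rich N 3 {} (gspan A)"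
    and "conn acc gs" "\<forall>g\<in>set acc \<union> set gs. length g = n" "n \<le> N" "emb 0 ` set acc \<subseteq> A"
    and "\<forall>g\<in>set gs. emb 0 g \<in> D \<and> qf N c (emb 0 g)"
  shows "full N c D (gspan (A \<union> emb 0 ` set gs)) \<and> rich N 3 {} (gspan (A \<union> emb 0 ` set gs))"
  using assms(2-)
proof (induction gs arbitrary: acc A)
  case (Cons g gs)
  obtain x where x: "x \<in> set acc" "acomm g x" using Cons.prems(3) by auto
  then have xA: "emb 0 x \<in> gspan A" using Cons.prems(6) gspan_base by blast
  have "bc N (emb 0 g) (emb 0 x)" using x Cons.prems(4,5) by (simp add: bc_emb)
  then have fr: "full N c D (gspan (insert (emb 0 g) A)) \<and> rich N 3 {} (gspan (insert (emb 0 g) A))"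
    using pq.full_insert[OF assms(1) Cons.prems(1,2) _ _ xA] Cons.prems(7) by auto
  have "insert (emb 0 g) A \<union> emb 0 ` set gs = A \<union> emb 0 ` set (g # gs)" by auto
  moreover have "full N c D (gspan (insert (emb 0 g) A \<union> emb 0 ` set gs)) \<and> rich N 3 {} (gspan (insert (emb 0 g) A \<union> emb 0 ` set gs))"
    by (rule Cons.IH[OF conjunct1[OF fr] conjunct2[OF fr], of "g # acc"]) (use Cons.prems in auto)
  ultimately show ?case by simp
qed simp

definition gram_E6 :: "pauli list \<Rightarrow> pauli list \<Rightarrow> pauli list \<Rightarrow> pauli list \<Rightarrow> pauli list \<Rightarrow> pauli list \<Rightarrow> bool" where
  "gram_E6 a b c d e f \<longleftrightarrow> acomm a b \<and> acomm b c \<and> acomm c d \<and> acomm d e \<and> acomm c f \<and>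
     \<not> acomm a c \<and> \<not> acomm a d \<and> \<not> acomm a e \<and> \<not> acomm a f \<and> \<not> acomm b d \<and> \<not> acomm b e \<and> \<not> acomm b f \<and>
     \<not> acomm c e \<and> \<not> acomm d f \<and> \<not> acomm e f"

text \<open>The certificate produces an E6 diagram out of the generators. The generators are then
  attached to it one after the other, and as the diagram lies in their span, nothing is added to the
  span.\<close>

lemma full_E6_lists:
  assumes D: "pclosed N D" and n: "n \<le> N" and gs: "\<forall>g\<in>set gs. length g = n \<and> emb 0 g \<in> D"
    and q: "\<And>f. f \<in> D \<Longrightarrow> qf N c f"
    and es: "set [e1, e2, e3, e4, e5, e6] \<subseteq> set (derivl gs gs cert)" "gram_E6 e1 e2 e3 e4 e5 e6"
      and co: "conn [e1, e2, e3, e4, e5, e6] gs"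
  shows "full N c D (gspan (emb 0 ` set gs)) \<and> rich N 3 {} (gspan (emb 0 ` set gs))"
proof -
  define es where e: "es = [e1, e2, e3, e4, e5, e6]"
  note es = es[folded e] and co = co[folded e]
  have eD: "\<forall>l\<in>set es. length l = n \<and> emb 0 l \<in> D"
    using derivl_sound[OF D, of 0 n gs gs cert] n gs es(1) by auto
  \<comment> \<open>The certificate is read a second time with the span in place of D; this puts the
    six vectors into the span.\<close>
  have "\<forall>g\<in>set gs. length g = n \<and> emb 0 g \<in> gspan (emb 0 ` set gs)" using gs gspan_base by blast
  from derivl_sound[OF gspan_pclosed _ this this, of N cert]
  have eG: "\<forall>l\<in>set es. length l = n \<and> emb 0 l \<in> gspan (emb 0 ` set gs)"
    using n es(1) by (simp only: add_0) blast
  let ?E = "{emb 0 e1, emb 0 e2, emb 0 e3, emb 0 e4, emb 0 e5, emb 0 e6}"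
  have b: "bc N (emb 0 x) (emb 0 y) = acomm x y" if "x \<in> set es" "y \<in> set es" for x y
    using bc_emb[of x y 0 N] eD n that by simp
  have "full N c D (gspan ?E) \<and> rich N 3 {} (gspan ?E)"
    by (rule pq.full_E6[OF D]) (use eD q es(2) in \<open>simp_all add: b gram_E6_def e del: emb_Cons\<close>)
  then have fr: "full N c D (gspan (emb 0 ` set es))" "rich N 3 {} (gspan (emb 0 ` set es))" by (auto simp: e)
  have "full N c D (gspan (emb 0 ` set es \<union> emb 0 ` set gs)) \<and> rich N 3 {} (gspan (emb 0 ` set es \<union> emb 0 ` set gs))"
    by (rule conn_extend[OF D fr co _ n]) (use eD gs q in auto)
  moreover have "gspan (emb 0 ` set es \<union> emb 0 ` set gs) = gspan (emb 0 ` set gs)"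
    by (intro equalityI gspan_mono) (use eG in \<open>auto intro: gspan_base\<close>)
  ultimately show ?thesis by simp
qed

section \<open>Growing a chain site by site\<close>

lemma Suc_SucE: "2 \<le> i \<Longrightarrow> \<exists>k. i = Suc (Suc k)"
  by (rule exI[of _ "i - 2"]) simp

text \<open>Only the prefix grows; the form, D and the ambient length N stay those of the whole
  chain, so products may leave the prefix on the way.\<close>

lemma full_prefix:
  assumes D: "pclosed N D" and base: "full N c D (gspan (A k)) \<and> rich N 3 {} (gspan (A k))" and "k \<le> m" "m \<le> N"
    and step: "\<And>i. k \<le> i \<Longrightarrow> i < N \<Longrightarrow> \<exists>es. A (Suc i) = A i \<union> set es \<and> (\<forall>e\<in>set es. e \<in> D \<and> qf N c e \<and> (\<exists>x\<in>A i. bc N e x))"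
  shows "full N c D (gspan (A m)) \<and> rich N 3 {} (gspan (A m))"
  using \<open>k \<le> m\<close> \<open>m \<le> N\<close>
proof (induction m rule: dec_induct)
  case base then show ?case using assms by simp
next
  case (step i)
  obtain es where es: "A (Suc i) = A i \<union> set es" "\<forall>e\<in>set es. e \<in> D \<and> qf N c e \<and> (\<exists>x\<in>A i. bc N e x)"
    using assms(5)[of i] step by auto
  have "full N c D (gspan (A i))" "rich N 3 {} (gspan (A i))" using step by auto
  then show ?case unfolding es(1)
    by (rule pq.full_extend[OF D]) (use es(2) in \<open>auto simp: all_set_conv_all_nth\<close>)
qed

lemma pcl_gspan: "pcl n G \<subseteq> gspan G"
  by (rule pcl_least[OF _ gspan_pclosed]) (auto intro: gspan_base)

lemma pcl_q:
  assumes "\<And>g. g \<in> G \<Longrightarrow> qf n c g" "f \<in> pcl n G"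
  shows "qf n c f"
proof -
  have "pcl n G \<subseteq> {f. qf n c f}"
    by (rule pcl_least) (use assms(1) pq.q_add in \<open>auto intro!: pclosedI\<close>)
  then show ?thesis using assms(2) by blast
qed

text \<open>A product f + g of anticommuting strings anticommutes with its own factor g, so radical
  strings never arise.\<close>

lemma pcl_nonrad:
  assumes "\<And>g. g \<in> G \<Longrightarrow> \<exists>h\<in>G. bc n g h" "f \<in> pcl n G"
  shows "nonrad n (gspan G) f"
  using assms(2)
proof induction
  case (pcl_base f) then show ?case using assms(1)[of f] gspan_base pq.nonradI by blast
next
  case (pcl_step f g)
  have "bc n (f + g) g" using pcl_step by (simp add: bc_add)
  then show ?case using pcl_gspan pcl_step pq.nonradI by blast
qed

lemma pcl_full:
  assumes "full n c (pcl n G) (gspan G)" "\<And>g. g \<in> G \<Longrightarrow> qf n c g" "\<And>g. g \<in> G \<Longrightarrow> \<exists>h\<in>G. bc n g h"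
  shows "pcl n G = {f \<in> gspan G. qf n c f \<and> nonrad n (gspan G) f}"
  using assms(1) pcl_gspan[of n G] pcl_q[OF assms(2)] pcl_nonrad[OF assms(3)] by (auto simp: pq.full_def)

subsection \<open>Heisenberg-like chains\<close>

text \<open>Equal letters on the two sites of a bond, with a choice of letters depending on the
  bond: the common shape of the chains a3, a5, a6, a7 and a10 after a relabelling of letters site by
  site.\<close>

definition hg :: "nat \<Rightarrow> (nat \<Rightarrow> pauli set) \<Rightarrow> pstr set" where
  "hg n Ls = {pr j a a | j a. Suc j < n \<and> a \<in> Ls j}"

lemma hg_I: "Suc j < n \<Longrightarrow> a \<in> Ls j \<Longrightarrow> pr j a a \<in> hg n Ls"
  by (auto simp: hg_def)

lemma hg_E:
  assumes "g \<in> hg n Ls"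
  obtains j a where "g = pr j a a" "Suc j < n" "a \<in> Ls j"
  using assms by (auto simp: hg_def)

text \<open>The strings commuting with X on all sites and with Z on all sites; a letter repeated on
  a bond commutes with both.\<close>

definition V :: "nat \<Rightarrow> pstr set" where
  "V n = {f \<in> strs n. \<not> bc n f (\<lambda>_. PX) \<and> \<not> bc n f (\<lambda>_. PZ)}"

definition two :: "pauli set \<Rightarrow> bool" where
  "two S \<longleftrightarrow> 0 \<notin> S \<and> (\<exists>a\<in>S. \<exists>b\<in>S. a \<noteq> b)"

lemma bc_pr: "bc n (pr j a b) f = ((j < n \<and> anti a (f j)) \<noteq> (Suc j < n \<and> anti b (f (Suc j))))"
  by (simp add: pr_def bc_add)

lemma bc_pr2: "bc n f (pr j a b) = ((j < n \<and> anti (f j) a) \<noteq> (Suc j < n \<and> anti (f (Suc j)) b))"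
  by (simp add: pr_def bc_add2)

lemma pr_add: "pr j a b + pr j a' b' = pr j (a + a') (b + b')"
  unfolding pr_def pt_add[symmetric] by (simp add: ac_simps)

lemma pr_apply: "pr j a b i = (if i = j then a else if i = Suc j then b else 0)"
  by (simp add: pr_def fun_app)

lemma yodd_pr: "yodd n (pr j a b) = ((j < n \<and> a = PY) \<noteq> (Suc j < n \<and> b = PY))"
  by (simp add: pr_def yodd_add)

lemma two_span:
  assumes "two S"
  shows "\<exists>b\<in>S. \<exists>c\<in>S. a = 0 \<or> a = b \<or> a = b + c"
proof -
  obtain b c where "b \<in> S" "c \<in> S" "b \<noteq> c" "b \<noteq> 0" "c \<noteq> 0" using assms by (auto simp: two_def)
  moreover from this have "a = 0 \<or> a = b \<or> a = c \<or> a = b + c"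
    by (cases a; cases b; cases c) simp_all
  ultimately show ?thesis by blast
qed

lemma V_add: "f \<in> V n \<Longrightarrow> g \<in> V n \<Longrightarrow> f + g \<in> V n"
  by (simp add: V_def bc_add)

lemma V_0: "0 \<in> V n" by (simp add: V_def)

lemma gspan_hg:
  assumes "1 \<le> n" "\<And>j. two (Ls j)"
  shows "gspan (hg n Ls) = V n"
proof
  show "gspan (hg n Ls) \<subseteq> V n"
    by (rule gspan_least) (auto simp: hg_def V_0 V_add, auto simp: V_def bc_pr)
  have hm: "hg n Ls \<subseteq> hg (Suc n) Ls" for n by (auto elim!: hg_E intro!: hg_I)
  show "V n \<subseteq> gspan (hg n Ls)"
    using assms(1)
  proof (induction n rule: dec_induct)
    case base
    show ?case
    proof
      fix f assume f: "f \<in> V 1"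
      then have "f 0 = 0" by (cases "f 0") (auto simp: V_def)
      moreover have "f i = 0" if "i > 0" for i using f that by (auto simp: V_def strs_def)
      ultimately have "f = 0" by (auto simp: fun_eq_iff fun_app) (metis neq0_conv)
      then show "f \<in> gspan (hg 1 Ls)" by (simp add: gspan_0)
    qed
  next
    case (step n)
    have sub: "gspan (hg n Ls) \<subseteq> gspan (hg (Suc n) Ls)"
      by (rule gspan_mono) (use hm gspan_base in blast)
    show ?case
    proof
      fix f assume f: "f \<in> V (Suc n)"
      \<comment> \<open>Cancels the last letter of f by a bond string, which two distinct letters on
        that bond generate; the rest is a shorter string.\<close>
      let ?p = "pr (n - 1) (f n) (f n)"
      have n: "Suc (n - 1) = n" using step by simp
      have g: "pr (n - 1) b b \<in> gspan (hg (Suc n) Ls)" if "b \<in> Ls (n - 1)" for b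
        using that n by (intro gspan_base hg_I) auto
      obtain b c where "b \<in> Ls (n - 1)" "c \<in> Ls (n - 1)" "f n = 0 \<or> f n = b \<or> f n = b + c"
        using two_span[OF assms(2)] by blast
      then have p: "?p \<in> gspan (hg (Suc n) Ls)"
        using g gspan_add[OF g g, of b c] gspan_0 by (auto simp: pr_add) (auto simp: pr_def gspan_0)
      have z: "(f + ?p) n = 0" using n by (simp add: fun_app pr_apply)
      have "?p \<in> V (Suc n)" using n by (auto simp: V_def bc_pr simp del: bc.simps)
      then have s: "f + ?p \<in> V (Suc n)" using f V_add by blast
      have "f + ?p \<in> strs n"
        using s z by (auto simp: V_def strs_def) (metis le_Suc_eq not_less_eq_eq le_antisym)
      then have "f + ?p \<in> V n" using s z by (auto simp: V_def)
      then have "f + ?p + ?p \<in> gspan (hg (Suc n) Ls)" using step sub p gspan_add by blast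
      then show "f \<in> gspan (hg (Suc n) Ls)" by (simp add: add.assoc)
    qed
  qed
qed

text \<open>The letters on bond j that XX, YZ become when Y and Z are exchanged at odd sites.
  Likewise \<open>L5\<close> comes from XY, YZ by rotating the letters with period 3, and
  \<open>L7\<close> is the Heisenberg chain with all three letters.\<close>

definition L3 :: "nat \<Rightarrow> pauli set" where "L3 j = (if j mod 2 = 0 then {PX, PY} else {PX, PZ})"
definition L5 :: "nat \<Rightarrow> pauli set" where "L5 j = (if j mod 3 = 0 then {PX, PY} else if j mod 3 = 1 then {PX, PZ} else {PY, PZ})"
definition L7 :: "nat \<Rightarrow> pauli set" where "L7 j = {PX, PY, PZ}"

lemma L_vals: "L3 0 = {PX, PY}" "L3 1 = {PX, PZ}" "L3 2 = {PX, PY}" "L3 3 = {PX, PZ}"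
  "L5 0 = {PX, PY}" "L5 1 = {PX, PZ}" "L5 2 = {PY, PZ}" "L5 3 = {PX, PY}" "L7 j = {PX, PY, PZ}"
  by (auto simp: L3_def L5_def L7_def)

lemma upt_num: "[0..<2] = [0, 1::nat]" "[0..<3] = [0, 1, 2::nat]" "[0..<4] = [0, 1, 2, 3::nat]"
  by (simp_all add: numeral_eq_Suc)

lemma replicate_num: "replicate 2 x = [x, x]" "replicate 3 x = [x, x, x]" "replicate 4 x = [x, x, x, x]"
  by (simp_all add: numeral_eq_Suc)

text \<open>The twists c3 and c5 solve anti (c j) a ~= anti (c (j + 1)) a for all letters a of L3 and L5, so that the form equals 1 on all generators.\<close>
definition c3 :: pstr where "c3 j = (if j mod 4 = 0 then PZ else if j mod 4 = 1 then 0 else if j mod 4 = 2 then PY else PX)"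
definition c5 :: pstr where "c5 j = (if j mod 3 = 0 then PZ else if j mod 3 = 1 then 0 else PY)"

lemma two_L: "two (L3 j)" "two (L5 j)" "two (L7 j)"
  by (auto simp: two_def L3_def L5_def L7_def)

lemma hg_qI:
  assumes "\<And>j a. a \<in> Ls j \<Longrightarrow> anti (c j) a \<noteq> anti (c (Suc j)) a" "g \<in> hg m Ls" "m \<le> n"
  shows "qf n c g"
  using assms by (auto simp: hg_def qf_def yodd_pr bc_pr2)

lemma c3_step: "a \<in> L3 j \<Longrightarrow> anti (c3 j) a \<noteq> anti (c3 (Suc j)) a"
proof -
  assume "a \<in> L3 j"
  moreover have "j mod 2 = (j mod 4) mod 2" by (simp add: mod_mod_cancel)
  moreover have "Suc j mod 4 = (Suc (j mod 4)) mod 4" by (simp add: mod_Suc_eq)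
  moreover have "j mod 4 = 0 \<or> j mod 4 = 1 \<or> j mod 4 = 2 \<or> j mod 4 = 3" by linarith
  ultimately show ?thesis by (elim disjE) (auto simp: L3_def c3_def)
qed

lemma c5_step: "a \<in> L5 j \<Longrightarrow> anti (c5 j) a \<noteq> anti (c5 (Suc j)) a"
proof -
  assume "a \<in> L5 j"
  moreover have "Suc j mod 3 = (Suc (j mod 3)) mod 3" by (simp add: mod_Suc_eq)
  moreover have "j mod 3 = 0 \<or> j mod 3 = 1 \<or> j mod 3 = 2" by linarith
  ultimately show ?thesis by (auto simp: L5_def c5_def)
qed

lemma hg_nonrad:
  assumes L: "\<And>j. two (Ls j)" and n: "3 \<le> n" and g: "g \<in> hg n Ls"
  shows "\<exists>h\<in>hg n Ls. bc n g h"
proof -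
  obtain j a where ja: "g = pr j a a" "Suc j < n" "a \<in> Ls j" using g by (auto simp: hg_def)
  have a0: "a \<noteq> 0" using L[of j] ja(3) by (auto simp: two_def)
  have ex: "\<exists>b\<in>Ls i. anti a b" for i
    using L[of i] a0 by (auto simp: two_def anti_def) metis
  show ?thesis
  proof (cases "Suc (Suc j) < n")
    case True
    obtain b where "b \<in> Ls (Suc j)" "anti a b" using ex by blast
    moreover from this have "pr (Suc j) b b \<in> hg n Ls" using True by (auto intro: hg_I)
    ultimately show ?thesis using ja True by (intro bexI[of _ "pr (Suc j) b b"]) (simp_all add: bc_pr pr_apply)
  next
    case False
    then obtain i where i: "j = Suc i" using ja n by (cases j) auto
    obtain b where "b \<in> Ls i" "anti a b" using ex by blast
    moreover from this have "pr i b b \<in> hg n Ls" using ja i by (auto intro: hg_I)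
    ultimately show ?thesis using ja i by (intro bexI[of _ "pr i b b"]) (simp_all add: bc_pr pr_apply)
  qed
qed

lemma hg_step:
  assumes L: "\<And>j. two (Ls j)" "\<And>j. finite (Ls j)" and q: "\<And>g. g \<in> hg N Ls \<Longrightarrow> qf N c g" and D: "hg N Ls \<subseteq> D" and i: "2 \<le> i" "i < N"
  shows "\<exists>es. hg (Suc i) Ls = hg i Ls \<union> set es \<and> (\<forall>e\<in>set es. e \<in> D \<and> qf N c e \<and> (\<exists>x\<in>hg i Ls. bc N e x))"
proof -
  obtain k where k: "i = Suc (Suc k)" using Suc_SucE i by blast
  obtain ls where ls: "set ls = Ls (Suc k)" using finite_list[OF L(2)] by blast
  let ?es = "map (\<lambda>a. pr (Suc k) a a) ls"
  have "hg (Suc i) Ls = hg i Ls \<union> set ?es"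
    by (auto simp: hg_def ls k less_Suc_eq)
  moreover have "e \<in> D \<and> qf N c e \<and> (\<exists>x\<in>hg i Ls. bc N e x)" if e: "e \<in> set ?es" for e
  proof -
    obtain a where a: "e = pr (Suc k) a a" "a \<in> Ls (Suc k)" using e unfolding set_map ls by (rule imageE)
    then have "e \<in> hg N Ls" using i k by (auto intro: hg_I)
    moreover obtain b where "b \<in> Ls k" "anti a b"
      using L(1)[of k] L(1)[of "Suc k"] a(2) by (auto simp: two_def anti_def)
    then have "pr k b b \<in> hg i Ls" "bc N e (pr k b b)" using a i k by (auto simp: bc_pr pr_apply intro: hg_I)
    ultimately show ?thesis using q D by blast
  qed
  ultimately show ?thesis by blast
qed

lemma hg_3: "hg 3 Ls = {pr 0 a a | a. a \<in> Ls 0} \<union> {pr 1 a a | a. a \<in> Ls 1}"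
  and hg_4: "hg 4 Ls = hg 3 Ls \<union> {pr 2 a a | a. a \<in> Ls 2}"
  and hg_5: "hg 5 Ls = hg 4 Ls \<union> {pr 3 a a | a. a \<in> Ls 3}"
  by (auto simp: hg_def numeral_eq_Suc less_Suc_eq)

section \<open>Heisenberg-like chains: short lengths and starting diagrams\<close>

lemma full3_3_lists: "emb 0 ` set [[PX,PX,PI], [PY,PY,PI], [PI,PX,PX], [PI,PZ,PZ]] = hg 3 L3"
  unfolding hg_3 L_vals by (auto simp: pr_def numeral_eq_Suc)

text \<open>For n = 3 and n = 4 the form on \<open>V n\<close> has rank four, too small for E6, so
  all strings are listed: 10 for both chains at n = 3, then 40 for \<open>L3\<close> and 30 for
  \<open>L5\<close> at n = 4. These are the dimensions of sp(2), of four copies of sp(2) and of two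
  copies of su(4).\<close>

lemma full3_3: "full 3 c3 (pcl 3 (hg 3 L3)) (gspan (hg 3 L3))"
proof -
  let ?gs = "[[PX,PX,PI], [PY,PY,PI], [PI,PX,PX], [PI,PZ,PZ]]"
  have gs: "\<forall>g\<in>set ?gs. length g = 3 \<and> emb 0 g \<in> pcl 3 (hg 3 L3)"
    using pcl_base[of _ "hg 3 L3" 3] unfolding full3_3_lists[symmetric] by simp
  have m: "map c3 [0..<3] = [PZ, 0, PY]" by (simp add: c3_def upt_num)
  have "\<forall>l\<in>set (spanl 3 ?gs). (yoddl l \<noteq> acomm [PZ, 0, PY] l) \<and> (\<exists>g\<in>set ?gs. acomm l g)
      \<longrightarrow> l \<in> set (derivl ?gs ?gs [(3,0), (2,1), (3,1), (1,4), (3,5), (2,7)])"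
    by (simp add: Let_def replicate_num)
  then show ?thesis using full_lists[OF gs pcl_closed, of c3] unfolding m full3_3_lists by blast
qed

lemma full5_3_lists: "emb 0 ` set [[PX,PX,PI], [PY,PY,PI], [PI,PX,PX], [PI,PZ,PZ]] = hg 3 L5"
  unfolding hg_3 L_vals by (auto simp: pr_def numeral_eq_Suc)

lemma full5_3: "full 3 c5 (pcl 3 (hg 3 L5)) (gspan (hg 3 L5))"
proof -
  let ?gs = "[[PX,PX,PI], [PY,PY,PI], [PI,PX,PX], [PI,PZ,PZ]]"
  have gs: "\<forall>g\<in>set ?gs. length g = 3 \<and> emb 0 g \<in> pcl 3 (hg 3 L5)"
    using pcl_base[of _ "hg 3 L5" 3] unfolding full5_3_lists[symmetric] by simp
  have m: "map c5 [0..<3] = [PZ, 0, PY]" by (simp add: c5_def upt_num)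
  have "\<forall>l\<in>set (spanl 3 ?gs). (yoddl l \<noteq> acomm [PZ, 0, PY] l) \<and> (\<exists>g\<in>set ?gs. acomm l g)
      \<longrightarrow> l \<in> set (derivl ?gs ?gs [(3,0), (2,1), (3,1), (1,4), (3,5), (2,7)])"
    by (simp add: Let_def replicate_num)
  then show ?thesis using full_lists[OF gs pcl_closed, of c5] unfolding m full5_3_lists by blast
qed

lemma full3_4_lists: "emb 0 ` set [[PX,PX,PI,PI], [PY,PY,PI,PI], [PI,PX,PX,PI], [PI,PZ,PZ,PI], [PI,PI,PX,PX], [PI,PI,PY,PY]] = hg 4 L3"
  unfolding hg_4 hg_3 L_vals by (auto simp: pr_def numeral_eq_Suc)

lemma full3_4: "full 4 c3 (pcl 4 (hg 4 L3)) (gspan (hg 4 L3))"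
proof -
  let ?gs = "[[PX,PX,PI,PI], [PY,PY,PI,PI], [PI,PX,PX,PI], [PI,PZ,PZ,PI], [PI,PI,PX,PX], [PI,PI,PY,PY]]"
  have gs: "\<forall>g\<in>set ?gs. length g = 4 \<and> emb 0 g \<in> pcl 4 (hg 4 L3)"
    using pcl_base[of _ "hg 4 L3" 4] unfolding full3_4_lists[symmetric] by simp
  have m: "map c3 [0..<4] = [PZ, 0, PY, PX]" by (simp add: c3_def upt_num)
  have "\<forall>l\<in>set (spanl 4 ?gs). (yoddl l \<noteq> acomm [PZ, 0, PY, PX] l) \<and> (\<exists>g\<in>set ?gs. acomm l g)
      \<longrightarrow> l \<in> set (derivl ?gs ?gs [(3,0), (2,1), (3,1), (5,2), (4,3), (5,3), (1,6), (4,6), (5,6), (3,7), (5,7), (4,8), (5,8), (3,9), (5,10), (2,12), (4,12), (5,12), (5,13), (2,14), (4,15), (5,17), (4,19), (4,21), (3,22), (5,22), (3,23), (2,24), (3,24), (3,27), (3,29), (3,33), (1,36), (5,36)])"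
    by (simp add: Let_def replicate_num)
  then show ?thesis using full_lists[OF gs pcl_closed, of c3] unfolding m full3_4_lists by blast
qed

lemma full5_4_lists: "emb 0 ` set [[PX,PX,PI,PI], [PY,PY,PI,PI], [PI,PX,PX,PI], [PI,PZ,PZ,PI], [PI,PI,PY,PY], [PI,PI,PZ,PZ]] = hg 4 L5"
  unfolding hg_4 hg_3 L_vals by (auto simp: pr_def numeral_eq_Suc)

lemma full5_4: "full 4 c5 (pcl 4 (hg 4 L5)) (gspan (hg 4 L5))"
proof -
  let ?gs = "[[PX,PX,PI,PI], [PY,PY,PI,PI], [PI,PX,PX,PI], [PI,PZ,PZ,PI], [PI,PI,PY,PY], [PI,PI,PZ,PZ]]"
  have gs: "\<forall>g\<in>set ?gs. length g = 4 \<and> emb 0 g \<in> pcl 4 (hg 4 L5)"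
    using pcl_base[of _ "hg 4 L5" 4] unfolding full5_4_lists[symmetric] by simp
  have m: "map c5 [0..<4] = [PZ, 0, PY, PZ]" by (simp add: c5_def upt_num)
  have "\<forall>l\<in>set (spanl 4 ?gs). (yoddl l \<noteq> acomm [PZ, 0, PY, PZ] l) \<and> (\<exists>g\<in>set ?gs. acomm l g)
      \<longrightarrow> l \<in> set (derivl ?gs ?gs [(3,0), (2,1), (3,1), (4,2), (5,2), (4,3), (1,6), (4,6), (3,7), (4,7), (5,7), (4,8), (3,9), (5,9), (2,12), (4,12), (2,13), (5,14), (5,15), (5,18), (5,20), (3,21), (5,22), (2,24)])"
    by (simp add: Let_def replicate_num)
  then show ?thesis using full_lists[OF gs pcl_closed, of c5] unfolding m full5_4_lists by blast
qed

lemma full3_lists: "emb 0 ` set [[PY,PY,PI,PI,PI], [PI,PX,PX,PI,PI], [PI,PZ,PZ,PI,PI], [PX,PX,PI,PI,PI], [PI,PI,PX,PX,PI], [PI,PI,PY,PY,PI], [PI,PI,PI,PX,PX], [PI,PI,PI,PZ,PZ]] = hg 5 L3"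
  unfolding hg_5 hg_4 hg_3 L_vals by (auto simp: pr_def numeral_eq_Suc)

text \<open>Six of the generators themselves form the E6 diagram, so the certificate is empty. Its
  branching node is YY on bond 2, which anticommutes with XX on bond 1 and with both generators on
  bond 3.\<close>

lemma full3_5:
  assumes n: "5 \<le> n" and D: "pclosed n D" "hg n L3 \<subseteq> D" "\<And>f. f \<in> D \<Longrightarrow> qf n c3 f"
  shows "full n c3 D (gspan (hg n L3)) \<and> rich n 3 {} (gspan (hg n L3))"
proof (rule full_prefix[OF D(1) _ n le_refl])
  let ?gs = "[[PY,PY,PI,PI,PI], [PI,PX,PX,PI,PI], [PI,PZ,PZ,PI,PI], [PX,PX,PI,PI,PI], [PI,PI,PX,PX,PI], [PI,PI,PY,PY,PI], [PI,PI,PI,PX,PX], [PI,PI,PI,PZ,PZ]]"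
  let ?es = "[[PY,PY,PI,PI,PI], [PI,PX,PX,PI,PI], [PI,PI,PY,PY,PI], [PI,PI,PI,PZ,PZ], [PI,PI,PX,PX,PI], [PI,PI,PI,PX,PX]]"
  have "hg 5 L3 \<subseteq> hg n L3" using n by (auto elim!: hg_E intro!: hg_I)
  then have gs: "\<forall>g\<in>set ?gs. length g = 5 \<and> emb 0 g \<in> D"
    using D(2) unfolding full3_lists[symmetric] by (auto simp del: emb_Cons)
  have c: "set ?es \<subseteq> set (derivl ?gs ?gs [])" "gram_E6 [PY,PY,PI,PI,PI] [PI,PX,PX,PI,PI] [PI,PI,PY,PY,PI] [PI,PI,PI,PZ,PZ] [PI,PI,PX,PX,PI] [PI,PI,PI,PX,PX]" "conn ?es ?gs"
    by (simp_all add: gram_E6_def)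
  show "full n c3 D (gspan (hg 5 L3)) \<and> rich n 3 {} (gspan (hg 5 L3))"
    using full_E6_lists[OF D(1) n gs D(3) c] unfolding full3_lists .
  fix i assume "5 \<le> i" "i < n"
  then show "\<exists>es. hg (Suc i) L3 = hg i L3 \<union> set es \<and> (\<forall>e\<in>set es. e \<in> D \<and> qf n c3 e \<and> (\<exists>x\<in>hg i L3. bc n e x))"
    by (intro hg_step) (use D two_L in \<open>auto simp: L3_def\<close>)
qed

lemma full5_lists: "emb 0 ` set [[PX,PX,PI,PI,PI], [PY,PY,PI,PI,PI], [PI,PX,PX,PI,PI], [PI,PZ,PZ,PI,PI], [PI,PI,PY,PY,PI], [PI,PI,PZ,PZ,PI], [PI,PI,PI,PX,PX], [PI,PI,PI,PY,PY]] = hg 5 L5"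
  unfolding hg_5 hg_4 hg_3 L_vals by (auto simp: pr_def numeral_eq_Suc)

text \<open>Two nodes of the diagram are generators on bond 0, the other four are products of two
  generators listed by the certificate.\<close>

lemma full5_5:
  assumes n: "5 \<le> n" and D: "pclosed n D" "hg n L5 \<subseteq> D" "\<And>f. f \<in> D \<Longrightarrow> qf n c5 f"
  shows "full n c5 D (gspan (hg n L5)) \<and> rich n 3 {} (gspan (hg n L5))"
proof (rule full_prefix[OF D(1) _ n le_refl])
  let ?gs = "[[PX,PX,PI,PI,PI], [PY,PY,PI,PI,PI], [PI,PX,PX,PI,PI], [PI,PZ,PZ,PI,PI], [PI,PI,PY,PY,PI], [PI,PI,PZ,PZ,PI], [PI,PI,PI,PX,PX], [PI,PI,PI,PY,PY]]"
  let ?es = "[[PX,PX,PI,PI,PI], [PY,PX,PZ,PI,PI], [PY,PY,PI,PI,PI], [PY,PZ,PX,PI,PI], [PI,PI,PZ,PY,PX], [PI,PX,PZ,PY,PI]]"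
  have "hg 5 L5 \<subseteq> hg n L5" using n by (auto elim!: hg_E intro!: hg_I)
  then have gs: "\<forall>g\<in>set ?gs. length g = 5 \<and> emb 0 g \<in> D"
    using D(2) unfolding full5_lists[symmetric] by (auto simp del: emb_Cons)
  have c: "set ?es \<subseteq> set (derivl ?gs ?gs [(3,1), (2,1), (6,5), (4,2)])" "gram_E6 [PX,PX,PI,PI,PI] [PY,PX,PZ,PI,PI] [PY,PY,PI,PI,PI] [PY,PZ,PX,PI,PI] [PI,PI,PZ,PY,PX] [PI,PX,PZ,PY,PI]" "conn ?es ?gs"
    by (simp_all add: gram_E6_def)
  show "full n c5 D (gspan (hg 5 L5)) \<and> rich n 3 {} (gspan (hg 5 L5))"
    using full_E6_lists[OF D(1) n gs D(3) c] unfolding full5_lists .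
  fix i assume "5 \<le> i" "i < n"
  then show "\<exists>es. hg (Suc i) L5 = hg i L5 \<union> set es \<and> (\<forall>e\<in>set es. e \<in> D \<and> qf n c5 e \<and> (\<exists>x\<in>hg i L5. bc n e x))"
    by (intro hg_step) (use D two_L in \<open>auto simp: L5_def\<close>)
qed

theorem pcl_hg3:
  assumes "3 \<le> n"
  shows "pcl n (hg n L3) = {f \<in> V n. qf n c3 f \<and> nonrad n (V n) f}"
proof -
  have q: "qf n c3 g" if "g \<in> hg n L3" for g by (rule hg_qI[where Ls = L3 and c = c3, OF c3_step that le_refl])
  have "full n c3 (pcl n (hg n L3)) (gspan (hg n L3))"
  proof -
    consider "n = 3" | "n = 4" | "5 \<le> n" using assms by linarith
    then show ?thesis
    proof cases
      case 3
      then show ?thesis using full3_5[OF 3 pcl_closed, of "hg n L3"] pcl_base pcl_q[OF q] by blast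
    qed (use full3_3 full3_4 in auto)
  qed
  from pcl_full[OF this q hg_nonrad[where Ls = L3, OF two_L(1) assms]] show ?thesis
    using gspan_hg[of n L3] two_L(1) assms by simp
qed

theorem pcl_hg5:
  assumes "3 \<le> n"
  shows "pcl n (hg n L5) = {f \<in> V n. qf n c5 f \<and> nonrad n (V n) f}"
proof -
  have q: "qf n c5 g" if "g \<in> hg n L5" for g by (rule hg_qI[where Ls = L5 and c = c5, OF c5_step that le_refl])
  have "full n c5 (pcl n (hg n L5)) (gspan (hg n L5))"
  proof -
    consider "n = 3" | "n = 4" | "5 \<le> n" using assms by linarith
    then show ?thesis
    proof cases
      case 3
      then show ?thesis using full5_5[OF 3 pcl_closed, of "hg n L5"] pcl_base pcl_q[OF q] by blast
    qed (use full5_3 full5_4 in auto)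
  qed
  from pcl_full[OF this q hg_nonrad[where Ls = L5, OF two_L(2) assms]] show ?thesis
    using gspan_hg[of n L5] two_L(2) assms by simp
qed

text \<open>The form is nondegenerate on \<open>V 3\<close> of dimension four; six generators and
  nine products are its fifteen nonzero vectors.\<close>

lemma full7_3:
  assumes "f \<in> V 3" "nonrad 3 (V 3) f"
  shows "f \<in> pcl 3 (hg 3 L7)"
proof -
  let ?gs = "[[PX,PX,PI], [PY,PY,PI], [PZ,PZ,PI], [PI,PX,PX], [PI,PY,PY], [PI,PZ,PZ]]"
  let ?bs = "[[PX,PX,PI], [PZ,PZ,PI], [PI,PX,PX], [PI,PZ,PZ]]"
  have g: "emb 0 ` set ?gs = hg 3 L7" unfolding hg_3 L_vals by (auto simp: pr_def numeral_eq_Suc)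
  have b: "emb 0 ` set ?bs = hg 3 (\<lambda>_. {PX, PZ})" unfolding hg_3 by (auto simp: pr_def numeral_eq_Suc)
  have V: "gspan (emb 0 ` set ?bs) = V 3" unfolding b by (rule gspan_hg) (auto simp: two_def)
  have gs: "\<forall>g\<in>set ?gs. length g = 3 \<and> emb 0 g \<in> pcl 3 (hg 3 L7)"
    using pcl_base[of _ "hg 3 L7" 3] unfolding g[symmetric] by simp
  have "\<forall>l\<in>set (spanl 3 ?bs). True \<and> (\<exists>g\<in>set ?bs. acomm l g) \<longrightarrow> l \<in> set (derivl ?gs ?gs [(4,0), (5,0), (3,1), (5,1), (3,2), (4,2), (2,6), (5,6), (1,7)])"
    by (simp add: Let_def replicate_num)
  from list_closure[OF gs pcl_closed _ this, unfolded V, OF _ assms] show ?thesis by simp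
qed

lemma full_transfer:
  assumes D: "pclosed n D" "full n c D W" and W: "\<And>x y. x \<in> W \<Longrightarrow> y \<in> W \<Longrightarrow> x + y \<in> W"
    and e: "e \<in> D" "e \<in> W" "\<not> qf n c e" and f: "f \<in> W" "\<not> qf n c f" "bc n f e"
  shows "f \<in> D"
proof -
  have b: "bc n (f + e) e" using f(3) by (simp add: bc_add)
  have "qf n c (f + e)" using e(3) f(2,3) by (simp add: pq.q_add)
  moreover have "nonrad n W (f + e)" by (rule pq.nonradI[OF e(2) b])
  ultimately have "f + e \<in> D" using D(2) W[OF f(1) e(2)] unfolding pq.full_def by blast
  from pclosedD[OF D(1) this e(1) b] show ?thesis by (simp add: add.assoc)
qed

text \<open>\<open>L3\<close> already yields all nonradical strings with q = 1. The generator ZZII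
  has q = 0 and reaches IXIX; each nonradical string with q = 0 is ZZII itself or anticommutes with
  one of these two.\<close>

lemma full7_4:
  assumes f: "f \<in> V 4" "nonrad 4 (V 4) f"
  shows "f \<in> pcl 4 (hg 4 L7)"
proof -
  let ?D = "pcl 4 (hg 4 L7)" and ?e = "[PZ,PZ,PI,PI]" and ?h = "[PI,PX,PI,PX]"
  let ?bs = "[[PX,PX,PI,PI], [PY,PY,PI,PI], [PI,PX,PX,PI], [PI,PZ,PZ,PI], [PI,PI,PX,PX], [PI,PI,PY,PY]]"
  have V: "gspan (hg 4 L3) = V 4" by (rule gspan_hg) (use two_L in auto)
  have W: "x + y \<in> V 4" if "x \<in> V 4" "y \<in> V 4" for x y using V_add that .
  have "hg 4 L3 \<subseteq> hg 4 L7"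
    unfolding hg_def L3_def L7_def by auto
  then have "pcl 4 (hg 4 L3) \<subseteq> ?D" by (intro pcl_mono) (auto intro: pcl_base)
  then have F: "full 4 c3 ?D (V 4)" using full3_4 unfolding V by (auto simp: pq.full_def)
  have m: "map c3 [0..<4] = [PZ, 0, PY, PX]" by (simp add: c3_def upt_num)
  have q: "qf 4 c3 (emb 0 l) = (yoddl l \<noteq> acomm [PZ, 0, PY, PX] l)" if "length l = 4" for l
    using bc_emb_left[OF that, of c3] yodd_emb[of 0 l 4] that unfolding qf_def m by simp
  have b: "bc 4 (emb 0 l) (emb 0 m) = acomm l m" if "length l = 4" "length m = 4" for l m
    using bc_emb[of l m 0 4] that by simp
  have e: "emb 0 ?e \<in> ?D"
    using pcl_base[OF hg_I[of 0 4 PZ L7]] by (simp add: L7_def pr_def)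
  have eV: "emb 0 ?e \<in> V 4" "emb 0 ?h \<in> V 4" by (auto simp: V_def bc_add)
  have eq: "\<not> qf 4 c3 (emb 0 ?e)" "\<not> qf 4 c3 (emb 0 ?h)" using q[of ?e] q[of ?h] by simp_all
  have "bc 4 (emb 0 ?h) (emb 0 ?e)" using b[of ?h ?e] by simp
  from full_transfer[OF pcl_closed F W e eV(1) eq(1) eV(2) eq(2) this]
  have h: "emb 0 ?h \<in> ?D" by simp
  have bl: "\<forall>g\<in>set ?bs. length g = 4" by simp
  have V': "gspan (emb 0 ` set ?bs) = V 4" unfolding full3_4_lists by (rule V)
  obtain l where l: "l \<in> set (spanl 4 ?bs)" "length l = 4" "f = emb 0 l"
    using f(1) spanl_gspan[OF bl, of 0] unfolding V' by blast
  obtain g where "g \<in> set ?bs" "bc 4 f (emb 0 g)" using nonrad_gspan[of 4 "emb 0 ` set ?bs" f] f(2) unfolding V' by blast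
  then have g: "\<exists>g\<in>set ?bs. acomm l g" using b[OF l(2)] bl l(3) by blast
  have chk: "\<forall>l\<in>set (spanl 4 ?bs). (\<exists>g\<in>set ?bs. acomm l g) \<longrightarrow>
      (yoddl l \<noteq> acomm [PZ, 0, PY, PX] l) \<or> l = ?e \<or> acomm l ?e \<or> acomm l ?h"
    by (simp add: Let_def replicate_num)
  have be: "bc 4 f (emb 0 ?e) = acomm l ?e" "bc 4 f (emb 0 ?h) = acomm l ?h"
    unfolding l(3) by (rule b; simp add: l(2))+
  from bspec[OF chk l(1)] g have "(yoddl l \<noteq> acomm [PZ, 0, PY, PX] l) \<or> l = ?e \<or> acomm l ?e \<or> acomm l ?h" by blast
  then have "qf 4 c3 f \<or> f = emb 0 ?e \<or> bc 4 f (emb 0 ?e) \<or> bc 4 f (emb 0 ?h)"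
    unfolding be unfolding l(3) q[OF l(2)] by blast
  then show ?thesis
    using F f e full_transfer[OF pcl_closed F W e eV(1) eq(1) f(1)] full_transfer[OF pcl_closed F W h eV(2) eq(2) f(1)]
    unfolding pq.full_def by blast
qed

text \<open>The generators contain those of \<open>L3\<close>, which fill q = 1, and ZZ on bond 0,
  which has q = 0 and lifts the restriction.\<close>

theorem pcl_hg7:
  assumes n: "3 \<le> n"
  shows "pcl n (hg n L7) = {f \<in> V n. nonrad n (V n) f}"
proof
  have V: "gspan (hg n L7) = V n" by (rule gspan_hg) (use n two_L in auto)
  show "pcl n (hg n L7) \<subseteq> {f \<in> V n. nonrad n (V n) f}"
    using pcl_gspan[of n "hg n L7"] pcl_nonrad[OF hg_nonrad[where Ls = L7, OF two_L(3) n]] unfolding V by blast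
  show "{f \<in> V n. nonrad n (V n) f} \<subseteq> pcl n (hg n L7)"
  proof -
    consider "n = 3" | "n = 4" | "5 \<le> n" using n by linarith
    then show ?thesis
    proof cases
      case 3
      have V3: "gspan (hg n L3) = V n" by (rule gspan_hg) (use n two_L in auto)
      have q: "qf n c3 g" if "g \<in> hg n L3" for g by (rule hg_qI[where Ls = L3 and c = c3, OF c3_step that le_refl])
      have fr: "full n c3 (pcl n (hg n L3)) (V n)" "rich n 3 {} (V n)"
        using full3_5[OF 3 pcl_closed, of "hg n L3"] pcl_base pcl_q[OF q] unfolding V3 by blast+
      have sub: "pcl n (hg n L3) \<subseteq> pcl n (hg n L7)"
        by (rule pcl_mono) (auto simp: hg_def L3_def L7_def intro!: pcl_base split: if_splits)
      then have F: "full n c3 (pcl n (hg n L7)) (V n)" using fr(1) by (auto simp: pq.full_def)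
      let ?e = "pr 0 PZ PZ"
      have e: "?e \<in> hg n L7" using n by (intro hg_I) (simp_all add: L7_def)
      have "?e \<in> V n" using V e gspan_base by blast
      moreover have "\<not> qf n c3 ?e" using n by (simp add: qf_def yodd_pr bc_pr2 c3_def)
      moreover have "nonrad n (V n) ?e"
        using hg_nonrad[where Ls = L7, OF two_L(3) n e] V gspan_base pq.nonradI by blast
      ultimately have "f \<in> pcl n (hg n L7)" if "f \<in> V n" "nonrad n (V n) f" for f
        using pq.full_unrestricted[OF pq.subgr_gspan[of "hg n L3", unfolded V3] pcl_closed F fr(2) pcl_base[OF e]] that by blast
      then show ?thesis by blast
    qed (use full7_3 full7_4 in auto)
  qed
qed

subsection \<open>Symplectic and orthogonal chains\<close>

text \<open>The generators XY, XZ with the first site of the chain cut off: on the first bond only Y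
  and Z remain. The map \<open>hd9\<close> restores the missing letter.\<close>

definition ag :: "nat \<Rightarrow> pstr set" where
  "ag K = {pt 0 PY, pt 0 PZ} \<union> {pr j PX b | j b. Suc j < K \<and> b \<in> {PY, PZ}}"

text \<open>As \<open>ag\<close> spans all strings, the requirement q = 1 on it leaves a single
  twist. Y at site 0 serves the single letters, and Z further on serves XY and XZ alike.\<close>

definition c9 :: pstr where "c9 j = (if j = 0 then PY else PZ)"

lemma gspan_strs: "gspan (strs n) = strs n"
  using gspan_least[of "strs n" "strs n"] strs_add strs_0 gspan_base by blast

lemma ag_I: "Suc j < K \<Longrightarrow> b \<in> {PY, PZ} \<Longrightarrow> pr j PX b \<in> ag K"
  unfolding ag_def by blast

lemma ag_mono: "m \<le> n \<Longrightarrow> ag m \<subseteq> ag n"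
  unfolding ag_def using less_le_trans by blast

lemma gspan_ag:
  assumes "1 \<le> n"
  shows "gspan (ag n) = strs n"
proof
  have "ag n \<subseteq> strs n" using assms unfolding ag_def by auto
  then show "gspan (ag n) \<subseteq> strs n"
    using gspan_mono[of "ag n" "strs n"] unfolding gspan_strs by blast
  show "strs n \<subseteq> gspan (ag n)"
    using assms
  proof (induction n rule: dec_induct)
    case base
    show ?case
    proof
      fix f assume f: "f \<in> strs 1"
      have "pt 0 PY \<in> gspan (ag 1)" "pt 0 PZ \<in> gspan (ag 1)" by (auto simp: ag_def intro!: gspan_base)
      moreover from gspan_add[OF this] have "pt 0 PX \<in> gspan (ag 1)" by (simp add: pt_add)
      ultimately have "pt 0 (f 0) \<in> gspan (ag 1)" by (cases "f 0") (auto simp: gspan_0)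
      moreover have "f = pt 0 (f 0)" by (rule strs_eqI[of _ 1]) (use f in auto)
      ultimately show "f \<in> gspan (ag 1)" by simp
    qed
  next
    case (step n)
    have sub: "gspan (ag n) \<subseteq> gspan (ag (Suc n))"
      by (rule gspan_mono) (use ag_mono[of n "Suc n"] in \<open>auto intro: gspan_base\<close>)
    show ?case
    proof
      fix f assume f: "f \<in> strs (Suc n)"
      have n: "Suc (n - 1) = n" using step by simp
      have g: "pr (n - 1) PX b \<in> gspan (ag (Suc n))" if "b \<in> {PY, PZ}" for b
        using that n by (intro gspan_base ag_I) auto
      have "\<exists>p \<in> gspan (ag (Suc n)) \<inter> strs (Suc n). p n = f n"
      proof (cases "f n")
        case 0 then show ?thesis by (intro bexI[of _ 0]) (auto simp: gspan_0 fun_app)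
      next
        case X
        have "pr (n - 1) PX PY + pr (n - 1) PX PZ \<in> gspan (ag (Suc n))" by (intro gspan_add g) auto
        then show ?thesis using X n by (intro bexI[of _ "pr (n - 1) PX PY + pr (n - 1) PX PZ"]) (auto simp: fun_app pr_apply)
      next
        case Y then show ?thesis using g n by (intro bexI[of _ "pr (n - 1) PX PY"]) (auto simp: pr_apply)
      next
        case Z then show ?thesis using g n by (intro bexI[of _ "pr (n - 1) PX PZ"]) (auto simp: pr_apply)
      qed
      then obtain p where p: "p \<in> gspan (ag (Suc n))" "p \<in> strs (Suc n)" "p n = f n" by blast
      have "(f + p) i = 0" if "n \<le> i" for i
        using p f that by (cases "i = n") (auto simp: fun_app strs_def)
      then have "f + p \<in> gspan (ag n)" using step by (auto simp: strs_def)
      then have "f + p + p \<in> gspan (ag (Suc n))" using sub p gspan_add by blast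
      then show "f \<in> gspan (ag (Suc n))" by (simp add: add.assoc)
    qed
  qed
qed

lemma ag_q: "g \<in> ag m \<Longrightarrow> 1 \<le> m \<Longrightarrow> m \<le> n \<Longrightarrow> qf n c9 g"
  by (auto simp: ag_def qf_def yodd_pr bc_pr2 c9_def split: if_splits)

lemma ag_2: "ag 2 = {pt 0 PY, pt 0 PZ, pr 0 PX PY, pr 0 PX PZ}"
  and ag_3: "ag 3 = ag 2 \<union> {pr 1 PX PY, pr 1 PX PZ}"
  by (auto simp: ag_def numeral_eq_Suc less_Suc_eq)

lemma strs_nonrad: "nonrad n (strs n) f" if "f \<in> strs n" "f \<noteq> 0"
  using strs_nondeg[OF that] pq.nonradI by metis

text \<open>For n = 2 the ten strings with q = 1 are listed; for n at least 3 an E6 diagram lies in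
  the first three sites. No radical occurs since \<open>ag\<close> spans all strings.\<close>

theorem pcl_ag:
  assumes n: "2 \<le> n"
  shows "pcl n (ag n) = {f \<in> strs n. qf n c9 f}"
proof
  have V: "gspan (ag n) = strs n" by (rule gspan_ag) (use n in simp)
  have q: "qf n c9 g" if "g \<in> ag n" for g using ag_q[OF that] n by simp
  show "pcl n (ag n) \<subseteq> {f \<in> strs n. qf n c9 f}"
    using pcl_gspan[of n "ag n"] pcl_q[OF q] unfolding V by blast
  have "full n c9 (pcl n (ag n)) (gspan (ag n))"
  proof (cases "n = 2")
    case True
    let ?gs = "[[PY,PI], [PZ,PI], [PX,PY], [PX,PZ]]"
    have g: "emb 0 ` set ?gs = ag 2" unfolding ag_2 by (auto simp: pr_def numeral_eq_Suc)
    have gs: "\<forall>g\<in>set ?gs. length g = 2 \<and> emb 0 g \<in> pcl 2 (ag 2)"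
      using pcl_base[of _ "ag 2" 2] unfolding g[symmetric] by simp
    have m: "map c9 [0..<2] = [PY, PZ]" by (simp add: c9_def upt_num)
    have "\<forall>l\<in>set (spanl 2 ?gs). (yoddl l \<noteq> acomm [PY, PZ] l) \<and> (\<exists>g\<in>set ?gs. acomm l g)
        \<longrightarrow> l \<in> set (derivl ?gs ?gs [(1,0), (2,0), (3,0), (2,1), (3,1), (3,2)])"
      by (simp add: Let_def replicate_num)
    then show ?thesis using full_lists[OF gs pcl_closed, of c9] True unfolding m g by blast
  next
    case False
    then have n3: "3 \<le> n" using n by simp
    have "full n c9 (pcl n (ag n)) (gspan (ag n)) \<and> rich n 3 {} (gspan (ag n))"
    proof (rule full_prefix[OF pcl_closed _ n3 le_refl])
      let ?gs = "[[PY,PI,PI], [PZ,PI,PI], [PX,PY,PI], [PX,PZ,PI], [PI,PX,PY], [PI,PX,PZ]]"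
      let ?es = "[[PY,PI,PI], [PZ,PI,PI], [PY,PY,PI], [PI,PX,PY], [PI,PI,PX], [PI,PX,PI]]"
      have g: "emb 0 ` set ?gs = ag 3" unfolding ag_3 ag_2 by (auto simp: pr_def numeral_eq_Suc)
      have "ag 3 \<subseteq> ag n" by (rule ag_mono[OF n3])
      then have gs: "\<forall>g\<in>set ?gs. length g = 3 \<and> emb 0 g \<in> pcl n (ag n)"
        using pcl_base[of _ "ag n" n] unfolding g[symmetric] by simp
      have c: "set ?es \<subseteq> set (derivl ?gs ?gs [(2,1), (5,4), (3,2)])" "gram_E6 [PY,PI,PI] [PZ,PI,PI] [PY,PY,PI] [PI,PX,PY] [PI,PI,PX] [PI,PX,PI]" "conn ?es ?gs"
        by (simp_all add: gram_E6_def)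
      show "full n c9 (pcl n (ag n)) (gspan (ag 3)) \<and> rich n 3 {} (gspan (ag 3))"
        using full_E6_lists[OF pcl_closed n3 gs pcl_q[OF q] c] unfolding g .
      fix i assume i: "3 \<le> i" "i < n"
      then obtain k where k: "i = Suc (Suc k)" using Suc_SucE[of i] by auto
      let ?es = "[pr (Suc k) PX PY, pr (Suc k) PX PZ]"
      have "ag (Suc i) = ag i \<union> set ?es" by (auto simp: ag_def k less_Suc_eq)
      moreover have "e \<in> ag n \<and> bc n e (pr k PX PY)" if "e \<in> set ?es" for e
        using that i k by (auto simp: ag_def bc_pr pr_apply)
      moreover have "pr k PX PY \<in> ag i" using i k by (auto simp: ag_def)
      ultimately show "\<exists>es. ag (Suc i) = ag i \<union> set es \<and> (\<forall>e\<in>set es. e \<in> pcl n (ag n) \<and> qf n c9 e \<and> (\<exists>x\<in>ag i. bc n e x))"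
        using q pcl_base by blast
    qed
    then show ?thesis by blast
  qed
  then show "{f \<in> strs n. qf n c9 f} \<subseteq> pcl n (ag n)"
    using strs_nonrad[of _ n] unfolding V pq.full_def by (metis (mono_tags, lifting) mem_Collect_eq pq.q_0 subsetI)
qed

definition G11 :: "(pauli \<times> pauli) set" where "G11 = {(PX, PY), (PY, PX), (PY, PZ)}"

lemma strs_gspanI:
  assumes "\<And>j. j < n \<Longrightarrow> pt j PX \<in> gspan A \<and> pt j PY \<in> gspan A"
  shows "strs n \<subseteq> gspan A"
  using assms
proof (induction n)
  case 0 then show ?case by (simp add: strs_zero gspan_0)
next
  case (Suc n)
  show ?case
  proof
    fix f assume f: "f \<in> strs (Suc n)"
    have "pt n PX \<in> gspan A" "pt n PY \<in> gspan A" using Suc.prems[OF lessI] by blast+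
    moreover from gspan_add[OF this] have "pt n PZ \<in> gspan A" by (simp add: pt_add)
    ultimately have p: "pt n (f n) \<in> gspan A" by (cases "f n") (auto simp: gspan_0)
    have "(f + pt n (f n)) i = 0" if "n \<le> i" for i
      using f that by (cases "i = n") (auto simp: fun_app strs_def)
    then have "f + pt n (f n) \<in> strs n" by (simp add: strs_def)
    moreover have "strs n \<subseteq> gspan A" by (rule Suc.IH, rule Suc.prems) simp
    ultimately have "f + pt n (f n) \<in> gspan A" by blast
    from gspan_add[OF this p] show "f \<in> gspan A" by (simp add: add.assoc)
  qed
qed

lemma cg_mono: "m \<le> n \<Longrightarrow> cg m G \<subseteq> cg n G"
  unfolding cg_def using less_le_trans by blast

lemma cg_I: "(a, b) \<in> G \<Longrightarrow> Suc j < n \<Longrightarrow> pr j a b \<in> cg n G"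
  by (auto simp: cg_def)

lemma gspan_G11:
  assumes n: "3 \<le> n"
  shows "gspan (cg n G11) = strs n"
proof
  show "gspan (cg n G11) \<subseteq> strs n"
    using gspan_mono[of "cg n G11" "strs n"] cg_strs unfolding gspan_strs by blast
  have g: "pr j a b \<in> gspan (cg n G11)" if "(a, b) \<in> G11" "Suc j < n" for j a b
    using cg_I[OF that] gspan_base by blast
  have Y: "pt (Suc j) PY \<in> gspan (cg n G11)" if "Suc j < n" for j
  proof -
    have "pr j PY PX + pr j PY PZ \<in> gspan (cg n G11)" using that by (intro gspan_add g) (auto simp: G11_def)
    then show ?thesis by (simp add: pr_add) (simp add: pr_def)
  qed
  have X0: "pt j PX \<in> gspan (cg n G11)" if "Suc j < n" for j
  proof -
    have "pr j PX PY + pt (Suc j) PY \<in> gspan (cg n G11)" using that by (intro gspan_add g Y) (auto simp: G11_def)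
    then show ?thesis by (simp add: pr_def add.assoc)
  qed
  have Y0: "pt 0 PY \<in> gspan (cg n G11)"
  proof -
    have "pr 0 PY PX + pt 1 PX \<in> gspan (cg n G11)" using n by (intro gspan_add g X0) (auto simp: G11_def)
    then show ?thesis by (simp add: pr_def add.assoc)
  qed
  have X: "pt j PX \<in> gspan (cg n G11)" if "j < n" for j
  proof (cases "Suc j < n")
    case True then show ?thesis by (rule X0)
  next
    case False
    then obtain i where i: "j = Suc (Suc i)" using Suc_SucE[of j] n that by auto
    have "pr (Suc i) PY PX + pt (Suc i) PY \<in> gspan (cg n G11)" using that i by (intro gspan_add g Y) (auto simp: G11_def)
    then show ?thesis using i by (simp add: pr_def ac_simps pstr_dbl2)
  qed
  show "strs n \<subseteq> gspan (cg n G11)"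
  proof (rule strs_gspanI, intro conjI)
    fix j assume "j < n"
    then show "pt j PX \<in> gspan (cg n G11)" by (rule X)
    show "pt j PY \<in> gspan (cg n G11)" using Y0 Y \<open>j < n\<close> by (cases j) auto
  qed
qed

lemma cg_4: "cg 4 G = {pr 0 a b | a b. (a, b) \<in> G} \<union> {pr 1 a b | a b. (a, b) \<in> G} \<union> {pr 2 a b | a b. (a, b) \<in> G}"
  by (auto simp: cg_def numeral_eq_Suc less_Suc_eq)

text \<open>Each generator has exactly one Y, so the untwisted form, with c = 0, equals 1 on all of
  them, and their span has no radical.\<close>

theorem pcl_G11:
  assumes n: "4 \<le> n"
  shows "pcl n (cg n G11) = {f \<in> strs n. yodd n f}"
proof
  have V: "gspan (cg n G11) = strs n" by (rule gspan_G11) (use n in simp)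
  have q: "qf n 0 g" if "g \<in> cg n G11" for g using that by (auto simp: cg_def G11_def qf_def yodd_pr)
  have q0: "qf n 0 f = yodd n f" for f by (simp add: qf_def)
  show "pcl n (cg n G11) \<subseteq> {f \<in> strs n. yodd n f}"
    using pcl_gspan[of n "cg n G11"] pcl_q[OF q] unfolding V q0 by blast
  have "full n 0 (pcl n (cg n G11)) (gspan (cg n G11)) \<and> rich n 3 {} (gspan (cg n G11))"
  proof (rule full_prefix[OF pcl_closed _ n le_refl, where A = "\<lambda>m. cg m G11"])
    let ?gs = "[[PX,PY,PI,PI], [PI,PX,PY,PI], [PI,PI,PX,PY], [PY,PX,PI,PI], [PI,PY,PX,PI], [PI,PI,PY,PX], [PY,PZ,PI,PI], [PI,PY,PZ,PI], [PI,PI,PY,PZ]]"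
    let ?es = "[[PX,PY,PI,PI], [PI,PX,PY,PI], [PI,PI,PX,PY], [PY,PZ,PZ,PI], [PI,PI,PY,PX], [PI,PY,PX,PZ]]"
    have g: "emb 0 ` set ?gs = cg 4 G11" unfolding cg_4 G11_def by (auto simp: pr_def numeral_eq_Suc)
    have "cg 4 G11 \<subseteq> cg n G11" by (rule cg_mono[OF n])
    then have gs: "\<forall>g\<in>set ?gs. length g = 4 \<and> emb 0 g \<in> pcl n (cg n G11)"
      using pcl_base[of _ "cg n G11" n] unfolding g[symmetric] by simp
    have c: "set ?es \<subseteq> set (derivl ?gs ?gs [(7,3), (8,7)])" "gram_E6 [PX,PY,PI,PI] [PI,PX,PY,PI] [PI,PI,PX,PY] [PY,PZ,PZ,PI] [PI,PI,PY,PX] [PI,PY,PX,PZ]" "conn ?es ?gs"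
      by (simp_all add: gram_E6_def)
    show "full n 0 (pcl n (cg n G11)) (gspan (cg 4 G11)) \<and> rich n 3 {} (gspan (cg 4 G11))"
      using full_E6_lists[OF pcl_closed n gs pcl_q[OF q] c] unfolding g .
    fix i assume i: "4 \<le> i" "i < n"
    then obtain k where k: "i = Suc (Suc k)" using Suc_SucE[of i] by auto
    let ?es = "[pr (Suc k) PX PY, pr (Suc k) PY PX, pr (Suc k) PY PZ]"
    have "cg (Suc i) G11 = cg i G11 \<union> set ?es" by (auto simp: cg_def G11_def k less_Suc_eq)
    moreover have "e \<in> cg n G11 \<and> (bc n e (pr k PX PY) \<or> bc n e (pr k PY PX))" if "e \<in> set ?es" for e
      using that i k by (auto simp: cg_def G11_def bc_pr pr_apply)
    moreover have "pr k PX PY \<in> cg i G11" "pr k PY PX \<in> cg i G11" using i k by (auto simp: cg_def G11_def)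
    ultimately show "\<exists>es. cg (Suc i) G11 = cg i G11 \<union> set es \<and> (\<forall>e\<in>set es. e \<in> pcl n (cg n G11) \<and> qf n 0 e \<and> (\<exists>x\<in>cg i G11. bc n e x))"
    proof (intro exI[of _ ?es] conjI ballI, goal_cases)
      case (2 e) then show ?case using pcl_base[of e "cg n G11" n] by blast
    next
      case (3 e) then show ?case using q[of e] by blast
    next
      case (4 e) then show ?case by blast
    qed
  qed
  then show "{f \<in> strs n. yodd n f} \<subseteq> pcl n (cg n G11)"
    using strs_nonrad[of _ n] unfolding V pq.full_def q0 by (metis (mono_tags, lifting) mem_Collect_eq yodd_zero subsetI)
qed

declare bc.simps(2) [simp del] yodd.simps(2) [simp del]

section \<open>Quadratic forms and the orthogonal and symplectic algebras\<close>

lemma pcl_image: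
  assumes G: "G \<subseteq> strs n"
    and add: "\<And>f g. f \<in> strs n \<Longrightarrow> g \<in> strs n \<Longrightarrow> \<Psi> (f + g) = \<Psi> f + \<Psi> g"
    and bc: "\<And>f g. f \<in> strs n \<Longrightarrow> g \<in> strs n \<Longrightarrow> bc m (\<Psi> f) (\<Psi> g) = bc n f g"
  shows "pcl m (\<Psi> ` G) = \<Psi> ` pcl n G"
proof
  have s: "pcl n G \<subseteq> strs n" by (rule pcl_strs[OF G])
  show "pcl m (\<Psi> ` G) \<subseteq> \<Psi> ` pcl n G"
  proof (rule pcl_least)
    show "\<Psi> ` G \<subseteq> \<Psi> ` pcl n G" using pcl_base by blast
    show "pclosed m (\<Psi> ` pcl n G)"
    proof (rule pclosedI)
      fix f' g' assume "f' \<in> \<Psi> ` pcl n G" "g' \<in> \<Psi> ` pcl n G" "bc m f' g'"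
      then obtain f g where fg: "f \<in> pcl n G" "g \<in> pcl n G" "f' = \<Psi> f" "g' = \<Psi> g" "bc m (\<Psi> f) (\<Psi> g)" by blast
      then have "f + g \<in> pcl n G" using bc s by (intro pcl_step) auto
      moreover have "f \<in> strs n" "g \<in> strs n" using fg(1,2) s by blast+
      then have "f' + g' = \<Psi> (f + g)" by (simp add: fg(3,4) add)
      ultimately show "f' + g' \<in> \<Psi> ` pcl n G" by blast
    qed
  qed
  show "\<Psi> ` pcl n G \<subseteq> pcl m (\<Psi> ` G)"
  proof (rule image_subsetI)
    fix f assume "f \<in> pcl n G"
    then show "\<Psi> f \<in> pcl m (\<Psi> ` G)"
    proof induction
      case (pcl_base f) then show ?case by (intro pcl.pcl_base) simp
    next
      case (pcl_step f g)
      then have fg: "f \<in> strs n" "g \<in> strs n" using s by blast+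
      have "bc m (\<Psi> f) (\<Psi> g)" using pcl_step by (simp add: bc fg)
      from pcl.pcl_step[OF pcl_step.IH this] show ?case by (simp add: add fg)
    qed
  qed
qed

text \<open>The kernel of a map that preserves the form is orthogonal to everything, and
  \<open>strs n\<close> has no radical.\<close>

lemma symplectic_inj:
  assumes add: "\<And>f g. f \<in> strs n \<Longrightarrow> g \<in> strs n \<Longrightarrow> \<Psi> (f + g) = \<Psi> f + \<Psi> g"
    and bc: "\<And>f g. f \<in> strs n \<Longrightarrow> g \<in> strs n \<Longrightarrow> bc m (\<Psi> f) (\<Psi> g) = bc n f g"
  shows "inj_on \<Psi> (strs n)"
proof (rule inj_onI, rule ccontr)
  fix f g assume fg: "f \<in> strs n" "g \<in> strs n" "\<Psi> f = \<Psi> g" "f \<noteq> g"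
  have "f + g \<noteq> 0"
  proof
    assume "f + g = 0"
    then have "f + (f + g) = f" by simp
    then show False using fg(4) pstr_dbl2[of f g] by simp
  qed
  then obtain h where h: "h \<in> strs n" "bc n (f + g) h" using strs_nondeg[of "f + g" n] fg by auto
  have "bc n f h = bc n g h" using bc[OF fg(1) h(1)] bc[OF fg(2) h(1)] fg(3) by simp
  then show False using h(2) by (simp add: bc_add)
qed

lemma pclosed_qf:
  assumes "\<And>x y. x \<in> W \<Longrightarrow> y \<in> W \<Longrightarrow> x + y \<in> W"
  shows "pclosed n {f \<in> W. qf n c f}"
  by (rule pclosedI) (use assms pq.q_add in auto)

text \<open>The transvection along c + d exchanges the two forms.\<close>
lemma transvection_iso:
  assumes U: "U \<subseteq> strs m" "gspan U = U" and t: "c + d \<in> U" "\<not> qf m d (c + d)"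
  shows "spanR m {f \<in> U. qf m c f} \<cong>\<^sub>L spanR m {f \<in> U. qf m d f}"
proof -
  define t where "t = c + d"
  define \<tau> where "\<tau> f = (if bc m t f then f + t else f)" for f
  have ad: "f + g \<in> U" if "f \<in> U" "g \<in> U" for f g using that U(2) gspan_add by blast
  have qc: "qf m c f = (qf m d f \<noteq> bc m t f)" for f
    unfolding qf_def t_def by (auto simp: bc_add)
  \<comment> \<open>As t is singular for the form of d, adding t flips that form exactly when f
    anticommutes with t, which is where the two forms differ.\<close>
  have q\<tau>: "qf m d (\<tau> f) = qf m c f" for f
    using t(2) qc[of f] bc_sym[of m t f] by (simp add: \<tau>_def pq.q_add flip: t_def)
  have \<tau>\<tau>: "\<tau> (\<tau> f) = f" for f
    by (simp add: \<tau>_def bc_add2 add.assoc)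
  have \<tau>U: "\<tau> f \<in> U" if "f \<in> U" for f using that ad t(1) by (simp add: \<tau>_def t_def)
  have im: "\<tau> ` {f \<in> U. qf m c f} = {f \<in> U. qf m d f}"
  proof
    show "\<tau> ` {f \<in> U. qf m c f} \<subseteq> {f \<in> U. qf m d f}" using \<tau>U q\<tau> by auto
    show "{f \<in> U. qf m d f} \<subseteq> \<tau> ` {f \<in> U. qf m c f}"
    proof
      fix f assume f: "f \<in> {f \<in> U. qf m d f}"
      then have "qf m c (\<tau> f)" using q\<tau>[of "\<tau> f"] \<tau>\<tau>[of f] by simp
      then show "f \<in> \<tau> ` {f \<in> U. qf m c f}" using f \<tau>U \<tau>\<tau> by (intro image_eqI[of _ _ "\<tau> f"]) auto
    qed
  qed
  have "spanR m {f \<in> U. qf m c f} \<cong>\<^sub>L spanR m (\<tau> ` {f \<in> U. qf m c f})"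
  proof (rule frame_iso(1)[OF U])
    show "\<tau> f \<in> strs m" if "f \<in> U" for f using \<tau>U that U(1) by blast
    show "\<tau> (f + g) = \<tau> f + \<tau> g" for f g
      by (cases "bc m t f"; cases "bc m t g") (simp_all add: \<tau>_def bc_add2 ac_simps pstr_dbl2)
    show "bc m (\<tau> f) (\<tau> g) = bc m f g" for f g
      using bc_sym[of m t f] bc_sym[of m t g]
      by (cases "bc m t f"; cases "bc m t g") (simp_all add: \<tau>_def bc_add bc_add2)
    show "pclosed m {f \<in> U. qf m c f}" by (rule pclosed_qf) (rule ad)
    show "inj_on \<tau> {f \<in> U. qf m c f}" using \<tau>\<tau> by (metis inj_onI)
  qed auto
  then show ?thesis unfolding im .
qed

lemma qf_0: "qf m 0 f = yodd m f" by (simp add: qf_def)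

text \<open>The parity of Y in the twist is the Arf invariant of the form: twists of equal parity
  differ by a singular vector and are exchanged by a transvection.\<close>

lemma qf_self: "qf m c (c + d) = (yodd m c \<noteq> yodd m d)" "qf m d (c + d) = (yodd m c \<noteq> yodd m d)"
  using bc_sym[of m c d] by (auto simp: qf_def yodd_add bc_add2)

lemma gspan_dbl: "gspan T = T \<Longrightarrow> gspan (dbl T) = dbl T"
proof -
  assume T: "gspan T = T"
  have "0 \<in> T" and ad: "f + g \<in> T" if "f \<in> T" "g \<in> T" for f g using T gspan_0 gspan_add that by blast+
  then have z: "0 \<in> T" using T gspan_0 by blast
  have "gspan (dbl T) \<subseteq> dbl T"
  proof (rule gspan_least)
    show "0 \<in> dbl T" using z by (auto simp: dbl_def intro!: exI[of _ 0])
    show "f + g \<in> dbl T" if "f \<in> dbl T" "g \<in> dbl T" for f g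
      using that ad by (auto simp: dbl_def cons_add)
  qed auto
  then show ?thesis using gspan_base by blast
qed

lemma dbl_strs: "T \<subseteq> strs k \<Longrightarrow> dbl T \<subseteq> strs (Suc k)"
  by (auto simp: dbl_def)

lemma qf_cons: "a \<in> {0, PZ} \<Longrightarrow> qf (Suc k) (cons 0 c) (cons a f) = qf k c f"
  by (auto simp: qf_def yodd_cons bc_cons)

lemma dbl_qf: "{f \<in> dbl T. qf (Suc k) (cons 0 c) f} = dbl {f \<in> T. qf k c f}"
  unfolding dbl_def by (auto simp: qf_cons)

lemma spanR_dbl2:
  assumes "finite T"
  shows "spanR (Suc (Suc k)) (dbl (dbl T)) = dpow (spanR k T) 4"
proof -
  have "finite (dbl T)"
    using finite_surj[of "{0, PZ} \<times> T" "dbl T" "\<lambda>(a, f). cons a f"] assms by (auto simp: dbl_def)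
  then show ?thesis using assms by (simp add: spanR_dbl dsum_assoc numeral_eq_Suc)
qed

text \<open>The letter that anticommutes with X iff the first argument holds and with Z iff the
  second does; so a twist is read off from the values of a form on X and Z at each site.\<close>

definition letter :: "bool \<Rightarrow> bool \<Rightarrow> pauli" where
  "letter x z = (if x then (if z then PY else PZ) else (if z then PX else 0))"

definition lets :: "nat \<Rightarrow> (pstr \<Rightarrow> bool) \<Rightarrow> pstr" where
  "lets m Q = (\<lambda>j. if j < m then letter (Q (pt j PX)) (Q (pt j PZ)) else 0)"

lemma lets_strs [simp]: "lets m Q \<in> strs m" by (simp add: lets_def strs_def)

text \<open>Two quadratic forms with the same polar form agree once they agree on a generating set,
  here X and Z at every site.\<close>

lemma quad_repr:
  assumes Q: "\<And>f g. f \<in> strs m \<Longrightarrow> g \<in> strs m \<Longrightarrow> Q (f + g) = ((Q f \<noteq> Q g) \<noteq> bc m f g)"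
    and f: "f \<in> strs m"
  shows "Q f = qf m (lets m Q) f"
proof -
  define A where "A = {pt j a | j a. j < m \<and> a \<in> {PX, PZ}}"
  have "\<not> Q 0" using Q[of 0 0] by simp
  moreover have "Q g = qf m (lets m Q) g" if "g \<in> A" for g
    using that by (auto simp: A_def qf_def lets_def letter_def split: if_splits)
  moreover have "A \<subseteq> strs m" by (auto simp: A_def)
  ultimately have "gspan A \<subseteq> {g \<in> strs m. Q g = qf m (lets m Q) g}"
    by (intro gspan_least) (use Q pq.q_add in \<open>auto simp: qf_def\<close>)
  moreover have "strs m \<subseteq> gspan A"
  proof (rule strs_gspanI, intro conjI)
    fix j assume "j < m"
    then have *: "pt j PX \<in> gspan A" "pt j PZ \<in> gspan A" by (auto simp: A_def intro!: gspan_base)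
    then show "pt j PX \<in> gspan A" by blast
    have "pt j PX + pt j PZ \<in> gspan A" by (rule gspan_add[OF *])
    then show "pt j PY \<in> gspan A" unfolding pt_add by simp
  qed
  ultimately show ?thesis using f by blast
qed

text \<open>Arf invariant zero: the form is carried to the count of Y, which cuts out so. In the
  second claim two leading letters I or Z are carried along by performing the transvection inside
  the doubled space, which gives four copies.\<close>

lemma quad_so:
  assumes Q: "\<And>f g. f \<in> strs m \<Longrightarrow> g \<in> strs m \<Longrightarrow> Q (f + g) = ((Q f \<noteq> Q g) \<noteq> bc m f g)"
    and y: "\<not> yodd m (lets m Q)"
  shows "spanR m {f \<in> strs m. Q f} \<cong>\<^sub>L so_alg (2 ^ m)"
    and "spanR (Suc (Suc m)) (dbl (dbl {f \<in> strs m. Q f})) \<cong>\<^sub>L dpow (so_alg (2 ^ m)) 4"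
proof -
  have e: "{f \<in> strs m. Q f} = {f \<in> strs m. qf m (lets m Q) f}" using quad_repr[of m Q] Q by blast
  have "\<not> qf m 0 (lets m Q + 0)" unfolding qf_self(2) using y by simp
  from transvection_iso[OF order_refl gspan_strs _ this]
  show "spanR m {f \<in> strs m. Q f} \<cong>\<^sub>L so_alg (2 ^ m)" unfolding e so_alg_spanR qf_0 by simp
  let ?c = "cons 0 (cons 0 (lets m Q))"
  have U: "dbl (dbl (strs m)) \<subseteq> strs (Suc (Suc m))" "gspan (dbl (dbl (strs m))) = dbl (dbl (strs m))"
    by (intro dbl_strs order_refl, intro gspan_dbl gspan_strs)
  have "?c + 0 \<in> dbl (dbl (strs m))" by (simp add: dbl_def)
  moreover have "\<not> qf (Suc (Suc m)) 0 (?c + 0)" unfolding qf_self(2) using y by (simp add: yodd_cons)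
  ultimately have "spanR (Suc (Suc m)) {f \<in> dbl (dbl (strs m)). qf (Suc (Suc m)) ?c f} \<cong>\<^sub>L
      spanR (Suc (Suc m)) {f \<in> dbl (dbl (strs m)). qf (Suc (Suc m)) (cons 0 (cons 0 0)) f}"
    using transvection_iso[OF U] by simp
  then show "spanR (Suc (Suc m)) (dbl (dbl {f \<in> strs m. Q f})) \<cong>\<^sub>L dpow (so_alg (2 ^ m)) 4"
    unfolding dbl_qf e so_alg_spanR qf_0 by (simp add: spanR_dbl2)
qed

lemma quad_sp:
  assumes Q: "\<And>f g. f \<in> strs (Suc m) \<Longrightarrow> g \<in> strs (Suc m) \<Longrightarrow> Q (f + g) = ((Q f \<noteq> Q g) \<noteq> bc (Suc m) f g)"
    and y: "yodd (Suc m) (lets (Suc m) Q)"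
  shows "spanR (Suc m) {f \<in> strs (Suc m). Q f} \<cong>\<^sub>L sp_alg (2 ^ m)"
    and "spanR (Suc (Suc (Suc m))) (dbl (dbl {f \<in> strs (Suc m). Q f})) \<cong>\<^sub>L dpow (sp_alg (2 ^ m)) 4"
proof -
  let ?k = "Suc m" and ?y = "pt 0 PY"
  have e: "{f \<in> strs ?k. Q f} = {f \<in> strs ?k. qf ?k (lets ?k Q) f}" using quad_repr[of ?k Q] Q by blast
  have "\<not> qf ?k ?y (lets ?k Q + ?y)" unfolding qf_self(2) using y by simp
  from transvection_iso[OF order_refl gspan_strs _ this]
  show "spanR ?k {f \<in> strs ?k. Q f} \<cong>\<^sub>L sp_alg (2 ^ m)" unfolding e sp_alg_spanR by simp
  let ?c = "cons 0 (cons 0 (lets ?k Q))" and ?d = "cons 0 (cons 0 ?y)"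
  have U: "dbl (dbl (strs ?k)) \<subseteq> strs (Suc (Suc ?k))" "gspan (dbl (dbl (strs ?k))) = dbl (dbl (strs ?k))"
    by (intro dbl_strs order_refl, intro gspan_dbl gspan_strs)
  have "?c + ?d \<in> dbl (dbl (strs ?k))" unfolding dbl_def cons_add by auto
  moreover have "\<not> qf (Suc (Suc ?k)) ?d (?c + ?d)" unfolding qf_self(2) yodd_cons using y by simp
  ultimately have "spanR (Suc (Suc ?k)) {f \<in> dbl (dbl (strs ?k)). qf (Suc (Suc ?k)) ?c f} \<cong>\<^sub>L
      spanR (Suc (Suc ?k)) {f \<in> dbl (dbl (strs ?k)). qf (Suc (Suc ?k)) ?d f}"
    using transvection_iso[OF U] by blast
  then show "spanR (Suc (Suc ?k)) (dbl (dbl {f \<in> strs ?k. Q f})) \<cong>\<^sub>L dpow (sp_alg (2 ^ m)) 4"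
    unfolding dbl_qf e sp_alg_spanR by (simp add: spanR_dbl2)
qed

text \<open>The classical formula for the Arf invariant: the sum over a symplectic basis of the
  products of the values on X and Z at each site.\<close>

lemma yodd_lets:
  assumes "\<And>j. j < m \<Longrightarrow> (Q (pt j PX) \<and> Q (pt j PZ)) = P j"
  shows "yodd m (lets m Q) = yodd m (\<lambda>j. if P j then PY else 0)"
proof -
  have *: "yodd m f = yodd m g" if "\<And>j. j < m \<Longrightarrow> (f j = PY) = (g j = PY)" for f g
    using that by (induction m) (auto simp: yodd.simps)
  show ?thesis
    by (rule *) (use assms in \<open>auto simp: lets_def letter_def\<close>)
qed

section \<open>Counting sites in residue classes\<close>

lemma less8: "r < 8 \<Longrightarrow> r = 0 \<or> r = 1 \<or> r = 2 \<or> r = 3 \<or> r = 4 \<or> r = 5 \<or> r = 6 \<or> r = (7::nat)"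
  by linarith

lemma mod8_table: "m mod 8 = 0 \<and> Suc m mod 8 = 1 \<and> m mod 4 = 0 \<or>
   m mod 8 = 1 \<and> Suc m mod 8 = 2 \<and> m mod 4 = 1 \<or>
   m mod 8 = 2 \<and> Suc m mod 8 = 3 \<and> m mod 4 = 2 \<or>
   m mod 8 = 3 \<and> Suc m mod 8 = 4 \<and> m mod 4 = 3 \<or>
   m mod 8 = 4 \<and> Suc m mod 8 = 5 \<and> m mod 4 = 0 \<or>
   m mod 8 = 5 \<and> Suc m mod 8 = 6 \<and> m mod 4 = 1 \<or>
   m mod 8 = 6 \<and> Suc m mod 8 = 7 \<and> m mod 4 = 2 \<or>
   m mod 8 = 7 \<and> Suc m mod 8 = 0 \<and> m mod 4 = 3"
proof -
  have c: "m mod 4 = r mod 4" if "m mod 8 = r" for r using that by (auto simp: mod_mod_cancel)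
  have s: "Suc m mod 8 = Suc r mod 8" if "m mod 8 = r" for r using that by (metis mod_Suc_eq)
  have m: "m mod 8 < 8" by simp
  show ?thesis by (insert less8[OF m], elim disjE; frule c; frule s; simp)
qed

lemma mod6_table: "m mod 6 = 0 \<and> Suc m mod 6 = 1 \<and> m mod 3 = 0 \<and> Suc m mod 3 = 1 \<and> m mod 2 = 0 \<or>
   m mod 6 = 1 \<and> Suc m mod 6 = 2 \<and> m mod 3 = 1 \<and> Suc m mod 3 = 2 \<and> m mod 2 = 1 \<or>
   m mod 6 = 2 \<and> Suc m mod 6 = 3 \<and> m mod 3 = 2 \<and> Suc m mod 3 = 0 \<and> m mod 2 = 0 \<or>
   m mod 6 = 3 \<and> Suc m mod 6 = 4 \<and> m mod 3 = 0 \<and> Suc m mod 3 = 1 \<and> m mod 2 = 1 \<or>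
   m mod 6 = 4 \<and> Suc m mod 6 = 5 \<and> m mod 3 = 1 \<and> Suc m mod 3 = 2 \<and> m mod 2 = 0 \<or>
   m mod 6 = 5 \<and> Suc m mod 6 = 0 \<and> m mod 3 = 2 \<and> Suc m mod 3 = 0 \<and> m mod 2 = 1"
proof -
  have c: "m mod 3 = r mod 3" "m mod 2 = r mod 2" if "m mod 6 = r" for r using that by (auto simp: mod_mod_cancel)
  have s: "Suc m mod 6 = Suc r mod 6" if "m mod 6 = r" for r using that by (metis mod_Suc_eq)
  have t: "Suc m mod 3 = Suc r mod 3" if "m mod 6 = r" for r using c(1)[OF that] by (metis mod_Suc_eq)
  have m: "m mod 6 < 6" by simp
  then have m': "m mod 6 < 8" by simp
  show ?thesis by (insert less8[OF m'] m, elim disjE; frule c(1); frule c(2); frule s; frule t; simp)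
qed

lemma mod3_table: "m mod 3 = 0 \<and> Suc m mod 3 = 1 \<or> m mod 3 = 1 \<and> Suc m mod 3 = 2 \<or> m mod 3 = 2 \<and> Suc m mod 3 = 0"
  using mod6_table[of m] by blast

lemma mod4_table: "m mod 4 = 0 \<and> Suc m mod 4 = 1 \<and> m mod 2 = 0 \<or>
   m mod 4 = 1 \<and> Suc m mod 4 = 2 \<and> m mod 2 = 1 \<or>
   m mod 4 = 2 \<and> Suc m mod 4 = 3 \<and> m mod 2 = 0 \<or>
   m mod 4 = 3 \<and> Suc m mod 4 = 0 \<and> m mod 2 = 1"
proof -
  have c: "m mod 2 = r mod 2" if "m mod 4 = r" for r using that by (auto simp: mod_mod_cancel)
  have s: "Suc m mod 4 = Suc r mod 4" if "m mod 4 = r" for r using that by (metis mod_Suc_eq)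
  have m: "m mod 4 < 4" by simp
  then have m': "m mod 4 < 8" by simp
  show ?thesis by (insert less8[OF m'] m, elim disjE; frule c; frule s; simp)
qed

lemma mod_pred2: "k mod 8 = (Suc (Suc k) mod 8 + 6) mod 8" "k mod 6 = (Suc (Suc k) mod 6 + 4) mod 6" "k mod 4 = (Suc (Suc k) mod 4 + 2) mod 4"
proof -
  have "(Suc (Suc k) mod 8 + 6) mod 8 = (k + 8) mod 8" by (simp only: mod_add_left_eq) simp
  then show "k mod 8 = (Suc (Suc k) mod 8 + 6) mod 8" by simp
  have "(Suc (Suc k) mod 6 + 4) mod 6 = (k + 6) mod 6" by (simp only: mod_add_left_eq) simp
  then show "k mod 6 = (Suc (Suc k) mod 6 + 4) mod 6" by simp
  have "(Suc (Suc k) mod 4 + 2) mod 4 = (k + 4) mod 4" by (simp only: mod_add_left_eq) simp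
  then show "k mod 4 = (Suc (Suc k) mod 4 + 2) mod 4" by simp
qed

text \<open>The number of sites in a residue class modulo 4 changes parity every 4 sites and thus
  has period 8 modulo 2; for classes modulo 3 the period is 6.\<close>

lemma yodd_periodic:
  "yodd m (\<lambda>j. if j mod 4 = 1 then PY else 0) = (m mod 8 \<in> {2, 3, 4, 5})"
  "yodd m (\<lambda>j. if j mod 4 = 3 then PY else 0) = (m mod 8 \<in> {4, 5, 6, 7})"
  "yodd m (\<lambda>j. if j mod 3 = 0 then PY else 0) = (m mod 6 \<in> {1, 2, 3})"
  "yodd m (\<lambda>j. if j mod 3 = 1 then PY else 0) = (m mod 6 \<in> {2, 3, 4})"
proof (induction m)
  case (Suc m)
  { case 1 have "(Suc m mod 8 \<in> {2, 3, 4, 5}) = ((m mod 8 \<in> {2, 3, 4, 5}) \<noteq> (m mod 4 = 1))" using mod8_table[of m] by (elim disjE) simp_all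
    then show ?case using Suc(1) by (simp add: yodd.simps) }
  { case 2 have "(Suc m mod 8 \<in> {4, 5, 6, 7}) = ((m mod 8 \<in> {4, 5, 6, 7}) \<noteq> (m mod 4 = 3))" using mod8_table[of m] by (elim disjE) simp_all
    then show ?case using Suc(2) by (simp add: yodd.simps) }
  { case 3 have "(Suc m mod 6 \<in> {1, 2, 3}) = ((m mod 6 \<in> {1, 2, 3}) \<noteq> (m mod 3 = 0))" using mod6_table[of m] by (elim disjE) simp_all
    then show ?case using Suc(3) by (simp add: yodd.simps) }
  { case 4 have "(Suc m mod 6 \<in> {2, 3, 4}) = ((m mod 6 \<in> {2, 3, 4}) \<noteq> (m mod 3 = 1))" using mod6_table[of m] by (elim disjE) simp_all
    then show ?case using Suc(4) by (simp add: yodd.simps) }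
qed simp_all

section \<open>The Heisenberg chains\<close>

definition ones :: "nat \<Rightarrow> pauli \<Rightarrow> pstr" where "ones n a = (\<lambda>i. if i < n then a else 0)"

lemma ones_strs [simp]: "ones n a \<in> strs n" by (simp add: ones_def strs_def)
lemma ones_apply: "ones n a i = (if i < n then a else 0)" by (simp add: ones_def)
lemma bc_ones: "bc n f (ones n a) = bc n f (\<lambda>_. a)" by (rule bc_cong) (simp_all add: ones_apply fun_app)
lemma bc_const: "bc n (\<lambda>_. a) (\<lambda>_. b) = (odd n \<and> anti a b)"
  by (induction n) (auto simp: bc.simps)
lemma bc_ones2: "bc n (ones n a) (ones n b) = (odd n \<and> anti a b)"
  using bc_cong[of n "ones n a" "\<lambda>_. a" "ones n b" "\<lambda>_. b"] by (simp add: bc_const ones_def)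
lemma yodd_ones: "a \<noteq> PY \<Longrightarrow> \<not> yodd n (ones n a)"
proof -
  have "\<not> yodd n (\<lambda>_. a)" if "a \<noteq> PY" using that by (induction n) (auto simp: yodd.simps)
  moreover have "yodd n (ones n a) = yodd n (\<lambda>_. a)" by (rule yodd_cong) (simp add: ones_def)
  ultimately show "a \<noteq> PY \<Longrightarrow> \<not> yodd n (ones n a)" by simp
qed
lemma V_iff: "f \<in> V n \<longleftrightarrow> f \<in> strs n \<and> \<not> bc n f (ones n PX) \<and> \<not> bc n f (ones n PZ)"
  by (simp add: V_def bc_ones)

lemma if_add: "(if p \<noteq> q then x else 0) = (if p then x else 0) + (if q then x else (0 :: pstr))"
  by auto

text \<open>The symplectic frame of strs (n - 1) in V n, n odd, sends X at j to X at j and n - 1, and Z at j to Z at all other sites.\<close>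
definition xo :: "nat \<Rightarrow> pstr \<Rightarrow> pstr" where
  "xo n f = f + (if bc n f (ones n PX) then ones n PZ else 0) + (if bc n f (ones n PZ) then pt (n - 1) PX else 0)"

lemma xo_add: "xo n (f + g) = xo n f + xo n g"
  unfolding xo_def bc_add if_add by (simp only: ac_simps)

lemma xo_bc:
  assumes "odd n" "f \<in> strs (n - 1)" "g \<in> strs (n - 1)"
  shows "bc n (xo n f) (xo n g) = bc (n - 1) f g"
proof -
  have z: "f (n - Suc 0) = 0" "g (n - Suc 0) = 0" using assms by (auto simp: strs_def)
  have n: "n - 1 < n" using assms(1) by (cases n) auto
  have s: "bc n (ones n PX) g = bc n g (ones n PX)" "bc n (ones n PZ) g = bc n g (ones n PZ)" by (auto simp: bc_sym)
  have "bc n (xo n f) (xo n g) = bc n f g" using assms(1) n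
    by (cases "bc n f (ones n PX)"; cases "bc n f (ones n PZ)"; cases "bc n g (ones n PX)"; cases "bc n g (ones n PZ)")
      (simp_all add: xo_def bc_add bc_add2 s z bc_ones2, simp_all add: ones_apply fun_app z)
  also have "\<dots> = bc (n - 1) f g" by (rule bc_mono[OF assms(2)]) simp
  finally show ?thesis .
qed

lemma xo_V:
  assumes "odd n"
  shows "V n = xo n ` strs (n - 1)"
proof
  have n: "n - 1 < n" using assms(1) by (cases n) auto
  show "xo n ` strs (n - 1) \<subseteq> V n"
  proof
    fix v assume "v \<in> xo n ` strs (n - 1)"
    then obtain f where f: "f \<in> strs (n - 1)" "v = xo n f" by blast
    then have "f \<in> strs n" using strs_mono by simp
    then have "v \<in> strs n" using f n by (simp add: xo_def)
    then show "v \<in> V n" using assms n unfolding V_iff f(2)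
      by (cases "bc n f (ones n PX)"; cases "bc n f (ones n PZ)") (simp_all add: xo_def bc_add bc_ones2, simp_all add: ones_apply fun_app)
  qed
  show "V n \<subseteq> xo n ` strs (n - 1)"
  proof
    fix v assume v: "v \<in> V n"
    \<comment> \<open>The last letter of v tells which of the two corrections \<open>xo\<close> has
      added; removing them leaves the preimage.\<close>
    define h where "h = (if anti (v (n - 1)) PX then ones n PZ else 0) + (if anti (v (n - 1)) PZ then pt (n - 1) PX else 0)"
    have hs: "h \<in> strs n" using n by (simp add: h_def)
    have "h (n - 1) = v (n - 1)" using n by (cases "v (n - 1)") (simp_all add: h_def fun_app ones_apply)
    then have "(v + h) i = 0" if "n - 1 \<le> i" for i
      using v hs that by (cases "i = n - 1") (auto simp: fun_app V_def strs_def)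
    then have s: "v + h \<in> strs (n - 1)" by (simp add: strs_def)
    have a: "bc n (v + h) (ones n PX) = anti (v (n - 1)) PX" "bc n (v + h) (ones n PZ) = anti (v (n - 1)) PZ"
      using v n assms unfolding V_iff by (simp_all add: h_def bc_add bc_ones2, simp_all add: ones_apply fun_app)
    have "xo n (v + h) = v + h + h" unfolding xo_def a add.assoc[of "v + h"] h_def[symmetric] ..
    then have "v = xo n (v + h)" by (simp add: add.assoc)
    then show "v \<in> xo n ` strs (n - 1)" using s by blast
  qed
qed

text \<open>For odd n the strings of all X and of all Z anticommute, so they span a hyperbolic plane
  and its complement \<open>V n\<close> is nondegenerate.\<close>

lemma xo_nonrad:
  assumes "odd n" "f \<in> strs (n - 1)"
  shows "nonrad n (V n) (xo n f) = (f \<noteq> 0)"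
proof (cases "f = 0")
  case True
  then have "xo n f = 0" by (simp add: xo_def)
  then show ?thesis using True by (simp add: pq.nonrad_def)
next
  case False
  obtain g where g: "g \<in> strs (n - 1)" "bc (n - 1) f g" using strs_nondeg[OF assms(2) False] by blast
  have "xo n g \<in> V n" using g xo_V[OF assms(1)] by blast
  then show ?thesis using False pq.nonradI[of "xo n g" "V n" n "xo n f"] xo_bc[OF assms g(1)] g(2) by simp
qed

lemma xo_set:
  assumes "odd n"
  shows "{v \<in> V n. P v \<and> nonrad n (V n) v} = xo n ` {f \<in> strs (n - 1). f \<noteq> 0 \<and> P (xo n f)}"
  unfolding xo_V[OF assms] using xo_nonrad[OF assms] unfolding xo_V[OF assms] by blast

lemma xo_iso:
  assumes n: "odd n" and S: "S \<subseteq> strs (n - 1)" "pclosed (n - 1) S"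
  shows "spanR n (xo n ` S) \<cong>\<^sub>L spanR (n - 1) S"
proof (rule frame_iso(2)[OF order_refl gspan_strs _ _ _ S])
  show "xo n f \<in> strs n" if "f \<in> strs (n - 1)" for f
    using that xo_V[OF n] by (auto simp: V_def)
  show "xo n (f + g) = xo n f + xo n g" for f g by (rule xo_add)
  show "bc n (xo n f) (xo n g) = bc (n - 1) f g" if "f \<in> strs (n - 1)" "g \<in> strs (n - 1)" for f g
    by (rule xo_bc[OF n that])
  show "inj_on (xo n) S"
    using symplectic_inj[of "n - 1" "xo n" n] xo_add xo_bc[OF n] S(1) inj_on_subset by metis
qed

text \<open>Here X at j goes to X at j and k, and Z at j goes to Z at j and k + 1; the strings of all X and of all Z span the radical.\<close>
definition xe :: "nat \<Rightarrow> pstr \<Rightarrow> pstr" where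
  "xe k f = f + (if bc k f (ones k PZ) then pt k PX else 0) + (if bc k f (ones k PX) then pt (Suc k) PZ else 0)"

text \<open>Coordinates on \<open>V (Suc (Suc k))\<close> for even k: a leading Z marks the presence
  of the central strings of all X and of all Z, the remaining letters are coordinates in the frame
  \<open>xe\<close>. With central directions encoded by I and Z the doubling lemmas apply.\<close>

definition xu :: "nat \<Rightarrow> pstr \<Rightarrow> pstr" where
  "xu k u = (if u 0 = PZ then ones (Suc (Suc k)) PX else 0) + (if u 1 = PZ then ones (Suc (Suc k)) PZ else 0)
     + xe k (\<lambda>i. u (Suc (Suc i)))"

lemma xu_cons: "xu k (cons a (cons b f)) =
    (if a = PZ then ones (Suc (Suc k)) PX else 0) + (if b = PZ then ones (Suc (Suc k)) PZ else 0) + xe k f"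
  by (simp add: xu_def)

lemma xe_strs: "f \<in> strs k \<Longrightarrow> xe k f \<in> strs (Suc (Suc k))"
  using strs_mono[of f k "Suc (Suc k)"] by (simp add: xe_def)

lemma xe_add: "xe k (f + g) = xe k f + xe k g"
  unfolding xe_def bc_add if_add by (simp only: ac_simps)

lemma bc_Suc2: "f \<in> strs k \<Longrightarrow> bc (Suc (Suc k)) f g = bc k f g" "f \<in> strs k \<Longrightarrow> bc (Suc (Suc k)) g f = bc k g f"
  using bc_mono[of f k "Suc (Suc k)" g] bc_sym by auto

lemma xe_bc:
  assumes "f \<in> strs k" "g \<in> strs k"
  shows "bc (Suc (Suc k)) (xe k f) (xe k g) = bc k f g"
proof -
  have z: "f k = 0" "g k = 0" "f (Suc k) = 0" "g (Suc k) = 0" using assms by (auto simp: strs_def)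
  show ?thesis
    by (cases "bc k f (ones k PX)"; cases "bc k f (ones k PZ)"; cases "bc k g (ones k PX)"; cases "bc k g (ones k PZ)")
      (simp_all add: xe_def bc_add bc_add2 z bc_Suc2[OF assms(1)], simp_all add: fun_app z)
qed

lemma xe_ones:
  assumes "f \<in> strs k" "a \<in> {PX, PZ}"
  shows "\<not> bc (Suc (Suc k)) (xe k f) (ones (Suc (Suc k)) a)"
proof -
  have "bc (Suc (Suc k)) f (ones (Suc (Suc k)) a) = bc k f (ones k a)"
    unfolding bc_Suc2[OF assms(1)] by (rule bc_cong) (simp_all add: ones_def)
  then show ?thesis using assms(2) by (auto simp: xe_def bc_add ones_apply)
qed

definition U2 :: "nat \<Rightarrow> pstr set" where "U2 k = dbl (dbl (strs k))"

lemma U2_E: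
  assumes "u \<in> U2 k"
  obtains a b f where "u = cons a (cons b f)" "a \<in> {0, PZ}" "b \<in> {0, PZ}" "f \<in> strs k"
  using assms by (auto simp: U2_def dbl_def)

lemma U2_I: "a \<in> {0, PZ} \<Longrightarrow> b \<in> {0, PZ} \<Longrightarrow> f \<in> strs k \<Longrightarrow> cons a (cons b f) \<in> U2 k"
  unfolding U2_def dbl_def by blast

lemma U2_strs: "U2 k \<subseteq> strs (Suc (Suc k))" "gspan (U2 k) = U2 k"
  unfolding U2_def by (intro dbl_strs order_refl, intro gspan_dbl gspan_strs)

lemma xu_add:
  assumes "u \<in> U2 k" "u' \<in> U2 k"
  shows "xu k (u + u') = xu k u + xu k u'"
proof -
  obtain a b f where u: "u = cons a (cons b f)" "a \<in> {0, PZ}" "b \<in> {0, PZ}" using assms(1) by (rule U2_E)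
  obtain a' b' f' where u': "u' = cons a' (cons b' f')" "a' \<in> {0, PZ}" "b' \<in> {0, PZ}" using assms(2) by (rule U2_E)
  show ?thesis unfolding u(1) u'(1) cons_add xu_cons xe_add
    using u(2,3) u'(2,3) by (auto simp: ac_simps pstr_dbl2)
qed

lemma xu_bc:
  assumes "even k" "u \<in> U2 k" "u' \<in> U2 k"
  shows "bc (Suc (Suc k)) (xu k u) (xu k u') = bc (Suc (Suc k)) u u'"
proof -
  obtain a b f where u: "u = cons a (cons b f)" "a \<in> {0, PZ}" "b \<in> {0, PZ}" "f \<in> strs k" using assms(2) by (rule U2_E)
  obtain a' b' f' where u': "u' = cons a' (cons b' f')" "a' \<in> {0, PZ}" "b' \<in> {0, PZ}" "f' \<in> strs k" using assms(3) by (rule U2_E)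
  have o: "\<not> bc (Suc (Suc k)) (xe k g) (ones (Suc (Suc k)) PX)" "\<not> bc (Suc (Suc k)) (xe k g) (ones (Suc (Suc k)) PZ)"
    "\<not> bc (Suc (Suc k)) (ones (Suc (Suc k)) PX) (xe k g)" "\<not> bc (Suc (Suc k)) (ones (Suc (Suc k)) PZ) (xe k g)"
    if "g \<in> strs k" for g
    using xe_ones[OF that, of PX] xe_ones[OF that, of PZ] bc_sym by auto
  have "bc (Suc (Suc k)) (xu k u) (xu k u') = bc k f f'"
    unfolding u(1) u'(1) xu_cons using assms(1)
    by (simp add: bc_add bc_add2 o u(4) u'(4) xe_bc bc_ones2)
  also have "\<dots> = bc (Suc (Suc k)) u u'" unfolding u(1) u'(1) bc_cons using u(2,3) u'(2,3) by auto
  finally show ?thesis .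
qed

lemma xu_V:
  assumes "even k"
  shows "V (Suc (Suc k)) = xu k ` U2 k"
proof
  let ?n = "Suc (Suc k)"
  show "xu k ` U2 k \<subseteq> V ?n"
  proof
    fix v assume "v \<in> xu k ` U2 k"
    then obtain a b f where v: "v = xu k (cons a (cons b f))" "f \<in> strs k" by (auto elim: U2_E)
    show "v \<in> V ?n" using xe_strs[OF v(2)] xe_ones[OF v(2), of PX] xe_ones[OF v(2), of PZ] assms
      unfolding v(1) xu_cons V_iff by (simp add: bc_add bc_ones2)
  qed
  show "V ?n \<subseteq> xu k ` U2 k"
  proof
    fix v assume v: "v \<in> V ?n"
    \<comment> \<open>The central strings are chosen so that, after adding them, site k carries I or
      X and site k + 1 carries I or Z, as in the image of \<open>xe\<close>.\<close>
    define b where "b = (if anti (v k) PX then PZ else 0)"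
    define a where "a = (if anti (v (Suc k)) PZ then PZ else 0)"
    define h where "h = (if a = PZ then ones ?n PX else 0) + (if b = PZ then ones ?n PZ else 0)"
    define w where "w = v + h"
    have hV: "h \<in> V ?n" unfolding V_iff using assms by (simp add: h_def bc_add bc_ones2)
    have w: "w \<in> V ?n" unfolding w_def using v hV V_add by blast
    have "w k = v k + (if a = PZ then PX else 0) + b" by (simp add: w_def h_def fun_app ones_apply b_def ac_simps)
    moreover have "w (Suc k) = v (Suc k) + (if a = PZ then PX else 0) + b"
      by (simp add: w_def h_def fun_app ones_apply b_def ac_simps)
    ultimately have wl: "w k \<in> {0, PX}" "w (Suc k) \<in> {0, PZ}"
      unfolding a_def b_def by (cases "v k"; cases "v (Suc k)"; simp)+
    define f where "f = w + pt k (w k) + pt (Suc k) (w (Suc k))"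
    have "f i = 0" if "k \<le> i" for i
      using w that by (cases "i = k"; cases "i = Suc k") (auto simp: f_def fun_app V_def strs_def)
    then have fs: "f \<in> strs k" by (simp add: strs_def)
    have bk: "bc k f (ones k c) = bc ?n f (ones ?n c)" for c
      unfolding bc_Suc2[OF fs] by (rule bc_cong) (simp_all add: ones_def)
    have bn: "bc ?n f (ones ?n PX) = (w (Suc k) = PZ)" "bc ?n f (ones ?n PZ) = (w k = PX)"
      using w wl unfolding V_iff f_def by (auto simp: bc_add ones_apply)
    have "xe k f = f + pt k (w k) + pt (Suc k) (w (Suc k))"
      unfolding xe_def bk bn using wl by auto
    then have "xe k f = w" by (simp add: f_def ac_simps pstr_dbl2)
    then have "xu k (cons a (cons b f)) = v" unfolding xu_cons h_def[symmetric] w_def by (simp add: ac_simps pstr_dbl2)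
    moreover have "cons a (cons b f) \<in> U2 k" using fs by (intro U2_I) (auto simp: a_def b_def)
    ultimately show "v \<in> xu k ` U2 k" by blast
  qed
qed

lemma xu_inj:
  assumes "even k"
  shows "inj_on (xu k) (U2 k)"
proof (rule inj_onI)
  fix u u' assume uu: "u \<in> U2 k" "u' \<in> U2 k" "xu k u = xu k u'"
  obtain a b f where u: "u = cons a (cons b f)" "a \<in> {0, PZ}" "b \<in> {0, PZ}" "f \<in> strs k" using uu(1) by (rule U2_E)
  obtain a' b' f' where u': "u' = cons a' (cons b' f')" "a' \<in> {0, PZ}" "b' \<in> {0, PZ}" "f' \<in> strs k" using uu(2) by (rule U2_E)
  have "f + f' = 0"
  proof (rule ccontr)
    assume ne: "f + f' \<noteq> 0"
    obtain g where g: "g \<in> strs k" "bc k (f + f') g" using strs_nondeg[OF strs_add[OF u(4) u'(4)] ne] by blast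
    have gU: "cons 0 (cons 0 g) \<in> U2 k" using g by (intro U2_I) auto
    have "bc k f g = bc k f' g"
      using xu_bc[OF assms uu(1) gU] xu_bc[OF assms uu(2) gU] uu(3) unfolding u(1) u'(1) bc_cons by simp
    then show False using g(2) by (simp add: bc_add)
  qed
  then have ff: "f = f'" using pstr_dbl2[of f f'] by simp
  let ?x = "(if a = PZ then ones (Suc (Suc k)) PX else 0) + (if b = PZ then ones (Suc (Suc k)) PZ else 0)"
  let ?y = "(if a' = PZ then ones (Suc (Suc k)) PX else 0) + (if b' = PZ then ones (Suc (Suc k)) PZ else 0)"
  have "?x = ?y" using uu(3) unfolding u(1) u'(1) xu_cons ff by simp
  then have "?x 0 = ?y 0" by simp
  then have "a = a' \<and> b = b'" using u(2,3) u'(2,3) by (auto simp: fun_app ones_apply split: if_splits)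
  then show "u = u'" using u(1) u'(1) ff by simp
qed

lemma xu_nonrad:
  assumes "even k" "a \<in> {0, PZ}" "b \<in> {0, PZ}" "f \<in> strs k"
  shows "nonrad (Suc (Suc k)) (V (Suc (Suc k))) (xu k (cons a (cons b f))) = (f \<noteq> 0)"
proof -
  have u: "cons a (cons b f) \<in> U2 k" using assms by (intro U2_I)
  have "nonrad (Suc (Suc k)) (V (Suc (Suc k))) (xu k (cons a (cons b f)))
    = (\<exists>u'\<in>U2 k. bc (Suc (Suc k)) (cons a (cons b f)) u')"
    unfolding pq.nonrad_def xu_V[OF assms(1)] using xu_bc[OF assms(1) u] by auto
  also have "\<dots> = (\<exists>g\<in>strs k. bc k f g)"
  proof
    assume "\<exists>u'\<in>U2 k. bc (Suc (Suc k)) (cons a (cons b f)) u'"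
    then show "\<exists>g\<in>strs k. bc k f g" using assms(2,3) by (auto elim!: U2_E simp: bc_cons)
  next
    assume "\<exists>g\<in>strs k. bc k f g"
    then obtain g where "g \<in> strs k" "bc k f g" by blast
    then show "\<exists>u'\<in>U2 k. bc (Suc (Suc k)) (cons a (cons b f)) u'"
      by (intro bexI[of _ "cons 0 (cons 0 g)"] U2_I) (simp_all add: bc_cons)
  qed
  also have "\<dots> = (f \<noteq> 0)" using strs_nondeg[OF assms(4)] by (metis bc_zero(1))
  finally show ?thesis .
qed

definition xuS :: "nat \<Rightarrow> (pstr \<Rightarrow> bool) \<Rightarrow> pstr set" where
  "xuS k P = {cons a (cons b f) | a b f. a \<in> {0, PZ} \<and> b \<in> {0, PZ} \<and> f \<in> strs k \<and> f \<noteq> 0 \<and> P (xu k (cons a (cons b f)))}"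

lemma xu_set:
  assumes "even k"
  shows "{v \<in> V (Suc (Suc k)). P v \<and> nonrad (Suc (Suc k)) (V (Suc (Suc k))) v} = xu k ` xuS k P"
proof
  show "{v \<in> V (Suc (Suc k)). P v \<and> nonrad (Suc (Suc k)) (V (Suc (Suc k))) v} \<subseteq> xu k ` xuS k P"
  proof
    fix v assume v: "v \<in> {v \<in> V (Suc (Suc k)). P v \<and> nonrad (Suc (Suc k)) (V (Suc (Suc k))) v}"
    then have "v \<in> xu k ` U2 k" using xu_V[OF assms] by blast
    then obtain u where u: "u \<in> U2 k" "v = xu k u" by blast
    obtain a b f where abf: "u = cons a (cons b f)" "a \<in> {0, PZ}" "b \<in> {0, PZ}" "f \<in> strs k" using u(1) by (rule U2_E)
    then have "u \<in> xuS k P" using v xu_nonrad[OF assms abf(2-4)] u(2) unfolding xuS_def by blast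
    then show "v \<in> xu k ` xuS k P" using u(2) by blast
  qed
  show "xu k ` xuS k P \<subseteq> {v \<in> V (Suc (Suc k)). P v \<and> nonrad (Suc (Suc k)) (V (Suc (Suc k))) v}"
  proof
    fix v assume "v \<in> xu k ` xuS k P"
    then obtain a b f where abf: "v = xu k (cons a (cons b f))" "a \<in> {0, PZ}" "b \<in> {0, PZ}" "f \<in> strs k" "f \<noteq> 0" "P v"
      unfolding xuS_def by blast
    then show "v \<in> {v \<in> V (Suc (Suc k)). P v \<and> nonrad (Suc (Suc k)) (V (Suc (Suc k))) v}"
      using xu_V[OF assms] U2_I[OF abf(2-4)] xu_nonrad[OF assms abf(2-4)] by blast
  qed
qed

lemma xuS_U2: "xuS k P \<subseteq> U2 k" unfolding xuS_def using U2_I by blast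

lemma xu_iso:
  assumes k: "even k" and S: "S \<subseteq> U2 k" "pclosed (Suc (Suc k)) S"
  shows "spanR (Suc (Suc k)) (xu k ` S) \<cong>\<^sub>L spanR (Suc (Suc k)) S"
proof (rule frame_iso(2)[OF U2_strs _ _ _ S])
  show "xu k f \<in> strs (Suc (Suc k))" if "f \<in> U2 k" for f
    using that xu_V[OF k] by (auto simp: V_def)
  show "inj_on (xu k) S" using xu_inj[OF k] S(1) inj_on_subset by blast
qed (use xu_add xu_bc[OF k] in auto)

text \<open>Dropping the first letter, which is central on U2, is injective as soon as it is determined by the rest.\<close>
lemma tail_iso:
  assumes S: "S \<subseteq> U2 k" "pclosed (Suc (Suc k)) S" and inj: "inj_on (\<lambda>u i. u (Suc i)) S"
  shows "spanR (Suc (Suc k)) S \<cong>\<^sub>L spanR (Suc k) ((\<lambda>u i. u (Suc i)) ` S)"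
proof (rule frame_iso(1)[OF U2_strs _ _ _ S inj])
  have t: "(\<lambda>i. cons a f (Suc i)) = f" for a f by (rule ext) simp
  show "(\<lambda>i. u (Suc i)) \<in> strs (Suc k)" if "u \<in> U2 k" for u
    using subsetD[OF U2_strs(1) that] by (simp add: strs_def)
  show "(\<lambda>i. (u + u') (Suc i)) = (\<lambda>i. u (Suc i)) + (\<lambda>i. u' (Suc i))" for u u' :: pstr
    by (simp add: fun_eq_iff fun_app)
  show "bc (Suc k) (\<lambda>i. u (Suc i)) (\<lambda>i. u' (Suc i)) = bc (Suc (Suc k)) u u'" if uU: "u \<in> U2 k" "u' \<in> U2 k" for u u'
  proof -
    obtain a b f where u: "u = cons a (cons b f)" "a \<in> {0, PZ}" "b \<in> {0, PZ}" "f \<in> strs k" using uU(1) by (rule U2_E)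
    obtain a' b' f' where u': "u' = cons a' (cons b' f')" "a' \<in> {0, PZ}" "b' \<in> {0, PZ}" "f' \<in> strs k" using uU(2) by (rule U2_E)
    show ?thesis unfolding u(1) u'(1) t bc_cons using u(2) u'(2) by auto
  qed
qed

section \<open>Relabelling the letters site by site\<close>

definition relab :: "(nat \<Rightarrow> pauli \<Rightarrow> pauli) \<Rightarrow> pstr \<Rightarrow> pstr" where
  "relab L f = (\<lambda>i. L i (f i))"

text \<open>A permutation of the three letters at each site is symplectic, so only the generators
  have to be compared, bond by bond.\<close>

lemma relab_iso:
  assumes add: "\<And>i a b. L i (a + b) = L i a + L i b" and anti: "\<And>i a b. anti (L i a) (L i b) = anti a b"
    and G: "\<And>j. (\<lambda>(a, b). (L j a, L (Suc j) b)) ` G = (\<lambda>a. (a, a)) ` Ls j"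
  shows "chain_alg G n \<cong>\<^sub>L spanR n (pcl n (hg n Ls))"
proof -
  have L0: "L i 0 = 0" for i using add[of i 0 0] by simp
  have ad: "relab L (f + g) = relab L f + relab L g" for f g
    by (simp add: relab_def fun_eq_iff fun_app add)
  have bc: "bc m (relab L f) (relab L g) = bc m f g" for m f g
    by (induction m) (simp_all add: bc.simps relab_def anti)
  have p: "relab L (pr j a b) = pr j (L j a) (L (Suc j) b)" for j a b
    by (auto simp: relab_def fun_eq_iff pr_apply L0)
  have s: "relab L f \<in> strs n" if "f \<in> strs n" for f using that by (simp add: relab_def strs_def L0)
  have im: "relab L ` cg n G = hg n Ls"
  proof
    show "relab L ` cg n G \<subseteq> hg n Ls"
    proof
      fix x assume "x \<in> relab L ` cg n G"
      then obtain j a b where x: "x = pr j (L j a) (L (Suc j) b)" "(a, b) \<in> G" "Suc j < n" by (auto simp: cg_def p)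
      have "(L j a, L (Suc j) b) \<in> (\<lambda>a. (a, a)) ` Ls j" unfolding G[symmetric] using x(2) by force
      then show "x \<in> hg n Ls" using x by (auto intro: hg_I)
    qed
    show "hg n Ls \<subseteq> relab L ` cg n G"
    proof
      fix x assume "x \<in> hg n Ls"
      then obtain j c where x: "x = pr j c c" "Suc j < n" "c \<in> Ls j" by (rule hg_E)
      have "(c, c) \<in> (\<lambda>(a, b). (L j a, L (Suc j) b)) ` G" unfolding G using x(3) by blast
      then obtain a b where "(a, b) \<in> G" "c = L j a" "c = L (Suc j) b" by auto
      then have "x = relab L (pr j a b)" "pr j a b \<in> cg n G" using x p by (auto intro: cg_I)
      then show "x \<in> relab L ` cg n G" by blast
    qed
  qed
  have "spanR n (pcl n (cg n G)) \<cong>\<^sub>L spanR n (relab L ` pcl n (cg n G))"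
  proof (rule frame_iso(1)[OF order_refl gspan_strs])
    show "pcl n (cg n G) \<subseteq> strs n" by (rule pcl_strs[OF cg_strs])
    then show "inj_on (relab L) (pcl n (cg n G))"
      using symplectic_inj[where n = n and m = n and \<Psi> = "relab L"] ad bc inj_on_subset by blast
  qed (simp_all add: ad bc s pcl_closed)
  also note * = this
  have "relab L ` pcl n (cg n G) = pcl n (hg n Ls)"
    using pcl_image[OF cg_strs[of n G], where \<Psi> = "relab L" and m = n] ad bc im by simp
  then show ?thesis using * by (simp add: chain_alg_spanR)
qed

definition sw :: "pauli \<Rightarrow> pauli" where "sw a = (if a = PY then PZ else if a = PZ then PY else a)"
definition cyc :: "pauli \<Rightarrow> pauli" where "cyc a = (if a = PX then PY else if a = PY then PZ else if a = PZ then PX else 0)"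
text \<open>The generators XX, YZ, ZY match each letter with its swap on the next site, and XY, YZ,
  ZX with its cyclic successor. Undoing this at every second or third site turns both letters of a
  generator into the same one.\<close>

definition lam3 :: "nat \<Rightarrow> pauli \<Rightarrow> pauli" where "lam3 j = (if j mod 2 = 0 then id else sw)"
definition lam5 :: "nat \<Rightarrow> pauli \<Rightarrow> pauli" where
  "lam5 j = (if j mod 3 = 0 then id else if j mod 3 = 1 then cyc \<circ> cyc else cyc)"

lemma sw_cyc: "sw (a + b) = sw a + sw b" "anti (sw a) (sw b) = anti a b"
  "cyc (a + b) = cyc a + cyc b" "anti (cyc a) (cyc b) = anti a b"
  by (cases a; cases b; simp add: sw_def cyc_def)+

lemma lam3: "lam3 i (a + b) = lam3 i a + lam3 i b" "anti (lam3 i a) (lam3 i b) = anti a b"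
  and lam5: "lam5 i (a + b) = lam5 i a + lam5 i b" "anti (lam5 i a) (lam5 i b) = anti a b"
  by (simp_all add: lam3_def lam5_def sw_cyc)

lemma aa_3: "aa 3 n \<cong>\<^sub>L spanR n (pcl n (hg n L3))"
  unfolding aa_def
proof (rule relab_iso[where L = lam3], goal_cases)
  case (3 j)
  have "j mod 2 = 0 \<and> Suc j mod 2 = 1 \<or> j mod 2 = 1 \<and> Suc j mod 2 = 0" by (auto simp: mod_Suc)
  then show ?case by (elim disjE) (simp_all add: a_gens_def lam3_def L3_def sw_def)
qed (simp_all add: lam3)

lemma aa_6: "aa 6 n \<cong>\<^sub>L spanR n (pcl n (hg n L7))"
  unfolding aa_def
proof (rule relab_iso[where L = lam3], goal_cases)
  case (3 j)
  have "j mod 2 = 0 \<and> Suc j mod 2 = 1 \<or> j mod 2 = 1 \<and> Suc j mod 2 = 0" by (auto simp: mod_Suc)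
  then show ?case by (elim disjE) (simp_all add: a_gens_def lam3_def L7_def sw_def insert_commute)
qed (simp_all add: lam3)

lemma aa_7: "aa 7 n \<cong>\<^sub>L spanR n (pcl n (hg n L7))"
  unfolding aa_def by (rule relab_iso[where L = "\<lambda>_ a. a"]) (simp_all add: a_gens_def L7_def)

lemma aa_5: "aa 5 n \<cong>\<^sub>L spanR n (pcl n (hg n L5))"
  unfolding aa_def
proof (rule relab_iso[where L = lam5], goal_cases)
  case (3 j)
  show ?case using mod3_table[of j] by (elim disjE) (simp_all add: a_gens_def lam5_def L5_def cyc_def insert_commute)
qed (simp_all add: lam5)

lemma aa_10: "aa 10 n \<cong>\<^sub>L spanR n (pcl n (hg n L7))"
  unfolding aa_def
proof (rule relab_iso[where L = lam5], goal_cases)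
  case (3 j)
  show ?case using mod3_table[of j] by (elim disjE) (simp_all add: a_gens_def lam5_def L7_def cyc_def insert_commute)
qed (simp_all add: lam5)

text \<open>\<open>P j\<close> evaluates the Arf product at site j in the frame \<open>xo\<close>: X
  at j becomes X at j and n - 1, and Z at j becomes Z at all other sites. Neither contains Y, so
  only the twist contributes.\<close>

lemma odd_hg:
  assumes n: "odd n" "3 \<le> n"
    and P: "\<And>j. j < n - 1 \<Longrightarrow> ((anti (c j) PX \<noteq> anti (c (n - 1)) PX) \<and> (anti (c j) PZ \<noteq> bc n c (\<lambda>_. PZ))) = P j"
  shows "\<not> yodd (n - 1) (\<lambda>j. if P j then PY else 0) \<Longrightarrow>
      spanR n {f \<in> V n. qf n c f \<and> nonrad n (V n) f} \<cong>\<^sub>L so_alg (2 ^ (n - 1))"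
    and "yodd (n - 1) (\<lambda>j. if P j then PY else 0) \<Longrightarrow>
      spanR n {f \<in> V n. qf n c f \<and> nonrad n (V n) f} \<cong>\<^sub>L sp_alg (2 ^ (n - 2))"
proof -
  obtain m where m: "n = Suc (Suc m)" using Suc_SucE[of n] n by auto
  define Q where "Q f = qf n c (xo n f)" for f
  have Q: "Q (f + g) = ((Q f \<noteq> Q g) \<noteq> bc (Suc m) f g)" if "f \<in> strs (Suc m)" "g \<in> strs (Suc m)" for f g
    using xo_bc[OF n(1), of f g] that by (simp add: Q_def xo_add pq.q_add m)
  have Q0: "\<not> Q 0" using Q[of 0 0] by simp
  have S: "{f \<in> V n. qf n c f \<and> nonrad n (V n) f} = xo n ` {f \<in> strs (Suc m). Q f}"
    unfolding xo_set[OF n(1)] Q_def[symmetric] using Q0 by (auto simp: m intro!: arg_cong[of _ _ "\<lambda>S. xo (Suc (Suc m)) ` S"])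
  have "pclosed (Suc m) {f \<in> strs (Suc m). Q f}" by (rule pclosedI) (simp add: Q)
  then have iso: "spanR n {f \<in> V n. qf n c f \<and> nonrad n (V n) f} \<cong>\<^sub>L spanR (Suc m) {f \<in> strs (Suc m). Q f}"
    unfolding S using xo_iso[OF n(1), of "{f \<in> strs (Suc m). Q f}"] by (simp add: m)
  have "(Q (pt j PX) \<and> Q (pt j PZ)) = P j" if j: "j < Suc m" for j
  proof -
    have "xo n (pt j PX) = pt j PX + pt (Suc m) PX" "xo n (pt j PZ) = pt j PZ + ones n PZ"
      using j by (simp_all add: xo_def ones_apply m)
    then have "Q (pt j PX) = (anti (c j) PX \<noteq> anti (c (Suc m)) PX)" "Q (pt j PZ) = (anti (c j) PZ \<noteq> bc n c (\<lambda>_. PZ))"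
      using j by (simp_all add: Q_def qf_def yodd_add bc_add2 yodd_ones bc_ones, simp_all add: m ones_apply bc_ones)
    then show ?thesis using P[of j] j by (simp add: m)
  qed
  then have y: "yodd (Suc m) (lets (Suc m) Q) = yodd (n - 1) (\<lambda>j. if P j then PY else 0)"
    using yodd_lets[of "Suc m" Q P] by (simp add: m)
  show "spanR n {f \<in> V n. qf n c f \<and> nonrad n (V n) f} \<cong>\<^sub>L so_alg (2 ^ (n - 1))"
    if "\<not> yodd (n - 1) (\<lambda>j. if P j then PY else 0)"
    using lie_iso_trans[OF iso quad_so(1)[of "Suc m" Q]] Q y that by (simp add: m)
  show "spanR n {f \<in> V n. qf n c f \<and> nonrad n (V n) f} \<cong>\<^sub>L sp_alg (2 ^ (n - 2))"
    if "yodd (n - 1) (\<lambda>j. if P j then PY else 0)"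
    using lie_iso_trans[OF iso quad_sp(1)[of m Q]] Q y that by (simp add: m)
qed

lemma pclosed_xuS:
  assumes k: "even k" and P: "\<And>v w. P v \<Longrightarrow> P w \<Longrightarrow> bc (Suc (Suc k)) v w \<Longrightarrow> P (v + w)"
  shows "pclosed (Suc (Suc k)) (xuS k P)"
proof (rule pclosedI)
  fix u u' assume uu: "u \<in> xuS k P" "u' \<in> xuS k P" "bc (Suc (Suc k)) u u'"
  obtain a b f where u: "u = cons a (cons b f)" "a \<in> {0, PZ}" "b \<in> {0, PZ}" "f \<in> strs k" "P (xu k u)" using uu(1) by (auto simp: xuS_def)
  obtain a' b' f' where u': "u' = cons a' (cons b' f')" "a' \<in> {0, PZ}" "b' \<in> {0, PZ}" "f' \<in> strs k" "P (xu k u')" using uu(2) by (auto simp: xuS_def)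
  have U: "u \<in> U2 k" "u' \<in> U2 k" using uu xuS_U2 by blast+
  have "P (xu k (u + u'))" unfolding xu_add[OF U] using P u(5) u'(5) xu_bc[OF k U] uu(3) by blast
  moreover have "bc k f f'" using uu(3) u(2,3) u'(2,3) unfolding u(1) u'(1) bc_cons by auto
  then have "f + f' \<noteq> 0" using pstr_dbl2[of f f'] by fastforce
  moreover have "a + a' \<in> {0, PZ}" "b + b' \<in> {0, PZ}" "f + f' \<in> strs k" using u(2-4) u'(2-4) by auto
  ultimately show "u + u' \<in> xuS k P" unfolding xuS_def u(1) u'(1) cons_add by blast
qed

lemma even_hg:
  assumes k: "even k" and n: "n = Suc (Suc k)" and P: "\<And>v w. P v \<Longrightarrow> P w \<Longrightarrow> bc n v w \<Longrightarrow> P (v + w)"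
  shows "spanR n {v \<in> V n. P v \<and> nonrad n (V n) v} \<cong>\<^sub>L spanR n (xuS k P)"
  unfolding n xu_set[OF k]
  by (rule xu_iso[OF k xuS_U2 pclosed_xuS[OF k]]) (use P n in auto)

lemma even_hg_su4:
  assumes "even k" "n = Suc (Suc k)"
  shows "spanR n {v \<in> V n. nonrad n (V n) v} \<cong>\<^sub>L dpow (su_alg (2 ^ k)) 4"
proof -
  have "xuS k (\<lambda>_. True) = dbl (dbl (strs k - {0}))" by (auto simp: xuS_def dbl_def)
  then show ?thesis using even_hg[of k n "\<lambda>_. True"] assms by (simp add: spanR_dbl2 su_alg_spanR)
qed

lemma pclosed_nz: "pclosed n (strs n - {0})"
proof (rule pclosedI)
  fix f g assume "f \<in> strs n - {0}" "g \<in> strs n - {0}" "bc n f g"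
  moreover from this have "f + g \<noteq> 0" using pstr_dbl2[of f g] by fastforce
  ultimately show "f + g \<in> strs n - {0}" by simp
qed

lemma odd_hg_su:
  assumes n: "odd n"
  shows "spanR n {v \<in> V n. nonrad n (V n) v} \<cong>\<^sub>L su_alg (2 ^ (n - 1))"
proof -
  have e: "{v \<in> V n. nonrad n (V n) v} = xo n ` (strs (n - 1) - {0})"
    using xo_set[OF n, of "\<lambda>_. True"] by (auto intro!: arg_cong[of _ _ "\<lambda>S. xo n ` S"])
  show ?thesis unfolding e su_alg_spanR by (intro xo_iso[OF n] pclosed_nz) auto
qed

text \<open>On the radical the form is linear, with the values of the twist against all X and all Z.
  Whether it vanishes there decides between four copies and two.\<close>

lemma qf_xu:
  assumes "even k" "f \<in> strs k"
  shows "qf (Suc (Suc k)) c (xu k (cons a (cons b f))) =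
    (((a = PZ \<and> bc (Suc (Suc k)) c (\<lambda>_. PX)) \<noteq> (b = PZ \<and> bc (Suc (Suc k)) c (\<lambda>_. PZ))) \<noteq> qf (Suc (Suc k)) c (xe k f))"
proof -
  have o: "\<not> bc (Suc (Suc k)) (ones (Suc (Suc k)) PX) (xe k f)" "\<not> bc (Suc (Suc k)) (ones (Suc (Suc k)) PZ) (xe k f)"
    using xe_ones[OF assms(2), of PX] xe_ones[OF assms(2), of PZ] bc_sym by auto
  have "qf (Suc (Suc k)) c (ones (Suc (Suc k)) a) = bc (Suc (Suc k)) c (\<lambda>_. a)" if "a \<noteq> PY" for a
    using that by (simp add: qf_def yodd_ones bc_ones)
  then show ?thesis unfolding xu_cons using assms(1) by (auto simp: pq.q_add bc_add o bc_ones2)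
qed

text \<open>The string of all X is central with q = 1, so for any remaining coordinates exactly one
  choice of the first letter achieves q = 1. Dropping that letter removes the quadratic restriction
  and leaves one central letter: two copies of su.\<close>

lemma even_hg_su2:
  assumes k: "even k" and n: "n = Suc (Suc k)" and c: "bc n c (\<lambda>_. PX)"
  shows "spanR n {f \<in> V n. qf n c f \<and> nonrad n (V n) f} \<cong>\<^sub>L dpow (su_alg (2 ^ k)) 2"
proof -
  let ?t = "\<lambda>u i. u (Suc i)"
  have P: "qf n c (v + w)" if "qf n c v" "qf n c w" "bc n v w" for v w using that by (simp add: pq.q_add)
  have t: "?t (cons a f) = f" for a f by (rule ext) simp
  have i1: "spanR n {f \<in> V n. qf n c f \<and> nonrad n (V n) f} \<cong>\<^sub>L spanR n (xuS k (qf n c))"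
    by (rule even_hg[where P = "qf n c", OF k n P])
  have i2: "spanR n (xuS k (qf n c)) \<cong>\<^sub>L spanR (Suc k) (?t ` xuS k (qf n c))"
    unfolding n
  proof (rule tail_iso[OF xuS_U2 pclosed_xuS[OF k]])
    show "inj_on ?t (xuS k (qf (Suc (Suc k)) c))"
    proof (rule inj_onI)
      fix u u' assume uu: "u \<in> xuS k (qf (Suc (Suc k)) c)" "u' \<in> xuS k (qf (Suc (Suc k)) c)" "?t u = ?t u'"
      obtain a b f where u: "u = cons a (cons b f)" "a \<in> {0, PZ}" "f \<in> strs k" "qf (Suc (Suc k)) c (xu k u)" using uu(1) by (auto simp: xuS_def)
      obtain a' b' f' where u': "u' = cons a' (cons b' f')" "a' \<in> {0, PZ}" "f' \<in> strs k" "qf (Suc (Suc k)) c (xu k u')" using uu(2) by (auto simp: xuS_def)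
      have e: "b = b'" "f = f'" using uu(3) unfolding u(1) u'(1) t by auto
      have "(a = PZ) = (a' = PZ)" using u(4) u'(4) c unfolding u(1) u'(1) e qf_xu[OF k u'(3)] n by blast
      then show "u = u'" using e u(1,2) u'(1,2) by auto
    qed
  qed (use P n in auto)
  have im: "?t ` xuS k (qf n c) = dbl (strs k - {0})"
  proof
    show "?t ` xuS k (qf n c) \<subseteq> dbl (strs k - {0})" unfolding xuS_def dbl_def by (auto simp: t)
    show "dbl (strs k - {0}) \<subseteq> ?t ` xuS k (qf n c)"
    proof
      fix x assume "x \<in> dbl (strs k - {0})"
      then obtain b f where x: "x = cons b f" "b \<in> {0, PZ}" "f \<in> strs k" "f \<noteq> 0" by (auto simp: dbl_def)
      have "qf n c (xu k (cons 0 (cons b f))) \<or> qf n c (xu k (cons PZ (cons b f)))"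
        using c unfolding n qf_xu[OF k x(3)] by auto
      then obtain a where "a \<in> {0, PZ}" "qf n c (xu k (cons a (cons b f)))" by blast
      then have "cons a x \<in> xuS k (qf n c)" unfolding xuS_def x(1) using x by blast
      then show "x \<in> ?t ` xuS k (qf n c)" by (intro image_eqI[of _ _ "cons a x"]) (simp_all add: t)
    qed
  qed
  from lie_iso_trans[OF i1 i2] show ?thesis unfolding im su_alg_spanR by (simp add: spanR_dbl numeral_2_eq_2)
qed

text \<open>The form vanishes on the radical, so both leading letters are free and the restriction
  falls on the remaining coordinates alone: four copies of the algebra given by the Arf
  invariant.\<close>

lemma even_hg4:
  assumes k: "even k" and n: "n = Suc (Suc k)" "2 \<le> k" and c: "\<not> bc n c (\<lambda>_. PX)" "\<not> bc n c (\<lambda>_. PZ)"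
    and P: "\<And>j. j < k \<Longrightarrow> ((anti (c j) PX \<noteq> anti (c k) PX) \<and> (anti (c j) PZ \<noteq> anti (c (Suc k)) PZ)) = P j"
  shows "\<not> yodd k (\<lambda>j. if P j then PY else 0) \<Longrightarrow>
      spanR n {f \<in> V n. qf n c f \<and> nonrad n (V n) f} \<cong>\<^sub>L dpow (so_alg (2 ^ k)) 4"
    and "yodd k (\<lambda>j. if P j then PY else 0) \<Longrightarrow>
      spanR n {f \<in> V n. qf n c f \<and> nonrad n (V n) f} \<cong>\<^sub>L dpow (sp_alg (2 ^ (k - 1))) 4"
proof -
  obtain m where m: "k = Suc m" using n by (cases k) auto
  define Q where "Q f = qf n c (xe k f)" for f
  have Q: "Q (f + g) = ((Q f \<noteq> Q g) \<noteq> bc k f g)" if "f \<in> strs k" "g \<in> strs k" for f g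
    using xe_bc[of f k g] that by (simp add: Q_def xe_add pq.q_add n)
  have Q0: "\<not> Q 0" using Q[of 0 0] by simp
  have "xuS k (qf n c) = dbl (dbl {f \<in> strs k. Q f})"
  proof -
    have "qf n c (xu k (cons a (cons b f))) = Q f" if "f \<in> strs k" for a b f
      using qf_xu[OF k that, of c a b] c unfolding Q_def n by simp
    then show ?thesis unfolding xuS_def dbl_def using Q0 by blast
  qed
  moreover have "qf n c (v + w)" if "qf n c v" "qf n c w" "bc n v w" for v w using that by (simp add: pq.q_add)
  ultimately have iso: "spanR n {f \<in> V n. qf n c f \<and> nonrad n (V n) f} \<cong>\<^sub>L spanR n (dbl (dbl {f \<in> strs k. Q f}))"
    using even_hg[OF k n(1), of "qf n c"] by simp
  have "(Q (pt j PX) \<and> Q (pt j PZ)) = P j" if j: "j < k" for j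
  proof -
    have "xe k (pt j PX) = pt j PX + pt k PX" "xe k (pt j PZ) = pt j PZ + pt (Suc k) PZ"
      using j by (simp_all add: xe_def ones_apply)
    then have "Q (pt j PX) = (anti (c j) PX \<noteq> anti (c k) PX)" "Q (pt j PZ) = (anti (c j) PZ \<noteq> anti (c (Suc k)) PZ)"
      using j by (simp_all add: Q_def qf_def yodd_add bc_add2 n(1))
    then show ?thesis using P[of j] j by simp
  qed
  then have y: "yodd k (lets k Q) = yodd k (\<lambda>j. if P j then PY else 0)" by (rule yodd_lets)
  show "spanR n {f \<in> V n. qf n c f \<and> nonrad n (V n) f} \<cong>\<^sub>L dpow (so_alg (2 ^ k)) 4"
    if "\<not> yodd k (\<lambda>j. if P j then PY else 0)"
    using lie_iso_trans[OF iso[unfolded n(1)] quad_so(2)[of k Q]] Q y that by (simp add: n(1))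
  show "spanR n {f \<in> V n. qf n c f \<and> nonrad n (V n) f} \<cong>\<^sub>L dpow (sp_alg (2 ^ (k - 1))) 4"
    if "yodd k (\<lambda>j. if P j then PY else 0)"
    using lie_iso_trans[OF iso[unfolded n(1)], of "dpow (sp_alg (2 ^ (k - 1))) 4"] quad_sp(2)[of m Q] Q y that by (simp add: n(1) m)
qed

section \<open>Arf invariants for the twists of a3 and a5\<close>

lemma bc_c3: "bc n c3 (\<lambda>_. PX) = (n mod 4 \<in> {1, 2})" "bc n c3 (\<lambda>_. PZ) = (n mod 4 = 3)"
proof (induction n)
  case (Suc n)
  { case 1 show ?case using mod4_table[of n] Suc(1) by (elim disjE) (simp_all add: bc.simps c3_def) }
  { case 2 show ?case using mod4_table[of n] Suc(2) by (elim disjE) (simp_all add: bc.simps c3_def) }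
qed simp_all

lemma bc_c5: "bc n c5 (\<lambda>_. PX) = (n mod 3 \<noteq> 0)" "bc n c5 (\<lambda>_. PZ) = (n mod 6 \<in> {3, 4, 5})"
proof (induction n)
  case (Suc n)
  { case 1 show ?case using mod6_table[of n] Suc(1) by (elim disjE) (simp_all add: bc.simps c5_def) }
  { case 2 show ?case using mod6_table[of n] Suc(2) by (elim disjE) (simp_all add: bc.simps c5_def) }
qed simp_all

lemma mod4_cases: "j mod 4 = 0 \<or> j mod 4 = 1 \<or> j mod 4 = 2 \<or> j mod 4 = (3::nat)" by linarith
lemma mod3_cases: "j mod 3 = 0 \<or> j mod 3 = 1 \<or> j mod 3 = (2::nat)" by linarith

lemma mod8:
  "n mod 8 = 1 \<Longrightarrow> odd n \<and> n mod 4 = 1 \<and> (n - 1) mod 8 = (0::nat)"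
  "n mod 8 = 7 \<Longrightarrow> odd n \<and> n mod 4 = 3 \<and> (n - 1) mod 8 = (6::nat)"
  "n mod 8 = 3 \<Longrightarrow> odd n \<and> n mod 4 = 3 \<and> (n - 1) mod 8 = (2::nat)"
  "n mod 8 = 5 \<Longrightarrow> odd n \<and> n mod 4 = 1 \<and> (n - 1) mod 8 = (4::nat)"
proof -
  have o: "odd n" "n mod 4 = n mod 8 mod 4" if "odd (n mod 8)"
    using that by (simp_all add: mod_mod_cancel odd_iff_mod_2_eq_one)
  have p: "(n - 1) mod 8 = n mod 8 - 1" if "n mod 8 \<noteq> 0"
    using that mod_Suc[of "n - 1" 8] by (cases n) (auto split: if_splits)
  show "odd n \<and> n mod 4 = 1 \<and> (n - 1) mod 8 = (0::nat)" if "n mod 8 = 1" using o p that by simp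
  show "odd n \<and> n mod 4 = 3 \<and> (n - 1) mod 8 = (6::nat)" if "n mod 8 = 7" using o p that by simp
  show "odd n \<and> n mod 4 = 3 \<and> (n - 1) mod 8 = (2::nat)" if "n mod 8 = 3" using o p that by simp
  show "odd n \<and> n mod 4 = 1 \<and> (n - 1) mod 8 = (4::nat)" if "n mod 8 = 5" using o p that by simp
qed

lemma mod6_odd:
  "n mod 6 = 1 \<Longrightarrow> odd n \<and> (n - 1) mod 6 = (0::nat)"
  "n mod 6 = 3 \<Longrightarrow> odd n \<and> (n - 1) mod 6 = (2::nat)"
  "n mod 6 = 5 \<Longrightarrow> odd n \<and> (n - 1) mod 6 = (4::nat)"
proof -
  have o: "odd n" if "odd (n mod 6)"
    using that by (simp add: mod_mod_cancel odd_iff_mod_2_eq_one)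
  have p: "(n - 1) mod 6 = n mod 6 - 1" if "n mod 6 \<noteq> 0"
    using that mod_Suc[of "n - 1" 6] by (cases n) (auto split: if_splits)
  show "odd n \<and> (n - 1) mod 6 = (0::nat)" if "n mod 6 = 1" using o p that by simp
  show "odd n \<and> (n - 1) mod 6 = (2::nat)" if "n mod 6 = 3" using o p that by simp
  show "odd n \<and> (n - 1) mod 6 = (4::nat)" if "n mod 6 = 5" using o p that by simp
qed

theorem aa_3_odd:
  assumes n: "3 \<le> n"
  shows "n mod 8 \<in> {1, 7} \<Longrightarrow> aa 3 n \<cong>\<^sub>L so_alg (2 ^ (n - 1))"
    and "n mod 8 \<in> {3, 5} \<Longrightarrow> aa 3 n \<cong>\<^sub>L sp_alg (2 ^ (n - 2))"
proof -
  \<comment> \<open>The sites where both frame vectors have q = 1: those with twist letter X if n is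
    1 modulo 4, and those with twist letter I if n is 3 modulo 4.\<close>
  let ?P = "\<lambda>j. if n mod 4 = 1 then j mod 4 = 3 else j mod 4 = 1"
  have P: "((anti (c3 j) PX \<noteq> anti (c3 (n - 1)) PX) \<and> (anti (c3 j) PZ \<noteq> bc n c3 (\<lambda>_. PZ))) = ?P j" if "odd n" for j
  proof -
    obtain m where m: "n = Suc m" using n by (cases n) auto
    then have "even m" using that by simp
    then have "m mod 4 = 0 \<and> Suc m mod 4 = 1 \<or> m mod 4 = 2 \<and> Suc m mod 4 = 3"
      using mod4_table[of m] by (auto simp: even_iff_mod_2_eq_zero)
    then have "n mod 4 = 1 \<and> (n - 1) mod 4 = 0 \<or> n mod 4 = 3 \<and> (n - 1) mod 4 = 2" using m by auto
    then show ?thesis unfolding bc_c3 using mod4_cases[of j] by (elim disjE) (simp_all add: c3_def)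
  qed
  have y: "yodd (n - 1) (\<lambda>j. if ?P j then PY else 0) = (if n mod 4 = 1 then (n - 1) mod 8 \<in> {4, 5, 6, 7} else (n - 1) mod 8 \<in> {2, 3, 4, 5})"
    by (cases "n mod 4 = 1") (simp_all add: yodd_periodic yodd_periodic[simplified])
  note r = lie_iso_trans[OF aa_3[of n], unfolded pcl_hg3[OF n]]
  show "aa 3 n \<cong>\<^sub>L so_alg (2 ^ (n - 1))" if h: "n mod 8 \<in> {1, 7}"
  proof -
    have o: "odd n" and "n mod 4 = 1 \<and> (n - 1) mod 8 = 0 \<or> n mod 4 = 3 \<and> (n - 1) mod 8 = 6"
      using h mod8[of n] by auto
    then have "\<not> yodd (n - 1) (\<lambda>j. if ?P j then PY else 0)" unfolding y by auto
    from r[OF odd_hg(1)[OF o n P[OF o] this]] show ?thesis .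
  qed
  show "aa 3 n \<cong>\<^sub>L sp_alg (2 ^ (n - 2))" if h: "n mod 8 \<in> {3, 5}"
  proof -
    have o: "odd n" and "n mod 4 = 1 \<and> (n - 1) mod 8 = 4 \<or> n mod 4 = 3 \<and> (n - 1) mod 8 = 2"
      using h mod8[of n] by auto
    then have "yodd (n - 1) (\<lambda>j. if ?P j then PY else 0)" unfolding y by auto
    from r[OF odd_hg(2)[OF o n P[OF o] this]] show ?thesis .
  qed
qed

theorem aa_3_even:
  assumes n: "3 \<le> n"
  shows "n mod 8 = 0 \<Longrightarrow> aa 3 n \<cong>\<^sub>L dpow (so_alg (2 ^ (n - 2))) 4"
    and "n mod 8 \<in> {2, 6} \<Longrightarrow> aa 3 n \<cong>\<^sub>L dpow (su_alg (2 ^ (n - 2))) 2"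
    and "n mod 8 = 4 \<Longrightarrow> aa 3 n \<cong>\<^sub>L dpow (sp_alg (2 ^ (n - 3))) 4"
proof -
  obtain k where k: "n = Suc (Suc k)" using Suc_SucE[of n] n by auto
  \<comment> \<open>The twist ends with Y at k and X at k + 1, so exactly the sites with twist
    letter I contribute.\<close>
  have P: "((anti (c3 j) PX \<noteq> anti (c3 k) PX) \<and> (anti (c3 j) PZ \<noteq> anti (c3 (Suc k)) PZ)) = (j mod 4 = 1)" if "n mod 4 = 0" for j
  proof -
    have "k mod 4 = 2" "Suc k mod 4 = 3" using that k mod_pred2(3)[of k] mod4_table[of k] by auto
    then show ?thesis using mod4_cases[of j] by (elim disjE) (simp_all add: c3_def)
  qed
  note r = lie_iso_trans[OF aa_3[of n], unfolded pcl_hg3[OF n]]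
  have c: "even k \<and> 2 \<le> k \<and> \<not> bc n c3 (\<lambda>_. PX) \<and> \<not> bc n c3 (\<lambda>_. PZ)" if "n mod 4 = 0"
  proof -
    have k2: "k mod 4 = 2" using that k mod_pred2(3)[of k] by simp
    then have "even k" using mod4_table[of k] by (auto simp: even_iff_mod_2_eq_zero)
    moreover have "2 \<le> k" using mod_less_eq_dividend[of k 4] k2 by simp
    ultimately show ?thesis using that unfolding bc_c3 by simp
  qed
  show "aa 3 n \<cong>\<^sub>L dpow (so_alg (2 ^ (n - 2))) 4" if h: "n mod 8 = 0"
  proof -
    have n4: "n mod 4 = 0" "k mod 8 = 6" using h k mod8_table[of n] mod_pred2(1)[of k] by auto
    then have "\<not> yodd k (\<lambda>j. if j mod 4 = 1 then PY else 0)" unfolding yodd_periodic by simp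
    from r[OF even_hg4(1)[OF _ k _ _ _ P[OF n4(1)] this]] show ?thesis using c[OF n4(1)] k by simp
  qed
  show "aa 3 n \<cong>\<^sub>L dpow (sp_alg (2 ^ (n - 3))) 4" if h: "n mod 8 = 4"
  proof -
    have n4: "n mod 4 = 0" "k mod 8 = 2" using h k mod8_table[of n] mod_pred2(1)[of k] by auto
    then have "yodd k (\<lambda>j. if j mod 4 = 1 then PY else 0)" unfolding yodd_periodic by simp
    from r[OF even_hg4(2)[OF _ k _ _ _ P[OF n4(1)] this]] show ?thesis using c[OF n4(1)] k by (simp add: numeral_3_eq_3)
  qed
  show "aa 3 n \<cong>\<^sub>L dpow (su_alg (2 ^ (n - 2))) 2" if h: "n mod 8 \<in> {2, 6}"
  proof -
    have n4: "n mod 4 = 2" using h mod8_table[of n] by auto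
    then have "k mod 4 = 0" using mod_pred2(3)[of k] k by simp
    then have "even k" using mod4_table[of k] by (auto simp: even_iff_mod_2_eq_zero)
    then show ?thesis using r[OF even_hg_su2[OF _ k]] bc_c3[of n] k n4 by simp
  qed
qed

theorem aa_5_odd:
  assumes n: "3 \<le> n"
  shows "n mod 6 \<in> {1, 5} \<Longrightarrow> aa 5 n \<cong>\<^sub>L so_alg (2 ^ (n - 1))"
    and "n mod 6 = 3 \<Longrightarrow> aa 5 n \<cong>\<^sub>L sp_alg (2 ^ (n - 2))"
proof -
  \<comment> \<open>For n equal to 1 modulo 6 a site would need the twist letter X, which
    \<open>c5\<close> never takes.\<close>
  let ?P = "\<lambda>j. if n mod 6 = 1 then False else if n mod 6 = 3 then j mod 3 = 1 else j mod 3 = 0"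
  have P: "((anti (c5 j) PX \<noteq> anti (c5 (n - 1)) PX) \<and> (anti (c5 j) PZ \<noteq> bc n c5 (\<lambda>_. PZ))) = ?P j" if "odd n" for j
  proof -
    obtain m where m: "n = Suc m" using n by (cases n) auto
    then have "even m" using that by simp
    then have "Suc m mod 6 = 1 \<and> m mod 3 = 0 \<or> Suc m mod 6 = 3 \<and> m mod 3 = 2 \<or> Suc m mod 6 = 5 \<and> m mod 3 = 1"
      using mod6_table[of m] by (auto simp: even_iff_mod_2_eq_zero)
    then have "n mod 6 = 1 \<and> (n - 1) mod 3 = 0 \<or> n mod 6 = 3 \<and> (n - 1) mod 3 = 2 \<or> n mod 6 = 5 \<and> (n - 1) mod 3 = 1" using m by auto
    then show ?thesis unfolding bc_c5 using mod3_cases[of j] by (elim disjE) (simp_all add: c5_def)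
  qed
  have "\<not> yodd m (\<lambda>j. 0)" for m using yodd_zero[of m] by (simp add: zero_fun_def)
  then have y: "yodd (n - 1) (\<lambda>j. if ?P j then PY else 0) = (n mod 6 \<noteq> 1 \<and> (if n mod 6 = 3 then (n - 1) mod 6 \<in> {2, 3, 4} else (n - 1) mod 6 \<in> {1, 2, 3}))"
    by (cases "n mod 6 = 1"; cases "n mod 6 = 3") (simp_all add: yodd_periodic yodd_periodic[simplified])
  note r = lie_iso_trans[OF aa_5[of n], unfolded pcl_hg5[OF n]]
  show "aa 5 n \<cong>\<^sub>L so_alg (2 ^ (n - 1))" if h: "n mod 6 \<in> {1, 5}"
  proof -
    have o: "odd n" and "n mod 6 = 1 \<or> n mod 6 = 5 \<and> (n - 1) mod 6 = 4"
      using h mod6_odd[of n] by auto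
    then have "\<not> yodd (n - 1) (\<lambda>j. if ?P j then PY else 0)" unfolding y by auto
    from r[OF odd_hg(1)[OF o n P[OF o] this]] show ?thesis .
  qed
  show "aa 5 n \<cong>\<^sub>L sp_alg (2 ^ (n - 2))" if h: "n mod 6 = 3"
  proof -
    have o: "odd n" and "(n - 1) mod 6 = 2" using h mod6_odd[of n] by auto
    then have "yodd (n - 1) (\<lambda>j. if ?P j then PY else 0)" unfolding y using h by auto
    from r[OF odd_hg(2)[OF o n P[OF o] this]] show ?thesis .
  qed
qed

theorem aa_5_even:
  assumes n: "3 \<le> n"
  shows "n mod 6 = 0 \<Longrightarrow> aa 5 n \<cong>\<^sub>L dpow (so_alg (2 ^ (n - 2))) 4"
    and "n mod 6 \<in> {2, 4} \<Longrightarrow> aa 5 n \<cong>\<^sub>L dpow (su_alg (2 ^ (n - 2))) 2"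
proof -
  obtain k where k: "n = Suc (Suc k)" using Suc_SucE[of n] n by auto
  note r = lie_iso_trans[OF aa_5[of n], unfolded pcl_hg5[OF n]]
  show "aa 5 n \<cong>\<^sub>L dpow (so_alg (2 ^ (n - 2))) 4" if h: "n mod 6 = 0"
  proof -
    have k6: "k mod 6 = 4" "k mod 3 = 1" "Suc k mod 3 = 2" "even k" "n mod 3 = 0" "2 \<le> k"
    proof -
      show k4: "k mod 6 = 4" using h k mod_pred2(2)[of k] by simp
      then show "k mod 3 = 1" "Suc k mod 3 = 2" "even k" using mod6_table[of k] by (auto simp: even_iff_mod_2_eq_zero)
      show "n mod 3 = 0" using h mod6_table[of n] by auto
      show "2 \<le> k" using mod_less_eq_dividend[of k 6] k4 by simp
    qed
    have P: "((anti (c5 j) PX \<noteq> anti (c5 k) PX) \<and> (anti (c5 j) PZ \<noteq> anti (c5 (Suc k)) PZ)) = (j mod 3 = 0)" for j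
      using mod3_cases[of j] k6 by (elim disjE) (simp_all add: c5_def)
    have "\<not> yodd k (\<lambda>j. if j mod 3 = 0 then PY else 0)" unfolding yodd_periodic using k6 by simp
    moreover have "\<not> bc n c5 (\<lambda>_. PX)" "\<not> bc n c5 (\<lambda>_. PZ)" unfolding bc_c5 using k6 h by auto
    ultimately show ?thesis using r[OF even_hg4(1)[OF k6(4) k k6(6) _ _ P]] k by simp
  qed
  show "aa 5 n \<cong>\<^sub>L dpow (su_alg (2 ^ (n - 2))) 2" if h: "n mod 6 \<in> {2, 4}"
  proof -
    have n3: "n mod 3 \<noteq> 0" "n mod 2 = 0" using h mod6_table[of n] by auto
    then have "even k" using k by (simp add: even_iff_mod_2_eq_zero[symmetric])
    then show ?thesis using r[OF even_hg_su2[OF _ k]] bc_c5[of n] k n3 by simp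
  qed
qed

theorem aa_6_7_10:
  assumes n: "3 \<le> n"
  shows "aa 6 n \<cong>\<^sub>L aa 7 n" "aa 7 n \<cong>\<^sub>L aa 10 n"
    and "odd n \<Longrightarrow> k \<in> {6, 7, 10} \<Longrightarrow> aa k n \<cong>\<^sub>L su_alg (2 ^ (n - 1))"
    and "even n \<Longrightarrow> k \<in> {6, 7, 10} \<Longrightarrow> aa k n \<cong>\<^sub>L dpow (su_alg (2 ^ (n - 2))) 4"
proof -
  have lie: "real_lie_subalg (2 ^ n) (aa k n)" for k
    unfolding aa_def chain_alg_spanR by (rule spanR_lie[OF pcl_strs[OF cg_strs] pcl_closed])
  show "aa 6 n \<cong>\<^sub>L aa 7 n" by (rule lie_iso_trans[OF aa_6 lie_iso_sym[OF aa_7 lie]])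
  show "aa 7 n \<cong>\<^sub>L aa 10 n" by (rule lie_iso_trans[OF aa_7 lie_iso_sym[OF aa_10 lie]])
  have i: "aa k n \<cong>\<^sub>L spanR n {v \<in> V n. nonrad n (V n) v}" if "k \<in> {6, 7, 10}" for k
    using that aa_6[of n] aa_7[of n] aa_10[of n] unfolding pcl_hg7[OF n] by auto
  show "aa k n \<cong>\<^sub>L su_alg (2 ^ (n - 1))" if "odd n" "k \<in> {6, 7, 10}"
    by (rule lie_iso_trans[OF i[OF that(2)] odd_hg_su[OF that(1)]])
  obtain m where m: "n = Suc (Suc m)" using Suc_SucE[of n] n by auto
  show "aa k n \<cong>\<^sub>L dpow (su_alg (2 ^ (n - 2))) 4" if "even n" "k \<in> {6, 7, 10}"
    using lie_iso_trans[OF i[OF that(2)] even_hg_su4[of m n]] that(1) m by simp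
qed

section \<open>Free-fermion and abelian chains\<close>

lemma aa_pcl: "aa k n = spanR n (pcl n (cg n (a_gens k)))"
  by (simp add: aa_def chain_alg_spanR)

lemma bb_pcl: "bb k n = spanR n (pcl n (cg n (b_gens k)))"
  by (simp add: bb_def chain_alg_spanR)

lemma cg_insert: "cg n (insert (a, b) G) = {pr j a b | j. Suc j < n} \<union> cg n G"
  and cg_empty: "cg n {} = {}"
  by (auto simp: cg_def)

text \<open>Jordan-Wigner strings with tail p.\<close>
definition mj :: "pauli \<Rightarrow> nat \<Rightarrow> pauli \<Rightarrow> pstr" where "mj p k x = ones k p + pt k x"

lemma mj_strs: "k < n \<Longrightarrow> mj p k x \<in> strs n"
  using strs_mono[OF ones_strs[of k p], of n] by (simp add: mj_def)

lemma bc_mj: "k < n \<Longrightarrow> l < n \<Longrightarrow> bc n (mj p k x) (mj p l y) = (if k < l then anti x p else if l < k then anti p y else anti x y)"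
proof -
  have "\<not> bc n (ones k p) (ones l p)" by (induction n) (simp_all add: bc.simps ones_apply)
  then show "k < n \<Longrightarrow> l < n \<Longrightarrow> ?thesis" by (simp add: mj_def bc_add bc_add2 ones_apply) (simp add: fun_app ones_apply)
qed

text \<open>The tails cancel below site k; at site k the longer tail multiplies x by p.\<close>

lemma mj_pair: "mj p k x + mj p (Suc k) y = pr k (x + p) y"
proof -
  have "ones (Suc k) p = ones k p + pt k p" by (auto simp: fun_eq_iff ones_apply fun_app less_Suc_eq)
  then have "mj p k x + mj p (Suc k) y = (pt k x + pt k p) + pt (Suc k) y" by (simp add: mj_def ac_simps pstr_dbl2)
  then show ?thesis unfolding pt_add pr_def .
qed

lemma mj_same: "mj p k x + mj p k y = pt k (x + y)"
proof -
  have "mj p k x + mj p k y = pt k x + pt k y" by (simp add: mj_def ac_simps pstr_dbl2)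
  then show ?thesis unfolding pt_add .
qed

lemma path_iso:
  assumes c: "\<And>i. i < m \<Longrightarrow> c i \<in> strs n" and anti: "\<And>i j. i < m \<Longrightarrow> j < m \<Longrightarrow> bc n (c i) (c j) = (i \<noteq> j)"
  shows "spanR n (pcl n {c k + c (Suc k) | k. Suc k < m}) \<cong>\<^sub>L so_alg m"
proof -
  have "pcl n {c k + c (Suc k) | k. Suc k < m} = {c i + c j | i j. i < j \<and> j < m}" by (rule pcl_path) (rule anti)
  then show ?thesis using majorana_iso[of m c n] c anti by simp
qed

lemma pcl_Un:
  assumes "\<And>f g. f \<in> pcl n G1 \<Longrightarrow> g \<in> pcl n G2 \<Longrightarrow> \<not> bc n f g"
  shows "pcl n (G1 \<union> G2) = pcl n G1 \<union> pcl n G2"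
proof
  show "pcl n (G1 \<union> G2) \<subseteq> pcl n G1 \<union> pcl n G2"
  proof (rule pcl_least)
    show "G1 \<union> G2 \<subseteq> pcl n G1 \<union> pcl n G2" using pcl_base by blast
    show "pclosed n (pcl n G1 \<union> pcl n G2)"
    proof (rule pclosedI)
      fix f g assume fg: "f \<in> pcl n G1 \<union> pcl n G2" "g \<in> pcl n G1 \<union> pcl n G2" "bc n f g"
      then have "f \<in> pcl n G1 \<and> g \<in> pcl n G1 \<or> f \<in> pcl n G2 \<and> g \<in> pcl n G2"
        using assms[of f g] assms[of g f] bc_sym[of n f g] by auto
      then show "f + g \<in> pcl n G1 \<union> pcl n G2" using fg(3) pcl_step by blast
    qed
  qed
  show "pcl n G1 \<union> pcl n G2 \<subseteq> pcl n (G1 \<union> G2)"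
    using pcl_mono[of G1 n "G1 \<union> G2"] pcl_mono[of G2 n "G1 \<union> G2"] pcl_base by blast
qed

text \<open>All strings of both families anticommute mutually, so sums of two from one family
  commute with sums of two from the other. They are distinct as well, since c i anticommutes with a
  sum containing it but with no sum of two d.\<close>

lemma two_paths_iso:
  assumes c: "\<And>i. i < m \<Longrightarrow> c i \<in> strs n" and anti: "\<And>i j. i < m \<Longrightarrow> j < m \<Longrightarrow> bc n (c i) (c j) = (i \<noteq> j)"
    and d: "\<And>i. i < m \<Longrightarrow> d i \<in> strs n" and anti': "\<And>i j. i < m \<Longrightarrow> j < m \<Longrightarrow> bc n (d i) (d j) = (i \<noteq> j)"
    and cd: "\<And>i j. i < m \<Longrightarrow> j < m \<Longrightarrow> bc n (c i) (d j)"
  shows "spanR n (pcl n ({c k + c (Suc k) | k. Suc k < m} \<union> {d k + d (Suc k) | k. Suc k < m})) \<cong>\<^sub>L so_alg m \<oplus>\<^sub>L so_alg m"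
proof -
  let ?C = "{c i + c j | i j. i < j \<and> j < m}" and ?D = "{d i + d j | i j. i < j \<and> j < m}"
  have com: "\<not> bc n f g" if fC: "f \<in> ?C" and gD: "g \<in> ?D" for f g
  proof -
    obtain i j where f: "f = c i + c j" "i < m" "j < m" using fC by auto
    obtain k l where g: "g = d k + d l" "k < m" "l < m" using gD by auto
    show ?thesis using f(2,3) g(2,3) by (simp add: f(1) g(1) bc_add bc_add2 cd)
  qed
  have pc: "pcl n {c k + c (Suc k) | k. Suc k < m} = ?C" by (rule pcl_path) (rule anti)
  have pd: "pcl n {d k + d (Suc k) | k. Suc k < m} = ?D" by (rule pcl_path) (rule anti')
  have U: "pcl n ({c k + c (Suc k) | k. Suc k < m} \<union> {d k + d (Suc k) | k. Suc k < m}) = ?C \<union> ?D"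
    using pcl_Un[of n "{c k + c (Suc k) | k. Suc k < m}" "{d k + d (Suc k) | k. Suc k < m}"] com
    unfolding pc pd by blast
  have pC: "pclosed n ?C" unfolding pc[symmetric] by (rule pcl_closed)
  have pD: "pclosed n ?D" unfolding pd[symmetric] by (rule pcl_closed)
  have disj: "?C \<inter> ?D = {}"
  proof (rule ccontr)
    assume "?C \<inter> ?D \<noteq> {}"
    then obtain i j f where f: "f \<in> ?D" "f = c i + c j" "i < j" "j < m" by blast
    have "bc n (c i) f" using f anti[of i i] anti[of i j] by (simp add: bc_add2)
    moreover have "\<not> bc n (c i) f" using f(1) cd[of i] f(3,4) by (auto simp: bc_add2)
    ultimately show False by blast
  qed
  show ?thesis unfolding U
  proof (rule spanR_union[OF _ _ disj pC pD com majorana_iso[OF c anti] majorana_iso[OF d anti'] so_alg_carrier so_alg_carrier])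
    show "?C \<subseteq> strs n" using c by fastforce
    show "?D \<subseteq> strs n" using d by fastforce
  qed
qed

theorem aa_1: "aa 1 n \<cong>\<^sub>L so_alg n"
proof -
  \<comment> \<open>The tail Z turns the Y at site k into X, so neighbours multiply to XY.\<close>
  have "cg n (a_gens 1) = {mj PZ k PY + mj PZ (Suc k) PY | k. Suc k < n}"
    by (simp add: a_gens_def cg_insert cg_empty mj_pair)
  then show ?thesis unfolding aa_pcl
    using path_iso[of n "\<lambda>k. mj PZ k PY" n] by (simp add: mj_strs bc_mj)
qed

theorem aa_2: "aa 2 n \<cong>\<^sub>L so_alg n \<oplus>\<^sub>L so_alg n"
proof -
  have "cg n (a_gens 2) = {mj PZ k PY + mj PZ (Suc k) PY | k. Suc k < n} \<union> {mj PZ k PX + mj PZ (Suc k) PX | k. Suc k < n}"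
    by (simp add: a_gens_def cg_insert cg_empty mj_pair)
  then show ?thesis unfolding aa_pcl
    using two_paths_iso[of n "\<lambda>k. mj PZ k PY" n "\<lambda>k. mj PZ k PX"] by (simp add: mj_strs bc_mj)
qed

theorem aa_4: "aa 4 n \<cong>\<^sub>L so_alg n \<oplus>\<^sub>L so_alg n"
proof -
  \<comment> \<open>The letters alternate so that each bond carries XX in one family and YY in the
    other.\<close>
  let ?c = "\<lambda>k. mj PZ k (if even k then PY else PX)" and ?d = "\<lambda>k. mj PZ k (if even k then PX else PY)"
  have c: "?c k + ?c (Suc k) = (if even k then pr k PX PX else pr k PY PY)" "?d k + ?d (Suc k) = (if even k then pr k PY PY else pr k PX PX)" for k
    by (simp_all add: mj_pair)
  have "cg n (a_gens 4) = {?c k + ?c (Suc k) | k. Suc k < n} \<union> {?d k + ?d (Suc k) | k. Suc k < n}"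
    unfolding c by (auto simp: a_gens_def cg_insert cg_empty)
  then show ?thesis unfolding aa_pcl
    using two_paths_iso[of n ?c n ?d] by (simp add: mj_strs bc_mj)
qed

lemma even_odd_num: "k = 2 * (k div 2) \<and> even k \<or> k = Suc (2 * (k div 2)) \<and> odd k"
  by presburger

text \<open>Multiplying XY with XX or YY isolates Z at each site. With all Z and XX available the
  chain is a path through 2n Majorana strings, X and Y at every site, whose neighbours multiply to Z
  on a site and to XX on a bond alternately.\<close>

theorem aa_14: "2 \<le> n \<Longrightarrow> aa 14 n \<cong>\<^sub>L so_alg (2 * n)"
proof -
  assume n: "2 \<le> n"
  let ?c = "\<lambda>r. mj PZ (r div 2) (if even r then PX else PY)"
  let ?G = "a_gens 14"
  define P where "P = {?c k + ?c (Suc k) | k. Suc k < 2 * n}"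
  have G: "?G = {(PX, PX), (PY, PY), (PX, PY)}" by (simp add: a_gens_def)
  have c: "?c (2 * i) + ?c (Suc (2 * i)) = pt i PZ" "?c (Suc (2 * i)) + ?c (Suc (Suc (2 * i))) = pr i PX PX" for i
    by (simp_all add: mj_pair mj_same)
  have b: "pr j PX PX \<in> pcl n (cg n ?G)" "pr j PY PY \<in> pcl n (cg n ?G)" "pr j PX PY \<in> pcl n (cg n ?G)" if "Suc j < n" for j
    unfolding G using that by (intro pcl_base cg_I; simp)+
  have z: "pt j PZ \<in> pcl n (cg n ?G)" if jn: "j < n" for j
  proof (cases "Suc j < n")
    case True
    from pcl_step[OF b(2,3)[OF True]] show ?thesis using True by (simp add: bc_pr pr_apply pr_add) (simp add: pr_def)
  next
    case False
    then obtain i where i: "j = Suc i" "Suc i < n" using jn n by (cases j) auto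
    from pcl_step[OF b(1,3)[OF i(2)]] show ?thesis using i by (simp add: bc_pr pr_apply pr_add) (simp add: pr_def)
  qed
  have P: "P \<subseteq> pcl n (cg n ?G)"
  proof
    fix x assume "x \<in> P"
    then obtain k where x: "x = ?c k + ?c (Suc k)" "Suc k < 2 * n" unfolding P_def by blast
    obtain i where "k = 2 * i \<or> k = Suc (2 * i)" using even_odd_num[of k] by blast
    then have "x = pt i PZ \<and> i < n \<or> x = pr i PX PX \<and> Suc i < n" using x(2) c[of i] unfolding x(1) by auto
    then show "x \<in> pcl n (cg n ?G)" using z b by blast
  qed
  have zP: "pt i PZ \<in> pcl n P" if "i < n" for i
    using that c(1)[of i, symmetric] unfolding P_def by (intro pcl_base CollectI exI[of _ "2 * i"]) simp
  have xP: "pr i PX PX \<in> pcl n P" if "Suc i < n" for i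
    using that c(2)[of i, symmetric] unfolding P_def by (intro pcl_base CollectI exI[of _ "Suc (2 * i)"]) simp
  have xyP: "pr i PX PY \<in> pcl n P" if "Suc i < n" for i
  proof -
    have "pr i PX PX + pt (Suc i) PZ \<in> pcl n P" using that by (intro pcl_step xP zP) (simp_all add: pr_apply)
    then show ?thesis by (simp add: pr_def add.assoc pt_add)
  qed
  have yyP: "pr i PY PY \<in> pcl n P" if "Suc i < n" for i
  proof -
    have "pt i PZ + pr i PX PY \<in> pcl n P" using that by (intro pcl_step zP xyP) (simp_all add: pr_apply)
    then show ?thesis by (simp add: pr_def pt_add flip: add.assoc)
  qed
  have "cg n ?G \<subseteq> pcl n P" unfolding G using xP xyP yyP by (auto simp: cg_insert cg_empty)
  then have "pcl n (cg n ?G) = pcl n P" by (rule pcl_eqI[OF _ P])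
  moreover have "spanR n (pcl n P) \<cong>\<^sub>L so_alg (2 * n)"
  unfolding P_def
  proof (rule path_iso)
    show "?c i \<in> strs n" if "i < 2 * n" for i using that by (intro mj_strs) auto
    show "bc n (?c i) (?c j) = (i \<noteq> j)" if "i < 2 * n" "j < 2 * n" for i j
    proof -
      have "i div 2 < n" "j div 2 < n" using that by auto
      moreover have "i = j \<longleftrightarrow> i div 2 = j div 2 \<and> even i = even j" by presburger
      ultimately show ?thesis by (auto simp: bc_mj)
    qed
  qed
  ultimately show ?thesis unfolding aa_pcl by simp
qed

theorem aa_8: "2 \<le> n \<Longrightarrow> aa 8 n \<cong>\<^sub>L so_alg (2 * n - 1)"
proof -
  assume n: "2 \<le> n"
  \<comment> \<open>The product of XX and XZ on a bond is Y on its right site, so no single letter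
    arises at site 0. That site contributes one Majorana string, every other site two, hence the
    shift in the index and the total 2n - 1.\<close>
  let ?c = "\<lambda>r. mj PY (Suc r div 2) (if even r then PZ else PX)"
  let ?G = "a_gens 8"
  define P where "P = {?c k + ?c (Suc k) | k. Suc k < 2 * n - 1}"
  have G: "?G = {(PX, PX), (PX, PZ)}" by (simp add: a_gens_def)
  have c: "?c (2 * i) + ?c (Suc (2 * i)) = pr i PX PX" "?c (Suc (2 * i)) + ?c (Suc (Suc (2 * i))) = pt (Suc i) PY" for i
    by (simp_all add: mj_pair mj_same)
  have b: "pr j PX PX \<in> pcl n (cg n ?G)" "pr j PX PZ \<in> pcl n (cg n ?G)" if "Suc j < n" for j
    unfolding G using that by (intro pcl_base cg_I; simp)+
  have y: "pt (Suc j) PY \<in> pcl n (cg n ?G)" if "Suc j < n" for j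
    using pcl_step[OF b[OF that]] that by (simp add: bc_pr pr_apply pr_add) (simp add: pr_def)
  have P: "P \<subseteq> pcl n (cg n ?G)"
  proof
    fix x assume "x \<in> P"
    then obtain k where x: "x = ?c k + ?c (Suc k)" "Suc k < 2 * n - 1" unfolding P_def by blast
    obtain i where "k = 2 * i \<or> k = Suc (2 * i)" using even_odd_num[of k] by blast
    then have "(x = pr i PX PX \<or> x = pt (Suc i) PY) \<and> Suc i < n" using x(2) c[of i] unfolding x(1) by auto
    then show "x \<in> pcl n (cg n ?G)" using y b by blast
  qed
  have xP: "pr i PX PX \<in> pcl n P" if "Suc i < n" for i
    using that c(1)[of i, symmetric] unfolding P_def by (intro pcl_base CollectI exI[of _ "2 * i"]) simp
  have yP: "pt (Suc i) PY \<in> pcl n P" if "Suc i < n" for i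
    using that c(2)[of i, symmetric] unfolding P_def by (intro pcl_base CollectI exI[of _ "Suc (2 * i)"]) simp
  have xzP: "pr i PX PZ \<in> pcl n P" if "Suc i < n" for i
  proof -
    have "pr i PX PX + pt (Suc i) PY \<in> pcl n P" using that by (intro pcl_step xP yP) (simp_all add: pr_apply)
    then show ?thesis by (simp add: pr_def add.assoc pt_add)
  qed
  have "cg n ?G \<subseteq> pcl n P" unfolding G using xP xzP by (auto simp: cg_insert cg_empty)
  then have "pcl n (cg n ?G) = pcl n P" by (rule pcl_eqI[OF _ P])
  moreover have "spanR n (pcl n P) \<cong>\<^sub>L so_alg (2 * n - 1)"
  unfolding P_def
  proof (rule path_iso)
    show "?c i \<in> strs n" if "i < 2 * n - 1" for i using that by (intro mj_strs) auto
    show "bc n (?c i) (?c j) = (i \<noteq> j)" if "i < 2 * n - 1" "j < 2 * n - 1" for i j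
    proof -
      have "Suc i div 2 < n" "Suc j div 2 < n" using that by auto
      moreover have "i = j \<longleftrightarrow> Suc i div 2 = Suc j div 2 \<and> even i = even j" by presburger
      ultimately show ?thesis by (auto simp: bc_mj)
    qed
  qed
  ultimately show ?thesis unfolding aa_pcl by simp
qed

section \<open>Abelian chains and decoupled sites\<close>

lemma abelian_pcl:
  assumes "\<And>f g. f \<in> G \<Longrightarrow> g \<in> G \<Longrightarrow> \<not> bc n f g"
  shows "pcl n G = G"
proof
  show "pcl n G \<subseteq> G" by (rule pcl_least) (use assms in \<open>auto intro!: pclosedI\<close>)
  show "G \<subseteq> pcl n G" using pcl_base by blast
qed

lemma abelian_iso:
  assumes G: "cg n G = f ` {..m}" and s: "\<And>j. j \<le> m \<Longrightarrow> f j \<in> strs n" and i: "inj_on f {..m}"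
    and b: "\<And>i j. i \<le> m \<Longrightarrow> j \<le> m \<Longrightarrow> \<not> bc n (f i) (f j)"
  shows "spanR n (pcl n (cg n G)) \<cong>\<^sub>L dpow u1 (Suc m)"
proof -
  have "pcl n (f ` {..m}) = f ` {..m}" by (rule abelian_pcl) (use b in auto)
  then show ?thesis unfolding G using spanR_abelian[OF s i b] by simp
qed

lemma pr_inj: "a \<noteq> 0 \<Longrightarrow> pr i a b = pr j a b \<Longrightarrow> i = j"
proof (rule ccontr)
  assume a: "a \<noteq> 0" "pr i a b = pr j a b" "i \<noteq> j"
  have "pr i a b i = pr j a b i" "pr i a b j = pr j a b j" using a(2) by auto
  then show False using a(1,3) by (auto simp: pr_apply split: if_splits)
qed

theorem aa_0: "2 \<le> n \<Longrightarrow> aa 0 n \<cong>\<^sub>L dpow u1 (n - 1)"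
proof -
  assume n: "2 \<le> n"
  then obtain m where m: "n = Suc (Suc m)" using Suc_SucE by blast
  have "spanR n (pcl n (cg n (a_gens 0))) \<cong>\<^sub>L dpow u1 (Suc m)"
  proof (rule abelian_iso)
    show "cg n (a_gens 0) = (\<lambda>j. pr j PX PX) ` {..m}" by (auto simp: a_gens_def cg_def m)
    show "inj_on (\<lambda>j. pr j PX PX) {..m}" using pr_inj[of PX] by (intro inj_onI) simp
  qed (simp_all add: m bc_pr pr_apply)
  then show ?thesis by (simp add: aa_pcl m)
qed

lemma pt_inj: "a \<noteq> 0 \<Longrightarrow> pt i a = pt j b \<Longrightarrow> i = j \<and> a = b"
proof -
  assume a: "a \<noteq> 0" "pt i a = pt j b"
  have "pt i a i = pt j b i" using a(2) by simp
  then show ?thesis using a(1) by (auto split: if_splits)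
qed

lemma bc_X:
  assumes "\<And>i. f i = 0 \<or> f i = a" "\<And>i. g i = 0 \<or> g i = a"
  shows "\<not> bc n f g"
proof (induction n)
  case (Suc n) then show ?case using assms(1)[of n] assms(2)[of n] by (auto simp: bc.simps)
qed simp

lemma cg_singles:
  assumes "2 \<le> n"
  shows "cg n (insert (a, PI) (insert (PI, a) G)) = {pt j a | j. j < n} \<union> cg n G"
proof -
  have p: "pr j a 0 = pt j a" "pr j 0 a = pt (Suc j) a" for j by (simp_all add: pr_def)
  have "{pt j a | j. Suc j < n} \<union> {pt (Suc j) a | j. Suc j < n} = {pt j a | j. j < n}"
  proof (intro equalityI subsetI)
    fix x assume "x \<in> {pt j a | j. j < n}"
    then obtain j where j: "x = pt j a" "j < n" by blast
    show "x \<in> {pt j a | j. Suc j < n} \<union> {pt (Suc j) a | j. Suc j < n}"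
    proof (cases j)
      case 0
      then have "Suc j < n" using assms by simp
      then show ?thesis using j(1) by blast
    qed (use j in blast)
  qed (blast dest: Suc_lessD)
  then show ?thesis unfolding cg_insert PI_0 p by blast
qed

theorem bb_0: "2 \<le> n \<Longrightarrow> bb 0 n \<cong>\<^sub>L dpow u1 n"
proof -
  assume n: "2 \<le> n"
  then obtain m where m: "n = Suc m" by (cases n) auto
  have "spanR n (pcl n (cg n (b_gens 0))) \<cong>\<^sub>L dpow u1 (Suc m)"
  proof (rule abelian_iso)
    show "cg n (b_gens 0) = (\<lambda>j. pt j PX) ` {..m}"
      using cg_singles[OF n, of PX "{}"] by (auto simp: b_gens_def cg_empty m)
    show "inj_on (\<lambda>j. pt j PX) {..m}" by (rule inj_onI) (use pt_inj[OF pauli_neq_0(1)] in blast)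
  qed (simp_all add: m)
  then show ?thesis by (simp add: bb_pcl m)
qed

theorem bb_1: "2 \<le> n \<Longrightarrow> bb 1 n \<cong>\<^sub>L dpow u1 (2 * n - 1)"
proof -
  assume n: "2 \<le> n"
  \<comment> \<open>Indices below n enumerate the sites and the others the n - 1 bonds, so the last
    index is 2n - 2.\<close>
  let ?f = "\<lambda>i. if i < n then pt i PX else pr (i - n) PX PX"
  have ne: "pt i PX \<noteq> pr j PX PX" for i j
  proof
    assume e: "pt i PX = pr j PX PX"
    have "pt i PX j = pr j PX PX j" "pt i PX (Suc j) = pr j PX PX (Suc j)" by (simp_all only: e)
    then show False by (auto simp: pr_apply split: if_splits)
  qed
  have "spanR n (pcl n (cg n (b_gens 1))) \<cong>\<^sub>L dpow u1 (Suc (2 * n - 2))"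
  proof (rule abelian_iso)
    have "cg n (b_gens 1) = cg n (insert (PX, PI) (insert (PI, PX) {(PX, PX)}))" by (simp add: b_gens_def insert_commute)
    also have "\<dots> = {pt j PX | j. j < n} \<union> {pr j PX PX | j. Suc j < n}" unfolding cg_singles[OF n] by (simp add: cg_insert cg_empty)
    also have "\<dots> = ?f ` {..2 * n - 2}"
    proof (intro equalityI subsetI)
      fix x assume "x \<in> {pt j PX | j. j < n} \<union> {pr j PX PX | j. Suc j < n}"
      then consider j where "x = ?f j" "j < n" | j where "x = ?f (j + n)" "Suc j < n" by auto
      then show "x \<in> ?f ` {..2 * n - 2}"
      proof cases
        case 1 then show ?thesis by (intro image_eqI[of _ _ j]) auto
      next
        case 2 then show ?thesis by (intro image_eqI[of _ _ "j + n"]) auto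
      qed
    next
      fix x assume "x \<in> ?f ` {..2 * n - 2}"
      then obtain i where i: "x = ?f i" "i \<le> 2 * n - 2" by blast
      then show "x \<in> {pt j PX | j. j < n} \<union> {pr j PX PX | j. Suc j < n}"
      proof (cases "i < n")
        case False
        then have "x = pr (i - n) PX PX" "Suc (i - n) < n" using i n by auto
        then show ?thesis by blast
      qed auto
    qed
    finally show "cg n (b_gens 1) = ?f ` {..2 * n - 2}" .
    show "inj_on ?f {..2 * n - 2}"
    proof (rule inj_onI)
      fix i j assume ij: "?f i = ?f j"
      show "i = j"
      proof (cases "i < n")
        case True
        then have "pt i PX = ?f j" using ij by simp
        then have "j < n \<and> pt i PX = pt j PX" using ne[of i "j - n"] by (simp split: if_split_asm)
        then show ?thesis using pt_inj[OF pauli_neq_0(1), of i j PX] by blast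
      next
        case False
        then have e: "pr (i - n) PX PX = ?f j" using ij by simp
        then have "\<not> j < n" using ne[of j "i - n"] by (metis (no_types))
        moreover from this e have "i - n = j - n" using pr_inj[OF pauli_neq_0(1)] by simp
        ultimately show ?thesis using False by simp
      qed
    qed
    show "?f j \<in> strs n" if j: "j \<le> 2 * n - 2" for j
    proof (cases "j < n")
      case False
      then have "Suc (j - n) < n" using j n by simp
      then show ?thesis using False by simp
    qed simp
    show "\<not> bc n (?f i) (?f j)" for i j by (rule bc_X[of _ PX]) (simp_all add: pr_apply)
  qed
  then show ?thesis using n by (simp add: bb_pcl Suc_diff_Suc numeral_2_eq_2)
qed

text \<open>All generators are single letters, so sites decouple; X and Y at one site give the three
  letters of su(2).\<close>

theorem bb_3: "2 \<le> n \<Longrightarrow> bb 3 n \<cong>\<^sub>L dpow (su_alg 2) n"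
proof -
  assume n: "2 \<le> n"
  then obtain m where m: "n = Suc m" by (cases n) auto
  let ?S = "\<lambda>j. {pt j a | a. a \<noteq> 0}" and ?G = "{pt j PX | j. j < n} \<union> {pt j PY | j. j < n}"
  have "b_gens 3 = insert (PX, PI) (insert (PI, PX) (insert (PY, PI) (insert (PI, PY) {})))" by (auto simp: b_gens_def)
  then have G: "cg n (b_gens 3) = ?G" unfolding cg_singles[OF n] by (simp only:) (simp only: cg_singles[OF n] cg_empty Un_empty_right)
  have iso: "spanR n (?S j) \<cong>\<^sub>L su_alg 2" if "j < n" for j
  proof -
    have "(\<lambda>f. pt j (f 0)) ` (strs 1 - {0}) = ?S j"
    proof (intro equalityI subsetI)
      fix x assume "x \<in> (\<lambda>f. pt j (f 0)) ` (strs 1 - {0})"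
      then obtain f where f: "x = pt j (f 0)" "f \<in> strs 1" "f \<noteq> 0" by blast
      have "f 0 \<noteq> 0"
      proof
        assume "f 0 = 0"
        then have "f = 0" using f(2) by (intro strs_eqI[of _ 1]) (simp_all add: fun_app)
        then show False using f(3) by simp
      qed
      then show "x \<in> ?S j" using f(1) by blast
    next
      fix x assume "x \<in> ?S j"
      then obtain a where a: "x = pt j a" "a \<noteq> 0" by blast
      have "pt 0 a \<noteq> 0" using a(2) pt_apply[of 0 a 0] by (metis zero_fun_apply)
      then show "x \<in> (\<lambda>f. pt j (f 0)) ` (strs 1 - {0})" using a(1) by (intro image_eqI[of _ _ "pt 0 a"]) auto
    qed
    moreover have "spanR n ((\<lambda>f. pt j (f 0)) ` (strs 1 - {0})) \<cong>\<^sub>L spanR 1 (strs 1 - {0})"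
    proof (rule frame_iso(2)[OF order_refl gspan_strs _ _ _ _ pclosed_nz])
      show "pt j ((f + g) 0) = pt j (f 0) + pt j (g 0)" for f g by (simp add: fun_app pt_add)
      show "bc n (pt j (f 0)) (pt j (g 0)) = bc 1 f g" for f g using that by (simp add: bc.simps)
      show "inj_on (\<lambda>f. pt j (f 0)) (strs 1 - {0})"
      proof (rule inj_onI)
        fix f g assume fg: "f \<in> strs 1 - {0}" "g \<in> strs 1 - {0}" "pt j (f 0) = pt j (g 0)"
        have "f 0 = g 0" using fun_cong[OF fg(3), of j] by simp
        then show "f = g" using fg by (intro strs_eqI[of _ 1]) simp_all
      qed
    qed (use that in auto)
    ultimately show ?thesis using su_alg_spanR[of 1] by simp
  qed
  have "pclosed n (\<Union>j\<le>m. ?S j) \<and> spanR n (\<Union>j\<le>m. ?S j) \<cong>\<^sub>L dpow (su_alg 2) (Suc m)"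
  proof (rule spanR_UN)
    fix j assume j: "j \<le> m"
    show "?S j \<subseteq> strs n" using j m by auto
    show "spanR n (?S j) \<cong>\<^sub>L su_alg 2" using iso j m by simp
    show "pclosed n (?S j)"
    proof (rule pclosedI)
      fix f g assume "f \<in> ?S j" "g \<in> ?S j" "bc n f g"
      then obtain a b where ab: "f = pt j a" "g = pt j b" "anti a b" by auto
      have "f + g = pt j (a + b)" "a + b \<noteq> 0" using ab by (simp_all add: pt_add) (cases a; cases b; simp)
      then show "f + g \<in> ?S j" by blast
    qed
  next
    fix i j :: nat assume "i \<noteq> j"
    then show "?S i \<inter> ?S j = {}"
    proof -
      have False if xi: "x \<in> ?S i" and xj: "x \<in> ?S j" for x
      proof -
        obtain a where "x = pt i a" "a \<noteq> 0" using xi by blast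
        moreover obtain b where "x = pt j b" using xj by blast
        ultimately show False using pt_inj[of a i j b] \<open>i \<noteq> j\<close> by simp
      qed
      then show ?thesis by blast
    qed
    show "\<not> bc n f g" if "f \<in> ?S i" "g \<in> ?S j" for f g using that \<open>i \<noteq> j\<close> by auto
  qed (rule su_alg_carrier)
  moreover have "pcl n ?G = (\<Union>j\<le>m. ?S j)"
  proof
    show "pcl n ?G \<subseteq> (\<Union>j\<le>m. ?S j)"
    proof (rule pcl_least)
      show "?G \<subseteq> (\<Union>j\<le>m. ?S j)" using m pauli_neq_0 by fastforce
    qed (use calculation in blast)
    have "pt j a \<in> pcl n ?G" if j: "j < n" and a: "a \<noteq> 0" for j a
    proof -
      have b: "pt j PX \<in> pcl n ?G" "pt j PY \<in> pcl n ?G" using j by (auto intro!: pcl_base)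
      have "pt j PX + pt j PY \<in> pcl n ?G" by (rule pcl_step[OF b]) (use j in simp)
      then have "pt j PZ \<in> pcl n ?G" unfolding pt_add by simp
      with a b show ?thesis by (cases a) auto
    qed
    then show "(\<Union>j\<le>m. ?S j) \<subseteq> pcl n ?G" using m by auto
  qed
  ultimately show ?thesis unfolding bb_pcl G by (simp add: m)
qed

section \<open>Local generation of full algebras\<close>

text \<open>The order is bond by bond from the left, and on each bond as in G; generator numbers in
  certificates refer to it.\<close>

definition winl :: "nat \<Rightarrow> (pauli \<times> pauli) list \<Rightarrow> pauli list list" where
  "winl w G = concat (map (\<lambda>i. map (\<lambda>(a, b). replicate i PI @ [a, b] @ replicate (w - 2 - i) PI) G) [0..<w - 1])"

lemma emb_append: "emb k (l @ m) = emb k l + emb (k + length l) m"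
  by (induction l arbitrary: k) (simp_all add: add.assoc)

lemma emb_replicate: "emb k (replicate i PI) = 0"
  using emb_replicate_0 by simp

lemma window:
  assumes "k + w \<le> N" "2 \<le> w" "l \<in> set (derivl (winl w G) (winl w G) cert)"
  shows "emb k l \<in> pcl N (cg N (set G))"
proof (rule derivl_pcl[OF _ assms(1,3)], intro ballI conjI)
  fix l assume "l \<in> set (winl w G)"
  then obtain i a b where l: "i < w - 1" "(a, b) \<in> set G" "l = replicate i PI @ [a, b] @ replicate (w - 2 - i) PI"
    by (auto simp: winl_def)
  then show "length l = w" using assms(2) by auto
  have "emb k l = pr (k + i) a b" unfolding l(3) emb_append emb_replicate by (simp add: pr_def emb_replicate[simplified])
  then show "emb k l \<in> pcl N (cg N (set G))" using l assms(1) by (auto intro!: pcl_base cg_I)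
qed

text \<open>A window starting at bond j may overrun the right end; then the last window is used.
  Therefore the certificate has to produce the string at every offset inside the window.\<close>

lemma window_bond:
  assumes w: "2 \<le> w" "w \<le> N" and j: "Suc j < N"
    and chk: "\<forall>i\<in>set [0..<w - 1]. replicate i PI @ [a, b] @ replicate (w - 2 - i) PI \<in> set (derivl (winl w G) (winl w G) cert)"
  shows "pr j a b \<in> pcl N (cg N (set G))"
proof -
  define k where "k = min j (N - w)"
  have k: "k + w \<le> N" "k \<le> j" "j - k < w - 1" using w j by (auto simp: k_def)
  have "emb k (replicate (j - k) PI @ [a, b] @ replicate (w - 2 - (j - k)) PI) \<in> pcl N (cg N (set G))"
    by (rule window[OF k(1) w(1)]) (use chk k(3) in auto)
  moreover have "emb k (replicate (j - k) PI @ [a, b] @ replicate (w - 2 - (j - k)) PI) = pr j a b"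
    unfolding emb_append emb_replicate using k(2) by (simp add: pr_def emb_replicate[simplified])
  ultimately show ?thesis by simp
qed

lemma window_single:
  assumes w: "2 \<le> w" "w \<le> N" and j: "j < N"
    and chk: "\<forall>i\<in>set [0..<w]. replicate i PI @ [a] @ replicate (w - 1 - i) PI \<in> set (derivl (winl w G) (winl w G) cert)"
  shows "pt j a \<in> pcl N (cg N (set G))"
proof -
  define k where "k = min j (N - w)"
  have k: "k + w \<le> N" "k \<le> j" "j - k < w" using w j by (auto simp: k_def)
  have "emb k (replicate (j - k) PI @ [a] @ replicate (w - 1 - (j - k)) PI) \<in> pcl N (cg N (set G))"
    by (rule window[OF k(1) w(1)]) (use chk k(3) in auto)
  moreover have "emb k (replicate (j - k) PI @ [a] @ replicate (w - 1 - (j - k)) PI) = pt j a"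
    unfolding emb_append emb_replicate using k(2) by (simp add: emb_replicate[simplified])
  ultimately show ?thesis by simp
qed

lemma anti_ex: "g \<noteq> 0 \<Longrightarrow> \<exists>c. c \<noteq> 0 \<and> anti c g"
  by (cases g) (auto intro: exI[of _ PX] exI[of _ PY])

lemma ne0I: "f j \<noteq> 0 \<Longrightarrow> f \<noteq> (0 :: pstr)"
  by (auto simp: fun_app)

lemma cg_pcl_subset:
  assumes "\<And>a b j. (a, b) \<in> H \<Longrightarrow> Suc j < n \<Longrightarrow> (a, b) \<in> G \<or> pr j a b \<in> pcl n (cg n G)"
  shows "cg n H \<subseteq> pcl n (cg n G)"
proof
  fix x assume "x \<in> cg n H"
  then obtain a b j where "x = pr j a b" "(a, b) \<in> H" "Suc j < n" unfolding cg_def by blast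
  then show "x \<in> pcl n (cg n G)" using assms[of a b j] pcl_base[OF cg_I[of a b G j n]] by blast
qed

text \<open>Induction on the length: the new last letter is attached by a bond string whose first
  letter anticommutes with what stands at its left site. The parameter k0 keeps the first sites
  untouched, for chains where they carry central letters.\<close>

lemma local_full:
  assumes D: "pclosed n D" and s: "\<And>j a. k0 \<le> j \<Longrightarrow> j < n \<Longrightarrow> a \<noteq> 0 \<Longrightarrow> pt j a \<in> D"
    and p: "\<And>j. k0 \<le> j \<Longrightarrow> Suc j < n \<Longrightarrow> \<exists>a b. a \<noteq> 0 \<and> b \<noteq> 0 \<and> pr j a b \<in> D"
    and f: "f \<in> strs n" "f \<noteq> 0" "\<And>i. i < k0 \<Longrightarrow> f i = 0"
  shows "f \<in> D"
proof -
  \<comment> \<open>One bond string of weight two gives all of them, since single letters change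
    each of its letters at will.\<close>
  have pp: "pr j a b \<in> D" if j: "k0 \<le> j" "Suc j < n" and ab: "a \<noteq> 0" "b \<noteq> 0" for j a b
  proof -
    obtain a0 b0 where 0: "a0 \<noteq> 0" "b0 \<noteq> 0" "pr j a0 b0 \<in> D" using p[OF j] by blast
    have 1: "pr j a b0 \<in> D"
    proof (cases "a = a0")
      case False
      then have c: "a0 + a \<noteq> 0" "anti a0 (a0 + a)" using 0(1) ab by (cases a0; cases a; simp)+
      have "pr j a0 b0 + pt j (a0 + a) \<in> D" by (rule pclosedD[OF D 0(3) s]) (use c j in \<open>simp_all add: pr_apply\<close>)
      moreover have "pr j a0 b0 + pt j (a0 + a) = pr j a0 b0 + pr j (a0 + a) 0" by (simp add: pr_def)
      ultimately show ?thesis by (simp add: pr_add flip: add.assoc)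
    qed (use 0 in simp)
    show ?thesis
    proof (cases "b = b0")
      case False
      then have c: "b0 + b \<noteq> 0" "anti b0 (b0 + b)" using 0(2) ab by (cases b0; cases b; simp)+
      have "pr j a b0 + pt (Suc j) (b0 + b) \<in> D" by (rule pclosedD[OF D 1 s]) (use c j in \<open>simp_all add: pr_apply\<close>)
      moreover have "pr j a b0 + pt (Suc j) (b0 + b) = pr j a b0 + pr j 0 (b0 + b)" by (simp add: pr_def)
      ultimately show ?thesis by (simp add: pr_add flip: add.assoc)
    qed (use 1 in simp)
  qed
  have "\<forall>f\<in>strs m. f \<noteq> 0 \<and> (\<forall>i<k0. f i = 0) \<longrightarrow> f \<in> D" if "m \<le> n" for m
    using that
  proof (induction m)
    case 0 then show ?case by (simp add: strs_zero)
  next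
    case (Suc m)
    then have IH: "g \<in> D" if "g \<in> strs m" "g \<noteq> 0" "\<forall>i<k0. g i = 0" for g using that by simp
    show ?case
    proof (intro ballI impI)
      fix f assume f: "f \<in> strs (Suc m)" "f \<noteq> 0 \<and> (\<forall>i<k0. f i = 0)"
      define b g where "b = f m" and "g = f + pt m (f m)"
      have fg: "f = g + pt m b" by (simp add: b_def g_def add.assoc)
      have "g i = 0" if "m \<le> i" for i using f(1) that by (cases "i = m") (auto simp: g_def fun_app strs_def)
      then have gm: "g \<in> strs m" by (simp add: strs_def)
      have g0: "\<forall>i<k0. g i = 0" using f(2) unfolding g_def by (auto simp: fun_app)
      show "f \<in> D"
      proof (cases "b = 0 \<or> g = 0")
        case True
        then consider "f = g" | "f = pt m b" "b \<noteq> 0" using fg f(2) by (cases "b = 0") auto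
        then show ?thesis
        proof cases
          case 1 then show ?thesis using IH[OF gm _ g0] f(2) by simp
        next
          case 2
          have "k0 \<le> m"
          proof (rule ccontr)
            assume "\<not> k0 \<le> m"
            then have "f m = 0" using f(2) by simp
            then show False using 2(2) by (simp add: b_def)
          qed
          then show ?thesis using 2 s Suc.prems by simp
        qed
      next
        case False
        then have b: "b \<noteq> 0" and gne: "g \<noteq> 0" by auto
        obtain i0 where i0: "g i0 \<noteq> 0" using gne by (auto simp: fun_eq_iff fun_app)
        have i0m: "k0 \<le> i0" "i0 < m" using i0 g0 gm by (auto simp: strs_def not_le[symmetric])
        then obtain j where j: "m = Suc j" "k0 \<le> j" by (cases m) auto
        \<comment> \<open>The letter c at site j is inserted into g and removed again by the bond
          string c b, which thereby attaches b.\<close>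
        have step: "g + pt m b \<in> D" if g: "g \<in> strs m" "\<forall>i<k0. g i = 0" "g j \<noteq> 0" for g
        proof -
          obtain c where c: "c \<noteq> 0" "anti c (g j)" using anti_ex g(3) by blast
          have "(g + pt j c) j \<noteq> 0" using c by (simp add: fun_app) (cases c; cases "g j"; simp)
          then have "g + pt j c \<noteq> 0" by (rule ne0I)
          moreover have "\<forall>i<k0. (g + pt j c) i = 0" using g(2) j by (simp add: fun_app)
          ultimately have "g + pt j c \<in> D" using g(1) j by (intro IH) simp_all
          moreover have "pr j c b \<in> D" using j Suc.prems c b by (intro pp) simp_all
          moreover have "bc n (g + pt j c) (pr j c b)"
          proof -
            have "g (Suc j) = 0" using g(1) j by (simp add: strs_def)
            then show ?thesis using j Suc.prems c(2) anti_sym[of c "g j"] by (simp add: bc_add bc_pr2) (simp add: fun_app anti_add)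
          qed
          ultimately have "g + pt j c + pr j c b \<in> D" by (rule pclosedD[OF D])
          moreover have "g + pt j c + pr j c b = g + pt m b" by (simp add: pr_def j ac_simps pstr_dbl2)
          ultimately show ?thesis by simp
        qed
        show ?thesis
        proof (cases "g j = 0")
          case False then show ?thesis unfolding fg by (rule step[OF gm g0])
        next
          case True
          obtain c where c: "c \<noteq> 0" "anti c (g i0)" using anti_ex i0 by blast
          have ij: "i0 \<noteq> j" using i0 True by auto
          \<comment> \<open>When g has no letter at j, h lends it a Z there; h anticommutes with g
            through site i0 and can be taken away at the end.\<close>
          let ?h = "pt i0 c + pt j PZ"
          have hs: "?h \<in> strs m" using i0m j by simp
          have hne: "?h j \<noteq> 0" using ij by (simp add: fun_app)
          then have hn: "?h \<noteq> 0" by (rule ne0I)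
          have h0: "\<forall>i<k0. ?h i = 0" using i0m j by (simp add: fun_app)
          have "g + ?h + pt m b \<in> D"
            by (rule step) (use gm hs g0 h0 True hne in \<open>simp_all add: fun_app\<close>)
          moreover have "?h \<in> D" using hs hn h0 by (rule IH)
          moreover have "bc n (g + ?h + pt m b) ?h"
          proof -
            have "bc n g ?h" using c True i0m j Suc.prems anti_sym[of c] by (simp add: bc_add2)
            moreover have "\<not> bc n (pt m b) ?h" using i0m j by (simp add: bc_add2)
            ultimately show ?thesis by (simp add: bc_add)
          qed
          ultimately have "g + ?h + pt m b + ?h \<in> D" by (rule pclosedD[OF D])
          moreover have "g + ?h + pt m b + ?h = f" unfolding fg by (simp add: ac_simps pstr_dbl2)
          ultimately show ?thesis by simp
        qed
      qed
    qed
  qed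
  from this[of n] show ?thesis using f by blast
qed

text \<open>Multiplying by \<open>cons 0 (h + h')\<close> moves from tail h to an anticommuting tail
  h'. Two such moves join any two nonzero tails, because some w anticommutes with both: one of u, v,
  u + v does.\<close>

lemma doubling:
  assumes D: "pclosed (Suc K) D" and all: "\<And>g. g \<in> strs K \<Longrightarrow> g \<noteq> 0 \<Longrightarrow> cons 0 g \<in> D"
    and g0: "cons x g0 \<in> D" "g0 \<in> strs K" "g0 \<noteq> 0" and g: "g \<in> strs K" "g \<noteq> 0"
  shows "cons x g \<in> D"
proof -
  have step: "cons x h' \<in> D" if h: "cons x h \<in> D" "h \<in> strs K" "h' \<in> strs K" "bc K h h'" for h h'
  proof -
    have "h + h' \<noteq> 0" using h(4) pstr_dbl2[of h h'] by fastforce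
    then have "cons 0 (h + h') \<in> D" using all h by simp
    then have "cons x h + cons 0 (h + h') \<in> D" using h by (intro pclosedD[OF D]) (simp_all add: bc_cons bc_add2)
    then show ?thesis by (simp add: cons_add pstr_dbl2)
  qed
  obtain u where u: "u \<in> strs K" "bc K g0 u" using strs_nondeg[OF g0(2,3)] by blast
  obtain v where v: "v \<in> strs K" "bc K v g" using strs_nondeg[OF g] bc_sym by metis
  have "\<exists>w\<in>strs K. bc K g0 w \<and> bc K w g"
  proof (cases "bc K u g \<or> bc K g0 v")
    case True then show ?thesis using u v by blast
  next
    case False then show ?thesis using u v by (intro bexI[of _ "u + v"]) (simp_all add: bc_add bc_add2)
  qed
  then show ?thesis using step[OF g0(1,2)] step g(1) by blast
qed

text \<open>The certificate yields X and Z at each of four consecutive sites, hence every single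
  letter. A generator with two nontrivial letters supplies the bonds, and nonzero first letters
  exclude the identity string.\<close>

lemma aa_su:
  assumes n: "4 \<le> n" and G: "a_gens k = set G"
    and chk: "\<forall>i\<in>set [0..<4]. \<forall>a\<in>{PX, PZ}. replicate i PI @ [a] @ replicate (4 - 1 - i) PI \<in> set (derivl (winl 4 G) (winl 4 G) cert)"
    and p: "(a, b) \<in> set G" "\<forall>(a, b)\<in>set G. a \<noteq> 0" "b \<noteq> 0"
  shows "aa k n = su_alg (2 ^ n)"
proof -
  let ?D = "pcl n (cg n (set G))"
  have s: "pt j c \<in> ?D" if "j < n" "c \<noteq> 0" for j c
  proof -
    have x: "pt j PX \<in> ?D" "pt j PZ \<in> ?D" using n that(1) chk by (intro window_single[where w = 4 and cert = cert]; simp)+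
    have "pt j PX + pt j PZ \<in> ?D" by (rule pcl_step[OF x]) (use that in simp)
    then have "pt j PY \<in> ?D" unfolding pt_add by simp
    then show ?thesis using x that(2) by (cases c) auto
  qed
  have b: "\<exists>a b. a \<noteq> 0 \<and> b \<noteq> 0 \<and> pr j a b \<in> ?D" if "Suc j < n" for j
    using p that by (intro exI[of _ a] exI[of _ b]) (auto intro!: pcl_base cg_I)
  have "f \<in> ?D" if "f \<in> strs n - {0}" for f
    by (rule local_full[where ?k0.0 = 0, OF pcl_closed s b]) (use that in auto)
  moreover have "?D \<subseteq> strs n - {0}"
  proof (rule pcl_least[OF _ pclosed_nz])
    have "pr j a b \<noteq> 0" if "(a, b) \<in> set G" for j a b
    proof
      assume "pr j a b = 0"
      then have "pr j a b j = 0" by (simp add: fun_app)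
      then show False using that p(2) by (auto simp: pr_apply)
    qed
    then show "cg n (set G) \<subseteq> strs n - {0}" using cg_strs[of n "set G"] by (auto simp: cg_def)
  qed
  ultimately have "?D = strs n - {0}" by blast
  then show ?thesis by (simp add: aa_pcl G su_alg_spanR)
qed

lemmas eval_win = winl_def upt_num replicate_num a_gens_def

lemma aa_12: "4 \<le> n \<Longrightarrow> aa 12 n = su_alg (2 ^ n)"
  by (rule aa_su[of n 12 "[(PX,PX), (PX,PY), (PY,PZ)]"
      "[(1,0), (3,1), (4,1), (4,3), (6,4), (7,6), (4,9), (2,10), (6,11), (7,12), (5,13), (5,15), (4,16), (5,17), (8,18), (7,19), (5,21), (7,22), (8,24), (2,25), (8,26), (5,27), (5,29), (2,31)]"
      PX PX]) (simp_all add: eval_win)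

lemma aa_17: "4 \<le> n \<Longrightarrow> aa 17 n = su_alg (2 ^ n)"
  by (rule aa_su[of n 17 "[(PX,PX), (PX,PY), (PZ,PX)]"
      "[(1,0), (4,1), (4,3), (7,6), (2,9), (3,9), (4,9), (5,10), (6,11), (4,13), (5,14), (7,15), (2,16), (8,17), (5,18), (8,20), (6,21), (1,23), (4,24), (8,25), (6,26), (5,27), (5,28), (8,29), (8,30), (1,31), (5,32), (6,33), (2,35), (7,36)]"
      PX PX]) (simp_all add: eval_win)

lemma aa_18: "4 \<le> n \<Longrightarrow> aa 18 n = su_alg (2 ^ n)"
  by (rule aa_su[of n 18 "[(PX,PX), (PX,PZ), (PY,PY), (PZ,PY)]"
      "[(1,0), (6,1), (3,2), (5,4), (7,6), (11,10), (4,12), (7,12), (7,13), (8,15), (9,15), (7,18), (6,19), (2,20), (11,21), (11,22)]"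
      PX PX]) (simp_all add: eval_win)

lemma aa_19: "4 \<le> n \<Longrightarrow> aa 19 n = su_alg (2 ^ n)"
  by (rule aa_su[of n 19 "[(PX,PX), (PX,PY), (PZ,PX), (PY,PZ)]"
      "[(1,0), (6,0), (6,2), (5,4), (9,8), (4,12), (5,12), (4,13), (4,14), (9,15), (6,17), (7,18), (3,19), (3,20), (11,21)]"
      PX PX]) (simp_all add: eval_win)

lemma aa_21: "4 \<le> n \<Longrightarrow> aa 21 n = su_alg (2 ^ n)"
  by (rule aa_su[of n 21 "[(PX,PX), (PY,PY), (PX,PY), (PZ,PX)]"
      "[(2,0), (2,1), (6,4), (9,4), (10,8), (1,12), (4,12), (8,14), (11,15), (3,17), (7,18), (11,19), (5,20), (7,24), (11,25), (8,26), (10,27)]"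
      PX PX]) (simp_all add: eval_win)

lemma aa_22: "4 \<le> n \<Longrightarrow> aa 22 n = su_alg (2 ^ n)"
  by (rule aa_su[of n 22 "[(PX,PX), (PX,PY), (PX,PZ), (PY,PX)]"
      "[(1,0), (3,0), (2,1), (5,4), (6,5), (9,8), (10,9), (3,12), (5,19), (2,20), (0,21), (6,22), (2,23), (7,24), (3,25)]"
      PX PX]) (simp_all add: eval_win)

text \<open>The two sets differ by ZY, which a window of four sites derives from the generators of
  a11 at every offset.\<close>

theorem aa_11_16: "4 \<le> n \<Longrightarrow> aa 11 n = so_alg (2 ^ n)" "4 \<le> n \<Longrightarrow> aa 16 n = so_alg (2 ^ n)"
proof -
  assume n: "4 \<le> n"
  show 11: "aa 11 n = so_alg (2 ^ n)"
    using pcl_G11[OF n] by (simp add: aa_pcl so_alg_spanR a_gens_def G11_def)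
  have 1: "pr j PZ PY \<in> pcl n (cg n (set [(PX,PY), (PY,PX), (PY,PZ)]))" if "Suc j < n" for j
    by (rule window_bond[of 4 _ _ _ _ _ "[(3,0), (2,1), (5,4), (2,9), (3,10), (6,11), (1,12), (6,15), (3,16), (2,17), (4,18), (5,19), (6,20), (3,21)]"])
      (use n that in \<open>simp_all add: eval_win\<close>)
  have "pcl n (cg n (a_gens 16)) = pcl n (cg n (a_gens 11))"
  proof (rule pcl_eqI)
    have "a_gens 11 = set [(PX,PY), (PY,PX), (PY,PZ)]" "a_gens 16 = {(PX,PY),(PY,PX),(PY,PZ),(PZ,PY)}" by (simp_all add: a_gens_def)
    then show "cg n (a_gens 16) \<subseteq> pcl n (cg n (a_gens 11))"
      using 1 by (intro cg_pcl_subset) auto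
    show "cg n (a_gens 11) \<subseteq> pcl n (cg n (a_gens 16))"
      by (rule cg_pcl_subset) (auto simp: a_gens_def)
  qed
  then show "aa 16 n = so_alg (2 ^ n)" using 11 by (simp add: aa_pcl)
qed

text \<open>Windows of three sites suffice: one certificate derives ZY and ZZ from a13, the other
  derives YZ from a20.\<close>

lemma pcl_13_20: "3 \<le> n \<Longrightarrow> pcl n (cg n (a_gens 20)) = pcl n (cg n (a_gens 13))"
proof -
  assume n: "3 \<le> n"
  have 1: "pr j PZ a \<in> pcl n (cg n (set [(PX,PX), (PY,PY), (PY,PZ)]))" if "Suc j < n" "a \<in> {PY, PZ}" for j a
    by (rule window_bond[of 3 _ _ _ _ _ "[(4,0), (2,1), (2,6), (4,7), (5,7), (1,8), (3,8), (5,11), (5,12), (2,13), (3,15)]"])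
      (use n that in \<open>auto simp: eval_win\<close>)
  have 2: "pr j PY PZ \<in> pcl n (cg n (set [(PX,PX), (PY,PY), (PZ,PZ), (PZ,PY)]))" if "Suc j < n" for j
    by (rule window_bond[of 3 _ _ _ _ _ "[(3,1), (3,2), (2,8), (6,9)]"])
      (use n that in \<open>simp_all add: eval_win\<close>)
  show ?thesis
  proof (rule pcl_eqI)
    have e: "a_gens 13 = set [(PX,PX), (PY,PY), (PY,PZ)]" "a_gens 20 = set [(PX,PX), (PY,PY), (PZ,PZ), (PZ,PY)]" by (simp_all add: a_gens_def)
    show "cg n (a_gens 20) \<subseteq> pcl n (cg n (a_gens 13))"
      unfolding e(1) by (rule cg_pcl_subset) (use 1 in \<open>auto simp: a_gens_def\<close>)
    show "cg n (a_gens 13) \<subseteq> pcl n (cg n (a_gens 20))"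
      unfolding e(2) by (rule cg_pcl_subset) (use 2 in \<open>auto simp: a_gens_def\<close>)
  qed
qed

section \<open>Chains with a central first or global letter\<close>

lemma cons_pt: "cons a 0 = pt 0 a" "cons 0 (pt j b) = pt (Suc j) b" "cons a (pt 0 b) = pr 0 a b"
  and cons_pr: "cons 0 (pr j a b) = pr (Suc j) a b"
  by (rule ext, simp add: cons_def fun_app pr_apply split: nat.split)+

lemma X_head:
  assumes G: "\<And>a b. (a, b) \<in> G \<Longrightarrow> a = PX" and f: "f \<in> pcl n (cg n G)"
  shows "f 0 = 0 \<or> f 0 = PX"
proof -
  have "pcl n (cg n G) \<subseteq> {f. f 0 = 0 \<or> f 0 = PX}"
  proof (rule pcl_least)
    show "cg n G \<subseteq> {f. f 0 = 0 \<or> f 0 = PX}" using G by (auto simp: cg_def pr_apply)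
    show "pclosed n {f. f 0 = 0 \<or> f 0 = PX}" by (rule pclosedI) (auto simp: fun_app)
  qed
  then show ?thesis using f by blast
qed

text \<open>Every generator begins with X, so site 0 carries only I or X in the whole closure and X
  at site 0 is central. It splits off as u(1) if it is not already generated.\<close>

lemma add_center:
  assumes G: "\<And>a b. (a, b) \<in> G \<Longrightarrow> a = PX" and n: "1 \<le> n" and no: "pt 0 PX \<notin> pcl n (cg n G)"
    and iso: "spanR n (pcl n (cg n G)) \<cong>\<^sub>L L" and L: "L \<subseteq> carrier_mat N N"
  shows "spanR n (pcl n (cg n G \<union> {pt 0 PX})) \<cong>\<^sub>L L \<oplus>\<^sub>L u1"
proof -
  have com: "\<not> bc n f g" if "f \<in> pcl n (cg n G)" "g \<in> {pt 0 PX}" for f g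
  proof -
    have "f 0 = 0 \<or> f 0 = PX" by (rule X_head[OF _ that(1)]) (rule G)
    then show ?thesis using that(2) by auto
  qed
  have p: "pcl n {pt 0 PX} = {pt 0 PX}" by (rule abelian_pcl) simp
  have "pcl n (cg n G \<union> {pt 0 PX}) = pcl n (cg n G) \<union> {pt 0 PX}"
    using pcl_Un[of n "cg n G" "{pt 0 PX}"] com unfolding p by blast
  moreover have "pclosed n {pt 0 PX}" by (rule pclosedI) simp
  moreover have "spanR n {pt 0 PX} \<cong>\<^sub>L u1" by (rule spanR_single_u1) (use n in simp)
  ultimately show ?thesis
    using spanR_union[OF pcl_strs[OF cg_strs] _ _ pcl_closed _ com iso _ L u1_carrier, of "{pt 0 PX}"] no n by simp
qed

text \<open>XY and XZ on a bond multiply to X on its right site, and conversely that X turns XY into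
  XZ. Only X at site 0 lies to the right of no bond and has to be adjoined separately.\<close>

lemma center_eq:
  assumes n: "2 \<le> n"
  shows "pcl n (cg n (insert (PX, PI) (insert (PI, PX) (insert (PX, PY) C))))
    = pcl n (cg n (insert (PX, PY) (insert (PX, PZ) C)) \<union> {pt 0 PX})" (is "pcl n ?A = pcl n ?B")
proof (rule pcl_eqI)
  have A: "?A = {pt j PX | j. j < n} \<union> ({pr j PX PY | j. Suc j < n} \<union> cg n C)"
    by (simp only: cg_singles[OF n] cg_insert[of n PX PY])
  have B: "?B = {pr j PX PY | j. Suc j < n} \<union> ({pr j PX PZ | j. Suc j < n} \<union> cg n C) \<union> {pt 0 PX}"
    unfolding cg_insert ..
  have a1: "pt j PX \<in> pcl n ?B" if j: "j < n" for j
  proof (cases j)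
    case 0 then show ?thesis by (intro pcl_base) simp
  next
    case (Suc i)
    then have i: "Suc i < n" using j by simp
    then have "pr i PX PY \<in> pcl n ?B" "pr i PX PZ \<in> pcl n ?B" unfolding B by (auto intro!: pcl_base)
    then have "pr i PX PY + pr i PX PZ \<in> pcl n ?B" by (rule pcl_step) (use i in \<open>simp add: bc_pr pr_apply\<close>)
    moreover have "pr i PX PY + pr i PX PZ = pt j PX" unfolding pr_add by (simp add: pr_def Suc)
    ultimately show ?thesis by simp
  qed
  have "{pr j PX PY | j. Suc j < n} \<union> cg n C \<subseteq> ?B" unfolding B by blast
  then have "{pr j PX PY | j. Suc j < n} \<union> cg n C \<subseteq> pcl n ?B" using pcl_base by blast
  then show "?A \<subseteq> pcl n ?B" unfolding A using a1 by blast
  have b1: "pr j PX PZ \<in> pcl n ?A" if j: "Suc j < n" for j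
  proof -
    have "pr j PX PY \<in> pcl n ?A" "pt (Suc j) PX \<in> pcl n ?A" unfolding A using j by (auto intro!: pcl_base)
    then have "pr j PX PY + pt (Suc j) PX \<in> pcl n ?A" by (rule pcl_step) (use j in \<open>simp add: pr_apply\<close>)
    moreover have "pr j PX PY + pt (Suc j) PX = pr j PX PZ" by (simp add: pr_def add.assoc pt_add)
    ultimately show ?thesis by simp
  qed
  have "{pr j PX PY | j. Suc j < n} \<union> cg n C \<union> {pt 0 PX} \<subseteq> ?A" unfolding A using n by auto
  then have "{pr j PX PY | j. Suc j < n} \<union> cg n C \<union> {pt 0 PX} \<subseteq> pcl n ?A" using pcl_base by blast
  then show "?B \<subseteq> pcl n ?A" unfolding B using b1 by blast
qed

text \<open>In the chain XY, XZ the first letter is determined by the second: it is X exactly if the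
  second anticommutes with X. This holds on generators and is linear, so the first site carries no
  information.\<close>

definition hd9 :: "pstr \<Rightarrow> pstr" where "hd9 u = cons (if anti (u 0) PX then PX else 0) u"

lemma hd9_add: "hd9 (u + v) = hd9 u + hd9 v"
  unfolding hd9_def cons_add by (simp add: fun_app anti_add)

lemma hd9_bc: "bc (Suc K) (hd9 u) (hd9 v) = bc K u v"
  by (simp add: hd9_def bc_cons)

lemma hd9_ag: "hd9 ` ag K = cg (Suc K) {(PX, PY), (PX, PZ)}" if K: "1 \<le> K"
proof -
  have 1: "hd9 (pt 0 PY) = pr 0 PX PY" "hd9 (pt 0 PZ) = pr 0 PX PZ" by (simp_all add: hd9_def cons_pt)
  have 2: "hd9 (pr j PX b) = pr (Suc j) PX b" for j b by (simp add: hd9_def cons_pr pr_apply)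
  show ?thesis
  proof (intro equalityI subsetI)
    fix x assume "x \<in> hd9 ` ag K"
    then consider "x = pr 0 PX PY" | "x = pr 0 PX PZ" | j b where "x = pr (Suc j) PX b" "Suc j < K" "b \<in> {PY, PZ}"
      unfolding ag_def using 1 2 by auto
    then show "x \<in> cg (Suc K) {(PX, PY), (PX, PZ)}" using K by cases (auto intro!: cg_I)
  next
    fix x assume "x \<in> cg (Suc K) {(PX, PY), (PX, PZ)}"
    then obtain j b where x: "x = pr j PX b" "b \<in> {PY, PZ}" "j < K" unfolding cg_def by auto
    show "x \<in> hd9 ` ag K"
    proof (cases j)
      case 0
      then have "x = hd9 (pt 0 b)" "pt 0 b \<in> ag K" using x 1 by (auto simp: ag_def)
      then show ?thesis by blast
    next
      case (Suc i)
      then have "x = hd9 (pr i PX b)" "pr i PX b \<in> ag K" using x 2 by (auto intro: ag_I)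
      then show ?thesis by blast
    qed
  qed
qed

text \<open>Only site 0, where the twist is Y, contributes; Arf invariant one puts the chain on the
  symplectic side.\<close>

lemma yodd_c9: "yodd (Suc m) (lets (Suc m) (qf (Suc m) c9))"
proof -
  have "yodd (Suc m) (lets (Suc m) (qf (Suc m) c9)) = yodd (Suc m) (\<lambda>j. if j = 0 then PY else 0)"
    by (rule yodd_lets) (auto simp: qf_def c9_def)
  also have "(\<lambda>j. if j = 0 then PY else 0) = pt 0 PY" by (simp add: pt_def)
  finally show ?thesis by (simp only: yodd_pt) simp
qed

text \<open>The second claim serves b2: a string X at site 0 would need an empty tail, for which
  \<open>hd9\<close> supplies no X.\<close>

theorem aa_9:
  assumes n: "3 \<le> n"
  shows "aa 9 n \<cong>\<^sub>L sp_alg (2 ^ (n - 2))" and "pt 0 PX \<notin> pcl n (cg n {(PX, PY), (PX, PZ)})"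
proof -
  obtain m where m: "n = Suc (Suc m)" using Suc_SucE[of n] n by auto
  let ?K = "Suc m"
  have ag: "ag ?K \<subseteq> strs ?K" unfolding ag_def by auto
  have "pcl n (cg n {(PX, PY), (PX, PZ)}) = pcl (Suc ?K) (hd9 ` ag ?K)" using hd9_ag[of ?K] by (simp add: m)
  also have "\<dots> = hd9 ` pcl ?K (ag ?K)" by (rule pcl_image[OF ag]) (simp_all add: hd9_add hd9_bc)
  finally have D: "pcl n (cg n {(PX, PY), (PX, PZ)}) = hd9 ` {u \<in> strs ?K. qf ?K c9 u}" using pcl_ag[of ?K] n m by simp
  have c1: "spanR (Suc ?K) (hd9 ` {u \<in> strs ?K. qf ?K c9 u}) \<cong>\<^sub>L spanR ?K {u \<in> strs ?K. qf ?K c9 u}"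
  proof (rule frame_iso(2)[OF order_refl gspan_strs])
    show "pclosed ?K {u \<in> strs ?K. qf ?K c9 u}" by (rule pclosed_qf) simp
    show "inj_on hd9 {u \<in> strs ?K. qf ?K c9 u}" by (rule inj_onI) (simp add: hd9_def)
  qed (auto simp: hd9_add hd9_bc, simp add: hd9_def)
  have c2: "spanR ?K {u \<in> strs ?K. qf ?K c9 u} \<cong>\<^sub>L sp_alg (2 ^ m)"
    by (rule quad_sp(1)[OF pq.q_add yodd_c9])
  have "spanR n (pcl n (cg n {(PX, PY), (PX, PZ)})) \<cong>\<^sub>L sp_alg (2 ^ m)"
    unfolding D using lie_iso_trans[OF c1 c2] m by simp
  then show "aa 9 n \<cong>\<^sub>L sp_alg (2 ^ (n - 2))" by (simp add: aa_pcl a_gens_def m)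
  show "pt 0 PX \<notin> pcl n (cg n {(PX, PY), (PX, PZ)})"
  proof
    assume "pt 0 PX \<in> pcl n (cg n {(PX, PY), (PX, PZ)})"
    then obtain u where u: "cons PX 0 = hd9 u" unfolding D cons_pt(1) by blast
    then show False unfolding hd9_def by (auto simp: fun_app)
  qed
qed

theorem bb_2:
  assumes n: "3 \<le> n"
  shows "bb 2 n \<cong>\<^sub>L sp_alg (2 ^ (n - 2)) \<oplus>\<^sub>L u1"
proof -
  have "spanR n (pcl n (cg n {(PX, PY), (PX, PZ)})) \<cong>\<^sub>L sp_alg (2 ^ (n - 2))"
    using aa_9(1)[OF n] by (simp add: aa_pcl a_gens_def)
  from add_center[OF _ _ aa_9(2)[OF n] this sp_alg_carrier]
  have "spanR n (pcl n (cg n {(PX, PY), (PX, PZ)} \<union> {pt 0 PX})) \<cong>\<^sub>L sp_alg (2 ^ (n - 2)) \<oplus>\<^sub>L u1" using n by auto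
  then show ?thesis using center_eq[of n "{}"] n by (simp add: bb_pcl b_gens_def insert_commute)
qed

text \<open>The letter x is X where the chain itself has a central first site, and Z where the set
  is to be split into diagonal blocks.\<close>

definition heads :: "nat \<Rightarrow> pauli \<Rightarrow> pstr set" where
  "heads K x = {cons a g | a g. a \<in> {0, x} \<and> g \<in> strs K - {0}}"

lemma heads_dbl: "heads K PZ = dbl (strs K - {0})"
  by (auto simp: heads_def dbl_def)

lemma heads_I: "a \<in> {0, x} \<Longrightarrow> g \<in> strs K \<Longrightarrow> g \<noteq> 0 \<Longrightarrow> cons a g \<in> heads K x"
  unfolding heads_def by blast

lemma heads_E:
  assumes "u \<in> heads K x"
  obtains a g where "u = cons a g" "a \<in> {0, x}" "g \<in> strs K" "g \<noteq> 0"
  using assms unfolding heads_def by blast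

lemma pclosed_heads: "pclosed (Suc K) (heads K x)"
proof (rule pclosedI)
  fix u v assume uv: "u \<in> heads K x" "v \<in> heads K x" "bc (Suc K) u v"
  obtain a g where u: "u = cons a g" "a \<in> {0, x}" "g \<in> strs K" using uv(1) by (rule heads_E)
  obtain b h where v: "v = cons b h" "b \<in> {0, x}" "h \<in> strs K" using uv(2) by (rule heads_E)
  have "bc K g h" using uv(3) u(2) v(2) unfolding u(1) v(1) bc_cons by auto
  then have "g + h \<noteq> 0" using pstr_dbl2[of g h] by fastforce
  moreover have "a + b \<in> {0, x}" using u(2) v(2) by auto
  ultimately show "u + v \<in> heads K x" unfolding u(1) v(1) cons_add using u(3) v(3) by (intro heads_I) auto
qed

lemma pr_ne0: "a \<noteq> 0 \<Longrightarrow> pr j a b \<noteq> 0"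
proof
  assume "a \<noteq> 0" "pr j a b = 0"
  then have "pr j a b j = 0" by (simp add: fun_app)
  then show False using \<open>a \<noteq> 0\<close> by (simp add: pr_apply)
qed

lemma pt_ne0: "a \<noteq> 0 \<Longrightarrow> pt j a \<noteq> 0"
  using pr_ne0[of a j 0] by (simp add: pr_def)

lemma cons_local_full:
  assumes D: "pclosed (Suc K) D" and s: "\<And>j a. j < K \<Longrightarrow> a \<noteq> 0 \<Longrightarrow> pt (Suc j) a \<in> D"
    and p: "\<And>j. Suc j < K \<Longrightarrow> pr (Suc j) PX PX \<in> D" and g: "g \<in> strs K" "g \<noteq> 0"
  shows "cons 0 g \<in> D"
proof (rule local_full[where ?k0.0 = 1, OF D])
  show "pt j a \<in> D" if "1 \<le> j" "j < Suc K" "a \<noteq> 0" for j a using s[of "j - 1" a] that by simp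
  show "\<exists>a b. a \<noteq> 0 \<and> b \<noteq> 0 \<and> pr j a b \<in> D" if "1 \<le> j" "Suc j < Suc K" for j
    using p[of "j - 1"] that by (intro exI[of _ PX]) simp
  show "cons 0 g \<noteq> 0" using g(2) cons_eq[of 0 g 0 0] by simp
qed (use g in auto)

text \<open>Two generators on one bond multiply to any letter on its right site, so everything away
  from site 0 is generated; \<open>doubling\<close>, started at XX on bond 0, then attaches X at
  site 0 to every nonzero tail.\<close>

lemma pcl_15: "1 \<le> K \<Longrightarrow> pcl (Suc K) (cg (Suc K) {(PX, PX), (PX, PY), (PX, PZ)}) = heads K PX"
proof
  let ?G = "{(PX, PX), (PX, PY), (PX, PZ)}"
  let ?D = "pcl (Suc K) (cg (Suc K) ?G)"
  assume K: "1 \<le> K"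
  have b: "pr j PX a \<in> ?D" if "j < K" "a \<noteq> 0" for j a
    using that by (cases a) (auto intro!: pcl_base cg_I)
  show "?D \<subseteq> heads K PX"
  proof (rule pcl_least[OF _ pclosed_heads])
    show "cg (Suc K) ?G \<subseteq> heads K PX"
    proof
      fix x assume "x \<in> cg (Suc K) ?G"
      then obtain j a where x: "x = pr j PX a" "j < K" "a \<noteq> 0" unfolding cg_def by auto
      show "x \<in> heads K PX"
      proof (cases j)
        case 0
        then show ?thesis using x pt_ne0[of a 0] unfolding x(1) by (simp only: cons_pt(3)[symmetric]) (intro heads_I; simp)
      next
        case (Suc i)
        then show ?thesis using x pr_ne0[of PX i a] unfolding x(1) Suc cons_pr[symmetric] by (intro heads_I) simp_all
      qed
    qed
  qed
  have s: "pt (Suc j) a \<in> ?D" if j: "j < K" and a: "a \<noteq> 0" for j a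
  proof -
    obtain c d where cd: "c \<noteq> 0" "d \<noteq> 0" "c + d = a" "anti c d" using a
      by (cases a) (auto intro: that[of PX PY] that[of PX PZ] that[of PY PZ])
    have "pr j PX c + pr j PX d \<in> ?D" by (rule pcl_step[OF b b]) (use j cd in \<open>simp_all add: bc_pr pr_apply\<close>)
    then show ?thesis unfolding pr_add cd(3) by (simp add: pr_def)
  qed
  have 0: "cons 0 g \<in> ?D" if "g \<in> strs K" "g \<noteq> 0" for g
    by (rule cons_local_full[OF pcl_closed s _ that]) (use b in auto)
  have seed: "cons PX (pt 0 PX) \<in> ?D" unfolding cons_pt(3) using b K by simp
  have "cons PX g \<in> ?D" if "g \<in> strs K" "g \<noteq> 0" for g
    by (rule doubling[OF pcl_closed 0 seed _ _ that]) (use K pt_ne0 in auto)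
  then show "heads K PX \<subseteq> ?D" using 0 by (auto elim!: heads_E)
qed

text \<open>The action of the Hadamard gate with signs forgotten; it makes the central letter
  diagonal.\<close>

definition swz :: "pauli \<Rightarrow> pauli" where "swz a = (if a = PX then PZ else if a = PZ then PX else a)"

lemma swz: "swz (a + b) = swz a + swz b" "anti (swz a) (swz b) = anti a b" "swz 0 = 0"
  by (cases a; cases b; simp add: swz_def)+

lemma heads_su: "spanR (Suc K) (heads K PX) \<cong>\<^sub>L su_alg (2 ^ K) \<oplus>\<^sub>L su_alg (2 ^ K)"
proof -
  let ?\<Psi> = "\<lambda>f. cons (swz (f 0)) (\<lambda>i. f (Suc i))"
  have t: "(\<lambda>i. cons a f (Suc i)) = f" for a f by (rule ext) simp
  have im: "?\<Psi> ` heads K PX = dbl (strs K - {0})"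
  proof (intro equalityI subsetI)
    fix x assume "x \<in> ?\<Psi> ` heads K PX"
    then obtain u where u: "u \<in> heads K PX" "x = ?\<Psi> u" by blast
    obtain a g where "u = cons a g" "a \<in> {0, PX}" "g \<in> strs K" "g \<noteq> 0" using u(1) by (rule heads_E)
    then show "x \<in> dbl (strs K - {0})" unfolding heads_dbl[symmetric] u(2) by (auto simp: t swz_def intro!: heads_I)
  next
    fix x assume "x \<in> dbl (strs K - {0})"
    then obtain a g where x: "x = cons a g" "a \<in> {0, PZ}" "g \<in> strs K" "g \<noteq> 0" unfolding heads_dbl[symmetric] by (rule heads_E)
    have "cons (swz a) g \<in> heads K PX" using x by (intro heads_I) (auto simp: swz_def)
    moreover have "x = ?\<Psi> (cons (swz a) g)" using x(1,2) by (auto simp: t swz_def)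
    ultimately show "x \<in> ?\<Psi> ` heads K PX" by blast
  qed
  have "spanR (Suc K) (heads K PX) \<cong>\<^sub>L spanR (Suc K) (?\<Psi> ` heads K PX)"
  proof (rule frame_iso(1)[OF order_refl gspan_strs _ _ _ _ pclosed_heads])
    show "?\<Psi> f \<in> strs (Suc K)" if "f \<in> strs (Suc K)" for f using that by (auto simp: strs_def cons_def split: nat.split)
    show "?\<Psi> (f + g) = ?\<Psi> f + ?\<Psi> g" for f g :: pstr
      by (simp add: cons_add fun_app swz) (simp add: fun_eq_iff fun_app)
    show "bc (Suc K) (?\<Psi> f) (?\<Psi> g) = bc (Suc K) f g" for f g
    proof -
      have "bc (Suc K) (?\<Psi> f) (?\<Psi> g) = (anti (f 0) (g 0) \<noteq> bc K (\<lambda>i. f (Suc i)) (\<lambda>i. g (Suc i)))"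
        by (simp only: bc_cons swz)
      also have "\<dots> = bc (Suc K) f g"
        using bc_cons[of K "f 0" "\<lambda>i. f (Suc i)" "g 0" "\<lambda>i. g (Suc i)"] unfolding cons_collapse by simp
      finally show ?thesis .
    qed
    show "heads K PX \<subseteq> strs (Suc K)" unfolding heads_def by auto
    have ss: "swz (swz a) = a" for a by (simp add: swz_def)
    show "inj_on ?\<Psi> (heads K PX)"
    proof (rule inj_onI)
      fix f g assume "?\<Psi> f = ?\<Psi> g"
      then have h: "swz (f 0) = swz (g 0)" "(\<lambda>i. f (Suc i)) = (\<lambda>i. g (Suc i))" unfolding cons_eq by blast+
      have h0: "f 0 = g 0" using arg_cong[OF h(1), of swz] unfolding ss .
      have "f = cons (f 0) (\<lambda>i. f (Suc i))" by (rule cons_collapse[symmetric])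
      also have "\<dots> = cons (g 0) (\<lambda>i. g (Suc i))" unfolding h0 h(2) ..
      also have "\<dots> = g" by (rule cons_collapse)
      finally show "f = g" .
    qed
  qed
  then show ?thesis unfolding im by (simp add: spanR_dbl su_alg_spanR)
qed

theorem aa_15:
  assumes n: "2 \<le> n"
  shows "aa 15 n \<cong>\<^sub>L su_alg (2 ^ (n - 1)) \<oplus>\<^sub>L su_alg (2 ^ (n - 1))"
    and "bb 4 n \<cong>\<^sub>L su_alg (2 ^ (n - 1)) \<oplus>\<^sub>L su_alg (2 ^ (n - 1)) \<oplus>\<^sub>L u1"
proof -
  obtain K where K: "n = Suc K" "1 \<le> K" using n by (cases n) auto
  have i: "spanR n (pcl n (cg n {(PX, PX), (PX, PY), (PX, PZ)})) \<cong>\<^sub>L su_alg (2 ^ (n - 1)) \<oplus>\<^sub>L su_alg (2 ^ (n - 1))"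
    using heads_su[of K] pcl_15[OF K(2)] by (simp add: K(1))
  then show "aa 15 n \<cong>\<^sub>L su_alg (2 ^ (n - 1)) \<oplus>\<^sub>L su_alg (2 ^ (n - 1))" by (simp add: aa_pcl a_gens_def)
  have no: "pt 0 PX \<notin> pcl n (cg n {(PX, PX), (PX, PY), (PX, PZ)})"
    unfolding K(1) pcl_15[OF K(2)] heads_def cons_pt(1)[symmetric] by auto
  from add_center[OF _ _ no i dsum_carrier[OF su_alg_carrier su_alg_carrier]]
  have "spanR n (pcl n (cg n {(PX, PX), (PX, PY), (PX, PZ)} \<union> {pt 0 PX})) \<cong>\<^sub>L (su_alg (2 ^ (n - 1)) \<oplus>\<^sub>L su_alg (2 ^ (n - 1))) \<oplus>\<^sub>L u1"
    using n by auto
  moreover have "b_gens 4 = insert (PX, PI) (insert (PI, PX) (insert (PX, PY) {(PX, PX)}))"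
    "{(PX, PX), (PX, PY), (PX, PZ)} = insert (PX, PY) (insert (PX, PZ) {(PX, PX)})"
    by (auto simp: b_gens_def)
  ultimately show "bb 4 n \<cong>\<^sub>L su_alg (2 ^ (n - 1)) \<oplus>\<^sub>L su_alg (2 ^ (n - 1)) \<oplus>\<^sub>L u1"
    unfolding bb_pcl dsum_assoc by (simp only: center_eq[OF n])
qed

text \<open>In the chain a13 the string of all X is central. A tail is extended at site 0 by I or Z
  so that it commutes with this string, and a leading Z in the coordinates marks that the string of
  all X is to be multiplied in.\<close>

definition om :: "nat \<Rightarrow> pstr \<Rightarrow> pstr" where
  "om K u = cons (if bc K (\<lambda>i. u (Suc i)) (ones K PX) then PZ else 0) (\<lambda>i. u (Suc i)) + (if u 0 = PZ then ones (Suc K) PX else 0)"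

lemma om_cons: "om K (cons a g) = cons (if bc K g (ones K PX) then PZ else 0) g + (if a = PZ then ones (Suc K) PX else 0)"
proof -
  have "(\<lambda>i. cons a g (Suc i)) = g" by (rule ext) simp
  then show ?thesis by (simp add: om_def)
qed

lemma ones_cons: "ones (Suc K) a = cons a (ones K a)"
  by (rule ext) (simp add: ones_apply cons_def split: nat.split)

lemma dbl_E:
  assumes "u \<in> dbl T"
  obtains a g where "u = cons a g" "a \<in> {0, PZ}" "g \<in> T"
  using assms unfolding dbl_def by blast

lemma om_add:
  assumes "u \<in> dbl (strs K)" "v \<in> dbl (strs K)"
  shows "om K (u + v) = om K u + om K v"
proof -
  obtain a g where u: "u = cons a g" "a \<in> {0, PZ}" using assms(1) by (auto elim: dbl_E)
  obtain b h where v: "v = cons b h" "b \<in> {0, PZ}" using assms(2) by (auto elim: dbl_E)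
  have pz: "(a + b = PZ) = ((a = PZ) \<noteq> (b = PZ))" using u(2) v(2) by auto
  have cc: "cons (if bc K (g + h) (ones K PX) then PZ else 0) (g + h)
      = cons (if bc K g (ones K PX) then PZ else 0) g + cons (if bc K h (ones K PX) then PZ else 0) h"
    unfolding cons_add by (simp add: bc_add)
  show ?thesis unfolding u(1) v(1) cons_add[of a g b h] om_cons pz cc if_add by (simp only: ac_simps)
qed

lemma om_bc:
  assumes "u \<in> dbl (strs K)" "v \<in> dbl (strs K)"
  shows "bc (Suc K) (om K u) (om K v) = bc (Suc K) u v"
proof -
  obtain a g where u: "u = cons a g" "a \<in> {0, PZ}" using assms(1) by (auto elim: dbl_E)
  obtain b h where v: "v = cons b h" "b \<in> {0, PZ}" using assms(2) by (auto elim: dbl_E)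
  have o: "bc K (ones K PX) f = bc K f (ones K PX)" for f by (rule bc_sym)
  have c: "\<not> bc (Suc K) (cons (if bc K f (ones K PX) then PZ else 0) f) (ones (Suc K) PX)"
    "\<not> bc (Suc K) (ones (Suc K) PX) (cons (if bc K f (ones K PX) then PZ else 0) f)" for f
    unfolding ones_cons bc_cons o by simp_all
  have "bc (Suc K) (om K u) (om K v) = bc K g h"
    unfolding u(1) v(1) om_cons using c by (simp add: bc_add bc_add2 bc_ones2) (simp add: bc_cons)
  also have "\<dots> = bc (Suc K) u v" unfolding u(1) v(1) bc_cons using u(2) v(2) by auto
  finally show ?thesis .
qed

lemma om_strs: "u \<in> dbl (strs K) \<Longrightarrow> om K u \<in> strs (Suc K)"
  by (auto elim!: dbl_E simp: om_cons)

lemma om_inj: "inj_on (om K) (dbl (strs K))"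
proof (rule inj_onI)
  fix u v assume uv: "u \<in> dbl (strs K)" "v \<in> dbl (strs K)" "om K u = om K v"
  obtain a g where u: "u = cons a g" "a \<in> {0, PZ}" using uv(1) by (auto elim: dbl_E)
  obtain b h where v: "v = cons b h" "b \<in> {0, PZ}" using uv(2) by (auto elim: dbl_E)
  have z: "anti (om K (cons a g) 0) PZ = (a = PZ)" for a g by (simp add: om_cons fun_app ones_apply)
  have "(a = PZ) = (b = PZ)" using z[of a g] z[of b h] uv(3) u(1) v(1) by simp
  then have ab: "a = b" using u(2) v(2) by auto
  let ?o = "if b = PZ then ones (Suc K) PX else 0"
  have "om K (cons b g) + ?o = om K (cons b h) + ?o" using uv(3) unfolding u(1) v(1) ab by simp
  then have "g = h" unfolding om_cons by (simp add: add.assoc)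
  then show "u = v" using ab u(1) v(1) by simp
qed

lemma om_gens:
  "om K (cons 0 (pt j a)) = (if j < K \<and> anti a PX then pt 0 PZ else 0) + pt (Suc j) a"
  "Suc j < K \<Longrightarrow> anti a PX = anti b PX \<Longrightarrow> om K (cons 0 (pr j a b)) = pr (Suc j) a b"
  "1 \<le> K \<Longrightarrow> om K (cons PZ (ones K PX + pt 0 b)) = pr 0 (if anti b PX then PY else PX) b"
proof -
  have c: "cons x f = cons x 0 + cons 0 f" for x f by (simp add: cons_add)
  show "om K (cons 0 (pt j a)) = (if j < K \<and> anti a PX then pt 0 PZ else 0) + pt (Suc j) a"
    unfolding om_cons by (subst c) (simp add: cons_pt ones_apply)
  show "om K (cons 0 (pr j a b)) = pr (Suc j) a b" if "Suc j < K" "anti a PX = anti b PX"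
    unfolding om_cons using that by (simp add: bc_pr ones_apply cons_pr)
  show "om K (cons PZ (ones K PX + pt 0 b)) = pr 0 (if anti b PX then PY else PX) b" if "1 \<le> K"
    unfolding om_cons ones_cons using that by (simp add: cons_add bc_add bc_ones2 ones_apply cons_pt(3)[symmetric] ac_simps pstr_dbl2)
qed

text \<open>In the coordinates of \<open>om\<close> the central string is a leading letter, so the
  same two tools as for a15 apply: local generation of all tails, then \<open>doubling\<close> for
  the leading letter.\<close>

lemma pcl_13:
  assumes K: "2 \<le> K"
  shows "pcl (Suc K) (cg (Suc K) (a_gens 13)) = om K ` dbl (strs K - {0})"
proof
  let ?G = "a_gens 13" and ?T = "dbl (strs K - {0})"
  let ?D = "pcl (Suc K) (cg (Suc K) ?G)"
  have G: "?G = {(PX, PX), (PY, PY), (PY, PZ)}" by (simp add: a_gens_def)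
  have b: "pr j PX PX \<in> ?D" "pr j PY PY \<in> ?D" "pr j PY PZ \<in> ?D" if "j < K" for j
    unfolding G using that by (intro pcl_base cg_I; simp)+
  have zz: "pr j PZ PZ \<in> ?D" if "j < K" for j
    using that K pcl_base[OF cg_I[of PZ PZ "a_gens 20" j "Suc K"], of "Suc K"] pcl_13_20[of "Suc K"] by (simp add: a_gens_def)
  have T: "?T \<subseteq> dbl (strs K)" by (auto simp: dbl_def)
  have o1: "(ones K PX + pt 0 b) \<noteq> 0" for b
  proof
    assume "ones K PX + pt 0 b = 0"
    then have "(ones K PX + pt 0 b) 1 = 0" by (simp only:) (simp add: fun_app)
    then show False using K by (simp add: fun_app ones_apply)
  qed
  show "?D \<subseteq> om K ` ?T"
  proof (rule pcl_least)
    show "cg (Suc K) ?G \<subseteq> om K ` ?T"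
    proof
      fix x assume "x \<in> cg (Suc K) ?G"
      then obtain j a b where ab: "x = pr j a b" "j < K" "(a, b) \<in> {(PX, PX), (PY, PY), (PY, PZ)}"
        unfolding cg_def G by blast
      then have x: "x = pr j a b" "j < K" "a = (if anti b PX then PY else PX)" "anti a PX = anti b PX" "a \<noteq> 0" by auto
      show "x \<in> om K ` ?T"
      proof (cases j)
        case 0
        \<comment> \<open>Generators on bond 0 have X or Y at site 0, and only the string of all X
          contributes such a letter there; its X on the other sites is compensated in the
          tail.\<close>
        have "cons PZ (ones K PX + pt 0 b) \<in> heads K PZ" using o1 K by (intro heads_I) simp_all
        moreover have "x = om K (cons PZ (ones K PX + pt 0 b))" using om_gens(3)[of K b] K x(1,3) 0 by simp
        ultimately show ?thesis unfolding heads_dbl by blast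
      next
        case (Suc i)
        have "cons 0 (pr i a b) \<in> heads K PZ" using pr_ne0[OF x(5)] x(2) Suc by (intro heads_I) simp_all
        moreover have "x = om K (cons 0 (pr i a b))" using om_gens(2)[of i K a b] x(1,2,4) Suc by simp
        ultimately show ?thesis unfolding heads_dbl by blast
      qed
    qed
    show "pclosed (Suc K) (om K ` ?T)"
    proof (rule pclosedI)
      fix x y assume "x \<in> om K ` ?T" "y \<in> om K ` ?T" "bc (Suc K) x y"
      then obtain u v where uv: "u \<in> ?T" "v \<in> ?T" "x = om K u" "y = om K v" "bc (Suc K) (om K u) (om K v)" by blast
      then have d: "u \<in> dbl (strs K)" "v \<in> dbl (strs K)" using T by blast+
      then have "u + v \<in> ?T" using uv om_bc[OF d] pclosedD[OF pclosed_heads[of K PZ]] unfolding heads_dbl by blast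
      then show "x + y \<in> om K ` ?T" using om_add[OF d] uv(3,4) by force
    qed
  qed
  \<comment> \<open>The preimage of the closure; it is again closed, since \<open>om\<close> is
    symplectic on the doubled space.\<close>
  define D' where "D' = {u \<in> dbl (strs K). om K u \<in> ?D}"
  have D'I: "cons a g \<in> D'" if "a \<in> {0, PZ}" "g \<in> strs K" "om K (cons a g) \<in> ?D" for a g
    unfolding D'_def dbl_def using that by blast
  have cl: "pclosed (Suc K) D'"
  proof (rule pclosedI)
    fix u v assume "u \<in> D'" "v \<in> D'" and bcuv: "bc (Suc K) u v"
    then have d: "u \<in> dbl (strs K)" "v \<in> dbl (strs K)" "om K u \<in> ?D" "om K v \<in> ?D" unfolding D'_def by auto
    have "om K u + om K v \<in> ?D" using d om_bc[OF d(1,2)] bcuv by (intro pcl_step) simp_all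
    moreover have "u + v \<in> dbl (strs K)" using d(1,2) gspan_add gspan_dbl[OF gspan_strs] by metis
    ultimately show "u + v \<in> D'" using om_add[OF d(1,2)] unfolding D'_def by simp
  qed
  have xs: "pt (Suc j) PX \<in> ?D" if "j < K" for j
  proof -
    have "pr j PY PY + pr j PY PZ \<in> ?D" by (rule pcl_step) (use b that in \<open>simp_all add: bc_pr pr_apply\<close>)
    then show ?thesis unfolding pr_add by (simp add: pr_def)
  qed
  have ys: "pt 0 PZ + pt (Suc j) PY \<in> ?D" if "j < K" "pt 0 PZ + pt (Suc j) PZ \<in> ?D" for j
  proof -
    have "pt 0 PZ + pt (Suc j) PZ + pt (Suc j) PX \<in> ?D" by (rule pcl_step[OF that(2) xs]) (use that in \<open>simp_all add: fun_app\<close>)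
    then show ?thesis by (simp add: add.assoc pt_add)
  qed
  \<comment> \<open>Z at sites 0 and j + 1 is the image under \<open>om\<close> of Z at site j. To
    move one site to the right, Z is changed to Y at its old place, ZZ and XX on the next bond
    transport it, and a single X changes Y back to Z.\<close>
  have zs: "pt 0 PZ + pt (Suc j) PZ \<in> ?D" if "j < K" for j
    using that
  proof (induction j)
    case 0 then show ?case by (rule zz[of 0, unfolded pr_def])
  next
    case (Suc j)
    then have j: "j < K" "Suc j < K" by auto
    have e: "pt 0 PZ + pt (Suc j) PY \<in> ?D" by (rule ys[OF j(1) Suc.IH[OF j(1)]])
    let ?s2 = "pt 0 PZ + pt (Suc j) PX + pt (Suc (Suc j)) PZ" and ?s3 = "pt 0 PZ + pt (Suc (Suc j)) PY"
    have "pt 0 PZ + pt (Suc j) PY + pr (Suc j) PZ PZ \<in> ?D"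
      by (rule pcl_step[OF e zz[OF j(2)]]) (use j in \<open>simp add: bc_add pr_apply\<close>)
    moreover have "pt 0 PZ + pt (Suc j) PY + pr (Suc j) PZ PZ = ?s2"
      by (auto simp: fun_eq_iff fun_app pr_apply)
    ultimately have 2: "?s2 \<in> ?D" by simp
    have "?s2 + pr (Suc j) PX PX \<in> ?D"
      by (rule pcl_step[OF 2 b(1)[OF j(2)]]) (use j in \<open>simp add: bc_add pr_apply\<close>)
    moreover have "?s2 + pr (Suc j) PX PX = ?s3"
      by (auto simp: fun_eq_iff fun_app pr_apply)
    ultimately have 3: "?s3 \<in> ?D" by simp
    have 4: "?s3 + pt (Suc (Suc j)) PX \<in> ?D"
      by (rule pcl_step[OF 3 xs[OF j(2)]]) (use j in \<open>simp add: bc_add fun_app\<close>)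
    have "?s3 + pt (Suc (Suc j)) PX = pt 0 PZ + pt (Suc (Suc j)) PZ" by (simp add: add.assoc pt_add)
    from 4[unfolded this] show ?case .
  qed
  have "pt (Suc j) a \<in> D'" if "j < K" "a \<noteq> 0" for j a
    unfolding cons_pt(2)[symmetric]
    by (rule D'I) (use that xs zs ys in \<open>cases a; simp add: om_gens\<close>)+
  moreover have "pr (Suc j) PX PX \<in> D'" if "Suc j < K" for j
    unfolding cons_pr[symmetric] using that b(1)[of "Suc j"] by (intro D'I) (simp_all add: om_gens)
  ultimately have 0: "cons 0 g \<in> D'" if "g \<in> strs K" "g \<noteq> 0" for g
    using cons_local_full[OF cl _ _ that] by blast
  have seed: "cons PZ (ones K PX + pt 0 PX) \<in> D'" using b(1)[of 0] om_gens(3)[of K PX] K by (intro D'I) simp_all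
  have "cons PZ g \<in> D'" if "g \<in> strs K" "g \<noteq> 0" for g
    by (rule doubling[OF cl 0 seed _ o1 that]) (use K in auto)
  then show "om K ` ?T \<subseteq> ?D" using 0 unfolding heads_dbl[symmetric] by (auto elim!: heads_E simp: D'_def)
qed

theorem aa_13:
  assumes n: "3 \<le> n"
  shows "aa 13 n = aa 20 n" and "aa 13 n \<cong>\<^sub>L su_alg (2 ^ (n - 1)) \<oplus>\<^sub>L su_alg (2 ^ (n - 1))"
proof -
  show "aa 13 n = aa 20 n" by (simp add: aa_pcl pcl_13_20[OF n])
  obtain K where K: "n = Suc K" "2 \<le> K" using n by (cases n) auto
  have T: "dbl (strs K - {0}) \<subseteq> dbl (strs K)" by (auto simp: dbl_def)
  have "spanR (Suc K) (om K ` dbl (strs K - {0})) \<cong>\<^sub>L spanR (Suc K) (dbl (strs K - {0}))"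
  proof (rule frame_iso(2)[OF _ gspan_dbl[OF gspan_strs] om_strs om_add om_bc T])
    show "dbl (strs K) \<subseteq> strs (Suc K)" by (rule dbl_strs) simp
    show "pclosed (Suc K) (dbl (strs K - {0}))" unfolding heads_dbl[symmetric] by (rule pclosed_heads)
    show "inj_on (om K) (dbl (strs K - {0}))" by (rule inj_on_subset[OF om_inj T])
  qed
  then show "aa 13 n \<cong>\<^sub>L su_alg (2 ^ (n - 1)) \<oplus>\<^sub>L su_alg (2 ^ (n - 1))"
    by (simp add: aa_pcl K(1) pcl_13[OF K(2)] spanR_dbl su_alg_spanR)
qed

section \<open>Assembly of all cases\<close>

lemma lie_aa: "real_lie_subalg (2 ^ n) (aa k n)"
  unfolding aa_pcl by (rule spanR_lie[OF pcl_strs[OF cg_strs] pcl_closed])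

theorem theorem1:
  fixes n :: nat
  assumes "n \<ge> 3"
  shows
    "aa 0 n \<cong>\<^sub>L dpow u1 (n - 1)
   \<and> aa 1 n \<cong>\<^sub>L so_alg n
   \<and> aa 2 n \<cong>\<^sub>L aa 4 n \<and> aa 2 n \<cong>\<^sub>L so_alg n \<oplus>\<^sub>L so_alg n \<and> aa 4 n \<cong>\<^sub>L so_alg n \<oplus>\<^sub>L so_alg n
   \<and> (n mod 8 = 0 \<longrightarrow> aa 3 n \<cong>\<^sub>L dpow (so_alg (2 ^ (n - 2))) 4)
   \<and> (n mod 8 \<in> {1, 7} \<longrightarrow> aa 3 n \<cong>\<^sub>L so_alg (2 ^ (n - 1)))
   \<and> (n mod 8 \<in> {2, 6} \<longrightarrow> aa 3 n \<cong>\<^sub>L dpow (su_alg (2 ^ (n - 2))) 2)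
   \<and> (n mod 8 \<in> {3, 5} \<longrightarrow> aa 3 n \<cong>\<^sub>L sp_alg (2 ^ (n - 2)))
   \<and> (n mod 8 = 4 \<longrightarrow> aa 3 n \<cong>\<^sub>L dpow (sp_alg (2 ^ (n - 3))) 4)
   \<and> (n mod 6 = 0 \<longrightarrow> aa 5 n \<cong>\<^sub>L dpow (so_alg (2 ^ (n - 2))) 4)
   \<and> (n mod 6 \<in> {1, 5} \<longrightarrow> aa 5 n \<cong>\<^sub>L so_alg (2 ^ (n - 1)))
   \<and> (n mod 6 \<in> {2, 4} \<longrightarrow> aa 5 n \<cong>\<^sub>L dpow (su_alg (2 ^ (n - 2))) 2)
   \<and> (n mod 6 = 3 \<longrightarrow> aa 5 n \<cong>\<^sub>L sp_alg (2 ^ (n - 2)))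
   \<and> aa 6 n \<cong>\<^sub>L aa 7 n \<and> aa 7 n \<cong>\<^sub>L aa 10 n
   \<and> (odd n \<longrightarrow> (\<forall>k\<in>{6, 7, 10}. aa k n \<cong>\<^sub>L su_alg (2 ^ (n - 1))))
   \<and> (even n \<and> n \<ge> 4 \<longrightarrow> (\<forall>k\<in>{6, 7, 10}. aa k n \<cong>\<^sub>L dpow (su_alg (2 ^ (n - 2))) 4))
   \<and> aa 8 n \<cong>\<^sub>L so_alg (2 * n - 1)
   \<and> aa 9 n \<cong>\<^sub>L sp_alg (2 ^ (n - 2))
   \<and> (n \<ge> 4 \<longrightarrow> aa 11 n = so_alg (2 ^ n) \<and> aa 16 n = so_alg (2 ^ n))
   \<and> (n \<ge> 4 \<longrightarrow> (\<forall>k\<in>{12, 17, 18, 19, 21, 22}. aa k n = su_alg (2 ^ n)))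
   \<and> aa 13 n = aa 20 n \<and> aa 20 n \<cong>\<^sub>L aa 15 n
   \<and> aa 13 n \<cong>\<^sub>L su_alg (2 ^ (n - 1)) \<oplus>\<^sub>L su_alg (2 ^ (n - 1))
   \<and> aa 15 n \<cong>\<^sub>L su_alg (2 ^ (n - 1)) \<oplus>\<^sub>L su_alg (2 ^ (n - 1))
   \<and> aa 14 n \<cong>\<^sub>L so_alg (2 * n)
   \<and> bb 0 n \<cong>\<^sub>L dpow u1 n
   \<and> bb 1 n \<cong>\<^sub>L dpow u1 (2 * n - 1)
   \<and> bb 2 n \<cong>\<^sub>L sp_alg (2 ^ (n - 2)) \<oplus>\<^sub>L u1
   \<and> bb 3 n \<cong>\<^sub>L dpow (su_alg 2) n
   \<and> bb 4 n \<cong>\<^sub>L su_alg (2 ^ (n - 1)) \<oplus>\<^sub>L su_alg (2 ^ (n - 1)) \<oplus>\<^sub>L u1"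
proof -
  have n: "2 \<le> n" using assms by simp
  have i24: "aa 2 n \<cong>\<^sub>L aa 4 n" by (rule lie_iso_trans[OF aa_2 lie_iso_sym[OF aa_4 lie_aa]])
  have i2015: "aa 20 n \<cong>\<^sub>L aa 15 n"
    using lie_iso_trans[OF aa_13(2)[OF assms] lie_iso_sym[OF aa_15(1)[OF n] lie_aa]] aa_13(1)[OF assms] by simp
  have su: "\<forall>k\<in>{12, 17, 18, 19, 21, 22}. aa k n = su_alg (2 ^ n)" if "4 \<le> n"
    using aa_12[OF that] aa_17[OF that] aa_18[OF that] aa_19[OF that] aa_21[OF that] aa_22[OF that] by simp
  have hodd: "\<forall>k\<in>{6, 7, 10}. aa k n \<cong>\<^sub>L su_alg (2 ^ (n - 1))" if "odd n"
    using aa_6_7_10(3)[OF assms that] by blast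
  have heven: "\<forall>k\<in>{6, 7, 10}. aa k n \<cong>\<^sub>L dpow (su_alg (2 ^ (n - 2))) 4" if "even n \<and> 4 \<le> n"
    using aa_6_7_10(4)[OF assms] that by blast
  show ?thesis
    by (intro conjI impI;
      (rule aa_0[OF n] aa_1 i24 aa_2 aa_4 aa_6_7_10(1,2)[OF assms] aa_8[OF n] aa_9(1)[OF assms] aa_13[OF assms] i2015
          aa_15[OF n] aa_14[OF n] bb_0[OF n] bb_1[OF n] bb_2[OF assms] bb_3[OF n]
      | (rule aa_3_even[OF assms] aa_3_odd[OF assms] aa_5_even[OF assms] aa_5_odd[OF assms] hodd heven aa_11_16 su, assumption)))
qed

end
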